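(* Let $\Omega\subset\mathbb{R}^3$ be a polygonal domain with a partition $\mathcal{T}=\{C_i\}_{i=1}^N$ of $\overline{\Omega}$ into cuboids. Let $\mathcal{G}=\{G_1,\ldots,G_N\}$ be a set of labeled cuboid graphs with common iso-level $c\in(0,1)$, arising from one labeling of the cuboid vertices as described in the context, where $C_i$ is the cuboid of $G_i$ for $i=1,\ldots,N$. Assume that all $G_i$ are singular iso-path free and isolated iso-path free, and that no iso-path touches $\partial\Omega$. Compute all iso-paths (inner and outer) of each $G_i$ by the iso-path algorithm. Then each iso-line of an arbitrary $G\in\mathcal{G}$ is common to at least two distinct iso-paths, where these iso-paths can be in $G$ or in face-neighbors or edge-neighbors of $G$.
   Context: **Labeled cuboid graphs.** A cuboid is $C=[a_1,b_1]\times[a_2,b_2]\times[a_3,b_3]\subset\mathbb{R}^3$. A labeled cuboid graph $G(V,E,\mathcal{F})$ consists of the 8 vertices $V$ and 12 edges $E$ of a cuboid (the cuboid of $G$) and $\mathcal{F}:V\to[0,1]$. Two nodes are incident if they are the end points of an edge. Fix an iso-level $c\in(0,1)$. A node $P$ is disperse if $\mathcal{F}(P)>c$ and continuous if $\mathcal{F}(P)\le c$; $D(G)$ is the number of disperse nodes. $G$ (or a face, or an edge) is disperse (continuous) if all its nodes are. On an edge with end points $x_0,x_1$ such that $\mathcal{F}(x_0)\le c<\mathcal{F}(x_1)$, the iso-point is the point $x_0+(x_1-x_0)\frac{c-\mathcal{F}(x_0)}{\mathcal{F}(x_1)-\mathcal{F}(x_0)}$; these are all iso-points of $G$. An iso-node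 is a node that is an iso-point (label $c$ and incident to a disperse node). An L-face is a face with exactly two disperse and two continuous nodes, the disperse ones not incident; it is trivial if both its continuous nodes are iso-nodes, otherwise non-trivial. $L(G)$ is the set of L-faces. A singular face has three disperse nodes and one iso-node. A regular face is one that is not an L-face, disperse, continuous or singular. Two faces of a cuboid are parallel if they have no common node. Two graphs are face-neighbors (edge-neighbors) if the intersection of their cuboids is a face (an edge) of both. **Singular / isolated iso-paths; regular graphs.** A $T_1$-subgraph of $G$: a node with label $c$ together with its three incident nodes, all disperse. A $T_2$-subgraph: a subgraph with seven nodes, two of which are incident and have label $c$ while the other five are disperse. $G$ is an $F_1$-graph if there is $\tilde V\subset V$, $|\tilde V|=4$, with each $P\in\tilde V$ incident to exactly two nodes of $V\setminus\tilde V$, $\mathcal{F}=c$ on $\tilde V$ and $\mathcal{F}>c$ on $V\setminus\tilde V$. $G_1$ is an $F_2$-graph if it has a face-neighbor $G_2$ such that all four common nodes have label $c$ (in both) and all other nodes of $G_1$ and of $G_2$ are disperse. $G$ is singular iso-path free if it has no $T_1$- or $T_2$-subgraph, and isolated iso-path free if it is not an $F_1$- or $F_2$-graph. $G$ is regular if it is neither disperse nor continuous, is singular iso-path free and isolated iso-path free. **Partition and labeling.** A partition $\mathcal{T}$ into cuboids is such that two cuboids share a face, or an edge, or a vertex, or are disjoint. All cuboid vertices carry labels in $[0,1]$, giving one labeled cuboid graph per cuboid. Removal step, performed separately in each cuboid: if the graph is not an $F_1$- or $F_2$-graph, the label-$c$ node of every $T_1$-subgraph, and then both label-$c$ nodes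 of a $T_2$-subgraph (if any), are relabeled $1$; if the graph is an $F_1$- or $F_2$-graph, its four label-$c$ nodes are relabeled $1$. The resulting graphs are the $G_i$; labels of neighboring graphs at a common vertex may therefore differ after this step. **$S$-subgraphs.** $S_1$-subgraph: a disperse node and its three incident nodes, all continuous. $S_2$-subgraph: two incident disperse nodes and the four further nodes incident to them, all continuous. $S_3$-subgraph: a node with label $<c$ and its three incident nodes, all disperse. An $S_i$-rule at an $S_i$-subgraph $H$ records the closed polygon through the iso-points on the edges of $H$ (a triangle for $i=1,3$; for $i=2$ the quadrilateral through the four iso-points, consecutive ones on a common face), and then relabels: for $i=1,2$ the disperse nodes of $H$ get label $0$; for $i=3$ the continuous node of $H$ gets label $1$. The $S_i^n$-rule is the successive application of the $S_i$-rule at $n$ distinct $S_i$-subgraphs. Table of $S^n$-rules for regular $G$ with $L(G)\ne\emptyset$: $D=2$: $S_1$. $D=3$: $S_1$ if $|L(G)|=1$, $S_1^2$ if $|L(G)|=3$. $D=4$: if $|L(G)|=2$, $S_1$ for non-parallel and $S_2$ for parallel L-faces; $S_1^3$ if $|L(G)|=6$. $D=5$: $S_3$ if $|L(G)|=1$, $S_1$ if $|L(G)|=3$. $D=6$: $S_3$. **Iso-path algorithm.** $C$-rules: on each regular face join the two iso-points lying on the edges of the face that have one disperse and one continuous end point. Inner iso-paths of a regular $G$: (1) if $L(G)\neq\emptyset$, apply the $S^n$-rule from the table, recording $n$ polygons; the resulting graph has a further iso-path, formed by the segments given by the $C$-rules; (2) if $L(G)=\emptyset$, $D(G)=2$ and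 $G$ has an $S_1$-subgraph (resp. $D(G)=6$ and $G$ has an $S_3$-subgraph), apply the $S_1$-rule (resp. $S_3$-rule) once and then the $C$-rules to the resulting graph; (3) otherwise the $C$-rules applied to $G$ give the iso-path. Non-regular graphs have no iso-path. Outer iso-path: a simple closed polygon lying on a non-trivial L-face of $G$, with common face $M$ of the cuboids of $G$ and its face-neighbor $G'$, which equals $\bigcup_k J_k\cap M$, where $\{J_k\}$ are the inner iso-paths of $G$ and $G'$. An iso-path is an inner or outer iso-path; an iso-line is a line segment that is an edge of an iso-path (joining two iso-points on the same face). An iso-line is common to two iso-paths if it is an edge of both.
   Formalization: A T_2-subgraph must also contain all nodes incident to its two label-c nodes (the claim fails without this), and inner iso-paths of different graphs count as distinct even when they coincide as polygons. *)

theory Defs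
  imports "HOL-Analysis.Analysis"
begin

type_synonym point = "real ^ 3"

subsection \<open>Labeled cuboid graphs\<close>

definition cuboid :: "point set \<Rightarrow> bool" where
  "cuboid C \<longleftrightarrow> (\<exists>a b. (\<forall>i. a $ i < b $ i) \<and> C = cbox a b)"

text \<open>The vertices and edges of the graph are those of its cuboid.  The label function is total;
  only its values on the nodes are ever used.\<close>

datatype lgraph = LGraph (cuboid_of: "point set") (label: "point \<Rightarrow> real")

definition nodes :: "lgraph \<Rightarrow> point set" where
  "nodes G = {P. P extreme_point_of cuboid_of G}"

definition incident :: "lgraph \<Rightarrow> point \<Rightarrow> point \<Rightarrow> bool" where
  "incident G P Q \<longleftrightarrow> P \<in> nodes G \<and> Q \<in> nodes G \<and> closed_segment P Q edge_of cuboid_of G"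

definition labeled_cuboid_graph :: "lgraph \<Rightarrow> bool" where
  "labeled_cuboid_graph G \<longleftrightarrow> cuboid (cuboid_of G) \<and> (\<forall>P\<in>nodes G. label G P \<in> {0..1})"

definition relabel :: "lgraph \<Rightarrow> point set \<Rightarrow> real \<Rightarrow> lgraph" where
  "relabel G A t = LGraph (cuboid_of G) (\<lambda>P. if P \<in> A then t else label G P)"

definition disperse_nodes :: "real \<Rightarrow> lgraph \<Rightarrow> point set" where
  "disperse_nodes c G = {P \<in> nodes G. label G P > c}"

definition continuous_nodes :: "real \<Rightarrow> lgraph \<Rightarrow> point set" where
  "continuous_nodes c G = {P \<in> nodes G. label G P \<le> c}"

definition disperse_graph :: "real \<Rightarrow> lgraph \<Rightarrow> bool" where
  "disperse_graph c G \<longleftrightarrow> nodes G \<subseteq> disperse_nodes c G"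

definition continuous_graph :: "real \<Rightarrow> lgraph \<Rightarrow> bool" where
  "continuous_graph c G \<longleftrightarrow> nodes G \<subseteq> continuous_nodes c G"

text \<open>The iso-points on the edges of \<open>G\<close> having both end points in the node set \<open>H\<close>.\<close>

definition iso_points_on :: "real \<Rightarrow> lgraph \<Rightarrow> point set \<Rightarrow> point set" where
  "iso_points_on c G H =
    {x0 + ((c - label G x0) / (label G x1 - label G x0)) *\<^sub>R (x1 - x0) | x0 x1.
      x0 \<in> H \<and> x1 \<in> H \<and> incident G x0 x1 \<and> label G x0 \<le> c \<and> c < label G x1}"

definition iso_nodes :: "real \<Rightarrow> lgraph \<Rightarrow> point set" where
  "iso_nodes c G = nodes G \<inter> iso_points_on c G (nodes G)"

definition L_faces :: "real \<Rightarrow> lgraph \<Rightarrow> point set set" where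
  "L_faces c G = {M. M facet_of cuboid_of G \<and>
     card (disperse_nodes c G \<inter> M) = 2 \<and> card (continuous_nodes c G \<inter> M) = 2 \<and>
     (\<forall>P \<in> disperse_nodes c G \<inter> M. \<forall>Q \<in> disperse_nodes c G \<inter> M. \<not> incident G P Q)}"

definition trivial_L_face :: "real \<Rightarrow> lgraph \<Rightarrow> point set \<Rightarrow> bool" where
  "trivial_L_face c G M \<longleftrightarrow> M \<in> L_faces c G \<and> continuous_nodes c G \<inter> M \<subseteq> iso_nodes c G"

definition singular_face :: "real \<Rightarrow> lgraph \<Rightarrow> point set \<Rightarrow> bool" where
  "singular_face c G M \<longleftrightarrow> M facet_of cuboid_of G \<and>
     card (disperse_nodes c G \<inter> M) = 3 \<and> card (iso_nodes c G \<inter> M) = 1"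

definition regular_face :: "real \<Rightarrow> lgraph \<Rightarrow> point set \<Rightarrow> bool" where
  "regular_face c G M \<longleftrightarrow> M facet_of cuboid_of G \<and> M \<notin> L_faces c G \<and>
     \<not> nodes G \<inter> M \<subseteq> disperse_nodes c G \<and> \<not> nodes G \<inter> M \<subseteq> continuous_nodes c G \<and>
     \<not> singular_face c G M"

definition parallel_faces :: "lgraph \<Rightarrow> point set \<Rightarrow> point set \<Rightarrow> bool" where
  "parallel_faces G M M' \<longleftrightarrow> nodes G \<inter> M \<inter> M' = {}"

definition face_neighbors :: "lgraph \<Rightarrow> lgraph \<Rightarrow> bool" where
  "face_neighbors G G' \<longleftrightarrow>
     (cuboid_of G \<inter> cuboid_of G') facet_of cuboid_of G \<and>
     (cuboid_of G \<inter> cuboid_of G') facet_of cuboid_of G'"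

definition edge_neighbors :: "lgraph \<Rightarrow> lgraph \<Rightarrow> bool" where
  "edge_neighbors G G' \<longleftrightarrow>
     (cuboid_of G \<inter> cuboid_of G') edge_of cuboid_of G \<and>
     (cuboid_of G \<inter> cuboid_of G') edge_of cuboid_of G'"

subsection \<open>Singular and isolated iso-paths\<close>

definition incident_nodes :: "lgraph \<Rightarrow> point set \<Rightarrow> point set" where
  "incident_nodes G A = {Q. Q \<notin> A \<and> (\<exists>P\<in>A. incident G P Q)}"

definition T1_subgraph :: "real \<Rightarrow> lgraph \<Rightarrow> point \<Rightarrow> bool" where
  "T1_subgraph c G P \<longleftrightarrow> P \<in> nodes G \<and> label G P = c \<and>
     incident_nodes G {P} \<subseteq> disperse_nodes c G"

text \<open>As for \<open>T\<^sub>1\<close>, a \<open>T\<^sub>2\<close>-subgraph contains all nodes that are incident to its label-\<open>c\<close> nodes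
  \<open>P\<close> and \<open>Q\<close>; so the one node outside \<open>H\<close> is incident to neither of them, and at most one pair
  \<open>{P, Q}\<close> of a graph without \<open>T\<^sub>1\<close>-subgraphs is of this kind.\<close>

definition T2_subgraph :: "real \<Rightarrow> lgraph \<Rightarrow> point set \<Rightarrow> point \<Rightarrow> point \<Rightarrow> bool" where
  "T2_subgraph c G H P Q \<longleftrightarrow> H \<subseteq> nodes G \<and> card H = 7 \<and> P \<in> H \<and> Q \<in> H \<and>
     incident G P Q \<and> label G P = c \<and> label G Q = c \<and>
     H - {P, Q} \<subseteq> disperse_nodes c G \<and> incident_nodes G {P, Q} \<subseteq> H"

definition F1_graph :: "real \<Rightarrow> lgraph \<Rightarrow> bool" where
  "F1_graph c G \<longleftrightarrow> (\<exists>W \<subseteq> nodes G. card W = 4 \<and>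
     (\<forall>P\<in>W. card {Q \<in> nodes G - W. incident G P Q} = 2) \<and>
     (\<forall>P\<in>W. label G P = c) \<and> (\<forall>P \<in> nodes G - W. label G P > c))"

definition F2_graph :: "real \<Rightarrow> lgraph set \<Rightarrow> lgraph \<Rightarrow> bool" where
  "F2_graph c \<G> G \<longleftrightarrow> (\<exists>G'\<in>\<G>. face_neighbors G G' \<and>
     (\<forall>P \<in> nodes G \<inter> nodes G'. label G P = c \<and> label G' P = c) \<and>
     (\<forall>P \<in> nodes G - nodes G'. label G P > c) \<and>
     (\<forall>P \<in> nodes G' - nodes G. label G' P > c))"

definition singular_iso_path_free :: "real \<Rightarrow> lgraph \<Rightarrow> bool" where
  "singular_iso_path_free c G \<longleftrightarrow>
     (\<nexists>P. T1_subgraph c G P) \<and> (\<nexists>H P Q. T2_subgraph c G H P Q)"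

definition isolated_iso_path_free :: "real \<Rightarrow> lgraph set \<Rightarrow> lgraph \<Rightarrow> bool" where
  "isolated_iso_path_free c \<G> G \<longleftrightarrow> \<not> F1_graph c G \<and> \<not> F2_graph c \<G> G"

definition regular_graph :: "real \<Rightarrow> lgraph set \<Rightarrow> lgraph \<Rightarrow> bool" where
  "regular_graph c \<G> G \<longleftrightarrow> \<not> disperse_graph c G \<and> \<not> continuous_graph c G \<and>
     singular_iso_path_free c G \<and> isolated_iso_path_free c \<G> G"

subsection \<open>Partition and removal step\<close>

definition polygonal_domain :: "point set \<Rightarrow> bool" where
  "polygonal_domain \<Omega> \<longleftrightarrow> \<Omega> \<noteq> {} \<and> open \<Omega> \<and> connected \<Omega> \<and> bounded \<Omega> \<and>
     (\<exists>\<P>. finite \<P> \<and> (\<forall>P\<in>\<P>. polytope P \<and> aff_dim P = 2) \<and> frontier \<Omega> = \<Union>\<P>)"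

definition cuboid_partition :: "point set \<Rightarrow> point set set \<Rightarrow> bool" where
  "cuboid_partition \<Omega> \<T> \<longleftrightarrow> finite \<T> \<and> (\<forall>C\<in>\<T>. cuboid C) \<and> \<Union>\<T> = closure \<Omega> \<and>
     (\<forall>C\<in>\<T>. \<forall>C'\<in>\<T>. C \<noteq> C' \<longrightarrow>
        (C \<inter> C') facet_of C \<and> (C \<inter> C') facet_of C' \<or>
        (C \<inter> C') edge_of C \<and> (C \<inter> C') edge_of C' \<or>
        (\<exists>P. C \<inter> C' = {P} \<and> P extreme_point_of C \<and> P extreme_point_of C') \<or>
        C \<inter> C' = {})"

text \<open>Whether a graph is an \<open>F\<^sub>2\<close>-graph is decided in the family \<open>\<G>\<close> of all graphs before any
  removal.\<close>

definition removal_step :: "real \<Rightarrow> lgraph set \<Rightarrow> lgraph \<Rightarrow> lgraph" where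
  "removal_step c \<G> G =
     (if F1_graph c G \<or> F2_graph c \<G> G then relabel G {P \<in> nodes G. label G P = c} 1
      else let G' = relabel G {P. T1_subgraph c G P} 1
           in relabel G' {P. \<exists>H Q. T2_subgraph c G' H P Q} 1)"

definition resulting_graphs :: "real \<Rightarrow> (point \<Rightarrow> real) \<Rightarrow> point set set \<Rightarrow> lgraph set" where
  "resulting_graphs c F \<T> =
     (let \<G> = (\<lambda>C. LGraph C F) ` \<T> in removal_step c \<G> ` \<G>)"

subsection \<open>Inner iso-paths\<close>

text \<open>Closed polygons are represented by the set of their edges, each edge being a closed segment.\<close>

type_synonym polygon = "point set set"

definition C_rules :: "real \<Rightarrow> lgraph \<Rightarrow> polygon" where
  "C_rules c G = {closed_segment p q | p q M.
     regular_face c G M \<and> p \<noteq> q \<and> iso_points_on c G (nodes G \<inter> M) = {p, q}}"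

datatype S_rule = S1 | S2 | S3

text \<open>An \<open>S\<^sub>i\<close>-subgraph is given by the set \<open>A\<close> of those of its nodes that the \<open>S\<^sub>i\<close>-rule relabels;
  its node set is \<open>A \<union> incident_nodes G A\<close>.\<close>

fun S_subgraph :: "real \<Rightarrow> lgraph \<Rightarrow> S_rule \<Rightarrow> point set \<Rightarrow> bool" where
  "S_subgraph c G S1 A \<longleftrightarrow> (\<exists>P \<in> disperse_nodes c G. A = {P} \<and>
     incident_nodes G A \<subseteq> continuous_nodes c G)"
| "S_subgraph c G S2 A \<longleftrightarrow> (\<exists>P \<in> disperse_nodes c G. \<exists>Q \<in> disperse_nodes c G.
     incident G P Q \<and> A = {P, Q} \<and> incident_nodes G A \<subseteq> continuous_nodes c G)"
| "S_subgraph c G S3 A \<longleftrightarrow> (\<exists>P \<in> nodes G. label G P < c \<and> A = {P} \<and>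
     incident_nodes G A \<subseteq> disperse_nodes c G)"

text \<open>The iso-points on the edges of an \<open>S\<close>-subgraph with node set \<open>H\<close>, joined whenever they lie on
  a common face: any two of the three iso-points for \<open>S\<^sub>1\<close> and \<open>S\<^sub>3\<close>; for \<open>S\<^sub>2\<close> the four cyclically
  consecutive pairs, since opposite corners of the quadrilateral share no face.\<close>

definition S_polygon :: "real \<Rightarrow> lgraph \<Rightarrow> point set \<Rightarrow> polygon" where
  "S_polygon c G H = {closed_segment p q | p q M.
     p \<in> iso_points_on c G H \<and> q \<in> iso_points_on c G H \<and> p \<noteq> q \<and>
     M facet_of cuboid_of G \<and> p \<in> M \<and> q \<in> M}"

definition S_step :: "real \<Rightarrow> S_rule \<Rightarrow> lgraph \<Rightarrow> polygon \<Rightarrow> lgraph \<Rightarrow> bool" where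
  "S_step c r G J G' \<longleftrightarrow> (\<exists>A. S_subgraph c G r A \<and>
     J = S_polygon c G (A \<union> incident_nodes G A) \<and>
     G' = relabel G A (if r = S3 then 1 else 0))"

text \<open>\<open>S_steps c r n G \<J> G'\<close>: some application of the \<open>S\<^sup>n\<close>-rule to \<open>G\<close> records the polygons \<open>\<J>\<close>
  and ends in \<open>G'\<close>.  The \<open>n\<close> subgraphs used are distinct, because relabeling turns the disperse
  (continuous) nodes in \<open>A\<close> into continuous (disperse) ones.\<close>

inductive S_steps :: "real \<Rightarrow> S_rule \<Rightarrow> nat \<Rightarrow> lgraph \<Rightarrow> polygon set \<Rightarrow> lgraph \<Rightarrow> bool"
  for c r where
  "S_steps c r 0 G {} G"
| "S_step c r G J G' \<Longrightarrow> S_steps c r n G' \<J> G'' \<Longrightarrow> S_steps c r (Suc n) G (insert J \<J>) G''"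

definition S_table :: "real \<Rightarrow> lgraph \<Rightarrow> S_rule \<Rightarrow> nat \<Rightarrow> bool" where
  "S_table c G r n \<longleftrightarrow>
    (let d = card (disperse_nodes c G); l = card (L_faces c G);
         par = (\<exists>M \<in> L_faces c G. \<exists>M' \<in> L_faces c G. M \<noteq> M' \<and> parallel_faces G M M')
     in d = 2 \<and> (r, n) = (S1, 1) \<or>
        d = 3 \<and> l = 1 \<and> (r, n) = (S1, 1) \<or>
        d = 3 \<and> l = 3 \<and> (r, n) = (S1, 2) \<or>
        d = 4 \<and> l = 2 \<and> \<not> par \<and> (r, n) = (S1, 1) \<or>
        d = 4 \<and> l = 2 \<and> par \<and> (r, n) = (S2, 1) \<or>
        d = 4 \<and> l = 6 \<and> (r, n) = (S1, 3) \<or>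
        d = 5 \<and> l = 1 \<and> (r, n) = (S3, 1) \<or>
        d = 5 \<and> l = 3 \<and> (r, n) = (S1, 1) \<or>
        d = 6 \<and> (r, n) = (S3, 1))"

text \<open>The algorithm may choose the subgraphs at which the \<open>S\<close>-rules are applied, so it is a relation:
  \<open>\<J>\<close> is a possible set of inner iso-paths computed for \<open>G\<close>.\<close>

definition inner_iso_paths :: "real \<Rightarrow> lgraph set \<Rightarrow> lgraph \<Rightarrow> polygon set \<Rightarrow> bool" where
  "inner_iso_paths c \<G> G \<J> \<longleftrightarrow>
    (if \<not> regular_graph c \<G> G then \<J> = {}
     else if L_faces c G \<noteq> {} then
       (\<exists>r n \<J>' G'. S_table c G r n \<and> S_steps c r n G \<J>' G' \<and> \<J> = insert (C_rules c G') \<J>')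
     else if card (disperse_nodes c G) = 2 \<and> (\<exists>A. S_subgraph c G S1 A) then
       (\<exists>J G'. S_step c S1 G J G' \<and> \<J> = {J, C_rules c G'})
     else if card (disperse_nodes c G) = 6 \<and> (\<exists>A. S_subgraph c G S3 A) then
       (\<exists>J G'. S_step c S3 G J G' \<and> \<J> = {J, C_rules c G'})
     else \<J> = {C_rules c G})"

subsection \<open>Outer iso-paths\<close>

text \<open>Consecutive edges are required not to be collinear, so that the point set of the polygon
  determines its edges.\<close>

definition simple_closed_polygon :: "polygon \<Rightarrow> bool" where
  "simple_closed_polygon E \<longleftrightarrow> (\<exists>xs :: point list.
     let n = length xs; x = (\<lambda>i. xs ! (i mod n)); s = (\<lambda>i. closed_segment (x i) (x (i + 1)))
     in n \<ge> 3 \<and> distinct xs \<and> E = s ` {..<n} \<and>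
        (\<forall>i<n. \<not> collinear {x i, x (i + 1), x (i + 2)}) \<and>
        (\<forall>i<n. s i \<inter> s (i + 1) = {x (i + 1)}) \<and>
        (\<forall>i<n. \<forall>j<n. j \<noteq> i \<and> j \<noteq> (i + 1) mod n \<and> i \<noteq> (j + 1) mod n \<longrightarrow> s i \<inter> s j = {}))"

text \<open>Here and below, \<open>\<J> G\<close> is the set of inner iso-paths computed for \<open>G\<close>.\<close>

definition outer_iso_path ::
    "real \<Rightarrow> lgraph set \<Rightarrow> (lgraph \<Rightarrow> polygon set) \<Rightarrow> lgraph \<Rightarrow> polygon \<Rightarrow> bool" where
  "outer_iso_path c \<G> \<J> G E \<longleftrightarrow> (\<exists>G' \<in> \<G>. \<exists>M. face_neighbors G G' \<and>
     M = cuboid_of G \<inter> cuboid_of G' \<and> M \<in> L_faces c G \<and> \<not> trivial_L_face c G M \<and>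
     simple_closed_polygon E \<and> \<Union>E = (\<Union>J \<in> \<J> G \<union> \<J> G'. \<Union>J) \<inter> M)"

text \<open>An inner iso-path carries the graph it was computed in: inner iso-paths of two different graphs
  are distinct iso-paths even if they coincide as polygons.  This can happen for face-neighbors whose
  common face has exactly three label-\<open>c\<close> nodes while all other nodes are disperse; both have the
  triangle of these three nodes as their only iso-path.  An outer iso-path is just a polygon, so it
  counts only once even if both adjacent graphs produce it.\<close>

datatype iso_path = Inner lgraph (iso_lines: polygon) | Outer (iso_lines: polygon)

definition iso_paths ::
    "real \<Rightarrow> lgraph set \<Rightarrow> (lgraph \<Rightarrow> polygon set) \<Rightarrow> lgraph \<Rightarrow> iso_path set" where
  "iso_paths c \<G> \<J> G = Inner G ` \<J> G \<union> Outer ` {E. outer_iso_path c \<G> \<J> G E}"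

end

theory Submission
  imports Defs
begin

text \<open>An iso-line lies either on an edge of the cuboid or in a single face.  On a face that is not an
  L-face the algorithm leaves exactly the line that the \<open>C\<close>-rules yield for the original labels, and on
  an L-face exactly the lines cutting off the disperse nodes or exactly those cutting off the nodes with
  label \<open>< c\<close>.  So two neighbours see the same lines on a common face, unless it is a non-trivial L-face on
  which they chose differently; then their lines together form the outer iso-path.  The line on a trivial
  L-face belongs to two inner iso-paths of the same graph.  An edge carries an iso-line of a cuboid if both
  its nodes have label \<open>c\<close> and the cuboid has a face at the edge whose other two nodes are disperse; if
  both faces are of this kind, then two inner iso-paths contain the edge, and otherwise one of the other
  three cuboids at the edge has exactly one such face as well.  The removal step does not affect these
  arguments: labels on faces with an iso-line change only on non-trivial L-faces, where this has the same
  effect as a choice of the second kind, and a removal at the partner cuboid of an edge would make a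
  neighbour an \<open>F\<^sub>2\<close>-graph that is known not to be one.\<close>

subsection \<open>Faces of a cuboid\<close>

text \<open>The algorithm may choose its \<open>S\<close>-subgraphs, so its result is not computed:
  each application of an \<open>S\<close>-rule is shown to preserve, side by side, the lines
  recorded so far together with those still to come, and the table guarantees that no L-face is left
  for the final \<open>C\<close>-rules. The delicate point is that two inner iso-paths of one graph
  that carry the same line must differ as polygons; equality would force a
  \<open>T\<^sub>1\<close>-subgraph or an \<open>F\<^sub>1\<close>-graph. At an edge with two
  disperse faces, freeness from \<open>T\<^sub>2\<close>-subgraphs forces the
  \<open>S\<^sub>2\<close>-row of the table. At an edge with one disperse face the partner exists by
  parity: around the edge, the faces change between disperse and not disperse an even number of
  times. An outer iso-path is given only by its point set, so its edges have to be recovered from a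
  union of segments, in spite of stray iso-points of lines that merely touch the face. The boundary
  hypothesis supplies the neighbours: the midpoint of an inner iso-line lies in the open domain, so
  the cuboids through it fill a neighbourhood.\<close>

text \<open>The corners of \<open>cbox a b\<close> are indexed by functions \<open>3 \<Rightarrow> bool\<close>, where \<open>True\<close> selects the upper bound.\<close>

definition corner :: "point \<Rightarrow> point \<Rightarrow> (3 \<Rightarrow> bool) \<Rightarrow> point" where
  "corner a b s = (\<chi> i. if s i then b $ i else a $ i)"

definition flip :: "3 \<Rightarrow> (3 \<Rightarrow> bool) \<Rightarrow> 3 \<Rightarrow> bool" where
  "flip i s = s(i := \<not> s i)"

definition side :: "point \<Rightarrow> point \<Rightarrow> 3 \<Rightarrow> bool \<Rightarrow> point set" where
  "side a b i t = {x \<in> cbox a b. x $ i = (if t then b $ i else a $ i)}"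

lemma corner_nth [simp]: "corner a b s $ i = (if s i then b $ i else a $ i)"
  by (simp add: corner_def)

lemma flip_same [simp]: "flip i s i = (\<not> s i)"
  by (simp add: flip_def)

lemma flip_other [simp]: "j \<noteq> i \<Longrightarrow> flip i s j = s j"
  by (simp add: flip_def)

lemma flip_apply: "flip i s j = (if j = i then \<not> s j else s j)"
  by (simp add: flip_def)

lemma flip_flip [simp]: "flip i (flip i s) = s"
  by (auto simp: flip_def fun_eq_iff)

lemma flip_commute: "flip i (flip j s) = flip j (flip i s)"
  by (auto simp: flip_def fun_eq_iff)

lemma flip_neq [simp]: "flip i s \<noteq> s" "s \<noteq> flip i s"
  by (metis flip_same)+

lemma flip_eq_iff [simp]: "flip i s = flip j s \<longleftrightarrow> i = j"
  by (metis flip_other flip_same)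

lemma flip_inj [simp]: "flip i s = flip i s' \<longleftrightarrow> s = s'"
  by (metis flip_flip)

text \<open>The indices \<open>i\<close> and \<open>j\<close> may coincide, so this also yields an
  index different from a single given one.\<close>

lemma third_index:
  obtains k :: 3 where "k \<noteq> i" "k \<noteq> j" 
proof -
  have "\<exists>k::3. k \<noteq> i \<and> k \<noteq> j"
  proof -
    have "card {i, j} < card (UNIV :: 3 set)"
      by (simp add: card_insert_if)
    then have "{i, j} \<noteq> UNIV" by (metis less_irrefl)
    then show ?thesis by auto
  qed
  then show thesis using that by blast
qed

lemma index_cases:
  fixes i j k l :: 3
  assumes "i \<noteq> j" "i \<noteq> k" "j \<noteq> k"
  shows "l = i \<or> l = j \<or> l = k"
  using assms exhaust_3[of i] exhaust_3[of j] exhaust_3[of k] exhaust_3[of l] by metis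

lemma all_index:
  fixes i j k :: 3
  assumes "i \<noteq> j" "i \<noteq> k" "j \<noteq> k"
  shows "(\<forall>l. Q l) \<longleftrightarrow> Q i \<and> Q j \<and> Q k"
  using index_cases[OF assms] by metis

locale corners =
  fixes a b :: point
  assumes box: "\<And>i. a $ i < b $ i"
begin

abbreviation "v \<equiv> corner a b"
abbreviation "sd \<equiv> side a b"

lemma mem_box: "x \<in> cbox a b \<longleftrightarrow> (\<forall>i. a $ i \<le> x $ i \<and> x $ i \<le> b $ i)"
  by (simp add: mem_box_cart)

lemma corner_in_box: "v s \<in> cbox a b"
  using box by (simp add: mem_box less_imp_le)

lemma corner_inj [simp]: "v s = v s' \<longleftrightarrow> s = s'"
  using box by (auto simp: vec_eq_iff fun_eq_iff) (metis less_irrefl)+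

lemma corner_in_side [simp]: "v s \<in> sd i t \<longleftrightarrow> s i = t"
  using box[of i] corner_in_box[of s] by (auto simp: side_def)

lemma side_subset: "sd i t \<subseteq> cbox a b"
  by (auto simp: side_def)

lemma side_face: "sd i t face_of cbox a b"
proof -
  have eq: "sd i t = cbox a b \<inter> {x. axis i 1 \<bullet> x = (if t then b $ i else a $ i)}"
    by (auto simp: side_def inner_axis')
  show ?thesis
  proof (cases t)
    case True
    show ?thesis unfolding eq
      by (rule face_of_Int_supporting_hyperplane_le) (auto simp: True inner_axis' mem_box)
  next
    case False
    show ?thesis unfolding eq
      by (rule face_of_Int_supporting_hyperplane_ge) (auto simp: False inner_axis' mem_box)
  qed
qed

lemma convex_side: "convex (sd i t)"
  using side_face face_of_imp_convex by blast

lemma side_eq_iff [simp]: "sd i t = sd j u \<longleftrightarrow> i = j \<and> t = u"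
proof
  assume eq: "sd i t = sd j u"
  show "i = j \<and> t = u"
  proof (rule ccontr)
    assume "\<not> (i = j \<and> t = u)"
    then consider "i \<noteq> j" | "i = j" "t \<noteq> u" by blast
    then show False
    proof cases
      case 1
      have "v ((\<lambda>_. t)(j := \<not> u)) \<in> sd i t" "v ((\<lambda>_. t)(j := \<not> u)) \<notin> sd j u" using 1 by auto
      then show False using eq by simp
    next
      case 2
      have "v (\<lambda>_. t) \<in> sd i t" "v (\<lambda>_. t) \<notin> sd j u" using 2 by auto
      then show False using eq by simp
    qed
  qed
qed auto

text \<open>Sides are faces by a supporting hyperplane; once edges are intersections of sides, they
  are faces as well, because faces are closed under intersection.\<close>

lemma edge_eq_sides:
  assumes "i \<noteq> j" "i \<noteq> k" "j \<noteq> k"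
  shows "closed_segment (v s) (v (flip k s)) = sd i (s i) \<inter> sd j (s j)"
proof -
  have conv: "convex (sd i (s i) \<inter> sd j (s j))" by (intro convex_Int convex_side)
  have "closed_segment (v s) (v (flip k s)) \<subseteq> sd i (s i) \<inter> sd j (s j)"
    using assms by (intro closed_segment_subset conv) auto
  moreover have "x \<in> closed_segment (v s) (v (flip k s))" if x: "x \<in> sd i (s i) \<inter> sd j (s j)" for x
  proof -
    let ?p = "v s $ k" and ?q = "v (flip k s) $ k"
    have xk: "a $ k \<le> x $ k" "x $ k \<le> b $ k" using x by (auto simp: side_def mem_box)
    \<comment> \<open>Only coordinate \<open>k\<close> is free, so its value fixes the parameter of
      \<open>x\<close> on the segment.\<close>
    have "x $ k \<in> closed_segment ?p ?q"
      using xk box[of k] by (auto simp: closed_segment_eq_real_ivl)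
    then obtain u where u: "0 \<le> u" "u \<le> 1" "x $ k = (1 - u) * ?p + u * ?q"
      by (auto simp: closed_segment_def)
    have "x = (1 - u) *\<^sub>R v s + u *\<^sub>R v (flip k s)"
    proof (subst vec_eq_iff, rule allI)
      fix l
      have "l = i \<or> l = j \<or> l = k" using index_cases[OF assms] by blast
      then show "x $ l = ((1 - u) *\<^sub>R v s + u *\<^sub>R v (flip k s)) $ l"
        using x u(3) assms by (auto simp: side_def algebra_simps)
    qed
    then show ?thesis using u by (auto simp: closed_segment_def)
  qed
  ultimately show ?thesis by blast
qed

lemma corner_eq_sides:
  assumes "i \<noteq> j" "i \<noteq> k" "j \<noteq> k"
  shows "{v s} = sd i (s i) \<inter> sd j (s j) \<inter> sd k (s k)"
proof -
  have "x = v s" if "x \<in> sd i (s i) \<inter> sd j (s j) \<inter> sd k (s k)" for x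
    unfolding vec_eq_iff all_index[OF assms] using that by (auto simp: side_def)
  then show ?thesis by auto
qed

lemma box_aff_dim: "aff_dim (cbox a b) = 3"
proof -
  have "interior (cbox a b) \<noteq> {}" using box by (simp add: interval_ne_empty_cart)
  then show ?thesis by (simp add: aff_dim_nonempty_interior)
qed

text \<open>Corner, edge, side and box form a chain of proper faces, so the dimensions increase
  strictly from 0 to 3, which leaves only 1 and 2 in between.\<close>

lemma aff_dims:
  assumes "i \<noteq> j" "i \<noteq> k" "j \<noteq> k"
  shows "aff_dim (closed_segment (v s) (v (flip k s))) = 1" "aff_dim (sd i (s i)) = 2"
proof -
  note E = edge_eq_sides[OF assms, of s]
  let ?E = "sd i (s i) \<inter> sd j (s j)"
  have 1: "{v s} face_of ?E"
  proof -
    have "{v s} face_of cbox a b"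
      unfolding corner_eq_sides[OF assms] by (intro face_of_Int side_face)
    then show ?thesis
      by (rule face_of_subset) (use side_subset in auto)
  qed
  have 2: "?E face_of sd i (s i)"
    using side_subset by (intro face_of_subset[OF face_of_Int[OF side_face side_face]]) auto
  have "v (flip k s) \<in> ?E" "v (flip k s) \<noteq> v s" using assms by auto
  then have n1: "{v s} \<noteq> ?E" by blast
  have "v (flip j s) \<in> sd i (s i)" "v (flip j s) \<notin> ?E" using assms by auto
  then have n2: "?E \<noteq> sd i (s i)" by blast
  have "v (flip i s) \<in> cbox a b" "v (flip i s) \<notin> sd i (s i)" by (auto simp: corner_in_box)
  then have n3: "sd i (s i) \<noteq> cbox a b" by blast
  have c: "convex ?E" by (intro convex_Int convex_side)
  have "aff_dim {v s} < aff_dim ?E" using face_of_aff_dim_lt[OF c 1 n1] .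
  moreover have "aff_dim ?E < aff_dim (sd i (s i))" using face_of_aff_dim_lt[OF convex_side 2 n2] .
  moreover have "aff_dim (sd i (s i)) < 3"
    using face_of_aff_dim_lt[OF convex_box(1) side_face n3] box_aff_dim by simp
  ultimately show "aff_dim (closed_segment (v s) (v (flip k s))) = 1" "aff_dim (sd i (s i)) = 2"
    unfolding E by auto
qed

text \<open>A face is determined by the sides through one of its relative interior points
  \<open>x\<close>. If \<open>y\<close> lies in all these sides, the segment from \<open>y\<close>
  to \<open>x\<close> can be prolonged a little beyond \<open>x\<close> within the box, and then the
  face property pulls \<open>y\<close> into \<open>F\<close>.\<close>

lemma face_eq:
  assumes F: "F face_of cbox a b" and x: "x \<in> rel_interior F"
  shows "F = {y \<in> cbox a b. \<forall>i t. x \<in> sd i t \<longrightarrow> y \<in> sd i t}"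
proof (intro subset_antisym subsetI CollectI conjI allI impI)
  have xF: "x \<in> F" using x rel_interior_subset by blast
  fix y assume y: "y \<in> F"
  then show "y \<in> cbox a b" using F face_of_imp_subset by blast
  fix i t assume t: "x \<in> sd i t"
  \<comment> \<open>A face of \<open>F\<close> that contains a relative interior point of
    \<open>F\<close> is all of \<open>F\<close>.\<close>
  have "F \<inter> sd i t face_of F"
    by (rule face_of_subset[of _ "cbox a b"]) (use F side_face face_of_imp_subset[OF F] in \<open>auto intro: face_of_Int\<close>)
  then have "F \<inter> sd i t = F"
    using face_of_disjoint_rel_interior[of "F \<inter> sd i t" F] x xF t by blast
  then show "y \<in> sd i t" using y by blast
next
  have xF: "x \<in> F" using x rel_interior_subset by blast
  have xb: "x \<in> cbox a b" using xF F face_of_imp_subset by blast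
  fix y assume "y \<in> {y \<in> cbox a b. \<forall>i t. x \<in> sd i t \<longrightarrow> y \<in> sd i t}"
  then have yb: "y \<in> cbox a b" and yi: "\<And>i t. x \<in> sd i t \<Longrightarrow> y \<in> sd i t" by auto
  show "y \<in> F"
  proof (cases "y = x")
    case True then show ?thesis using xF by simp
  next
    case False
    \<comment> \<open>Coordinate by coordinate: where \<open>x\<close> is on the boundary of the
      box, \<open>y\<close> agrees with it and nothing moves; elsewhere the distance
      \<open>?m\<close> to the bounds leaves room. The summand 1 in \<open>?w\<close> keeps the
      divisor positive.\<close>
    have ex: "\<exists>d>0. \<forall>e. 0 < e \<and> e < d \<longrightarrow> a $ i \<le> (x + e *\<^sub>R (x - y)) $ i \<and> (x + e *\<^sub>R (x - y)) $ i \<le> b $ i" for i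
    proof (cases "x $ i = a $ i \<or> x $ i = b $ i")
      case True
      then obtain t where t: "x \<in> sd i t" using xb by (auto simp: side_def intro: that[of True] that[of False])
      then have "y $ i = x $ i" using yi[OF t] by (auto simp: side_def)
      then show ?thesis using xb by (intro exI[of _ 1]) (auto simp: mem_box)
    next
      case nf: False
      then have xi: "a $ i < x $ i" "x $ i < b $ i" using xb by (auto simp: mem_box less_le)
      let ?m = "min (x $ i - a $ i) (b $ i - x $ i)" and ?w = "\<bar>x $ i - y $ i\<bar> + 1"
      have m: "?m > 0" "?w > 0" using xi by auto
      show ?thesis
      proof (intro exI[of _ "?m / ?w"] conjI allI impI)
        show "0 < ?m / ?w" using m by simp
        fix e assume e: "0 < e \<and> e < ?m / ?w"
        have "\<bar>e * (x $ i - y $ i)\<bar> \<le> e * ?w" using e by (auto simp: abs_mult intro!: mult_left_mono)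
        also have "\<dots> < ?m" using e m by (simp add: pos_less_divide_eq)
        finally show "a $ i \<le> (x + e *\<^sub>R (x - y)) $ i" "(x + e *\<^sub>R (x - y)) $ i \<le> b $ i"
          by (auto simp: abs_less_iff)
      qed
    qed
    then obtain d where d: "\<And>i. d i > 0" "\<And>i e. 0 < e \<Longrightarrow> e < d i \<Longrightarrow>
        a $ i \<le> (x + e *\<^sub>R (x - y)) $ i \<and> (x + e *\<^sub>R (x - y)) $ i \<le> b $ i"
      by metis
    define e where "e = Min (range d) / 2"
    have "Min (range d) > 0" using d(1) by (subst Min_gr_iff) auto
    then have e0: "e > 0" by (simp add: e_def)
    have le: "Min (range d) \<le> d i" for i by (rule Min_le) auto
    have e: "e > 0" "e < d i" for i
    proof -
      show "e > 0" by (rule e0)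
      have "e + e \<le> d i" using le[of i] by (simp add: e_def)
      then show "e < d i" using e0 by linarith
    qed
    define z where "z = x + e *\<^sub>R (x - y)"
    have zb: "z \<in> cbox a b" unfolding mem_box z_def using d(2) e by blast
    have "x \<in> open_segment y z"
    proof -
      \<comment> \<open>Since \<open>z\<close> is \<open>x + e (x - y)\<close>, the equation
        \<open>x = (1 - u) y + u z\<close> amounts to \<open>u (1 + e) = 1\<close>.\<close>
      let ?u = "1 / (1 + e)"
      have eq: "(1 - r) * p + r * (q + e * (q - p)) = q" if "r * (1 + e) = 1" for p q r :: real
      proof -
        have "(1 - r) * p + r * (q + e * (q - p)) = p + r * (1 + e) * (q - p)" by (simp add: algebra_simps)
        then show ?thesis using that by simp
      qed
      have "?u * (1 + e) = 1" using e(1) by simp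
      then have "x $ i = ((1 - ?u) *\<^sub>R y + ?u *\<^sub>R z) $ i" for i
        unfolding z_def using eq[of ?u "y $ i" "x $ i"] by simp
      then have "x = (1 - ?u) *\<^sub>R y + ?u *\<^sub>R z"
        unfolding vec_eq_iff by blast
      moreover have "0 < ?u" "?u < 1" using e by auto
      moreover have "y \<noteq> z"
      proof -
        have "z - y = (1 + e) *\<^sub>R (x - y)" unfolding z_def by (simp add: algebra_simps)
        moreover have "1 + e \<noteq> 0" "x - y \<noteq> 0" using e(1) False by auto
        ultimately show ?thesis by (metis eq_iff_diff_eq_0 scaleR_eq_0_iff)
      qed
      ultimately show ?thesis by (metis in_segment(2))
    qed
    then show ?thesis using F yb zb xF by (meson face_ofD)
  qed
qed

text \<open>The set \<open>I\<close> of coordinates in which a relative interior point attains a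
  bound decides: with 0, 1, 2 or 3 elements it gives the box, a side, an edge or a corner.\<close>

lemma face_cases:
  assumes F: "F face_of cbox a b" and ne: "F \<noteq> {}"
  obtains "F = cbox a b" | i t where "F = sd i t"
  | s k where "F = closed_segment (v s) (v (flip k s))" | s where "F = {v s}"
proof -
  have "convex F" using F face_of_imp_convex by blast
  then obtain x where x: "x \<in> rel_interior F" using ne rel_interior_eq_empty by blast
  have xb: "x \<in> cbox a b" using x rel_interior_subset F face_of_imp_subset by blast
  define s where "s i = (x $ i = b $ i)" for i
  define I where "I = {i. x $ i = a $ i \<or> x $ i = b $ i}"
  have side: "x \<in> sd i t \<longleftrightarrow> i \<in> I \<and> t = s i" for i t
    using xb box[of i] by (auto simp: side_def s_def I_def)
  have F': "F = {y \<in> cbox a b. \<forall>i\<in>I. y \<in> sd i (s i)}"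
    using face_eq[OF F x] unfolding side by auto
  consider "I = {}" | i where "I = {i}" | i j where "i \<noteq> j" "I = {i, j}" | "I = UNIV"
  proof -
    have "\<exists>i j k :: 3. i \<noteq> j \<and> i \<noteq> k \<and> j \<noteq> k"
      by (intro exI[of _ 1] exI[of _ 2] exI[of _ 3]) auto
    then obtain i j k :: 3 where ijk: "i \<noteq> j" "i \<noteq> k" "j \<noteq> k" by blast
    have U: "UNIV = {i, j, k}" using index_cases[OF ijk] by blast
    consider "I = {}" | "I = {i}" | "I = {j}" | "I = {k}" | "I = {i, j}" | "I = {i, k}" | "I = {j, k}"
      | "I = {i, j, k}"
    proof -
      have "I \<in> Pow {i, j, k}" using U by blast
      then have "I \<in> {{}, {i}, {j}, {k}, {i, j}, {i, k}, {j, k}, {i, j, k}}"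
        by (simp add: Pow_insert insert_commute image_iff)
      then show thesis using that by blast
    qed
    then show thesis
      by cases (simp_all add: that(1) that(2)[of i] that(2)[of j] that(2)[of k] that(3)[OF ijk(1)]
        that(3)[OF ijk(2)] that(3)[OF ijk(3)] that(4) U)
  qed
  then show thesis
  proof cases
    case 1 then show ?thesis using F' that(1) by simp
  next
    case (2 i) then show ?thesis using F' that(2)[of i "s i"] side_subset by auto
  next
    case (3 i j)
    obtain k where k: "k \<noteq> i" "k \<noteq> j" by (rule third_index)
    then show ?thesis using F' 3 edge_eq_sides[of i j k s] that(3)[of s k] side_subset by auto
  next
    case 4
    have ijk: "(1::3) \<noteq> 2" "(1::3) \<noteq> 3" "(2::3) \<noteq> 3" by auto
    have "F = {v s}" unfolding F' 4 corner_eq_sides[OF ijk] using side_subset all_index[OF ijk]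
      by auto
    then show ?thesis by (rule that(4))
  qed
qed

lemma facet_iff: "F facet_of cbox a b \<longleftrightarrow> (\<exists>i t. F = sd i t)"
proof
  assume "F facet_of cbox a b"
  then have F: "F face_of cbox a b" "F \<noteq> {}" "aff_dim F = 2"
    by (auto simp: facet_of_def box_aff_dim)
  from F(1,2) show "\<exists>i t. F = sd i t"
  proof (cases rule: face_cases)
    case (3 s k)
    obtain i where i: "i \<noteq> k" using third_index by blast
    obtain j where j: "j \<noteq> i" "j \<noteq> k" by (rule third_index)
    show ?thesis using aff_dims(1)[of i j k s] 3 F(3) i j by auto
  qed (use F(3) box_aff_dim in auto)
next
  assume "\<exists>i t. F = sd i t"
  then obtain i t where F: "F = sd i t" by blast
  obtain j where j: "j \<noteq> i" using third_index by blast
  obtain k where k: "k \<noteq> i" "k \<noteq> j" by (rule third_index)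
  have "aff_dim F = 2" using aff_dims(2)[of i j k "\<lambda>_. t"] j k F by auto
  then show "F facet_of cbox a b" unfolding facet_of_def F
    using side_face box_aff_dim corner_in_side[of "\<lambda>_. t" i t] by fastforce
qed

lemma edge_iff: "F edge_of cbox a b \<longleftrightarrow> (\<exists>s k. F = closed_segment (v s) (v (flip k s)))"
proof
  assume "F edge_of cbox a b"
  then have F: "F face_of cbox a b" "F \<noteq> {}" "aff_dim F = 1"
    by (auto simp: edge_of_def)
  from F(1,2) show "\<exists>s k. F = closed_segment (v s) (v (flip k s))"
  proof (cases rule: face_cases)
    case (2 i t)
    obtain j where j: "j \<noteq> i" using third_index by blast
    obtain k where k: "k \<noteq> i" "k \<noteq> j" by (rule third_index)
    show ?thesis using aff_dims(2)[of i j k "\<lambda>_. t"] j k 2 F(3) by auto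
  qed (use F(3) box_aff_dim in auto)
next
  assume "\<exists>s k. F = closed_segment (v s) (v (flip k s))"
  then obtain s k where F: "F = closed_segment (v s) (v (flip k s))" by blast
  obtain i where i: "i \<noteq> k" using third_index by blast
  obtain j where j: "j \<noteq> i" "j \<noteq> k" by (rule third_index)
  have eq: "F = sd i (s i) \<inter> sd j (s j)" using edge_eq_sides[of i j k s] i j F by auto
  show "F edge_of cbox a b" unfolding edge_of_def
    using aff_dims(1)[of i j k s] i j F eq side_face face_of_Int by metis
qed

lemma extreme_iff: "P extreme_point_of cbox a b \<longleftrightarrow> P \<in> range v"
proof
  assume "P extreme_point_of cbox a b"
  then have F: "{P} face_of cbox a b" "{P} \<noteq> {}" by (auto simp: face_of_singleton)
  from F show "P \<in> range v"
  proof (cases rule: face_cases)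
    case 1
    then have "v (\<lambda>_. True) \<in> {P}" using corner_in_box by simp
    then show ?thesis by blast
  next
    case (2 i t)
    then have "v (\<lambda>_. t) \<in> {P}" by (metis corner_in_side)
    then show ?thesis by blast
  next
    case (3 s k)
    then have "v s \<in> {P}" by (metis ends_in_segment(1))
    then show ?thesis by blast
  qed auto
next
  assume "P \<in> range v"
  then obtain s where s: "P = v s" by blast
  have ijk: "(1::3) \<noteq> 2" "(1::3) \<noteq> 3" "(2::3) \<noteq> 3" by auto
  have "{P} face_of cbox a b" unfolding s corner_eq_sides[OF ijk] by (intro face_of_Int side_face)
  then show "P extreme_point_of cbox a b" by (simp add: face_of_singleton)
qed

lemma incident_corner:
  assumes "cuboid_of G = cbox a b"
  shows "incident G (v s) (v s') \<longleftrightarrow> (\<exists>i. s' = flip i s)"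
  unfolding incident_def nodes_def assms edge_iff extreme_iff
  by (auto simp: doubleton_eq_iff) (metis flip_flip)+

end

subsection \<open>Iso-points in corner coordinates\<close>

text \<open>The case distinction starts the interpolation at the continuous end, so both
  orientations of a mixed edge give the same point.\<close>

definition iso_pt :: "real \<Rightarrow> (point \<Rightarrow> real) \<Rightarrow> point \<Rightarrow> point \<Rightarrow> point" where
  "iso_pt c f x y = (if f x \<le> c then x + ((c - f x) / (f y - f x)) *\<^sub>R (y - x)
     else y + ((c - f y) / (f x - f y)) *\<^sub>R (x - y))"

lemma face_indices:
  assumes "i \<noteq> j" "i \<noteq> k" "j \<noteq> k"
  shows "{u. u i = s i} = {s, flip j s, flip k s, flip j (flip k s)}"
proof -
  have "u \<in> {s, flip j s, flip k s, flip j (flip k s)}" if "u i = s i" for u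
  proof -
    have *: "u = w" if "u i = w i" "u j = w j" "u k = w k" for w
      using all_index[OF assms, of "\<lambda>l. u l = w l"] that by auto
    show ?thesis
      using that assms *[of s] *[of "flip j s"] *[of "flip k s"] *[of "flip j (flip k s)"]
      by (auto simp: flip_apply)
  qed
  then have "{u. u i = s i} \<subseteq> {s, flip j s, flip k s, flip j (flip k s)}" by blast
  moreover have "{s, flip j s, flip k s, flip j (flip k s)} \<subseteq> {u. u i = s i}" using assms by simp
  ultimately show ?thesis by (rule subset_antisym)
qed

lemma flip2_neq [simp]: "j \<noteq> k \<Longrightarrow> flip j (flip k s) \<noteq> s" "j \<noteq> k \<Longrightarrow> s \<noteq> flip j (flip k s)"
  by (metis flip_eq_iff flip_flip)+

lemma flip3_neq [simp]:
  assumes "i \<noteq> j" "i \<noteq> k" "j \<noteq> k"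
  shows "flip i (flip j (flip k s)) \<noteq> s" "s \<noteq> flip i (flip j (flip k s))"
proof -
  have "flip i (flip j (flip k s)) i \<noteq> s i" using assms by (simp add: flip_apply)
  then show "flip i (flip j (flip k s)) \<noteq> s" "s \<noteq> flip i (flip j (flip k s))" by metis+
qed

lemma face_distinct:
  assumes "j \<noteq> k"
  shows "distinct [s, flip j s, flip k s, flip j (flip k s)]"
proof -
  have "s \<noteq> flip j (flip k s)" "flip k s \<noteq> flip j (flip k s)" "flip j s \<noteq> flip j (flip k s)"
    "flip j s \<noteq> flip k s" "s \<noteq> flip j s" "s \<noteq> flip k s"
    using flip2_neq[OF assms, of s] assms by simp_all
  then show ?thesis by simp
qed

lemma exhaust_flips:
  assumes "i \<noteq> j" "i \<noteq> k" "j \<noteq> k"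
  shows "u \<in> {s, flip j s, flip k s, flip j (flip k s), flip i s, flip i (flip j s), flip i (flip k s),
    flip i (flip j (flip k s))}"
proof (cases "u i = s i")
  case True
  then show ?thesis using face_indices[OF assms, of s] by blast
next
  case False
  then have "flip i u i = s i" by auto
  then have "flip i u \<in> {s, flip j s, flip k s, flip j (flip k s)}" using face_indices[OF assms, of s] by blast
  then have "flip i (flip i u) \<in> flip i ` {s, flip j s, flip k s, flip j (flip k s)}" by (rule imageI)
  then show ?thesis unfolding flip_flip image_insert image_empty by blast
qed

locale iso_corners = corners +
  fixes c :: real
  assumes c01: "0 < c" "c < 1"
begin

text \<open>\<open>D\<close>: disperse; \<open>Z\<close>: label \<open>c\<close>; \<open>xp f s j\<close>: iso-point on the edge leaving corner \<open>s\<close> in direction \<open>j\<close>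
  (meaningful only if \<open>mix f s j\<close>); \<open>cend f s j\<close>: the continuous end of that edge.\<close>

definition D :: "(point \<Rightarrow> real) \<Rightarrow> (3 \<Rightarrow> bool) \<Rightarrow> bool" where "D f s \<longleftrightarrow> c < f (v s)"
definition Z :: "(point \<Rightarrow> real) \<Rightarrow> (3 \<Rightarrow> bool) \<Rightarrow> bool" where "Z f s \<longleftrightarrow> f (v s) = c"
definition xp :: "(point \<Rightarrow> real) \<Rightarrow> (3 \<Rightarrow> bool) \<Rightarrow> 3 \<Rightarrow> point" where
  "xp f s j = iso_pt c f (v s) (v (flip j s))"
definition cend :: "(point \<Rightarrow> real) \<Rightarrow> (3 \<Rightarrow> bool) \<Rightarrow> 3 \<Rightarrow> 3 \<Rightarrow> bool" where
  "cend f s j = (if D f s then flip j s else s)"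

abbreviation "mix f s j \<equiv> D f s \<noteq> D f (flip j s)"

lemma Z_not_D [simp]: "Z f s \<Longrightarrow> \<not> D f s"
  by (simp add: Z_def D_def)

lemma xp_cont: "\<not> D f s \<Longrightarrow>
  xp f s j = v s + ((c - f (v s)) / (f (v (flip j s)) - f (v s))) *\<^sub>R (v (flip j s) - v s)"
  by (simp add: xp_def iso_pt_def D_def)

lemma xp_flip: "mix f s j \<Longrightarrow> xp f (flip j s) j = xp f s j"
  by (auto simp: xp_def iso_pt_def D_def)

lemma xp_cend: "mix f s j \<Longrightarrow> xp f s j = xp f (cend f s j) j"
  by (simp add: cend_def xp_flip)

lemma cend_D: "mix f s j \<Longrightarrow> \<not> D f (cend f s j)" "mix f s j \<Longrightarrow> D f (flip j (cend f s j))"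
  by (auto simp: cend_def)

lemma xp_nth_other [simp]: "i \<noteq> j \<Longrightarrow> xp f s j $ i = v s $ i"
  by (simp add: xp_def iso_pt_def)

lemma xp_Z: "Z f s \<Longrightarrow> xp f s j = v s"
  by (simp add: xp_cont Z_def D_def xp_def iso_pt_def)

lemma xp_Z_flip: "D f s \<Longrightarrow> Z f (flip j s) \<Longrightarrow> xp f s j = v (flip j s)"
proof -
  assume "D f s" "Z f (flip j s)"
  then have "mix f s j" by simp
  then show ?thesis using xp_Z[OF \<open>Z f (flip j s)\<close>] xp_flip by metis
qed

text \<open>A label strictly below \<open>c\<close> at the continuous end puts the interpolation
  parameter strictly between 0 and 1.\<close>

lemma xp_interior:
  assumes "mix f s j" "\<not> Z f (cend f s j)"
  shows "a $ j < xp f s j $ j" "xp f s j $ j < b $ j"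
proof -
  define u where "u = cend f s j"
  define \<tau> where "\<tau> = (c - f (v u)) / (f (v (flip j u)) - f (v u))"
  have u: "f (v u) < c" "c < f (v (flip j u))"
    using cend_D[OF assms(1)] assms(2) unfolding u_def by (auto simp: D_def Z_def)
  have t: "0 < \<tau>" "\<tau> < 1" using u by (auto simp: \<tau>_def divide_simps)
  have "xp f s j = v u + \<tau> *\<^sub>R (v (flip j u) - v u)"
    unfolding xp_cend[OF assms(1)] using xp_cont[OF cend_D(1)[OF assms(1)]] by (simp add: u_def \<tau>_def)
  then have x: "xp f s j $ j = v u $ j + \<tau> * (v (flip j u) $ j - v u $ j)" by simp
  have bj: "b $ j - a $ j > 0" using box[of j] by simp
  have "\<tau> * (b $ j - a $ j) > 0" "\<tau> * (b $ j - a $ j) < b $ j - a $ j"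
    using t bj by (auto simp: mult_less_cancel_right2)
  then show "a $ j < xp f s j $ j" "xp f s j $ j < b $ j"
    unfolding x by (auto simp: algebra_simps)
qed

lemma xp_in_box: "mix f s j \<Longrightarrow> xp f s j \<in> cbox a b"
proof -
  assume m: "mix f s j"
  have "a $ i \<le> xp f s j $ i \<and> xp f s j $ i \<le> b $ i" for i
  proof (cases "i = j")
    case True
    show ?thesis
    proof (cases "Z f (cend f s j)")
      case Z: True
      have "xp f s j = v (cend f s j)" using xp_cend[OF m] xp_Z[OF Z] by simp
      then show ?thesis using corner_in_box[of "cend f s j"] by (simp add: mem_box)
    qed (use xp_interior[OF m] True in auto)
  next
    case False
    then show ?thesis using corner_in_box[of s] unfolding mem_box by simp
  qed
  then show ?thesis by (simp add: mem_box)
qed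

text \<open>Basis of all position arguments: an iso-point inside an edge lies on exactly two sides,
  one at a label-\<open>c\<close> corner on three.\<close>

lemma xp_in_side:
  assumes "mix f s j"
  shows "xp f s j \<in> sd i t \<longleftrightarrow> (if i = j then Z f (cend f s j) \<and> t = cend f s j i else s i = t)"
proof (cases "i = j")
  case True
  show ?thesis
  proof (cases "Z f (cend f s j)")
    case Z: True
    have "xp f s j = v (cend f s j)" using xp_cend[OF assms] xp_Z[OF Z] by simp
    then show ?thesis using True Z by auto
  next
    case False
    then show ?thesis using xp_interior[OF assms False] True by (auto simp: side_def)
  qed
next
  case False
  then show ?thesis using xp_in_box[OF assms] box[of i] by (auto simp: side_def)
qed

text \<open>The sides through an iso-point determine its continuous end and, unless that end has
  label \<open>c\<close>, also its edge.\<close>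

lemma xp_eq_iff:
  assumes m: "mix f s j" and m': "mix f s' j'"
  shows "xp f s j = xp f s' j' \<longleftrightarrow>
    cend f s j = cend f s' j' \<and> (j = j' \<or> Z f (cend f s j))"
proof
  assume r: "cend f s j = cend f s' j' \<and> (j = j' \<or> Z f (cend f s j))"
  show "xp f s j = xp f s' j'"
    unfolding xp_cend[OF m] xp_cend[OF m'] using r by (auto simp: xp_Z)
next
  assume eq: "xp f s j = xp f s' j'"
  define u where "u = cend f s j"
  define u' where "u' = cend f s' j'"
  have eq': "xp f u j = xp f u' j'" using eq xp_cend m m' by (simp add: u_def u'_def)
  have u: "\<not> D f u" "D f (flip j u)" "\<not> D f u'" "D f (flip j' u')"
    using cend_D m m' by (auto simp: u_def u'_def)
  then have mm: "mix f u j" "mix f u' j'" by auto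
  have cu: "cend f u j = u" "cend f u' j' = u'" using u by (auto simp: cend_def)
  have sides: "(if i = j then Z f u \<and> t = u i else u i = t) \<longleftrightarrow> (if i = j' then Z f u' \<and> t = u' i else u' i = t)" for i t
    using xp_in_side[OF mm(1), of i t] xp_in_side[OF mm(2), of i t] eq' unfolding cu by simp
  show "cend f s j = cend f s' j' \<and> (j = j' \<or> Z f (cend f s j))"
    unfolding u_def[symmetric] u'_def[symmetric]
  proof (cases "Z f u")
    case True
    then have "u i = u' i" for i using sides[of i "u i"] by (auto split: if_splits)
    then show "u = u' \<and> (j = j' \<or> Z f u)" using True by auto
  next
    case False
    have jj: "j' = j" using sides[of j "u' j"] False by (auto split: if_splits)
    have o: "u i = u' i" if "i \<noteq> j" for i using sides[of i "u i"] that jj by auto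
    have "u j = u' j"
    proof (rule ccontr)
      assume "u j \<noteq> u' j"
      \<comment> \<open>Then \<open>u\<close> and \<open>u'\<close> are the two ends of one mixed
        edge, but both are continuous.\<close>
      then have "u' = flip j u" using o by (auto simp: fun_eq_iff flip_apply)
      then show False using u by simp
    qed
    then have "u i = u' i" for i using o by (cases "i = j") simp_all
    then have "u = u'" by blast
    then show "u = u' \<and> (j = j' \<or> Z f u)" using jj by simp
  qed
qed

section \<open>Notions of labeled cuboid graphs in terms of corner indices\<close>

abbreviation "gr f \<equiv> LGraph (cbox a b) f"

lemma nodes_gr: "nodes (gr f) = range v"
  by (auto simp: nodes_def extreme_iff)

lemma incident_gr: "incident (gr f) (v s) (v s') \<longleftrightarrow> (\<exists>i. s' = flip i s)"
  by (rule incident_corner) simp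

lemma facet_gr: "M facet_of cuboid_of (gr f) \<longleftrightarrow> (\<exists>i t. M = sd i t)"
  by (simp add: facet_iff)

lemma disperse_gr: "disperse_nodes c (gr f) = v ` {s. D f s}"
  by (auto simp: disperse_nodes_def nodes_gr D_def)

lemma continuous_gr: "continuous_nodes c (gr f) = v ` {s. \<not> D f s}"
  by (auto simp: continuous_nodes_def nodes_gr D_def)

lemma image_side: "v ` A \<inter> sd i t = v ` {s \<in> A. s i = t}"
  by auto

lemma v_image_mem: "v s \<in> v ` A \<longleftrightarrow> s \<in> A"
  by auto

lemma v_subset: "v ` A \<subseteq> v ` B \<longleftrightarrow> A \<subseteq> B"
  by (rule inj_image_subset_iff) (simp add: inj_def)

lemma card_v: "card (v ` A) = card A"
  by (rule card_image) (auto simp: inj_on_def)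

lemma nodes_side: "nodes (gr f) \<inter> sd i t = v ` {s. s i = t}"
  unfolding nodes_gr image_side by simp

lemma iso_points_gr:
  "iso_points_on c (gr f) (v ` H) = {xp f s j | s j. s \<in> H \<and> flip j s \<in> H \<and> mix f s j}"
proof (intro subset_antisym subsetI)
  fix p assume "p \<in> iso_points_on c (gr f) (v ` H)"
  then obtain x0 x1 where x: "p = x0 + ((c - f x0) / (f x1 - f x0)) *\<^sub>R (x1 - x0)" "x0 \<in> v ` H" "x1 \<in> v ` H"
    "incident (gr f) x0 x1" "f x0 \<le> c" "c < f x1"
    by (auto simp: iso_points_on_def)
  obtain s s' where s: "x0 = v s" "x1 = v s'" "s \<in> H" "s' \<in> H" using x by auto
  obtain j where j: "s' = flip j s" using x(4) s incident_gr by auto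
  have d: "\<not> D f s" "D f (flip j s)" using x s j by (auto simp: D_def)
  then have "p = xp f s j" using x(1) s j xp_cont by simp
  then show "p \<in> {xp f s j | s j. s \<in> H \<and> flip j s \<in> H \<and> mix f s j}" using d s j by auto
next
  fix p assume "p \<in> {xp f s j | s j. s \<in> H \<and> flip j s \<in> H \<and> mix f s j}"
  then obtain s j where s: "p = xp f s j" "s \<in> H" "flip j s \<in> H" "mix f s j" by auto
  define u where "u = cend f s j"
  have u: "u \<in> H" "flip j u \<in> H" "\<not> D f u" "D f (flip j u)" "p = xp f u j"
    using s cend_D[OF s(4)] xp_cend[OF s(4)] by (auto simp: u_def cend_def)
  show "p \<in> iso_points_on c (gr f) (v ` H)"
    unfolding iso_points_on_def
    apply (rule CollectI)
    apply (rule exI[of _ "v u"], rule exI[of _ "v (flip j u)"])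
    using u incident_gr[of f u "flip j u"] by (auto simp: xp_cont D_def)
qed

definition ipf :: "(point \<Rightarrow> real) \<Rightarrow> 3 \<Rightarrow> bool \<Rightarrow> point set" where
  "ipf f i t = {xp f s j | s j. s i = t \<and> j \<noteq> i \<and> mix f s j}"

lemma iso_points_side: "iso_points_on c (gr f) (nodes (gr f) \<inter> sd i t) = ipf f i t"
proof -
  have "s i = t \<and> flip j s i = t \<and> mix f s j \<longleftrightarrow> s i = t \<and> j \<noteq> i \<and> mix f s j" for s j
    by (cases "j = i") auto
  then show ?thesis unfolding nodes_side iso_points_gr ipf_def mem_Collect_eq conj_assoc by simp
qed

lemma ipf_eq:
  assumes ijk: "i \<noteq> j" "i \<noteq> k" "j \<noteq> k"
  shows "ipf f i (s i) = (if mix f s j then {xp f s j} else {}) \<union> (if mix f s k then {xp f s k} else {})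
    \<union> (if mix f (flip j s) k then {xp f (flip j s) k} else {})
    \<union> (if mix f (flip k s) j then {xp f (flip k s) j} else {})"
proof -
  have l: "l \<noteq> i \<longleftrightarrow> l = j \<or> l = k" for l using index_cases[OF ijk, of l] ijk by blast
  have "ipf f i (s i) = {xp f u l | u l. u \<in> {u. u i = s i} \<and> l \<noteq> i \<and> mix f u l}"
    by (simp add: ipf_def)
  also have "\<dots> = {xp f u l | u l. u \<in> {s, flip j s, flip k s, flip j (flip k s)} \<and> (l = j \<or> l = k) \<and> mix f u l}"
    unfolding face_indices[OF ijk] l ..
  also have "\<dots> = {xp f u l | u l. u \<in> {s, flip j s, flip k s, flip j (flip k s)} \<and> l = j \<and> mix f u l} \<union>
     {xp f u l | u l. u \<in> {s, flip j s, flip k s, flip j (flip k s)} \<and> l = k \<and> mix f u l}" by blast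
  finally have 1: "ipf f i (s i) = {xp f u l | u l. u \<in> {s, flip j s, flip k s, flip j (flip k s)} \<and> l = j \<and> mix f u l} \<union>
     {xp f u l | u l. u \<in> {s, flip j s, flip k s, flip j (flip k s)} \<and> l = k \<and> mix f u l}" .
  have 2: "{xp f u l | u l. u \<in> {s, flip j s, flip k s, flip j (flip k s)} \<and> l = j \<and> mix f u l} =
     (if mix f s j then {xp f s j} else {}) \<union> (if mix f (flip k s) j then {xp f (flip k s) j} else {})"
    using xp_flip[of f s j] xp_flip[of f "flip k s" j] by (auto simp: flip_commute)
  have 3: "{xp f u l | u l. u \<in> {s, flip j s, flip k s, flip j (flip k s)} \<and> l = k \<and> mix f u l} =
     (if mix f s k then {xp f s k} else {}) \<union> (if mix f (flip j s) k then {xp f (flip j s) k} else {})"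
    using xp_flip[of f s k] xp_flip[of f "flip j s" k] flip_commute[of j k s] by auto
  show ?thesis unfolding 1 2 3 by blast
qed

text \<open>The checkerboard pattern of an L-face; the witness \<open>s\<close> is one of its two
  disperse corners.\<close>

definition Lf :: "(point \<Rightarrow> real) \<Rightarrow> 3 \<Rightarrow> bool \<Rightarrow> bool" where
  "Lf f i t \<longleftrightarrow> (\<exists>s j k. i \<noteq> j \<and> i \<noteq> k \<and> j \<noteq> k \<and> s i = t \<and> D f s \<and> D f (flip j (flip k s)) \<and>
     \<not> D f (flip j s) \<and> \<not> D f (flip k s))"

text \<open>The pattern alternates, so it can be read off from any corner of the side, disperse or
  continuous.\<close>

lemma Lf_eq:
  assumes ijk: "i \<noteq> j" "i \<noteq> k" "j \<noteq> k"
  shows "Lf f i (s i) \<longleftrightarrow> D f s = D f (flip j (flip k s)) \<and> D f (flip j s) = D f (flip k s) \<and> D f s \<noteq> D f (flip j s)"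
proof
  assume "Lf f i (s i)"
  then obtain u l m where u: "i \<noteq> l" "i \<noteq> m" "l \<noteq> m" "u i = s i" "D f u" "D f (flip l (flip m u))"
     "\<not> D f (flip l u)" "\<not> D f (flip m u)" by (auto simp: Lf_def)
  have "(l = j \<and> m = k) \<or> (l = k \<and> m = j)" using index_cases[OF ijk, of l] index_cases[OF ijk, of m] u by blast
  moreover have "u \<in> {s, flip j s, flip k s, flip j (flip k s)}" using u(4) face_indices[OF ijk] by blast
  ultimately show "D f s = D f (flip j (flip k s)) \<and> D f (flip j s) = D f (flip k s) \<and> D f s \<noteq> D f (flip j s)"
    using u by (auto simp: flip_commute[of k j])
next
  assume r: "D f s = D f (flip j (flip k s)) \<and> D f (flip j s) = D f (flip k s) \<and> D f s \<noteq> D f (flip j s)"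
  show "Lf f i (s i)"
  proof (cases "D f s")
    case True
    then show ?thesis unfolding Lf_def using r ijk by (intro exI[of _ s] exI[of _ j] exI[of _ k]) auto
  next
    case False
    then show ?thesis unfolding Lf_def using r ijk
      by (intro exI[of _ "flip j s"] exI[of _ j] exI[of _ k]) (auto simp: flip_commute[of k j])
  qed
qed

lemma card_face:
  assumes ijk: "i \<noteq> j" "i \<noteq> k" "j \<noteq> k"
  shows "card {u. Q u \<and> u i = s i} = of_bool (Q s) + of_bool (Q (flip j s)) + of_bool (Q (flip k s)) + of_bool (Q (flip j (flip k s)))"
proof -
  let ?l = "[s, flip j s, flip k s, flip j (flip k s)]"
  have "card {u. Q u \<and> u i = s i} = card (set (filter Q ?l))"
    unfolding set_filter list.set using face_indices[OF ijk, of s]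
    by (intro arg_cong[of _ _ card]) blast
  also have "\<dots> = length (filter Q ?l)"
    by (rule distinct_card) (rule distinct_filter[OF face_distinct[OF ijk(3)]])
  also have "\<dots> = of_bool (Q s) + of_bool (Q (flip j s)) + of_bool (Q (flip k s)) + of_bool (Q (flip j (flip k s)))"
    by (cases "Q s"; cases "Q (flip j s)"; cases "Q (flip k s)"; cases "Q (flip j (flip k s))") simp_all
  finally show ?thesis .
qed

text \<open>Both cardinalities and the incidence condition depend only on which of the four corners
  of a side are disperse, so sixteen Boolean cases decide.\<close>

lemma L_faces_gr: "L_faces c (gr f) = {sd i t | i t. Lf f i t}"
proof -
  have "(card (disperse_nodes c (gr f) \<inter> sd i t) = 2 \<and> card (continuous_nodes c (gr f) \<inter> sd i t) = 2 \<and>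
     (\<forall>P \<in> disperse_nodes c (gr f) \<inter> sd i t. \<forall>Q \<in> disperse_nodes c (gr f) \<inter> sd i t. \<not> incident (gr f) P Q))
     \<longleftrightarrow> Lf f i t" for i t
  proof -
    obtain j where j: "j \<noteq> i" using third_index by blast
    obtain k where k: "k \<noteq> i" "k \<noteq> j" by (rule third_index)
    define s where "s = (\<lambda>_::3. t)"
    have ijk: "i \<noteq> j" "i \<noteq> k" "j \<noteq> k" and st: "t = s i" using j k by (auto simp: s_def)
    have cd: "card (disperse_nodes c (gr f) \<inter> sd i t) = of_bool (D f s) + of_bool (D f (flip j s)) + of_bool (D f (flip k s)) + of_bool (D f (flip j (flip k s)))"
      unfolding disperse_gr image_side card_v st using card_face[OF ijk, of "D f" s] by simp
    have cc: "card (continuous_nodes c (gr f) \<inter> sd i t) = of_bool (\<not> D f s) + of_bool (\<not> D f (flip j s)) + of_bool (\<not> D f (flip k s)) + of_bool (\<not> D f (flip j (flip k s)))"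
      unfolding continuous_gr image_side card_v st using card_face[OF ijk, of "\<lambda>u. \<not> D f u" s] by simp
    have inc: "(\<forall>P \<in> disperse_nodes c (gr f) \<inter> sd i t. \<forall>Q \<in> disperse_nodes c (gr f) \<inter> sd i t. \<not> incident (gr f) P Q)
      \<longleftrightarrow> \<not> (D f s \<and> D f (flip j s)) \<and> \<not> (D f s \<and> D f (flip k s)) \<and> \<not> (D f (flip j s) \<and> D f (flip j (flip k s)))
        \<and> \<not> (D f (flip k s) \<and> D f (flip j (flip k s)))" (is "?l \<longleftrightarrow> ?r")
    proof -
      have "?l \<longleftrightarrow> (\<forall>u. \<forall>u'. D f u \<and> u i = t \<and> D f u' \<and> u' i = t \<longrightarrow> \<not> (\<exists>l. u' = flip l u))"
        unfolding disperse_gr image_side ball_simps incident_gr by blast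
      also have "\<dots> \<longleftrightarrow> (\<forall>u \<in> {u. u i = s i}. \<forall>l. D f u \<and> D f (flip l u) \<longrightarrow> flip l u i \<noteq> t)"
        unfolding st by blast
      also have "\<dots> \<longleftrightarrow> (\<forall>u \<in> {u. u i = s i}. \<forall>l. l \<noteq> i \<longrightarrow> \<not> (D f u \<and> D f (flip l u)))"
        by (auto simp: st flip_apply)
      also have "\<dots> \<longleftrightarrow> (\<forall>u \<in> {s, flip j s, flip k s, flip j (flip k s)}. \<not> (D f u \<and> D f (flip j u)) \<and> \<not> (D f u \<and> D f (flip k u)))"
        unfolding face_indices[OF ijk] all_index[OF ijk] using ijk by simp
      also have "\<dots> \<longleftrightarrow> ?r" unfolding ball_simps flip_commute[of k j] flip_flip by blast
      finally show ?thesis .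
    qed
    show ?thesis
      unfolding cd cc inc unfolding st Lf_eq[OF ijk]
      by (cases "D f s"; cases "D f (flip j s)"; cases "D f (flip k s)"; cases "D f (flip j (flip k s))") simp_all
  qed
  then show ?thesis unfolding L_faces_def facet_gr by blast
qed

lemma iso_nodes_gr: "iso_nodes c (gr f) = v ` {s. Z f s \<and> (\<exists>j. D f (flip j s))}"
proof -
  have all: "iso_points_on c (gr f) (nodes (gr f)) = {xp f s j | s j. mix f s j}"
    unfolding nodes_gr iso_points_gr by simp
  have "v s \<in> iso_points_on c (gr f) (nodes (gr f)) \<longleftrightarrow> Z f s \<and> (\<exists>j. D f (flip j s))" for s
  proof
    assume "v s \<in> iso_points_on c (gr f) (nodes (gr f))"
    then obtain u j where u: "v s = xp f u j" "mix f u j" unfolding all by blast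
    define w where "w = cend f u j"
    have Zw: "Z f w"
    proof (rule ccontr)
      assume "\<not> Z f w"
      then have "a $ j < v s $ j" "v s $ j < b $ j" using xp_interior[OF u(2)] u(1) unfolding w_def by simp_all
      then show False by (simp split: if_splits)
    qed
    then have "v s = v w" using u xp_cend xp_Z w_def by metis
    then show "Z f s \<and> (\<exists>j. D f (flip j s))" using Zw cend_D[OF u(2)] w_def by auto
  next
    assume "Z f s \<and> (\<exists>j. D f (flip j s))"
    then obtain j where "Z f s" "D f (flip j s)" by blast
    then have "v s = xp f s j" "mix f s j" by (auto simp: xp_Z)
    then show "v s \<in> iso_points_on c (gr f) (nodes (gr f))" unfolding all by blast
  qed
  then show ?thesis unfolding iso_nodes_def by (auto simp: nodes_gr)
qed

text \<open>On an L-face the neighbours of a continuous corner within the face are disperse, so each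
  label-\<open>c\<close> corner is automatically an iso-node.\<close>

lemma trivial_gr: "trivial_L_face c (gr f) (sd i t) \<longleftrightarrow> Lf f i t \<and> (\<forall>s. s i = t \<and> \<not> D f s \<longrightarrow> Z f s)"
proof -
  have "Z f s \<and> (\<exists>j. D f (flip j s)) \<longleftrightarrow> Z f s" if "Lf f i t" "s i = t" for s
  proof -
    obtain j where j: "j \<noteq> i" using third_index by blast
    obtain k where k: "k \<noteq> i" "k \<noteq> j" by (rule third_index)
    have "Lf f i (s i)" using that by simp
    then show ?thesis using Lf_eq[of i j k f s] j k by (metis Z_not_D)
  qed
  moreover have "sd i t \<in> L_faces c (gr f) \<longleftrightarrow> Lf f i t" unfolding L_faces_gr by auto
  moreover have "continuous_nodes c (gr f) \<inter> sd i t \<subseteq> iso_nodes c (gr f) \<longleftrightarrow>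
      {s. \<not> D f s \<and> s i = t} \<subseteq> {s. Z f s \<and> (\<exists>j. D f (flip j s))}"
    unfolding continuous_gr iso_nodes_gr image_side v_subset by simp
  ultimately show ?thesis unfolding trivial_L_face_def by blast
qed

text \<open>Two distinct iso-points already imply the rest of regularity: disperse and continuous
  faces have no iso-points at all, and those of a singular face all coincide.\<close>

lemma C_rules_gr:
  "C_rules c (gr f) = {closed_segment p q | p q i t. p \<noteq> q \<and> \<not> Lf f i t \<and> ipf f i t = {p, q}}"
proof -
  have reg: "regular_face c (gr f) (sd i t)" if ip: "ipf f i t = {p, q}" "p \<noteq> q" "\<not> Lf f i t" for i t p q
  proof -
    obtain j where j: "j \<noteq> i" using third_index by blast
    obtain k where k: "k \<noteq> i" "k \<noteq> j" by (rule third_index)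
    have pip: "p \<in> ipf f i t" "q \<in> ipf f i t" using ip(1) by auto
    then obtain s l where s: "p = xp f s l" "s i = t" "l \<noteq> i" "mix f s l" by (auto simp: ipf_def)
    have fl: "flip l s i = t" using s by auto
    have nd: "\<not> nodes (gr f) \<inter> sd i t \<subseteq> disperse_nodes c (gr f)"
      unfolding nodes_side disperse_gr v_subset using s fl by blast
    have nc: "\<not> nodes (gr f) \<inter> sd i t \<subseteq> continuous_nodes c (gr f)"
      unfolding nodes_side continuous_gr v_subset using s fl by blast
    have ns: "\<not> singular_face c (gr f) (sd i t)"
    proof
      assume sing: "singular_face c (gr f) (sd i t)"
      obtain w where w: "w i = t" "Z f w"
        using sing unfolding singular_face_def iso_nodes_gr image_side card_v by (auto simp: card_1_singleton_iff) 
      have "card {u. D f u \<and> u i = t} = 3"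
        using sing unfolding singular_face_def disperse_gr image_side card_v by simp
      moreover have "card {u. u i = t} = 4"
        using card_face[of i j k "\<lambda>_. True" w] w j k by simp
      moreover have "{u. u i = t} = {u. D f u \<and> u i = t} \<union> {u. \<not> D f u \<and> u i = t}" by blast
      moreover have "card ({u. D f u \<and> u i = t} \<union> {u. \<not> D f u \<and> u i = t}) =
         card {u. D f u \<and> u i = t} + card {u. \<not> D f u \<and> u i = t}"
        by (rule card_Un_disjoint) auto
      ultimately have "card {u. \<not> D f u \<and> u i = t} = 1" by simp
      then obtain x where x: "{u. \<not> D f u \<and> u i = t} = {x}" by (auto simp: card_1_singleton_iff)
      have only: "u = w" if "\<not> D f u" "u i = t" for u
      proof -
        have "u \<in> {x}" "w \<in> {x}" unfolding x[symmetric] using that w by auto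
        then show ?thesis by simp
      qed
      \<comment> \<open>The label-\<open>c\<close> corner \<open>w\<close> is the only continuous
        corner of the side, so every mixed edge of the side has its iso-point there.\<close>
      have "x = v w" if x: "x \<in> ipf f i t" for x
      proof -
        obtain u m where u: "x = xp f u m" "u i = t" "m \<noteq> i" "mix f u m" using x unfolding ipf_def by blast
        have "cend f u m = w" using cend_D(1)[OF u(4)] u by (intro only) (auto simp: cend_def)
        then show ?thesis using u xp_cend[OF u(4)] xp_Z w by metis
      qed
      then show False using pip ip(2) by blast
    qed
    show ?thesis unfolding regular_face_def facet_gr using nd nc ns ip(3)
      by (auto simp: L_faces_gr)
  qed
  show ?thesis
  proof (intro subset_antisym subsetI)
    fix e assume "e \<in> C_rules c (gr f)"
    then obtain p q M where e: "e = closed_segment p q" "regular_face c (gr f) M" "p \<noteq> q"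
      "iso_points_on c (gr f) (nodes (gr f) \<inter> M) = {p, q}" by (auto simp: C_rules_def)
    obtain i t where M: "M = sd i t" using e(2) facet_gr by (auto simp: regular_face_def)
    have "\<not> Lf f i t" using e(2) unfolding M regular_face_def L_faces_gr by blast
    then show "e \<in> {closed_segment p q | p q i t. p \<noteq> q \<and> \<not> Lf f i t \<and> ipf f i t = {p, q}}"
      using e M iso_points_side by blast
  next
    fix e assume "e \<in> {closed_segment p q | p q i t. p \<noteq> q \<and> \<not> Lf f i t \<and> ipf f i t = {p, q}}"
    then show "e \<in> C_rules c (gr f)" unfolding C_rules_def using reg iso_points_side by blast
  qed
qed

lemma incident_nodes_gr: "incident_nodes (gr f) (v ` A) = v ` {s. s \<notin> A \<and> (\<exists>j. flip j s \<in> A)}"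
proof -
  have "incident_nodes (gr f) (v ` A) = {Q. Q \<in> range v \<and> Q \<notin> v ` A \<and> (\<exists>s\<in>A. incident (gr f) (v s) Q)}"
    unfolding incident_nodes_def by (auto simp: incident_def nodes_gr)
  also have "\<dots> = v ` {s. s \<notin> A \<and> (\<exists>s'\<in>A. incident (gr f) (v s') (v s))}" by auto
  finally have 1: "incident_nodes (gr f) (v ` A) = v ` {s. s \<notin> A \<and> (\<exists>s'\<in>A. incident (gr f) (v s') (v s))}" .
  have "{s. s \<notin> A \<and> (\<exists>s'\<in>A. incident (gr f) (v s') (v s))} = {s. s \<notin> A \<and> (\<exists>j. flip j s \<in> A)}"
    unfolding incident_gr by (metis flip_flip)
  then show ?thesis unfolding 1 by simp
qed

lemma relabel_gr: "relabel (gr f) A t = gr (\<lambda>P. if P \<in> A then t else f P)"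
  by (auto simp: relabel_def)

end

subsection \<open>Lines on the faces of one cuboid\<close>

context iso_corners
begin

text \<open>Normal form of a mixed edge, seen from its continuous end. It makes the representation
  of an iso-point unique up to the choice of \<open>l\<close> at a label-\<open>c\<close>
  corner.\<close>

definition isop :: "(point \<Rightarrow> real) \<Rightarrow> (3 \<Rightarrow> bool) \<Rightarrow> 3 \<Rightarrow> bool" where
  "isop f w l \<longleftrightarrow> \<not> D f w \<and> D f (flip l w)"

lemma isop_mix: "isop f w l \<Longrightarrow> mix f w l"
  by (auto simp: isop_def)

lemma isop_cend: "isop f w l \<Longrightarrow> cend f w l = w"
  by (simp add: isop_def cend_def)

lemma mix_isop: "mix f s l \<Longrightarrow> isop f (cend f s l) l"
  using cend_D by (simp add: isop_def)

lemma isop_in_side: "isop f w l \<Longrightarrow> xp f w l \<in> sd i t \<longleftrightarrow> w i = t \<and> (i \<noteq> l \<or> Z f w)"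
  using xp_in_side[OF isop_mix, of f w l i t] isop_cend[of f w l] by auto

lemma isop_eq_iff:
  "isop f w l \<Longrightarrow> isop f w' l' \<Longrightarrow> xp f w l = xp f w' l' \<longleftrightarrow> w = w' \<and> (l = l' \<or> Z f w)"
  using xp_eq_iff[OF isop_mix isop_mix, of f w l w' l'] isop_cend[of f w l] isop_cend[of f w' l'] by auto

lemma isop_eq_corner:
  assumes "isop f w l"
  shows "xp f w l = v u \<longleftrightarrow> w = u \<and> Z f w"
proof
  assume eq: "xp f w l = v u"
  have Z: "Z f w"
  proof (rule ccontr)
    assume "\<not> Z f w"
    then have "a $ l < v u $ l" "v u $ l < b $ l"
      using xp_interior[OF isop_mix[OF assms]] isop_cend[OF assms] eq by simp_all
    then show False by (simp split: if_splits)
  qed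
  then show "w = u \<and> Z f w" using eq xp_Z[OF Z] by simp
qed (auto simp: xp_Z)

definition edgeline :: "point set \<Rightarrow> bool" where
  "edgeline e \<longleftrightarrow> (\<exists>s i. e = closed_segment (v s) (v (flip i s)))"

lemma segment_side: "closed_segment p q \<subseteq> sd i t \<longleftrightarrow> p \<in> sd i t \<and> q \<in> sd i t"
  using closed_segment_subset[OF _ _ convex_side] ends_in_segment by blast

lemma segment_eq_iff: "closed_segment p q = closed_segment p' q' \<longleftrightarrow> p = p' \<and> q = q' \<or> p = q' \<and> q = p'"
  for p q :: point
  by (auto simp: doubleton_eq_iff)

lemma isop_edgeline:
  assumes "isop f w l" "isop f w' l'" "closed_segment (xp f w l) (xp f w' l') = closed_segment (v s) (v (flip m s))"
  shows "Z f s" "Z f (flip m s)" "(w = s \<and> w' = flip m s) \<or> (w' = s \<and> w = flip m s)"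
  using assms(3) unfolding segment_eq_iff
  using isop_eq_corner[OF assms(1)] isop_eq_corner[OF assms(2)] by auto

text \<open>An iso-line along an edge has the two continuous corners \<open>w\<close> and
  \<open>w'\<close> as its ends, so it suffices that these are not adjacent.\<close>

lemma isop_not_edgeline:
  assumes "isop f w l" "isop f w' l'" "\<And>m. w' \<noteq> flip m w"
  shows "\<not> edgeline (closed_segment (xp f w l) (xp f w' l'))"
proof
  assume "edgeline (closed_segment (xp f w l) (xp f w' l'))"
  then obtain s m where "closed_segment (xp f w l) (xp f w' l') = closed_segment (v s) (v (flip m s))"
    by (auto simp: edgeline_def)
  then show False using isop_edgeline(3)[OF assms(1,2)] assms(3) by (metis flip_flip)
qed

text \<open>Two different sides through distinct points meet in an edge, in direction
  \<open>k\<close>. Its corners on the line are both continuous, so neither iso-point is interior to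
  it, and both must be corners of label \<open>c\<close>.\<close>

lemma two_faces_edgeline:
  assumes p: "isop f w l" and q: "isop f w' l'" and ne: "xp f w l \<noteq> xp f w' l'"
    and s1: "xp f w l \<in> sd i t" "xp f w' l' \<in> sd i t" and s2: "xp f w l \<in> sd j u" "xp f w' l' \<in> sd j u"
    and d: "(i, t) \<noteq> (j, u)"
  shows "edgeline (closed_segment (xp f w l) (xp f w' l'))"
proof -
  have ij: "i \<noteq> j" using s1 s2 d by (auto simp: isop_in_side[OF p])
  obtain k where k: "k \<noteq> i" "k \<noteq> j" by (rule third_index)
  have ijk: "i \<noteq> j" "i \<noteq> k" "j \<noteq> k" using ij k by auto
  have wi: "w i = t" "w' i = t" "w j = u" "w' j = u" using s1 s2 isop_in_side[OF p] isop_in_side[OF q] by auto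
  have lk: "l = k \<or> Z f w" "l' = k \<or> Z f w'"
    using s1 s2 isop_in_side[OF p] isop_in_side[OF q] index_cases[OF ijk, of l] index_cases[OF ijk, of l'] by auto
  have ww: "w \<noteq> w'" using ne isop_eq_iff[OF p q] lk by auto
  have w': "w' = flip k w"
  proof
    fix x
    have "w' k \<noteq> w k" using ww wi all_index[OF ijk, of "\<lambda>x. w x = w' x"] by auto
    then show "w' x = flip k w x" using index_cases[OF ijk, of x] wi k by (auto simp: flip_apply)
  qed
  \<comment> \<open>Otherwise the edge between \<open>w\<close> and \<open>w'\<close> would be mixed
    although both ends are continuous.\<close>
  have "l \<noteq> k" "l' \<noteq> k" using p q w' by (auto simp: isop_def)
  then have "Z f w" "Z f w'" using lk by auto
  then show ?thesis unfolding edgeline_def using w' by (auto simp: xp_Z)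
qed

text \<open>\<open>fl\<close> collects the lines on a side that do not run along an edge, and \<open>ncl\<close> the line given by the \<open>C\<close>-rules
  there.  \<open>W1\<close> and \<open>W2\<close> cut off the disperse corners and the corners with label \<open>< c\<close>, the two possible
  outcomes on an L-face.\<close>

definition fl :: "polygon set \<Rightarrow> 3 \<Rightarrow> bool \<Rightarrow> point set set" where
  "fl \<J> i t = {e \<in> \<Union>\<J>. e \<subseteq> sd i t \<and> \<not> edgeline e}"

definition ncl :: "(point \<Rightarrow> real) \<Rightarrow> 3 \<Rightarrow> bool \<Rightarrow> point set set" where
  "ncl f i t = {closed_segment p q | p q. p \<noteq> q \<and> \<not> Lf f i t \<and> ipf f i t = {p, q} \<and>
     \<not> edgeline (closed_segment p q)}"

definition cuts :: "(point \<Rightarrow> real) \<Rightarrow> 3 \<Rightarrow> bool \<Rightarrow> ((3 \<Rightarrow> bool) \<Rightarrow> bool) \<Rightarrow> point set set" where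
  "cuts f i t Q = {closed_segment (xp f u j) (xp f u k) | u j k. u i = t \<and> i \<noteq> j \<and> i \<noteq> k \<and> j \<noteq> k \<and> Q u}"

abbreviation "W1 f i t \<equiv> cuts f i t (D f)"
abbreviation "W2 f i t \<equiv> cuts f i t (\<lambda>u. f (v u) < c)"

lemma fl_insert: "fl (insert J A) i t = fl {J} i t \<union> fl A i t"
  by (auto simp: fl_def)

lemma ipf_isop: "p \<in> ipf f i t \<longleftrightarrow> (\<exists>w l. p = xp f w l \<and> isop f w l \<and> w i = t \<and> l \<noteq> i)"
proof
  assume "p \<in> ipf f i t"
  then obtain s j where s: "p = xp f s j" "s i = t" "j \<noteq> i" "mix f s j" unfolding ipf_def by blast
  have "cend f s j i = t" using s by (auto simp: cend_def)
  then show "\<exists>w l. p = xp f w l \<and> isop f w l \<and> w i = t \<and> l \<noteq> i"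
    using s mix_isop xp_cend by blast
next
  assume "\<exists>w l. p = xp f w l \<and> isop f w l \<and> w i = t \<and> l \<noteq> i"
  then show "p \<in> ipf f i t" unfolding ipf_def using isop_mix by blast
qed

lemma ipf_side: "p \<in> ipf f i t \<Longrightarrow> p \<in> sd i t"
  unfolding ipf_isop using isop_in_side by blast

text \<open>A line that the \<open>C\<close>-rules draw on a different side can lie in this one only
  along a common edge, and such lines are left out on both sides of the equation.\<close>

lemma fl_C_rules: "fl {C_rules c (gr f)} i t = ncl f i t"
proof (intro subset_antisym subsetI)
  fix e assume "e \<in> fl {C_rules c (gr f)} i t"
  then have e: "e \<in> C_rules c (gr f)" "e \<subseteq> sd i t" "\<not> edgeline e" by (auto simp: fl_def)
  then obtain p q j u where pq: "e = closed_segment p q" "p \<noteq> q" "\<not> Lf f j u" "ipf f j u = {p, q}"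
    unfolding C_rules_gr by blast
  have "p \<in> ipf f j u" "q \<in> ipf f j u" using pq by auto
  then obtain w l w' l' where w: "p = xp f w l" "isop f w l" "q = xp f w' l'" "isop f w' l'"
    unfolding ipf_isop by blast
  have "p \<in> sd i t" "q \<in> sd i t" using e(2) pq(1) segment_side by auto
  moreover have "p \<in> sd j u" "q \<in> sd j u" using pq ipf_side[of _ f j u] by auto
  ultimately have "(i, t) = (j, u)"
    using two_faces_edgeline[OF w(2,4), of i t j u] e(3) pq(1,2) w by blast
  then show "e \<in> ncl f i t" unfolding ncl_def using pq e by blast
next
  fix e assume "e \<in> ncl f i t"
  then obtain p q where pq: "e = closed_segment p q" "p \<noteq> q" "\<not> Lf f i t" "ipf f i t = {p, q}" "\<not> edgeline e"
    unfolding ncl_def by blast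
  have "p \<in> sd i t" "q \<in> sd i t" using pq ipf_side[of _ f i t] by auto
  then have "e \<subseteq> sd i t" using pq segment_side by simp
  then show "e \<in> fl {C_rules c (gr f)} i t" unfolding fl_def C_rules_gr using pq by blast
qed

lemma ncl_pair:
  assumes "ipf f i t = {p, q}" "p \<noteq> q" "\<not> Lf f i t"
  shows "ncl f i t = (if edgeline (closed_segment p q) then {} else {closed_segment p q})"
proof -
  have eq: "closed_segment p' q' = closed_segment p q" if "ipf f i t = {p', q'}" for p' q'
    using that assms(1) by (auto simp: doubleton_eq_iff segment_eq_iff)
  have "e \<in> ncl f i t \<longleftrightarrow> e = closed_segment p q \<and> \<not> edgeline e" for e
  proof
    assume "e \<in> ncl f i t"
    then obtain p' q' where "e = closed_segment p' q'" "ipf f i t = {p', q'}" "\<not> edgeline e"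
      unfolding ncl_def by blast
    then show "e = closed_segment p q \<and> \<not> edgeline e" using eq by simp
  next
    assume "e = closed_segment p q \<and> \<not> edgeline e"
    then show "e \<in> ncl f i t" unfolding ncl_def using assms by blast
  qed
  then show ?thesis by auto
qed

lemma ncl_sub1: "ipf f i t \<subseteq> {p} \<Longrightarrow> ncl f i t = {}"
  unfolding ncl_def by auto

lemma ncl_Lf: "Lf f i t \<Longrightarrow> ncl f i t = {}"
  unfolding ncl_def by auto

lemma cuts_eq:
  assumes ijk: "i \<noteq> j" "i \<noteq> k" "j \<noteq> k"
  shows "cuts f i (s i) Q =
    {closed_segment (xp f u j) (xp f u k) | u. u \<in> {s, flip j s, flip k s, flip j (flip k s)} \<and> Q u}"
proof (intro subset_antisym subsetI)
  fix e assume "e \<in> cuts f i (s i) Q"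
  then obtain u l m where u: "e = closed_segment (xp f u l) (xp f u m)" "u i = s i" "i \<noteq> l" "i \<noteq> m" "l \<noteq> m" "Q u"
    unfolding cuts_def by blast
  have "(l = j \<and> m = k) \<or> (l = k \<and> m = j)" using index_cases[OF ijk, of l] index_cases[OF ijk, of m] u by blast
  then have "e = closed_segment (xp f u j) (xp f u k)" using u(1) by (auto simp: closed_segment_commute)
  then show "e \<in> {closed_segment (xp f u j) (xp f u k) | u. u \<in> {s, flip j s, flip k s, flip j (flip k s)} \<and> Q u}"
    using u face_indices[OF ijk, of s] by blast
next
  fix e assume "e \<in> {closed_segment (xp f u j) (xp f u k) | u. u \<in> {s, flip j s, flip k s, flip j (flip k s)} \<and> Q u}"
  then show "e \<in> cuts f i (s i) Q"
    unfolding cuts_def face_indices[OF ijk, symmetric] using ijk by blast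
qed

definition upd :: "(point \<Rightarrow> real) \<Rightarrow> (3 \<Rightarrow> bool) set \<Rightarrow> real \<Rightarrow> point \<Rightarrow> real" where
  "upd f X t = (\<lambda>P. if P \<in> v ` X then t else f P)"

lemma upd_v: "upd f X t (v s) = (if s \<in> X then t else f (v s))"
  by (auto simp: upd_def)

lemma D_upd: "D (upd f X t) s \<longleftrightarrow> (if s \<in> X then c < t else D f s)"
  by (simp add: D_def upd_v)

lemma Z_upd: "t \<noteq> c \<Longrightarrow> Z (upd f X t) s \<longleftrightarrow> s \<notin> X \<and> Z f s"
  by (simp add: Z_def upd_v)

lemma xp_cong: "f (v s) = g (v s) \<Longrightarrow> f (v (flip j s)) = g (v (flip j s)) \<Longrightarrow> xp f s j = xp g s j"
  by (simp add: xp_def iso_pt_def)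

lemma xp_upd: "s \<notin> X \<Longrightarrow> flip j s \<notin> X \<Longrightarrow> xp (upd f X t) s j = xp f s j"
  by (rule xp_cong) (simp_all add: upd_v)

lemma ipf_cong:
  assumes "\<And>s. s i = t \<Longrightarrow> f (v s) = g (v s)"
  shows "ipf f i t = ipf g i t"
proof -
  have eq: "p = xp f s j \<and> s i = t \<and> j \<noteq> i \<and> mix f s j \<longleftrightarrow> p = xp g s j \<and> s i = t \<and> j \<noteq> i \<and> mix g s j" for s j p
  proof -
    have "f (v s) = g (v s)" "f (v (flip j s)) = g (v (flip j s))" if "s i = t" "j \<noteq> i"
      using assms that by auto
    then show ?thesis using xp_cong[of f s g j] unfolding D_def by metis
  qed
  show ?thesis unfolding ipf_def eq ..
qed

lemma Lf_cong:
  assumes "\<And>s. s i = t \<Longrightarrow> f (v s) = g (v s)"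
  shows "Lf f i t = Lf g i t"
proof -
  obtain j where j: "j \<noteq> i" using third_index by blast
  obtain k where k: "k \<noteq> i" "k \<noteq> j" by (rule third_index)
  define s where "s = (\<lambda>_::3. t)"
  have D: "D f u = D g u" if "u i = t" for u using assms[of u] that by (simp add: D_def)
  have st: "s i = t" by (simp add: s_def)
  show ?thesis using Lf_eq[of i j k f s] Lf_eq[of i j k g s] j k D st by auto
qed

lemma ncl_cong:
  assumes "\<And>s. s i = t \<Longrightarrow> f (v s) = g (v s)"
  shows "ncl f i t = ncl g i t"
  unfolding ncl_def using ipf_cong[of i t f g] Lf_cong[of i t f g] assms by auto

lemma cuts_cong:
  assumes "\<And>s. s i = t \<Longrightarrow> f (v s) = g (v s)" "\<And>s. s i = t \<Longrightarrow> Q s = R s"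
  shows "cuts f i t Q = cuts g i t R"
proof -
  have eq: "e = closed_segment (xp f u j) (xp f u k) \<and> u i = t \<and> i \<noteq> j \<and> i \<noteq> k \<and> j \<noteq> k \<and> Q u \<longleftrightarrow>
    e = closed_segment (xp g u j) (xp g u k) \<and> u i = t \<and> i \<noteq> j \<and> i \<noteq> k \<and> j \<noteq> k \<and> R u" for e u j k
    using xp_cong[of f u g j] xp_cong[of f u g k] assms[of u] assms(1)[of "flip j u"] assms(1)[of "flip k u"]
    by (cases "u i = t \<and> i \<noteq> j \<and> i \<noteq> k") auto
  show ?thesis unfolding cuts_def eq ..
qed

lemma S_polygon_gr:
  "S_polygon c (gr f) (v ` H) = {closed_segment p q | p q i t.
     p \<in> {xp f s j | s j. s \<in> H \<and> flip j s \<in> H \<and> mix f s j} \<and>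
     q \<in> {xp f s j | s j. s \<in> H \<and> flip j s \<in> H \<and> mix f s j} \<and> p \<noteq> q \<and> p \<in> sd i t \<and> q \<in> sd i t}"
  unfolding S_polygon_def iso_points_gr facet_gr by blast

lemma v_image_Un: "v ` A \<union> v ` B = v ` (A \<union> B)"
  by auto

text \<open>Serves \<open>S1\<close> and \<open>S3\<close> alike, since in both all three edges at
  \<open>s\<close> are mixed. Any two of the iso-points share the side orthogonal to the remaining
  direction.\<close>

lemma star_polygon:
  assumes all: "\<And>j. D f s \<noteq> D f (flip j s)"
    and inj: "\<And>j k. j \<noteq> k \<Longrightarrow> xp f s j \<noteq> xp f s k"
  shows "S_polygon c (gr f) (v ` {s} \<union> incident_nodes (gr f) (v ` {s})) =
     {closed_segment (xp f s j) (xp f s k) | j k. j \<noteq> k}"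
proof -
  let ?H = "{s} \<union> {u. u \<notin> {s} \<and> (\<exists>j. flip j u \<in> {s})}"
  have fs: "flip j u = s \<longleftrightarrow> u = flip j s" for j u by (metis flip_flip)
  have H: "u \<in> ?H \<longleftrightarrow> u = s \<or> (\<exists>j. u = flip j s)" for u
    unfolding Un_iff mem_Collect_eq singleton_iff fs by blast
  have pts: "{xp f u j | u j. u \<in> ?H \<and> flip j u \<in> ?H \<and> mix f u j} = range (xp f s)" (is "?l = ?r")
  proof (intro subset_antisym subsetI)
    fix p assume "p \<in> ?l"
    then obtain u j where u: "p = xp f u j" "u \<in> ?H" "flip j u \<in> ?H" "mix f u j" by blast
    show "p \<in> ?r"
    proof (cases "u = s")
      case True then show ?thesis using u by blast
    next
      case False
      then obtain m where m: "u = flip m s" using u(2) H by blast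
      \<comment> \<open>Otherwise both ends of the edge would be neighbours of \<open>s\<close>;
        these are all of one kind, so the edge would not be mixed.\<close>
      have "flip j u = s"
      proof (rule ccontr)
        assume "flip j u \<noteq> s"
        then obtain n where "flip j u = flip n s" using u(3) H by blast
        then show False using u(4) m all by metis
      qed
      then have "u = flip j s" by (metis flip_flip)
      then show ?thesis using u xp_flip[of f s j] all by blast
    qed
  next
    fix p assume "p \<in> ?r"
    then obtain j where "p = xp f s j" by blast
    moreover have "s \<in> ?H" "flip j s \<in> ?H" using H by blast+
    ultimately show "p \<in> ?l" using all by blast
  qed
  have common: "\<exists>i t. xp f s j \<in> sd i t \<and> xp f s k \<in> sd i t" for j k
  proof -
    obtain i where i: "i \<noteq> j" "i \<noteq> k" by (rule third_index)
    have "xp f s j \<in> sd i (s i)" "xp f s k \<in> sd i (s i)"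
      using xp_in_side[of f s j i "s i"] xp_in_side[of f s k i "s i"] all i by simp_all
    then show ?thesis by blast
  qed
  have "S_polygon c (gr f) (v ` {s} \<union> incident_nodes (gr f) (v ` {s})) = {closed_segment p q | p q i t.
     p \<in> range (xp f s) \<and> q \<in> range (xp f s) \<and> p \<noteq> q \<and> p \<in> sd i t \<and> q \<in> sd i t}"
    unfolding incident_nodes_gr v_image_Un S_polygon_gr pts ..
  also have "\<dots> = {closed_segment (xp f s j) (xp f s k) | j k. j \<noteq> k}"
    using common inj by blast
  finally show ?thesis .
qed

end

subsection \<open>The \<open>S\<close>-rules\<close>

context iso_corners
begin

definition star_lines :: "(point \<Rightarrow> real) \<Rightarrow> (3 \<Rightarrow> bool) \<Rightarrow> point set set" where
  "star_lines f s = {closed_segment (xp f s j) (xp f s k) | j k. j \<noteq> k}"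

text \<open>The quadrilateral of \<open>S2\<close>: the first set holds its lines on the two sides
  orthogonal to \<open>m\<close>, the second those on the two sides that contain the bar from
  \<open>s\<close> to \<open>flip m s\<close>.\<close>

definition bar_lines :: "(point \<Rightarrow> real) \<Rightarrow> (3 \<Rightarrow> bool) \<Rightarrow> 3 \<Rightarrow> point set set" where
  "bar_lines f s m = {closed_segment (xp f u j) (xp f u k) | u j k. u \<in> {s, flip m s} \<and> j \<noteq> m \<and> k \<noteq> m \<and> j \<noteq> k}
     \<union> {closed_segment (xp f s j) (xp f (flip m s) j) | j. j \<noteq> m}"

definition star1 :: "(point \<Rightarrow> real) \<Rightarrow> (3 \<Rightarrow> bool) \<Rightarrow> bool" where
  "star1 f s \<longleftrightarrow> D f s \<and> (\<forall>j. \<not> D f (flip j s))"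

definition star3 :: "(point \<Rightarrow> real) \<Rightarrow> (3 \<Rightarrow> bool) \<Rightarrow> bool" where
  "star3 f s \<longleftrightarrow> f (v s) < c \<and> (\<forall>j. D f (flip j s))"

definition bar2 :: "(point \<Rightarrow> real) \<Rightarrow> (3 \<Rightarrow> bool) \<Rightarrow> 3 \<Rightarrow> bool" where
  "bar2 f s m \<longleftrightarrow> D f s \<and> D f (flip m s) \<and> (\<forall>j. j \<noteq> m \<longrightarrow> \<not> D f (flip j s) \<and> \<not> D f (flip j (flip m s)))"

lemma incident_image_gr:
  "incident_nodes (gr f) (v ` A) \<subseteq> v ` B \<longleftrightarrow> (\<forall>s\<in>A. \<forall>j. flip j s \<notin> A \<longrightarrow> flip j s \<in> B)"
proof -
  have "{s. s \<notin> A \<and> (\<exists>j. flip j s \<in> A)} \<subseteq> B \<longleftrightarrow> (\<forall>s\<in>A. \<forall>j. flip j s \<notin> A \<longrightarrow> flip j s \<in> B)" (is "?l \<longleftrightarrow> ?r")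
  proof
    assume ?l show ?r
    proof (intro ballI allI impI)
      fix s j assume "s \<in> A" "flip j s \<notin> A"
      then have "flip j (flip j s) \<in> A" by simp
      then show "flip j s \<in> B" using \<open>?l\<close> \<open>flip j s \<notin> A\<close> by blast
    qed
  next
    assume r: ?r show ?l
    proof
      fix s assume "s \<in> {s. s \<notin> A \<and> (\<exists>j. flip j s \<in> A)}"
      then obtain j where "s \<notin> A" "flip j s \<in> A" by blast
      then show "s \<in> B" using r by (metis flip_flip)
    qed
  qed
  then show ?thesis unfolding incident_nodes_gr v_subset .
qed

lemma star1_inj:
  assumes "star1 f s" "j \<noteq> k"
  shows "xp f s j \<noteq> xp f s k"
proof -
  have "mix f s j" "mix f s k" "cend f s j = flip j s" "cend f s k = flip k s"
    using assms by (auto simp: star1_def cend_def)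
  then show ?thesis using xp_eq_iff[of f s j s k] assms(2) by simp
qed

text \<open>The three iso-points share the continuous end \<open>s\<close>; the strict inequality in
  \<open>star3\<close> keeps them apart.\<close>

lemma star3_inj:
  assumes "star3 f s" "j \<noteq> k"
  shows "xp f s j \<noteq> xp f s k"
proof -
  have "isop f s j" "isop f s k" "\<not> Z f s"
    using assms by (auto simp: star3_def isop_def D_def Z_def)
  then show ?thesis using isop_eq_iff[of f s j s k] assms(2) by simp
qed

lemma bar_isop:
  assumes "bar2 f s m" "j \<noteq> m"
  shows "isop f (flip j s) j" "xp f s j = xp f (flip j s) j"
    "isop f (flip j (flip m s)) j" "xp f (flip m s) j = xp f (flip j (flip m s)) j"
  using assms xp_flip[of f s j] xp_flip[of f "flip m s" j] by (simp_all add: bar2_def isop_def)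

lemma star_isop:
  assumes "star1 f s"
  shows "isop f (flip j s) j" "xp f s j = xp f (flip j s) j"
  using assms xp_flip[of f s j] by (simp_all add: star1_def isop_def)

lemma star3_isop: "star3 f s \<Longrightarrow> isop f s j"
  by (auto simp: star3_def isop_def D_def)

lemma flip_bar: "u \<in> {s, flip m s} \<Longrightarrow> j \<noteq> m \<Longrightarrow> flip j u \<notin> {s, flip m s}"
proof -
  assume "u \<in> {s, flip m s}" "j \<noteq> m"
  moreover have "flip j s \<notin> {s, flip m s}" "flip j (flip m s) \<notin> {s, flip m s}"
    using \<open>j \<noteq> m\<close> by simp_all
  ultimately show ?thesis by (metis insertE singletonD)
qed

lemma bar_polygon:
  assumes b: "bar2 f s m"
  shows "S_polygon c (gr f) (v ` {s, flip m s} \<union> incident_nodes (gr f) (v ` {s, flip m s})) = bar_lines f s m"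
proof -
  define A where "A = {s, flip m s}"
  have A_iff: "u \<in> A \<longleftrightarrow> u = s \<or> u = flip m s" for u by (simp add: A_def)
  let ?H = "A \<union> {u. u \<notin> A \<and> (\<exists>j. flip j u \<in> A)}"
  have D: "D f u \<longleftrightarrow> u \<in> A" if uH: "u \<in> ?H" for u
  proof -
    consider "u \<in> A" | j where "u \<notin> A" "flip j u \<in> A" using uH by blast
    then show ?thesis
    proof cases
      case 1 then show ?thesis using b by (auto simp: bar2_def A_iff)
    next
      case 2
      define w where "w = flip j u"
      have w: "w \<in> A" "u = flip j w" using 2 by (simp_all add: w_def)
      have "j \<noteq> m" using 2 unfolding w_def A_def by auto
      then have "\<not> D f u" using b w by (auto simp: bar2_def A_iff)
      then show ?thesis using 2 by simp
    qed
  qed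
  have H: "flip j u \<in> ?H" if "u \<in> A" for j u
  proof -
    have "flip j (flip j u) \<in> A" using that by simp
    then show ?thesis by blast
  qed
  have fA: "flip j u \<notin> A" if "u \<in> A" "j \<noteq> m" for j u
    using flip_bar that unfolding A_def by blast
  have pts: "{xp f u j | u j. u \<in> ?H \<and> flip j u \<in> ?H \<and> mix f u j} = {xp f u j | u j. u \<in> A \<and> j \<noteq> m}" (is "?l = ?r")
  proof (intro subset_antisym subsetI)
    fix p assume "p \<in> ?l"
    then obtain u j where u: "p = xp f u j" "u \<in> ?H" "flip j u \<in> ?H" "mix f u j" by blast
    define w where "w = (if D f u then u else flip j u)"
    have w: "w \<in> A" "flip j w \<notin> A" "p = xp f w j"
      using u D[OF u(2)] D[OF u(3)] xp_flip[OF u(4)] unfolding w_def by (auto split: if_splits)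
    have "j \<noteq> m" using w(1,2) unfolding A_def by auto
    then show "p \<in> ?r" using w by blast
  next
    fix p assume "p \<in> ?r"
    then obtain u j where u: "p = xp f u j" "u \<in> A" "j \<noteq> m" by blast
    then have "mix f u j" using D[OF H[of u j]] D[of u] fA[of u j] by blast
    then show "p \<in> ?l" using u H[of u j] by blast
  qed
  have mm: "mix f u j" "cend f u j = flip j u" if "u \<in> A" "j \<noteq> m" for u j
    using D[OF H[of u j]] D[of u] fA[OF that] that by (auto simp: cend_def)
  have side: "xp f u j \<in> sd i t \<longleftrightarrow> flip j u i = t \<and> (i \<noteq> j \<or> Z f (flip j u))" if "u \<in> A" "j \<noteq> m" for u j i t
    using xp_in_side[OF mm(1)[OF that], of i t] mm(2)[OF that] by auto
  have eqS: "S_polygon c (gr f) (v ` A \<union> incident_nodes (gr f) (v ` A)) = {closed_segment p q | p q i t.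
     p \<in> {xp f u j | u j. u \<in> A \<and> j \<noteq> m} \<and> q \<in> {xp f u j | u j. u \<in> A \<and> j \<noteq> m} \<and> p \<noteq> q \<and> p \<in> sd i t \<and> q \<in> sd i t}"
    unfolding incident_nodes_gr v_image_Un S_polygon_gr pts ..
  show ?thesis unfolding A_def[symmetric] eqS
  proof (intro subset_antisym subsetI)
    fix e assume "e \<in> {closed_segment p q | p q i t.
     p \<in> {xp f u j | u j. u \<in> A \<and> j \<noteq> m} \<and> q \<in> {xp f u j | u j. u \<in> A \<and> j \<noteq> m} \<and> p \<noteq> q \<and> p \<in> sd i t \<and> q \<in> sd i t}"
    then obtain u j w k i t where e: "e = closed_segment (xp f u j) (xp f w k)" "u \<in> A" "j \<noteq> m" "w \<in> A" "k \<noteq> m"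
      "xp f u j \<noteq> xp f w k" "xp f u j \<in> sd i t" "xp f w k \<in> sd i t" by blast
    show "e \<in> bar_lines f s m"
    proof (cases "u = w")
      case True
      then have "j \<noteq> k" using e by auto
      then show ?thesis using True e unfolding bar_lines_def A_def by blast
    next
      case False
      then have w: "w = flip m u" using e by (auto simp: A_iff)
      \<comment> \<open>For \<open>j \<noteq> k\<close> the continuous ends \<open>flip j u\<close>
        and \<open>flip k w\<close> differ in all three directions, so no side contains both
        iso-points. This excludes the diagonals of the quadrilateral.\<close>
      have "j = k"
      proof (rule ccontr)
        assume jk: "j \<noteq> k"
        have 1: "flip j u i = t" "flip k w i = t" using side e by blast+
        have ijk: "m \<noteq> j" "m \<noteq> k" "j \<noteq> k" using e jk by auto
        show False using index_cases[OF ijk, of i] 1 w ijk by (auto simp: flip_apply)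
      qed
      then have "e = closed_segment (xp f s j) (xp f (flip m s) j)"
        using e w by (auto simp: closed_segment_commute A_iff)
      then show ?thesis using e(3) unfolding bar_lines_def by blast
    qed
  next
    fix e assume "e \<in> bar_lines f s m"
    then consider u j k where "e = closed_segment (xp f u j) (xp f u k)" "u \<in> A" "j \<noteq> m" "k \<noteq> m" "j \<noteq> k"
      | j where "e = closed_segment (xp f s j) (xp f (flip m s) j)" "j \<noteq> m"
      unfolding bar_lines_def A_def by blast
    then show "e \<in> {closed_segment p q | p q i t.
     p \<in> {xp f u j | u j. u \<in> A \<and> j \<noteq> m} \<and> q \<in> {xp f u j | u j. u \<in> A \<and> j \<noteq> m} \<and> p \<noteq> q \<and> p \<in> sd i t \<and> q \<in> sd i t}"
    proof cases
      case (1 u j k)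
      have "xp f u j \<in> sd m (u m)" "xp f u k \<in> sd m (u m)" using side 1 by auto
      moreover have "xp f u j \<noteq> xp f u k" using xp_eq_iff[OF mm(1)[of u j] mm(1)[of u k]] mm(2) 1 by auto
      ultimately show ?thesis using 1 by blast
    next
      case (2 j)
      have sA: "s \<in> A" "flip m s \<in> A" by (simp_all add: A_iff)
      obtain k where k: "k \<noteq> m" "k \<noteq> j" by (rule third_index)
      have "xp f s j \<in> sd k (s k)" "xp f (flip m s) j \<in> sd k (s k)" using side[of s j k] side[of "flip m s" j k] sA 2 k by auto
      moreover have "xp f s j \<noteq> xp f (flip m s) j" using xp_eq_iff[OF mm(1)[of s j] mm(1)[of "flip m s" j]] mm(2) sA 2 by auto
      ultimately show ?thesis using 2 sA by blast
    qed
  qed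
qed

lemma S_step_cases:
  assumes "S_step c r (gr f) J G'"
  obtains s where "r = S1" "star1 f s" "J = star_lines f s" "G' = gr (upd f {s} 0)"
    | s m where "r = S2" "bar2 f s m" "J = bar_lines f s m" "G' = gr (upd f {s, flip m s} 0)"
    | s where "r = S3" "star3 f s" "J = star_lines f s" "G' = gr (upd f {s} 1)"
proof -
  obtain A where A: "S_subgraph c (gr f) r A" "J = S_polygon c (gr f) (A \<union> incident_nodes (gr f) A)"
     "G' = relabel (gr f) A (if r = S3 then 1 else 0)"
    using assms unfolding S_step_def by blast
  have G': "G' = gr (upd f X (if r = S3 then 1 else 0))" if "A = v ` X" for X
    using A(3) that by (auto simp: relabel_def upd_def)
  show thesis
  proof (cases r)
    case S1
    then obtain s where s: "A = v ` {s}" "D f s" and "incident_nodes (gr f) A \<subseteq> continuous_nodes c (gr f)"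
      using A(1) by (auto simp: disperse_gr)
    then have "\<forall>j. \<not> D f (flip j s)" unfolding s(1) continuous_gr incident_image_gr by auto
    then have st: "star1 f s" using s by (simp add: star1_def)
    have "J = star_lines f s" unfolding A(2) s(1) star_lines_def
      by (rule star_polygon) (use st star1_inj in \<open>auto simp: star1_def\<close>)
    then show ?thesis using that(1) st G'[OF s(1)] S1 by simp
  next
    case S3
    then obtain s where s: "A = v ` {s}" "f (v s) < c" and "incident_nodes (gr f) A \<subseteq> disperse_nodes c (gr f)"
      using A(1) by (auto simp: nodes_gr)
    then have "\<forall>j. D f (flip j s)" unfolding s(1) disperse_gr incident_image_gr by auto
    then have st: "star3 f s" using s by (simp add: star3_def)
    have "J = star_lines f s" unfolding A(2) s(1) star_lines_def
      by (rule star_polygon) (use st star3_inj in \<open>auto simp: star3_def D_def\<close>)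
    then show ?thesis using that(3) st G'[OF s(1)] S3 by simp
  next
    case S2
    then obtain P Q where PQ: "P \<in> disperse_nodes c (gr f)" "Q \<in> disperse_nodes c (gr f)" "incident (gr f) P Q"
      "A = {P, Q}" "incident_nodes (gr f) A \<subseteq> continuous_nodes c (gr f)"
      using A(1) by auto
    obtain s s' where s: "P = v s" "Q = v s'" "D f s" "D f s'" using PQ by (auto simp: disperse_gr)
    obtain m where m: "s' = flip m s" using PQ(3) s incident_gr by auto
    have AX: "A = v ` {s, flip m s}" using PQ s m by simp
    have inc: "\<forall>u\<in>{s, flip m s}. \<forall>j. flip j u \<notin> {s, flip m s} \<longrightarrow> \<not> D f (flip j u)"
      using PQ(5) unfolding AX continuous_gr incident_image_gr by auto
    have "flip j u \<notin> {s, flip m s}" if "u \<in> {s, flip m s}" "j \<noteq> m" for j u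
      using flip_bar that by blast
    then have st: "bar2 f s m" unfolding bar2_def using inc s m by blast
    have "J = bar_lines f s m" unfolding A(2) AX by (rule bar_polygon[OF st])
    then show ?thesis using that(2) st G'[OF AX] S2 by simp
  qed
qed

end

text \<open>Each flip changes the parity of a corner. Hence two neighbours of the same corner are
  never adjacent.\<close>

lemma flip2_neq_flip: "flip m (flip j s) \<noteq> flip k s"
proof
  assume eq: "flip m (flip j s) = flip k s"
  show False
  proof (cases "m = j")
    case False
    have "flip m (flip j s) m = flip k s m" "flip m (flip j s) j = flip k s j" using eq by simp_all
    then have "k = m" "k = j" using False by (auto simp: flip_apply split: if_splits)
    then show False using False by simp
  qed (use eq in simp)
qed

section \<open>Lines of a recorded polygon on the individual sides\<close>

context iso_corners
begin

lemma star_pair_side: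
  assumes "star1 f s \<or> star3 f s" "j \<noteq> k"
  shows "xp f s j \<in> sd i t \<and> xp f s k \<in> sd i t \<longleftrightarrow> s i = t \<and> i \<noteq> j \<and> i \<noteq> k"
  using assms(1)
proof
  assume st: "star1 f s"
  show ?thesis
    using isop_in_side[OF star_isop(1)[OF st], of j i t] isop_in_side[OF star_isop(1)[OF st], of k i t]
      star_isop(2)[OF st, of j] star_isop(2)[OF st, of k] assms(2)
    by (cases "i = j"; cases "i = k") auto
next
  assume st: "star3 f s"
  have "\<not> Z f s" using st by (auto simp: star3_def Z_def)
  then show ?thesis
    using isop_in_side[OF star3_isop[OF st], of j i t] isop_in_side[OF star3_isop[OF st], of k i t] by auto
qed

lemma star_pair_not_edgeline:
  assumes "star1 f s \<or> star3 f s" "j \<noteq> k"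
  shows "\<not> edgeline (closed_segment (xp f s j) (xp f s k))"
  using assms(1)
proof
  assume st: "star1 f s"
  show ?thesis unfolding star_isop(2)[OF st, of j] star_isop(2)[OF st, of k]
    by (rule isop_not_edgeline[OF star_isop(1)[OF st] star_isop(1)[OF st]]) (metis flip2_neq_flip)
next
  assume st: "star3 f s"
  show ?thesis
    by (rule isop_not_edgeline[OF star3_isop[OF st] star3_isop[OF st]]) simp
qed

lemma star_fl:
  assumes st: "star1 f s \<or> star3 f s"
  shows "s i \<noteq> t \<Longrightarrow> fl {star_lines f s} i t = {}"
    and "i \<noteq> j \<Longrightarrow> i \<noteq> k \<Longrightarrow> j \<noteq> k \<Longrightarrow> fl {star_lines f s} i (s i) = {closed_segment (xp f s j) (xp f s k)}"
proof -
  have fl: "e \<in> fl {star_lines f s} i t \<longleftrightarrow> (\<exists>j k. j \<noteq> k \<and> e = closed_segment (xp f s j) (xp f s k) \<and> s i = t \<and> i \<noteq> j \<and> i \<noteq> k)" for e t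
  proof
    assume "e \<in> fl {star_lines f s} i t"
    then obtain j k where jk: "j \<noteq> k" "e = closed_segment (xp f s j) (xp f s k)" "e \<subseteq> sd i t"
      unfolding fl_def star_lines_def by blast
    then have "s i = t \<and> i \<noteq> j \<and> i \<noteq> k" using segment_side star_pair_side[OF st jk(1), of i t] by simp
    then show "\<exists>j k. j \<noteq> k \<and> e = closed_segment (xp f s j) (xp f s k) \<and> s i = t \<and> i \<noteq> j \<and> i \<noteq> k" using jk by blast
  next
    assume "\<exists>j k. j \<noteq> k \<and> e = closed_segment (xp f s j) (xp f s k) \<and> s i = t \<and> i \<noteq> j \<and> i \<noteq> k"
    then obtain j k where jk: "j \<noteq> k" "e = closed_segment (xp f s j) (xp f s k)" "s i = t" "i \<noteq> j" "i \<noteq> k" by blast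
    then have "e \<subseteq> sd i t" using segment_side star_pair_side[OF st jk(1), of i t] by simp
    moreover have "\<not> edgeline e" using star_pair_not_edgeline[OF st jk(1)] jk(2) by simp
    ultimately show "e \<in> fl {star_lines f s} i t" unfolding fl_def star_lines_def using jk by blast
  qed
  show "s i \<noteq> t \<Longrightarrow> fl {star_lines f s} i t = {}" using fl by blast
  assume ijk: "i \<noteq> j" "i \<noteq> k" "j \<noteq> k"
  have "e \<in> fl {star_lines f s} i (s i) \<longleftrightarrow> e = closed_segment (xp f s j) (xp f s k)" for e
  proof
    assume "e \<in> fl {star_lines f s} i (s i)"
    then obtain l m where l: "l \<noteq> m" "e = closed_segment (xp f s l) (xp f s m)" "i \<noteq> l" "i \<noteq> m" using fl by blast
    then have "l = j \<and> m = k \<or> l = k \<and> m = j" using index_cases[OF ijk, of l] index_cases[OF ijk, of m] by blast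
    then show "e = closed_segment (xp f s j) (xp f s k)" using l(2) by (auto simp: closed_segment_commute)
  qed (use fl ijk in blast)
  then show "fl {star_lines f s} i (s i) = {closed_segment (xp f s j) (xp f s k)}" by blast
qed

lemma bar2_flip: "bar2 f s m \<Longrightarrow> bar2 f (flip m s) m"
  by (simp add: bar2_def)

lemma bar_lines_flip: "bar_lines f (flip m s) m = bar_lines f s m"
  unfolding bar_lines_def flip_flip insert_commute[of "flip m s" s] by (simp add: closed_segment_commute)

text \<open>The third alternative arises because a line beside the bar lies in a further side when
  both its ends are label-\<open>c\<close> corners; it then runs along an edge.\<close>

lemma bar_lines_cases:
  assumes b: "bar2 f s m" and e: "e \<in> bar_lines f s m" "e \<subseteq> sd i t"
  obtains u j k where "u = s \<or> u = flip m s" "e = closed_segment (xp f u j) (xp f u k)" "m \<noteq> j" "m \<noteq> k" "j \<noteq> k"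
      "i = m" "u m = t" "\<not> edgeline e"
    | j k where "e = closed_segment (xp f s j) (xp f (flip m s) j)" "m \<noteq> j" "m \<noteq> k" "j \<noteq> k" "i = k" "s k = t"
    | j where "e = closed_segment (xp f s j) (xp f (flip m s) j)" "m \<noteq> j" "i = j" "edgeline e"
proof -
  from e(1) consider
      (a) u j k where "e = closed_segment (xp f u j) (xp f u k)" "u \<in> {s, flip m s}" "j \<noteq> m" "k \<noteq> m" "j \<noteq> k"
    | (b) j where "e = closed_segment (xp f s j) (xp f (flip m s) j)" "j \<noteq> m"
    unfolding bar_lines_def by blast
  then show thesis
  proof cases
    case a
    have u: "u = s \<or> u = flip m s" using a(2) by simp
    then have bu: "bar2 f u m" using b bar2_flip by blast
    have ne: "\<not> edgeline e" unfolding a(1) bar_isop(2)[OF bu a(3)] bar_isop(2)[OF bu a(4)]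
      by (rule isop_not_edgeline[OF bar_isop(1)[OF bu a(3)] bar_isop(1)[OF bu a(4)]]) (metis flip2_neq_flip)
    have mjk: "m \<noteq> j" "m \<noteq> k" "j \<noteq> k" using a by auto
    have "xp f u j \<in> sd i t" "xp f u k \<in> sd i t" using e(2) a(1) segment_side by simp_all
    then have 1: "flip j u i = t" "flip k u i = t"
      using isop_in_side[OF bar_isop(1)[OF bu a(3)], of i t] isop_in_side[OF bar_isop(1)[OF bu a(4)], of i t]
        bar_isop(2)[OF bu a(3)] bar_isop(2)[OF bu a(4)] by simp_all
    have i: "i = m" using index_cases[OF mjk, of i] 1 mjk by (auto simp: flip_apply)
    then have "u m = t" using 1 mjk by simp
    then show ?thesis using that(1)[of u j k] u a mjk ne i by blast
  next
    case b2: b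
    obtain k where k: "k \<noteq> m" "k \<noteq> j" by (rule third_index)
    have mjk: "m \<noteq> j" "m \<noteq> k" "j \<noteq> k" using k b2 by auto
    have "xp f s j \<in> sd i t" "xp f (flip m s) j \<in> sd i t" using e(2) b2(1) segment_side by simp_all
    then have 1: "flip j s i = t \<and> (i \<noteq> j \<or> Z f (flip j s))" "flip j (flip m s) i = t \<and> (i \<noteq> j \<or> Z f (flip j (flip m s)))"
      using isop_in_side[OF bar_isop(1)[OF b b2(2)], of i t] isop_in_side[OF bar_isop(3)[OF b b2(2)], of i t]
        bar_isop(2)[OF b b2(2)] bar_isop(4)[OF b b2(2)] by simp_all
    consider "i = m" | "i = j" | "i = k" using index_cases[OF mjk] by blast
    then show ?thesis
    proof cases
      case 1 then show ?thesis using \<open>flip j s i = t \<and> _\<close> \<open>flip j (flip m s) i = t \<and> _\<close> mjk by auto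
    next
      case 2
      then have "xp f s j = v (flip j s)" "xp f (flip m s) j = v (flip j (flip m s))"
        using 1 bar_isop(2)[OF b b2(2)] bar_isop(4)[OF b b2(2)] xp_Z by auto
      then have "e = closed_segment (v (flip j s)) (v (flip m (flip j s)))" using b2(1) by (simp add: flip_commute)
      then have "edgeline e" unfolding edgeline_def by blast
      then show ?thesis using that(3) b2 2 by blast
    next
      case 3
      then have "s k = t" using 1 mjk by auto
      then show ?thesis using that(2) b2 mjk 3 by blast
    qed
  qed
qed

lemma bar_fl_end:
  assumes b: "bar2 f s m" and mjk: "m \<noteq> j" "m \<noteq> k" "j \<noteq> k"
  shows "fl {bar_lines f s m} m (s m) = {closed_segment (xp f s j) (xp f s k)}"
proof (intro subset_antisym subsetI)
  fix e assume "e \<in> fl {bar_lines f s m} m (s m)"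
  then have e: "e \<in> bar_lines f s m" "e \<subseteq> sd m (s m)" "\<not> edgeline e" by (auto simp: fl_def)
  from b e(1,2) show "e \<in> {closed_segment (xp f s j) (xp f s k)}"
  proof (cases rule: bar_lines_cases)
    case (1 u j' k')
    have "u = s" using 1 by auto
    moreover have "j' = j \<and> k' = k \<or> j' = k \<and> k' = j"
      using index_cases[OF mjk, of j'] index_cases[OF mjk, of k'] 1 by blast
    ultimately show ?thesis using 1(2) by (auto simp: closed_segment_commute)
  qed (use e(3) in auto)
next
  fix e assume "e \<in> {closed_segment (xp f s j) (xp f s k)}"
  then have e: "e = closed_segment (xp f s j) (xp f s k)" by simp
  have jm: "j \<noteq> m" "k \<noteq> m" using mjk by auto
  have 1: "e \<in> bar_lines f s m" unfolding bar_lines_def e using mjk by blast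
  have 2: "\<not> edgeline e" unfolding e bar_isop(2)[OF b jm(1)] bar_isop(2)[OF b jm(2)]
    by (rule isop_not_edgeline[OF bar_isop(1)[OF b jm(1)] bar_isop(1)[OF b jm(2)]]) (metis flip2_neq_flip)
  have "xp f s j \<in> sd m (s m)" "xp f s k \<in> sd m (s m)"
    using isop_in_side[OF bar_isop(1)[OF b jm(1)], of m "s m"] isop_in_side[OF bar_isop(1)[OF b jm(2)], of m "s m"]
      bar_isop(2)[OF b jm(1)] bar_isop(2)[OF b jm(2)] mjk by simp_all
  then show "e \<in> fl {bar_lines f s m} m (s m)" using 1 2 segment_side e by (auto simp: fl_def)
qed

lemma bar_fl_side:
  assumes b: "bar2 f s m" and mjk: "m \<noteq> j" "m \<noteq> k" "j \<noteq> k"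
  shows "fl {bar_lines f s m} k t =
    (if s k = t \<and> \<not> edgeline (closed_segment (xp f s j) (xp f (flip m s) j))
     then {closed_segment (xp f s j) (xp f (flip m s) j)} else {})"
proof (intro subset_antisym subsetI)
  fix e assume "e \<in> fl {bar_lines f s m} k t"
  then have e: "e \<in> bar_lines f s m" "e \<subseteq> sd k t" "\<not> edgeline e" by (auto simp: fl_def)
  have "s k = t \<and> e = closed_segment (xp f s j) (xp f (flip m s) j)"
    using b e(1,2)
  proof (cases rule: bar_lines_cases)
    case (2 j' k')
    have "j' = j" using index_cases[OF mjk, of j'] 2 by blast
    then show ?thesis using 2 by blast
  qed (use e(3) mjk in auto)
  then show "e \<in> (if s k = t \<and> \<not> edgeline (closed_segment (xp f s j) (xp f (flip m s) j))
     then {closed_segment (xp f s j) (xp f (flip m s) j)} else {})" using e(3) by simp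
next
  fix e assume "e \<in> (if s k = t \<and> \<not> edgeline (closed_segment (xp f s j) (xp f (flip m s) j))
     then {closed_segment (xp f s j) (xp f (flip m s) j)} else {})"
  then have e: "e = closed_segment (xp f s j) (xp f (flip m s) j)" "s k = t" "\<not> edgeline e"
    by (auto split: if_splits)
  have jm: "j \<noteq> m" using mjk by auto
  have 1: "e \<in> bar_lines f s m" unfolding bar_lines_def e using mjk by blast
  have "xp f s j \<in> sd k t" "xp f (flip m s) j \<in> sd k t"
    using isop_in_side[OF bar_isop(1)[OF b jm], of k t] isop_in_side[OF bar_isop(3)[OF b jm], of k t]
      bar_isop(2)[OF b jm] bar_isop(4)[OF b jm] mjk e(2) by simp_all
  then show "e \<in> fl {bar_lines f s m} k t" using 1 segment_side e by (auto simp: fl_def)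
qed

text \<open>The invariant of an \<open>S\<close>-step that records \<open>J\<close> and changes the labels from \<open>f\<close> to \<open>g\<close>.\<close>

definition step_ok :: "(point \<Rightarrow> real) \<Rightarrow> polygon \<Rightarrow> (point \<Rightarrow> real) \<Rightarrow> 3 \<Rightarrow> bool \<Rightarrow> bool" where
  "step_ok f J g i t \<longleftrightarrow>
    (if Lf f i t then
      Lf g i t \<and> fl {J} i t = {} \<and> W1 g i t = W1 f i t \<and> W2 g i t = W2 f i t \<or>
      \<not> Lf g i t \<and> (fl {J} i t \<union> ncl g i t = W1 f i t \<or> fl {J} i t \<union> ncl g i t = W2 f i t)
     else \<not> Lf g i t \<and> ncl f i t = fl {J} i t \<union> ncl g i t)"

lemma step_ok_untouched:
  assumes "\<And>u. u i = t \<Longrightarrow> u \<notin> X" "fl {J} i t = {}"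
  shows "step_ok f J (upd f X r) i t"
proof -
  have eq: "upd f X r (v u) = f (v u)" if "u i = t" for u using assms(1)[of u] that by (simp add: upd_v)
  have D: "D (upd f X r) u = D f u" if "u i = t" for u using eq[of u] that by (simp add: D_def)
  have "Lf (upd f X r) i t = Lf f i t" by (rule Lf_cong) (rule eq)
  moreover have "ncl (upd f X r) i t = ncl f i t" by (rule ncl_cong) (rule eq)
  moreover have "W1 (upd f X r) i t = W1 f i t" by (rule cuts_cong) (use eq D in auto)
  moreover have "W2 (upd f X r) i t = W2 f i t" by (rule cuts_cong) (use eq in auto)
  ultimately show ?thesis unfolding step_ok_def using assms(2) by auto
qed

lemma cuts_eq4:
  assumes ijk: "i \<noteq> j" "i \<noteq> k" "j \<noteq> k"
  shows "cuts f i (s i) Q =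
    (if Q s then {closed_segment (xp f s j) (xp f s k)} else {}) \<union>
    (if Q (flip j s) then {closed_segment (xp f (flip j s) j) (xp f (flip j s) k)} else {}) \<union>
    (if Q (flip k s) then {closed_segment (xp f (flip k s) j) (xp f (flip k s) k)} else {}) \<union>
    (if Q (flip j (flip k s)) then {closed_segment (xp f (flip j (flip k s)) j) (xp f (flip j (flip k s)) k)} else {})"
  unfolding cuts_eq[OF ijk] by (intro set_eqI) (simp only: mem_Collect_eq Un_iff insert_iff empty_iff split: if_splits, blast)

text \<open>Without \<open>s\<close> the opposite corner is the only disperse one of the L-face, and
  the \<open>C\<close>-rules cut it off. \<open>X\<close> may reach beyond the side, as it does for
  \<open>S2\<close>.\<close>

lemma ncl_cut_disperse:
  assumes ijk: "i \<noteq> j" "i \<noteq> k" "j \<noteq> k"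
    and D: "D f s" "\<not> D f (flip j s)" "\<not> D f (flip k s)" "D f (flip j (flip k s))"
    and X: "s \<in> X" "\<And>u. u \<in> X \<Longrightarrow> u i = s i \<Longrightarrow> u = s"
  shows "ncl (upd f X 0) i (s i) = {closed_segment (xp f (flip j s) k) (xp f (flip k s) j)}"
proof -
  let ?g = "upd f X 0"
  note jk = flip_commute[of k j s]
  have nX: "flip j s \<notin> X" "flip k s \<notin> X" "flip j (flip k s) \<notin> X"
    using X(2)[of "flip j s"] X(2)[of "flip k s"] X(2)[of "flip j (flip k s)"] ijk by auto
  have Dg: "\<not> D ?g s" "\<not> D ?g (flip j s)" "\<not> D ?g (flip k s)" "D ?g (flip j (flip k s))"
    using X(1) nX D c01 by (simp_all add: D_upd)
  have ng: "\<not> Lf ?g i (s i)" unfolding Lf_eq[OF ijk] using Dg by simp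
  have eqs: "xp ?g (flip j s) k = xp f (flip j s) k" "xp ?g (flip k s) j = xp f (flip k s) j"
    using xp_upd[of "flip j s" X k f 0] xp_upd[of "flip k s" X j f 0] nX jk by simp_all
  have ip: "ipf ?g i (s i) = {xp f (flip j s) k, xp f (flip k s) j}"
    unfolding ipf_eq[OF ijk] eqs using Dg jk by (simp add: insert_commute)
  have is2: "isop f (flip j s) k" "isop f (flip k s) j" using D jk by (simp_all add: isop_def)
  have ne2: "xp f (flip j s) k \<noteq> xp f (flip k s) j" using isop_eq_iff[OF is2] ijk by simp
  have "\<not> edgeline (closed_segment (xp f (flip j s) k) (xp f (flip k s) j))"
    by (rule isop_not_edgeline[OF is2]) (metis flip2_neq_flip)
  then show ?thesis using ncl_pair[OF ip ne2 ng] by simp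
qed

text \<open>If the opposite corner is continuous, \<open>J\<close> takes over the line of the
  \<open>C\<close>-rules and the side becomes continuous. If it is disperse, \<open>J\<close>
  supplies one line of \<open>W1\<close> and the \<open>C\<close>-rules afterwards the
  other.\<close>

lemma cut_disperse_corner:
  assumes ijk: "i \<noteq> j" "i \<noteq> k" "j \<noteq> k"
    and D: "D f s" "\<not> D f (flip j s)" "\<not> D f (flip k s)"
    and X: "s \<in> X" "\<And>u. u \<in> X \<Longrightarrow> u i = s i \<Longrightarrow> u = s"
    and J: "fl {J} i (s i) = {closed_segment (xp f s j) (xp f s k)}"
  shows "step_ok f J (upd f X 0) i (s i)"
proof -
  let ?g = "upd f X 0"
  note jk = flip_commute[of k j s]
  have nX: "flip j s \<notin> X" "flip k s \<notin> X" "flip j (flip k s) \<notin> X"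
    using X(2)[of "flip j s"] X(2)[of "flip k s"] X(2)[of "flip j (flip k s)"] ijk by auto
  have Dg: "\<not> D ?g s" "\<not> D ?g (flip j s)" "\<not> D ?g (flip k s)" "D ?g (flip j (flip k s)) = D f (flip j (flip k s))"
    using X(1) nX D c01 by (simp_all add: D_upd)
  have ng: "\<not> Lf ?g i (s i)" unfolding Lf_eq[OF ijk] using Dg by simp
  let ?e = "closed_segment (xp f s j) (xp f s k)"
  have isop: "isop f (flip j s) j" "isop f (flip k s) k" using D by (simp_all add: isop_def)
  have xpe: "xp f s j = xp f (flip j s) j" "xp f s k = xp f (flip k s) k"
    using xp_flip[of f s j] xp_flip[of f s k] D by simp_all
  have ne: "xp f s j \<noteq> xp f s k" unfolding xpe using isop_eq_iff[OF isop] ijk by simp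
  have nedge: "\<not> edgeline ?e" unfolding xpe by (rule isop_not_edgeline[OF isop]) (metis flip2_neq_flip)
  show ?thesis
  proof (cases "D f (flip j (flip k s))")
    case False
    have L: "\<not> Lf f i (s i)" unfolding Lf_eq[OF ijk] using D False by simp
    have "ipf f i (s i) = {xp f s j, xp f s k}" unfolding ipf_eq[OF ijk] using D False jk by (simp add: insert_commute)
    then have 1: "ncl f i (s i) = {?e}" using ncl_pair[OF _ ne L] nedge by simp
    have "ipf ?g i (s i) = {}" unfolding ipf_eq[OF ijk] using Dg False jk by simp
    then have "ncl ?g i (s i) = {}" by (intro ncl_sub1) simp
    then show ?thesis unfolding step_ok_def using L ng J 1 by simp
  next
    case True
    have L: "Lf f i (s i)" unfolding Lf_eq[OF ijk] using D True by simp
    note n = ncl_cut_disperse[OF ijk D True X]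
    have xq: "xp f (flip j (flip k s)) j = xp f (flip k s) j" "xp f (flip j (flip k s)) k = xp f (flip j s) k"
      using xp_flip[of f "flip k s" j] xp_flip[of f "flip j s" k] D True jk by simp_all
    have "W1 f i (s i) = {?e, closed_segment (xp f (flip k s) j) (xp f (flip j s) k)}"
      unfolding cuts_eq4[OF ijk] using D True by (simp add: xq insert_commute)
    then show ?thesis unfolding step_ok_def using L ng J n by (auto simp: closed_segment_commute)
  qed
qed

text \<open>Dual to \<open>cut_disperse_corner\<close>, with \<open>W2\<close> in place of
  \<open>W1\<close>. If the opposite corner has label \<open>c\<close>, the remaining iso-points
  both sit at it; then no second line arises, and \<open>W2\<close> has none there either.\<close>

lemma cut_continuous_corner:
  assumes ijk: "i \<noteq> j" "i \<noteq> k" "j \<noteq> k"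
    and D: "f (v s) < c" "D f (flip j s)" "D f (flip k s)"
    and J: "fl {J} i (s i) = {closed_segment (xp f s j) (xp f s k)}"
  shows "step_ok f J (upd f {s} 1) i (s i)"
proof -
  let ?g = "upd f {s} 1"
  note jk = flip_commute[of k j s]
  have nX: "flip j s \<notin> {s}" "flip k s \<notin> {s}" "flip j (flip k s) \<notin> {s}" using ijk by auto
  have Ds: "\<not> D f s" "\<not> Z f s" using D by (auto simp: D_def Z_def)
  have Dg: "D ?g s" "D ?g (flip j s)" "D ?g (flip k s)" "D ?g (flip j (flip k s)) = D f (flip j (flip k s))"
    using nX D c01 by (simp_all add: D_upd)
  have ng: "\<not> Lf ?g i (s i)" unfolding Lf_eq[OF ijk] using Dg by simp
  have eqs: "xp ?g (flip j s) k = xp f (flip j s) k" "xp ?g (flip k s) j = xp f (flip k s) j"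
    using xp_upd[of "flip j s" "{s}" k f 1] xp_upd[of "flip k s" "{s}" j f 1] nX jk by simp_all
  let ?e = "closed_segment (xp f s j) (xp f s k)"
  have isop: "isop f s j" "isop f s k" using D Ds by (simp_all add: isop_def)
  have ne: "xp f s j \<noteq> xp f s k" using isop_eq_iff[OF isop] ijk Ds by simp
  have nedge: "\<not> edgeline ?e" by (rule isop_not_edgeline[OF isop]) simp
  show ?thesis
  proof (cases "D f (flip j (flip k s))")
    case True
    have L: "\<not> Lf f i (s i)" unfolding Lf_eq[OF ijk] using D Ds True by simp
    have "ipf f i (s i) = {xp f s j, xp f s k}" unfolding ipf_eq[OF ijk] using D Ds True jk by (simp add: insert_commute)
    then have 1: "ncl f i (s i) = {?e}" using ncl_pair[OF _ ne L] nedge by simp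
    have "ipf ?g i (s i) = {}" unfolding ipf_eq[OF ijk] using Dg True jk by simp
    then have "ncl ?g i (s i) = {}" by (intro ncl_sub1) simp
    then show ?thesis unfolding step_ok_def using L ng J 1 by simp
  next
    case False
    let ?w = "flip j (flip k s)"
    have L: "Lf f i (s i)" unfolding Lf_eq[OF ijk] using D Ds False by simp
    have ip: "ipf ?g i (s i) = {xp f (flip j s) k, xp f (flip k s) j}"
      unfolding ipf_eq[OF ijk] eqs using Dg False jk by (simp add: insert_commute)
    have xq: "xp f (flip k s) j = xp f ?w j" "xp f (flip j s) k = xp f ?w k"
      using xp_flip[of f "flip k s" j] xp_flip[of f "flip j s" k] D False jk by simp_all
    have kw: "flip k ?w = flip j s" by (simp add: flip_commute[of k j])
    have is2: "isop f ?w k" "isop f ?w j" using D False kw by (simp_all add: isop_def)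
    have W: "W2 f i (s i) = (if f (v ?w) < c then {?e, closed_segment (xp f ?w j) (xp f ?w k)} else {?e})"
      unfolding cuts_eq4[OF ijk] using D(1) D(2,3)[unfolded D_def] by simp
    show ?thesis
    proof (cases "Z f ?w")
      case True
      then have "ncl ?g i (s i) = {}" using ip xq by (intro ncl_sub1[of _ _ _ "v ?w"]) (simp add: xp_Z)
      moreover have "\<not> f (v ?w) < c" using True by (simp add: Z_def)
      ultimately show ?thesis unfolding step_ok_def using L ng J W by simp
    next
      case nZ: False
      have ne2: "xp f (flip j s) k \<noteq> xp f (flip k s) j" using isop_eq_iff[OF is2] ijk nZ xq by simp
      have "\<not> edgeline (closed_segment (xp f (flip j s) k) (xp f (flip k s) j))"
        unfolding xq by (rule isop_not_edgeline[OF is2]) simp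
      then have n: "ncl ?g i (s i) = {closed_segment (xp f (flip j s) k) (xp f (flip k s) j)}"
        using ncl_pair[OF ip ne2 ng] by simp
      have "f (v ?w) < c" using nZ False by (auto simp: Z_def D_def)
      then show ?thesis unfolding step_ok_def using L ng J W n xq by (auto simp: closed_segment_commute)
    qed
  qed
qed

lemma index_others:
  obtains j k :: 3 where "i \<noteq> j" "i \<noteq> k" "j \<noteq> k"
proof -
  obtain j where "j \<noteq> i" using third_index by blast
  moreover obtain k where "k \<noteq> i" "k \<noteq> j" by (rule third_index)
  ultimately show thesis using that by metis
qed

lemma step1_ok:
  assumes st: "star1 f s"
  shows "step_ok f (star_lines f s) (upd f {s} 0) i t"
proof (cases "s i = t")
  case True
  obtain j k where ijk: "i \<noteq> j" "i \<noteq> k" "j \<noteq> k" by (rule index_others)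
  show ?thesis unfolding True[symmetric]
    by (rule cut_disperse_corner[OF ijk]) (use st star_fl(2)[of f s i j k] ijk in \<open>auto simp: star1_def\<close>)
next
  case False
  then show ?thesis by (intro step_ok_untouched) (use star_fl(1) st in auto)
qed

lemma step3_ok:
  assumes st: "star3 f s"
  shows "step_ok f (star_lines f s) (upd f {s} 1) i t"
proof (cases "s i = t")
  case True
  obtain j k where ijk: "i \<noteq> j" "i \<noteq> k" "j \<noteq> k" by (rule index_others)
  show ?thesis unfolding True[symmetric]
    by (rule cut_continuous_corner[OF ijk]) (use st star_fl(2)[of f s i j k] ijk in \<open>auto simp: star3_def\<close>)
next
  case False
  then show ?thesis by (intro step_ok_untouched) (use star_fl(1) st in auto)
qed

text \<open>On a side orthogonal to the bar one of its ends is cut off. A side containing the bar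
  has two adjacent disperse corners, so it is no L-face, and it becomes continuous. The remaining
  sides are untouched.\<close>

lemma step2_ok:
  assumes b: "bar2 f s m"
  shows "step_ok f (bar_lines f s m) (upd f {s, flip m s} 0) i t"
proof (cases "i = m")
  case True
  obtain j k where mjk: "m \<noteq> j" "m \<noteq> k" "j \<noteq> k" by (rule index_others)
  have end1: "step_ok f (bar_lines f u m) (upd f {u, flip m u} 0) m (u m)" if bu: "bar2 f u m" for u
    by (rule cut_disperse_corner[OF mjk]) (use bu bar_fl_end[OF bu mjk] mjk in \<open>auto simp: bar2_def\<close>)
  show ?thesis
  proof (cases "s m = t")
    case True then show ?thesis using end1[OF b] \<open>i = m\<close> by simp
  next
    case False
    then have "flip m s m = t" by simp
    then show ?thesis
      using end1[OF bar2_flip[OF b]] \<open>i = m\<close> bar_lines_flip[of f m s] insert_commute[of s "flip m s" "{}"] by simp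
  qed
next
  case False
  obtain j where j: "j \<noteq> m" "j \<noteq> i" by (rule third_index)
  have mji: "m \<noteq> j" "m \<noteq> i" "j \<noteq> i" and imj: "i \<noteq> m" "i \<noteq> j" "m \<noteq> j" using j False by auto
  show ?thesis
  proof (cases "s i = t")
    case st: True
    let ?g = "upd f {s, flip m s} 0"
    note jm = flip_commute[of j m s]
    have D': "D f s" "D f (flip m s)" "\<not> D f (flip j s)" "\<not> D f (flip j (flip m s))"
      using b imj by (simp_all add: bar2_def)
    note D = D'(1-3) D'(4)[unfolded jm]
    have nX: "flip j s \<notin> {s, flip m s}" "flip m (flip j s) \<notin> {s, flip m s}"
      using flip_bar[of s s m j] flip_bar[of "flip m s" s m j] imj jm by simp_all
    have Dg: "\<not> D ?g s" "\<not> D ?g (flip m s)" "\<not> D ?g (flip j s)" "\<not> D ?g (flip m (flip j s))"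
      using nX D c01 by (simp_all add: D_upd)
    have L: "\<not> Lf f i (s i)" "\<not> Lf ?g i (s i)" unfolding Lf_eq[OF imj] using D Dg by simp_all
    have ip: "ipf f i (s i) = {xp f s j, xp f (flip m s) j}" "ipf ?g i (s i) = {}"
      unfolding ipf_eq[OF imj] using D Dg jm by (simp_all add: insert_commute)
    have jm': "j \<noteq> m" using imj by auto
    have ne: "xp f s j \<noteq> xp f (flip m s) j"
      using isop_eq_iff[OF bar_isop(1)[OF b jm'] bar_isop(3)[OF b jm']] bar_isop(2)[OF b jm'] bar_isop(4)[OF b jm'] by simp
    have "ncl ?g i (s i) = {}" using ip by (intro ncl_sub1) simp
    then show ?thesis
      unfolding step_ok_def st[symmetric] using L ncl_pair[OF ip(1) ne L(1)] bar_fl_side[OF b mji, of "s i"] by simp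
  next
    case False
    have "fl {bar_lines f s m} i t = {}" using bar_fl_side[OF b mji, of t] False by simp
    moreover have "u \<notin> {s, flip m s}" if "u i = t" for u using that False imj by auto
    ultimately show ?thesis by (rule step_ok_untouched[rotated])
  qed
qed

text \<open>The choice between \<open>W1\<close> and \<open>W2\<close> may differ from side to side
  of the same cuboid.\<close>

definition resolved :: "(point \<Rightarrow> real) \<Rightarrow> polygon set \<Rightarrow> bool" where
  "resolved f \<J> \<longleftrightarrow> (\<forall>i t. if Lf f i t then fl \<J> i t = W1 f i t \<or> fl \<J> i t = W2 f i t else fl \<J> i t = ncl f i t)"

lemma resolved_step:
  assumes "\<And>i t. step_ok f J g i t" "resolved g \<J>"
  shows "resolved f (insert J \<J>)"
  unfolding resolved_def
proof (intro allI)
  fix i t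
  have 1: "step_ok f J g i t" by (rule assms(1))
  have 2: "if Lf g i t then fl \<J> i t = W1 g i t \<or> fl \<J> i t = W2 g i t else fl \<J> i t = ncl g i t"
    using assms(2) unfolding resolved_def by blast
  have 3: "fl (insert J \<J>) i t = fl {J} i t \<union> fl \<J> i t" by (rule fl_insert)
  show "if Lf f i t then fl (insert J \<J>) i t = W1 f i t \<or> fl (insert J \<J>) i t = W2 f i t
    else fl (insert J \<J>) i t = ncl f i t"
    using 1 2 unfolding step_ok_def 3 by (auto split: if_splits)
qed

lemma S_step_ok:
  assumes "S_step c r (gr f) J G'"
  obtains g where "G' = gr g" "\<And>i t. step_ok f J g i t"
  using assms
proof (cases rule: S_step_cases)
  case (1 s) then show ?thesis using that step1_ok by blast
next
  case (2 s m) then show ?thesis using that step2_ok by blast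
next
  case (3 s) then show ?thesis using that step3_ok by blast
qed

lemma S_steps_gr:
  assumes "S_steps c r n (gr f) \<J> G'"
  obtains g where "G' = gr g"
proof -
  have "\<exists>g. G' = gr g" if "S_steps c r n G \<J> G'" "G = gr f" for G f
    using that
  proof (induction arbitrary: f rule: S_steps.induct)
    case (2 G J H n \<J> G'')
    then show ?case using S_step_ok[of r f J H] by metis
  qed auto
  then show thesis using assms that by blast
qed

text \<open>Works backwards: the \<open>C\<close>-rules resolve the final graph because it has no
  L-faces, and \<open>step_ok\<close> carries this across each preceding step.\<close>

lemma S_steps_resolved:
  assumes "S_steps c r n (gr f) \<J> (gr g)" "\<And>i t. \<not> Lf g i t"
  shows "resolved f (insert (C_rules c (gr g)) \<J>)"
proof -
  have "resolved f (insert (C_rules c (gr g)) \<J>)" if "S_steps c r n G \<J> G'" "G = gr f" "G' = gr g" for G G' f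
    using that
  proof (induction arbitrary: f rule: S_steps.induct)
    case (1 G)
    then have "f = g" by simp
    then show ?case unfolding resolved_def using fl_C_rules[of f] assms(2) by auto
  next
    case (2 G J H n \<J> G'')
    then obtain h where h: "H = gr h" "\<And>i t. step_ok f J h i t" using S_step_ok[of r f J H] by metis
    have "resolved h (insert (C_rules c (gr g)) \<J>)" using 2 h by blast
    then show ?case using resolved_step[OF h(2)] by (metis insert_commute)
  qed
  then show ?thesis using assms(1) by blast
qed

end

subsection \<open>Iso-lines along edges of one cuboid\<close>

lemma S_steps_0: "S_steps c r 0 G \<J> G' \<Longrightarrow> G' = G \<and> \<J> = {}"
  by (auto elim: S_steps.cases)

lemma S_steps_Suc:
  assumes "S_steps c r (Suc n) G \<J> G'"
  obtains J H \<J>' where "S_step c r G J H" "S_steps c r n H \<J>' G'" "\<J> = insert J \<J>'"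
  using assms by (auto elim: S_steps.cases)

lemma S_steps_Suc0:
  assumes "S_steps c r (Suc 0) G \<J> G'"
  obtains J where "S_step c r G J G'" "\<J> = {J}"
proof -
  from assms obtain J H \<J>' where "S_step c r G J H" "S_steps c r 0 H \<J>' G'" "\<J> = insert J \<J>'"
    by (rule S_steps_Suc)
  then show thesis using that S_steps_0 by blast
qed

context iso_corners
begin

abbreviation "eseg s m \<equiv> closed_segment (v s) (v (flip m s))"

text \<open>The edge in direction \<open>m\<close> at \<open>s\<close> is an iso-line.\<close>

definition EL :: "(point \<Rightarrow> real) \<Rightarrow> (3 \<Rightarrow> bool) \<Rightarrow> 3 \<Rightarrow> bool" where
  "EL f s m \<longleftrightarrow> Z f s \<and> Z f (flip m s) \<and> (\<exists>j. j \<noteq> m \<and> D f (flip j s) \<and> D f (flip m (flip j s)))"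

text \<open>A side that contains the edge has only one direction besides \<open>m\<close>; a
  label-\<open>c\<close> corner is an iso-point of the side only if the edge in that direction is
  mixed, which makes the other two corners disperse.\<close>

lemma EL_C_rules: "eseg s m \<in> C_rules c (gr f) \<longleftrightarrow> EL f s m"
proof
  assume "eseg s m \<in> C_rules c (gr f)"
  then obtain p q i t where pq: "eseg s m = closed_segment p q" "ipf f i t = {p, q}"
    unfolding C_rules_gr by blast
  have vs: "v s \<in> ipf f i t" "v (flip m s) \<in> ipf f i t" using pq by (auto simp: segment_eq_iff)
  obtain w l where w: "v s = xp f w l" "isop f w l" "w i = t" "l \<noteq> i" using vs(1) ipf_isop by blast
  obtain w' l' where w': "v (flip m s) = xp f w' l'" "isop f w' l'" "w' i = t" "l' \<noteq> i" using vs(2) ipf_isop by blast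
  have ws: "w = s" "Z f s" using isop_eq_corner[OF w(2), of s] w(1) by auto
  have ws': "w' = flip m s" "Z f (flip m s)" using isop_eq_corner[OF w'(2), of "flip m s"] w'(1) by auto
  have im: "i \<noteq> m" using w(3) w'(3) ws ws' by auto
  have lm: "l \<noteq> m" "l' \<noteq> m" using w(2) w'(2) ws ws' by (auto simp: isop_def)
  then have "l' = l" using index_cases[of i m l l'] im w(4) w'(4) by auto
  then have "D f (flip l s)" "D f (flip l (flip m s))" using w(2) w'(2) ws ws' by (simp_all add: isop_def)
  then have "D f (flip l s)" "D f (flip m (flip l s))" by (simp_all add: flip_commute[of l m])
  then show "EL f s m" unfolding EL_def using ws ws' lm by blast
next
  assume "EL f s m"
  then obtain j where j: "Z f s" "Z f (flip m s)" "j \<noteq> m" "D f (flip j s)" "D f (flip m (flip j s))"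
    by (auto simp: EL_def)
  obtain i where i: "i \<noteq> m" "i \<noteq> j" by (rule third_index)
  have imj: "i \<noteq> m" "i \<noteq> j" "m \<noteq> j" using i j by auto
  note jm = flip_commute[of j m s]
  have nD: "\<not> D f s" "\<not> D f (flip m s)" using j by auto
  have "ipf f i (s i) = {v s, v (flip m s)}"
    unfolding ipf_eq[OF imj] using j nD jm by (simp add: xp_Z insert_commute)
  moreover have "\<not> Lf f i (s i)" unfolding Lf_eq[OF imj] using nD j by simp
  moreover have "v s \<noteq> v (flip m s)" by simp
  ultimately show "eseg s m \<in> C_rules c (gr f)" unfolding C_rules_gr by blast
qed

lemma edgeline_eseg: "edgeline (eseg s m)"
  unfolding edgeline_def by blast

lemma eseg_star: "star1 f u \<or> star3 f u \<Longrightarrow> eseg s m \<notin> star_lines f u"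
proof
  assume st: "star1 f u \<or> star3 f u" and "eseg s m \<in> star_lines f u"
  then obtain j k where "j \<noteq> k" "eseg s m = closed_segment (xp f u j) (xp f u k)"
    unfolding star_lines_def by blast
  then show False using star_pair_not_edgeline[OF st] edgeline_eseg by metis
qed

lemma EL_mono: "(\<And>s. D g s \<Longrightarrow> D f s) \<Longrightarrow> (\<And>s. Z g s \<Longrightarrow> Z f s) \<Longrightarrow> EL g s m \<Longrightarrow> EL f s m"
  unfolding EL_def by blast

lemma D_Z_upd0: "D (upd f X 0) s \<longleftrightarrow> s \<notin> X \<and> D f s" "Z (upd f X 0) s \<longleftrightarrow> s \<notin> X \<and> Z f s"
  using c01 by (simp_all add: D_upd Z_upd)

text \<open>The disperse corners that witness \<open>EL\<close> are adjacent to each other, whereas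
  \<open>u\<close> has no disperse neighbour; so \<open>u\<close> is not among them.\<close>

lemma EL_step1:
  assumes st: "star1 f u"
  shows "EL f s m \<longleftrightarrow> EL (upd f {u} 0) s m"
proof
  assume "EL f s m"
  then obtain j where j: "Z f s" "Z f (flip m s)" "j \<noteq> m" "D f (flip j s)" "D f (flip m (flip j s))"
    by (auto simp: EL_def)
  have Du: "D f u" and all: "\<not> D f (flip l u)" for l using st by (simp_all add: star1_def)
  have "flip j s \<noteq> u" using all[of m] j(5) by metis
  moreover have "flip m (flip j s) \<noteq> u" using all[of m] j(4) by (metis flip_flip)
  moreover have "s \<noteq> u" "flip m s \<noteq> u" using Du j(1,2) Z_not_D by metis+
  ultimately show "EL (upd f {u} 0) s m" unfolding EL_def D_Z_upd0 using j by blast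
next
  assume "EL (upd f {u} 0) s m"
  then show "EL f s m" by (rule EL_mono[rotated 2]) (simp_all add: D_Z_upd0)
qed

text \<open>All neighbours of \<open>u\<close> are disperse, whereas each witness of
  \<open>EL\<close> has a neighbour of label \<open>c\<close>; so making \<open>u\<close> disperse
  creates no witness.\<close>

lemma EL_step3:
  assumes st: "star3 f u"
  shows "EL f s m \<longleftrightarrow> EL (upd f {u} 1) s m"
proof
  assume "EL f s m"
  moreover have "\<not> Z f u" using st by (auto simp: star3_def Z_def)
  ultimately show "EL (upd f {u} 1) s m"
    by (intro EL_mono[of f "upd f {u} 1"]) (use c01 in \<open>auto simp: D_upd Z_upd\<close>)
next
  assume "EL (upd f {u} 1) s m"
  then obtain j where j: "Z f s" "Z f (flip m s)" "j \<noteq> m" "D (upd f {u} 1) (flip j s)" "D (upd f {u} 1) (flip m (flip j s))"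
    using c01 by (auto simp: EL_def Z_upd)
  have all: "D f (flip l u)" for l using st by (simp add: star3_def)
  have "u \<noteq> flip j s"
  proof
    assume "u = flip j s"
    then have "flip j u = s" by simp
    then show False using all[of j] j(1) by simp
  qed
  moreover have "u \<noteq> flip m (flip j s)"
  proof
    assume "u = flip m (flip j s)"
    then have "flip j u = flip m s" by (simp add: flip_commute[of m j])
    then show False using all[of j] j(2) by simp
  qed
  ultimately show "EL f s m" unfolding EL_def using j by (auto simp: D_upd)
qed

lemma eseg_bar:
  assumes b: "bar2 f u n" and e: "eseg s m \<in> bar_lines f u n"
  shows "EL f s m"
proof -
  from e consider
      (a) w j k where "eseg s m = closed_segment (xp f w j) (xp f w k)" "w \<in> {u, flip n u}" "j \<noteq> n" "k \<noteq> n" "j \<noteq> k"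
    | (b) j where "eseg s m = closed_segment (xp f u j) (xp f (flip n u) j)" "j \<noteq> n"
    unfolding bar_lines_def by blast
  then show ?thesis
  proof cases
    case a
    have bw: "bar2 f w n" using a(2) b bar2_flip by auto
    have "\<not> edgeline (eseg s m)" unfolding a(1) bar_isop(2)[OF bw a(3)] bar_isop(2)[OF bw a(4)]
      by (rule isop_not_edgeline[OF bar_isop(1)[OF bw a(3)] bar_isop(1)[OF bw a(4)]]) (metis flip2_neq_flip)
    then show ?thesis using edgeline_eseg by blast
  next
    case b': b
    have eq: "closed_segment (xp f (flip j u) j) (xp f (flip j (flip n u)) j) = eseg s m"
      using b'(1) bar_isop(2)[OF b b'(2)] bar_isop(4)[OF b b'(2)] by simp
    note r = isop_edgeline[OF bar_isop(1)[OF b b'(2)] bar_isop(3)[OF b b'(2)] eq]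
    have D: "D f u" "D f (flip n u)" using b by (simp_all add: bar2_def)
    have fl: "flip j (flip n u) = flip n (flip j u)" by (rule flip_commute)
    from r(3) show ?thesis
    proof
      assume "flip j u = s \<and> flip j (flip n u) = flip m s"
      then have s: "s = flip j u" "n = m" using fl flip_eq_iff by metis+
      then have "flip j s = u" "flip m (flip j s) = flip n u" by simp_all
      then show ?thesis unfolding EL_def using r(1,2) D b'(2) s(2) by metis
    next
      assume "flip j (flip n u) = s \<and> flip j u = flip m s"
      then have s: "s = flip n (flip j u)" "flip m s = flip j u" by (metis fl)+
      then have "flip n s = flip m s" by simp
      then have n: "n = m" by simp
      have "flip j s = flip n u" using s(1) by (simp add: fl[symmetric])
      moreover then have "flip m (flip j s) = u" using n by simp
      ultimately show ?thesis unfolding EL_def using r(1,2) D b'(2) n by metis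
    qed
  qed
qed

text \<open>A corner of the bar has its only disperse neighbour in the bar. So the pair that
  witnesses \<open>EL\<close> either is the bar, and then the quadrilateral contains the edge, or
  avoids it and survives the relabelling.\<close>

lemma EL_step2:
  assumes b: "bar2 f u n"
  shows "EL f s m \<longleftrightarrow> eseg s m \<in> bar_lines f u n \<or> EL (upd f {u, flip n u} 0) s m"
proof
  assume "EL f s m"
  then obtain j where j: "Z f s" "Z f (flip m s)" "j \<noteq> m" "D f (flip j s)" "D f (flip m (flip j s))"
    by (auto simp: EL_def)
  have Du: "D f u" "D f (flip n u)" using b by (simp_all add: bar2_def)
  have nb: "l = n" if "w = u \<or> w = flip n u" "D f (flip l w)" for w l
    using that b by (auto simp: bar2_def)
  have key: "eseg s m \<in> bar_lines f u n" if w: "w = u \<or> w = flip n u" and js: "flip j s = w \<or> flip m (flip j s) = w" for w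
  proof -
    have bw: "bar2 f w n" using w b bar2_flip by auto
    have bl: "bar_lines f w n = bar_lines f u n" using w bar_lines_flip by auto
    from js have mn: "m = n" using nb[OF w, of m] j(4,5) by auto
    have in1: "eseg s m \<in> bar_lines f w n" if "flip j s = w" "bar2 f w n" for w
    proof -
      have w1: "flip j w = s" "flip j (flip n w) = flip m s"
        using that(1) mn by (auto simp: flip_commute[of j n])
      have "D f w" "D f (flip n w)" using that(2) by (simp_all add: bar2_def)
      then have "xp f w j = v s" "xp f (flip n w) j = v (flip m s)"
        using xp_Z_flip[of f w j] xp_Z_flip[of f "flip n w" j] j(1,2) unfolding w1 by simp_all
      then have "eseg s m = closed_segment (xp f w j) (xp f (flip n w) j)" by simp
      then show ?thesis unfolding bar_lines_def using j(3) mn by blast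
    qed
    from js show ?thesis
    proof
      assume "flip j s = w" then show ?thesis using in1[OF _ bw] bl by simp
    next
      assume "flip m (flip j s) = w"
      then have "flip j s = flip n w" using mn by auto
      then show ?thesis using in1[OF _ bar2_flip[OF bw]] bl bar_lines_flip by simp
    qed
  qed
  show "eseg s m \<in> bar_lines f u n \<or> EL (upd f {u, flip n u} 0) s m"
  proof (cases "flip j s \<in> {u, flip n u} \<or> flip m (flip j s) \<in> {u, flip n u}")
    case True
    then show ?thesis using key by blast
  next
    case False
    moreover have "s \<notin> {u, flip n u}" "flip m s \<notin> {u, flip n u}"
      using j(1,2) Du Z_not_D by (metis insertE singletonD)+
    ultimately have "EL (upd f {u, flip n u} 0) s m" unfolding EL_def D_Z_upd0 using j by blast
    then show ?thesis ..
  qed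
next
  assume "eseg s m \<in> bar_lines f u n \<or> EL (upd f {u, flip n u} 0) s m"
  then show "EL f s m"
  proof
    assume "EL (upd f {u, flip n u} 0) s m"
    then show ?thesis by (rule EL_mono[rotated 2]) (simp_all add: D_Z_upd0)
  qed (rule eseg_bar[OF b])
qed

lemma S_step_EL:
  assumes "S_step c r (gr f) J (gr g)"
  shows "EL f s m \<longleftrightarrow> eseg s m \<in> J \<or> EL g s m"
  using assms
proof (cases rule: S_step_cases)
  case (1 u) then show ?thesis using EL_step1[of f u s m] eseg_star[of f u s m] by auto
next
  case (2 u n) then show ?thesis using EL_step2[of f u n s m] by auto
next
  case (3 u) then show ?thesis using EL_step3[of f u s m] eseg_star[of f u s m] by auto
qed

text \<open>In contrast to the lines inside L-faces, those along edges do not depend on the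
  subgraphs that the algorithm chooses.\<close>

lemma S_steps_EL:
  assumes "S_steps c r n (gr f) \<J> (gr g)"
  shows "eseg s m \<in> \<Union>(insert (C_rules c (gr g)) \<J>) \<longleftrightarrow> EL f s m"
proof -
  have "eseg s m \<in> \<Union>(insert (C_rules c (gr g)) \<J>) \<longleftrightarrow> EL f s m" if "S_steps c r n G \<J> G'" "G = gr f" "G' = gr g" for G G' f
    using that
  proof (induction arbitrary: f rule: S_steps.induct)
    case (1 G)
    then have "f = g" by simp
    then show ?case using EL_C_rules[of s m f] by simp
  next
    case (2 G J H n \<J> G'')
    then obtain h where h: "H = gr h" using S_step_ok[of r f J H] by metis
    have "eseg s m \<in> \<Union>(insert (C_rules c (gr g)) \<J>) \<longleftrightarrow> EL h s m" using 2 h by blast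
    moreover have "S_step c r (gr f) J (gr h)" using 2 h by simp
    then have "EL f s m \<longleftrightarrow> eseg s m \<in> J \<or> EL h s m" by (rule S_step_EL)
    ultimately show ?case by auto
  qed
  then show ?thesis using assms by blast
qed

section \<open>Two inner iso-paths of one graph through the same line\<close>

definition T1i :: "(point \<Rightarrow> real) \<Rightarrow> bool" where
  "T1i f \<longleftrightarrow> (\<exists>s. Z f s \<and> (\<forall>j. D f (flip j s)))"

text \<open>An \<open>F\<^sub>1\<close>-graph in corner indices: of the four edges in direction
  \<open>m\<close>, two diagonally opposite ones have label \<open>c\<close> and the other two are
  disperse.\<close>

definition F1i :: "(point \<Rightarrow> real) \<Rightarrow> bool" where
  "F1i f \<longleftrightarrow> (\<exists>s m. D f s \<and> D f (flip m s) \<and> (\<forall>j. j \<noteq> m \<longrightarrow> Z f (flip j s) \<and> Z f (flip m (flip j s)) \<and>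
     (\<forall>k. k \<noteq> m \<and> k \<noteq> j \<longrightarrow> D f (flip k (flip j s)) \<and> D f (flip m (flip k (flip j s))))))"

definition tri :: "(point \<Rightarrow> real) \<Rightarrow> 3 \<Rightarrow> bool \<Rightarrow> bool" where
  "tri f i t \<longleftrightarrow> Lf f i t \<and> (\<forall>s. s i = t \<and> \<not> D f s \<longrightarrow> Z f s)"

text \<open>After the relabelling the sides containing the bar are continuous, so a line beside the
  bar can recur only along an edge. That requires label \<open>c\<close> on this edge and a disperse
  edge opposite to the bar; for both lines together this is \<open>F1i\<close>.\<close>

lemma bar_neq_C_rules:
  assumes b: "bar2 f s m" and F1: "\<not> F1i f"
  shows "bar_lines f s m \<noteq> C_rules c (gr (upd f {s, flip m s} 0))"
proof
  let ?g = "upd f {s, flip m s} 0"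
  assume eq: "bar_lines f s m = C_rules c (gr ?g)"
  have Du: "D f s" "D f (flip m s)" using b by (simp_all add: bar2_def)
  have ng: "\<not> D ?g s" "\<not> D ?g (flip m s)" using c01 by (simp_all add: D_upd)
  have key: "Z f (flip j s) \<and> Z f (flip m (flip j s)) \<and> D f (flip k (flip j s)) \<and> D f (flip m (flip k (flip j s)))"
    if mjk: "m \<noteq> j" "m \<noteq> k" "j \<noteq> k" for j k
  proof -
    have jm: "j \<noteq> m" and kmj: "k \<noteq> m" "k \<noteq> j" using mjk by auto
    let ?e = "closed_segment (xp f s j) (xp f (flip m s) j)"
    have e: "?e \<in> C_rules c (gr ?g)" unfolding eq[symmetric] bar_lines_def using jm by blast
    have ng2: "\<not> D ?g (flip j s)" "\<not> D ?g (flip m (flip j s))"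
      using b jm c01 by (auto simp: bar2_def D_upd flip_commute[of m j])
    have "ipf ?g k (s k) = {}" unfolding ipf_eq[OF kmj mjk(1)]
      using ng ng2 by (simp add: flip_commute[of j m])
    then have "ncl ?g k (s k) = {}" by (intro ncl_sub1) simp
    then have "fl {C_rules c (gr ?g)} k (s k) = {}" by (simp add: fl_C_rules)
    then have "fl {bar_lines f s m} k (s k) = {}" by (simp add: eq)
    then have "edgeline ?e" using bar_fl_side[OF b mjk, of "s k"] by (simp split: if_splits)
    then obtain u n where un: "closed_segment (xp f (flip j s) j) (xp f (flip j (flip m s)) j) = eseg u n"
      using bar_isop(2)[OF b jm] bar_isop(4)[OF b jm] by (auto simp: edgeline_def)
    note r = isop_edgeline[OF bar_isop(1)[OF b jm] bar_isop(3)[OF b jm] un]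
    have Zs: "Z f (flip j s)" "Z f (flip j (flip m s))" using r by auto
    have "?e = eseg (flip j s) m"
      using bar_isop(2)[OF b jm] bar_isop(4)[OF b jm] Zs by (simp add: xp_Z flip_commute[of j m])
    then have "EL ?g (flip j s) m" using e EL_C_rules by metis
    then obtain l where l: "l \<noteq> m" "D ?g (flip l (flip j s))" "D ?g (flip m (flip l (flip j s)))"
      by (auto simp: EL_def)
    have "l \<noteq> j" using l(2) ng by auto
    then have "l = k" using index_cases[OF mjk, of l] l(1) by blast
    then have "D f (flip k (flip j s))" "D f (flip m (flip k (flip j s)))"
      using l Du by (auto simp: D_upd split: if_splits)
    then show ?thesis using Zs by (simp add: flip_commute[of j m])
  qed
  have "F1i f" unfolding F1i_def
  proof (intro exI[of _ s] exI[of _ m] conjI allI impI Du)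
    fix j assume j: "j \<noteq> m"
    obtain k where k: "k \<noteq> m" "k \<noteq> j" by (rule third_index)
    then show "Z f (flip j s)" "Z f (flip m (flip j s))" using key[of j k] j by auto
    fix k assume "k \<noteq> m \<and> k \<noteq> j"
    then show "D f (flip k (flip j s))" "D f (flip m (flip k (flip j s)))" using key[of j k] j by auto
  qed
  then show False using F1 by simp
qed

text \<open>On a trivial L-face the iso-points are the two label-\<open>c\<close> corners, so both
  cuts degenerate to the diagonal between them.\<close>

lemma tri_cut:
  assumes ijk: "i \<noteq> j" "i \<noteq> k" "j \<noteq> k" and tri: "tri f i (s i)" and Ds: "D f s"
  shows "\<not> D f (flip j s)" "\<not> D f (flip k s)" "D f (flip j (flip k s))" "Z f (flip j s)" "Z f (flip k s)"
    and "W1 f i (s i) = {closed_segment (v (flip j s)) (v (flip k s))}"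
    and "xp f s j = v (flip j s)" "xp f s k = v (flip k s)"
proof -
  have L: "Lf f i (s i)" using tri by (simp add: tri_def)
  then show D: "\<not> D f (flip j s)" "\<not> D f (flip k s)" "D f (flip j (flip k s))"
    unfolding Lf_eq[OF ijk] using Ds by auto
  show Zs: "Z f (flip j s)" "Z f (flip k s)" using tri D ijk unfolding tri_def by auto
  show x: "xp f s j = v (flip j s)" "xp f s k = v (flip k s)" using xp_Z_flip Ds Zs by auto
  have "xp f (flip j (flip k s)) j = v (flip k s)" "xp f (flip j (flip k s)) k = v (flip j s)"
    using xp_Z_flip[of f "flip j (flip k s)" j] xp_Z_flip[of f "flip j (flip k s)" k] D Zs
    by (simp_all add: flip_commute[of j k])
  then show "W1 f i (s i) = {closed_segment (v (flip j s)) (v (flip k s))}"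
    unfolding cuts_eq4[OF ijk] using Ds D x by (simp add: closed_segment_commute)
qed

text \<open>The triangle also has a line on another side \<open>k\<close>. If it recurred, the
  relabelled graph would need a line of the \<open>C\<close>-rules there, hence a disperse corner
  diagonally opposite to \<open>u\<close>; then the label-\<open>c\<close> corner
  \<open>flip j u\<close> would have three disperse neighbours.\<close>

lemma star_not_in_rest:
  assumes st: "star1 f u" and T1: "\<not> T1i f" and tri: "tri f i (u i)"
    and res: "resolved (upd f {u} 0) \<J>"
  shows "star_lines f u \<notin> \<J>"
proof
  assume inJ: "star_lines f u \<in> \<J>"
  let ?g = "upd f {u} 0"
  obtain j k where ijk: "i \<noteq> j" "i \<noteq> k" "j \<noteq> k" by (rule index_others)
  have kji: "k \<noteq> j" "k \<noteq> i" "j \<noteq> i" using ijk by auto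
  have Du: "D f u" using st by (simp add: star1_def)
  note tc = tri_cut[OF ijk tri Du]
  let ?e = "closed_segment (xp f u j) (xp f u i)"
  have "?e \<in> fl {star_lines f u} k (u k)" using star_fl(2)[of f u k j i] st kji by simp
  then have e: "?e \<in> fl \<J> k (u k)" using inJ by (auto simp: fl_def)
  have ng: "\<not> D ?g u" "\<not> D ?g (flip j u)" "\<not> D ?g (flip i u)"
    using st c01 by (simp_all add: D_upd star1_def)
  then have L: "\<not> Lf ?g k (u k)" unfolding Lf_eq[OF kji] by simp
  have ne: "ncl ?g k (u k) \<noteq> {}" using e res L unfolding resolved_def by fastforce
  have "D ?g (flip j (flip i u))"
  proof (rule ccontr)
    assume "\<not> D ?g (flip j (flip i u))"
    then have "ipf ?g k (u k) = {}" unfolding ipf_eq[OF kji] using ng by (simp add: flip_commute[of i j])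
    then show False using ne ncl_sub1[of ?g k "u k"] by auto
  qed
  then have "D f (flip i (flip j u))" using Du by (auto simp: D_upd flip_commute[of i j] split: if_splits)
  moreover have "D f (flip k (flip j u))" using tc(3) by (simp add: flip_commute[of k j])
  moreover have "D f (flip j (flip j u))" using Du by simp
  ultimately have "\<forall>l. D f (flip l (flip j u))" unfolding all_index[OF ijk] by blast
  then show False using T1 tc(4) by (auto simp: T1i_def)
qed

lemma two_paths_mono:
  assumes "\<exists>J1\<in>A. \<exists>J2\<in>A. J1 \<noteq> J2 \<and> e \<in> J1 \<and> e \<in> J2" "A \<subseteq> B"
  shows "\<exists>J1\<in>B. \<exists>J2\<in>B. J1 \<noteq> J2 \<and> e \<in> J1 \<and> e \<in> J2"
  using assms by blast

lemma two_pathsI: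
  "J1 \<in> A \<Longrightarrow> J2 \<in> A \<Longrightarrow> J1 \<noteq> J2 \<Longrightarrow> e \<in> J1 \<Longrightarrow> e \<in> J2 \<Longrightarrow> \<exists>J1\<in>A. \<exists>J2\<in>A. J1 \<noteq> J2 \<and> e \<in> J1 \<and> e \<in> J2"
  by blast

text \<open>The first star centred on the side records the diagonal. The rest has to draw it once
  more to cut off the opposite disperse corner, and by \<open>star_not_in_rest\<close> it does so in
  a different polygon.\<close>

lemma two_paths_trivial_S1:
  assumes "S_steps c S1 n (gr f) \<J> (gr g)" "\<And>i t. \<not> Lf g i t" "\<not> T1i f" "tri f i t" "e \<in> W1 f i t"
  shows "\<exists>J1\<in>insert (C_rules c (gr g)) \<J>. \<exists>J2\<in>insert (C_rules c (gr g)) \<J>. J1 \<noteq> J2 \<and> e \<in> J1 \<and> e \<in> J2"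
proof -
  have "\<exists>J1\<in>insert (C_rules c (gr g)) \<J>. \<exists>J2\<in>insert (C_rules c (gr g)) \<J>. J1 \<noteq> J2 \<and> e \<in> J1 \<and> e \<in> J2"
    if "S_steps c S1 n G \<J> G'" "G = gr f" "G' = gr g" "\<not> T1i f" "tri f i t" "e \<in> W1 f i t" for G G' f
    using that
  proof (induction arbitrary: f rule: S_steps.induct)
    case (1 G)
    then show ?case using assms(2) by (auto simp: tri_def)
  next
    case (2 G J H n \<J> G'')
    have "S_step c S1 (gr f) J H" using 2 by simp
    then obtain u where u: "star1 f u" "J = star_lines f u" "H = gr (upd f {u} 0)"
      by (cases rule: S_step_cases) auto
    let ?g = "upd f {u} 0"
    have res: "resolved ?g (insert (C_rules c (gr g)) \<J>)"
      using S_steps_resolved[of S1 n ?g \<J> g] 2 u assms(2) by simp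
    show ?case
    proof (cases "u i = t")
      case False
      have eq: "?g (v w) = f (v w)" if "w i = t" for w using that False by (auto simp: upd_v)
      have Dg: "D ?g w = D f w" "Z ?g w = Z f w" if "w i = t" for w using eq[of w] that by (auto simp: D_def Z_def)
      have "Lf ?g i t = Lf f i t" by (rule Lf_cong) (rule eq)
      then have "tri ?g i t" using \<open>tri f i t\<close> Dg unfolding tri_def by blast
      moreover have "W1 ?g i t = W1 f i t" by (rule cuts_cong) (use eq Dg in auto)
      moreover have "\<not> T1i ?g" using \<open>\<not> T1i f\<close> unfolding T1i_def D_Z_upd0 by blast
      moreover have "e \<in> W1 f i t" "G'' = gr g" using 2 by simp_all
      ultimately have "\<exists>J1\<in>insert (C_rules c (gr g)) \<J>. \<exists>J2\<in>insert (C_rules c (gr g)) \<J>. J1 \<noteq> J2 \<and> e \<in> J1 \<and> e \<in> J2"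
        using "2.IH"[OF u(3)] by simp
      then show ?thesis by (rule two_paths_mono) blast
    next
      case True
      obtain j k where ijk: "i \<noteq> j" "i \<noteq> k" "j \<noteq> k" by (rule index_others)
      have Du: "D f u" using u(1) by (simp add: star1_def)
      have tri: "tri f i (u i)" using 2 True by simp
      note tc = tri_cut[OF ijk tri Du]
      have e: "e = closed_segment (v (flip j u)) (v (flip k u))" using 2 True tc by simp
      have "e \<in> J" unfolding u(2) star_lines_def using e tc ijk by force
      have "ncl ?g i (u i) = {closed_segment (xp f (flip j u) k) (xp f (flip k u) j)}"
        by (rule ncl_cut_disperse[OF ijk Du tc(1-3)]) auto
      then have "e \<in> ncl ?g i t" using e tc True by (simp add: xp_Z)
      then have "e \<in> fl (insert (C_rules c (gr g)) \<J>) i t"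
        using res ncl_Lf[of ?g i t] unfolding resolved_def by fastforce
      then obtain J2 where J2: "J2 \<in> insert (C_rules c (gr g)) \<J>" "e \<in> J2" by (auto simp: fl_def)
      have "J \<noteq> J2" using star_not_in_rest[OF u(1) _ tri res] 2 u(2) J2 by auto
      then show ?thesis using J2 \<open>e \<in> J\<close> by (intro two_pathsI[of J _ J2]) auto
    qed
  qed
  then show ?thesis using assms by blast
qed

text \<open>For \<open>S2\<close> and \<open>S3\<close> there is a single step, and it touches the
  side. \<open>S3\<close> is impossible there because it needs a label below \<open>c\<close>. A bar
  cannot lie in the side because adjacent corners of an L-face are of different kinds, so it meets
  the side in one end.\<close>

lemma two_paths_trivial:
  assumes S: "S_steps c r n (gr f) \<J> (gr g)" "r = S1 \<or> n \<le> 1" and noL: "\<And>i t. \<not> Lf g i t"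
    and "\<not> T1i f" "\<not> F1i f" and tri: "tri f i t" and e: "e \<in> W1 f i t"
  shows "\<exists>J1\<in>insert (C_rules c (gr g)) \<J>. \<exists>J2\<in>insert (C_rules c (gr g)) \<J>. J1 \<noteq> J2 \<and> e \<in> J1 \<and> e \<in> J2"
proof (cases "r = S1")
  case True
  show ?thesis
    by (rule two_paths_trivial_S1[of n f \<J> g i t]) (use S(1) True noL \<open>\<not> T1i f\<close> tri e in auto)
next
  case r: False
  have Lf: "Lf f i t" using tri by (simp add: tri_def)
  have "n \<noteq> 0"
  proof
    assume "n = 0"
    then have "gr f = gr g" using S(1) S_steps_0 by metis
    then show False using Lf noL by auto
  qed
  then have "S_steps c r (Suc 0) (gr f) \<J> (gr g)" using S r by (cases n) auto
  then obtain J where J: "S_step c r (gr f) J (gr g)" "\<J> = {J}"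
    by (rule S_steps_Suc0)
  \<comment> \<open>\<open>g\<close> has no L-faces, so the L-face of \<open>f\<close> must contain
    a relabelled corner.\<close>
  have touched: "\<exists>u\<in>X. u i = t" if "g = upd f X q" for X q
  proof (rule ccontr)
    assume n: "\<not> (\<exists>u\<in>X. u i = t)"
    have "Lf g i t = Lf f i t" by (rule Lf_cong) (use n that in \<open>auto simp: upd_v\<close>)
    then show False using Lf noL by simp
  qed
  from J(1) show ?thesis
  proof (cases rule: S_step_cases)
    case (1 s) then show ?thesis using r by simp
  next
    case (3 s)
    then have "s i = t" using touched[of "{s}" 1] by auto
    then have "Z f s" using tri 3 unfolding tri_def star3_def D_def by auto
    then show ?thesis using 3 by (simp add: star3_def Z_def)
  next
    case (2 s m)
    have b: "bar2 f s m" by fact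
    have im: "i = m"
    proof (rule ccontr)
      assume im: "i \<noteq> m"
      have "s i = t" using touched[of "{s, flip m s}" 0] 2 im by auto
      obtain k where k: "k \<noteq> i" "k \<noteq> m" by (rule third_index)
      have imk: "i \<noteq> m" "i \<noteq> k" "m \<noteq> k" using im k by auto
      have "Lf f i (s i)" using Lf \<open>s i = t\<close> by simp
      then show False unfolding Lf_eq[OF imk] using b unfolding bar2_def by blast
    qed
    obtain w where w: "w = s \<or> w = flip m s" "w i = t" using touched[of "{s, flip m s}" 0] 2 by auto
    have bw: "bar2 f w m" using w b bar2_flip by auto
    have X: "{s, flip m s} = {w, flip m w}" using w by auto
    obtain j k where ijk: "i \<noteq> j" "i \<noteq> k" "j \<noteq> k" by (rule index_others)
    have Dw: "D f w" using bw by (simp add: bar2_def)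
    have tri': "tri f i (w i)" using tri w by simp
    note tc = tri_cut[OF ijk tri' Dw]
    have e': "e = closed_segment (v (flip j w)) (v (flip k w))" using e w tc by simp
    have Jw: "J = bar_lines f w m" using 2 w bar_lines_flip by auto
    have gw: "g = upd f {w, flip m w} 0" using 2 X by simp
    have "closed_segment (xp f w j) (xp f w k) \<in> bar_lines f w m" unfolding bar_lines_def using ijk im by blast
    then have "e \<in> J" using e' tc Jw by simp
    have "ncl g i (w i) = {closed_segment (xp f (flip j w) k) (xp f (flip k w) j)}" unfolding gw
      by (rule ncl_cut_disperse[OF ijk Dw tc(1-3)]) (use im in auto)
    then have "e \<in> fl {C_rules c (gr g)} i (w i)" unfolding fl_C_rules using e' tc by (simp add: xp_Z)
    then have "e \<in> C_rules c (gr g)" by (simp add: fl_def)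
    moreover have "J \<noteq> C_rules c (gr g)" unfolding Jw gw by (rule bar_neq_C_rules[OF bw]) fact
    ultimately show ?thesis using \<open>e \<in> J\<close> J(2) by (intro two_pathsI[of J _ "C_rules c (gr g)"]) auto
  qed
qed

text \<open>The disperse corners form two parallel edges in direction \<open>m\<close>, and the bar
  has to be one of them. Its quadrilateral contains the edge at \<open>s\<close>; the other disperse
  edge survives and makes the \<open>C\<close>-rules draw it again.\<close>

lemma two_paths_edge:
  assumes S: "S_steps c S2 1 (gr f) \<J> (gr g)" and F1: "\<not> F1i f"
    and Zs: "Z f s" "Z f (flip m s)"
    and Ds: "\<And>j. j \<noteq> m \<Longrightarrow> D f (flip j s) \<and> D f (flip m (flip j s))"
    and nD: "\<And>j k. j \<noteq> m \<Longrightarrow> k \<noteq> m \<Longrightarrow> j \<noteq> k \<Longrightarrow> \<not> D f (flip k (flip j s)) \<and> \<not> D f (flip m (flip k (flip j s)))"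
  shows "\<exists>J1\<in>insert (C_rules c (gr g)) \<J>. \<exists>J2\<in>insert (C_rules c (gr g)) \<J>. J1 \<noteq> J2 \<and> eseg s m \<in> J1 \<and> eseg s m \<in> J2"
proof -
  have "S_steps c S2 (Suc 0) (gr f) \<J> (gr g)" using S by simp
  then obtain J where J: "S_step c S2 (gr f) J (gr g)" "\<J> = {J}"
    by (rule S_steps_Suc0)
  then obtain u n where u: "bar2 f u n" "J = bar_lines f u n" "g = upd f {u, flip n u} 0"
    by (auto elim!: S_step_cases)
  have Du: "D f u" "D f (flip n u)" using u(1) by (simp_all add: bar2_def)
  obtain j where j: "j \<noteq> m" "u = flip j s \<or> u = flip m (flip j s)"
  proof -
    obtain j k where mjk: "m \<noteq> j" "m \<noteq> k" "j \<noteq> k" by (rule index_others)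
    have "u \<in> {s, flip j s, flip k s, flip j (flip k s), flip m s, flip m (flip j s), flip m (flip k s), flip m (flip j (flip k s))}"
      by (rule exhaust_flips[OF mjk])
    moreover have "u \<noteq> s" "u \<noteq> flip m s" using Du Zs Z_not_D by blast+
    moreover have "u \<noteq> flip j (flip k s)" "u \<noteq> flip m (flip j (flip k s))" using Du(1) nD[of k j] mjk by auto
    ultimately show thesis using that[of j] that[of k] mjk by auto
  qed
  obtain k where k: "k \<noteq> m" "k \<noteq> j" by (rule third_index)
  have mjk: "m \<noteq> j" "m \<noteq> k" "j \<noteq> k" using j(1) k by auto
  have n: "n = m"
  proof -
    have "n \<noteq> j"
    proof
      assume "n = j"
      then have "flip n u = s \<or> flip n u = flip m s" using j(2) by (auto simp: flip_commute[of m j])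
      then show False using Du(2) Zs by auto
    qed
    moreover have "n \<noteq> k"
    proof
      assume "n = k"
      then have "flip n u = flip k (flip j s) \<or> flip n u = flip m (flip k (flip j s))" using j(2) by (auto simp: flip_commute[of k m])
      then show False using Du(2) nD[of j k] j(1) k by auto
    qed
    ultimately show ?thesis using index_cases[OF mjk, of n] by blast
  qed
  have bj: "bar2 f (flip j s) m" using u(1) n j(2) bar2_flip[of f u m] by auto
  have Jj: "J = bar_lines f (flip j s) m" using u(2) n j(2) bar_lines_flip[of f m "flip j s"] by auto
  have gj: "g = upd f {flip j s, flip m (flip j s)} 0" using u(3) n j(2) by (auto simp: insert_commute)
  have "eseg s m \<in> J"
  proof -
    have "xp f (flip j s) j = v s" "xp f (flip m (flip j s)) j = v (flip m s)"
      using xp_Z_flip[of f "flip j s" j] xp_Z_flip[of f "flip m (flip j s)" j] Ds[OF j(1)] Zs by (auto simp: flip_commute[of m j])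
    then have "eseg s m = closed_segment (xp f (flip j s) j) (xp f (flip m (flip j s)) j)" by simp
    then show ?thesis unfolding Jj bar_lines_def using j(1) by blast
  qed
  moreover have "eseg s m \<in> C_rules c (gr g)"
  proof -
    have dd: "flip k s \<notin> {flip j s, flip m (flip j s)}" "flip m (flip k s) \<notin> {flip j s, flip m (flip j s)}"
      using mjk flip2_neq_flip[of m j s k] by (auto dest: sym)
    have ss: "s \<notin> {flip j s, flip m (flip j s)}" "flip m s \<notin> {flip j s, flip m (flip j s)}"
      using mjk by auto
    have "EL g s m" unfolding EL_def gj using dd ss Zs Ds[OF k(1)] c01 k(1)
      by (intro conjI exI[of _ k]) (simp_all add: D_upd Z_upd)
    then show ?thesis using EL_C_rules by simp
  qed
  moreover have "J \<noteq> C_rules c (gr g)" unfolding Jj gj by (rule bar_neq_C_rules[OF bj F1])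
  ultimately show ?thesis using J(2) by (intro two_pathsI[of J _ "C_rules c (gr g)"]) auto
qed

end

subsection \<open>Inner iso-paths of a regular graph\<close>

context iso_corners
begin

lemma card_rel:
  assumes ijk: "i \<noteq> j" "i \<noteq> k" "j \<noteq> k"
  shows "card {s. Q s} = of_bool (Q u) + of_bool (Q (flip i u)) + of_bool (Q (flip j u)) + of_bool (Q (flip k u))
    + of_bool (Q (flip i (flip j u))) + of_bool (Q (flip i (flip k u))) + of_bool (Q (flip j (flip k u)))
    + of_bool (Q (flip i (flip j (flip k u))))"
proof -
  have 1: "{s. Q s} = {s. Q s \<and> s i = u i} \<union> {s. Q s \<and> s i = flip i u i}" by auto
  have 2: "card {s. Q s} = card {s. Q s \<and> s i = u i} + card {s. Q s \<and> s i = flip i u i}"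
    unfolding 1 by (rule card_Un_disjoint) auto
  have c: "flip j (flip i w) = flip i (flip j w)" "flip k (flip i w) = flip i (flip k w)" for w
    by (rule flip_commute)+
  show ?thesis unfolding 2 card_face[OF ijk, of Q u] card_face[OF ijk, of Q "flip i u"] c by simp
qed

text \<open>Writes both sides of one direction through the corners seen from \<open>u\<close>, with
  flips in a fixed order, so that the table can be checked by Boolean cases.\<close>

lemma Lf_six:
  assumes ijk: "i \<noteq> j" "i \<noteq> k" "j \<noteq> k"
  shows "Lf f i (u i) \<longleftrightarrow> D f u = D f (flip j (flip k u)) \<and> D f (flip j u) = D f (flip k u) \<and> D f u \<noteq> D f (flip j u)"
    "Lf f i (\<not> u i) \<longleftrightarrow> D f (flip i u) = D f (flip i (flip j (flip k u))) \<and>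
       D f (flip i (flip j u)) = D f (flip i (flip k u)) \<and> D f (flip i u) \<noteq> D f (flip i (flip j u))"
proof -
  show "Lf f i (u i) \<longleftrightarrow> D f u = D f (flip j (flip k u)) \<and> D f (flip j u) = D f (flip k u) \<and> D f u \<noteq> D f (flip j u)"
    by (rule Lf_eq[OF ijk])
  have c: "flip j (flip i w) = flip i (flip j w)" "flip k (flip i w) = flip i (flip k w)" for w
    by (rule flip_commute)+
  have "Lf f i (flip i u i) \<longleftrightarrow> D f (flip i u) = D f (flip i (flip j (flip k u))) \<and>
       D f (flip i (flip j u)) = D f (flip i (flip k u)) \<and> D f (flip i u) \<noteq> D f (flip i (flip j u))"
    using Lf_eq[OF ijk, of f "flip i u"] unfolding c by simp
  then show "Lf f i (\<not> u i) \<longleftrightarrow> D f (flip i u) = D f (flip i (flip j (flip k u))) \<and>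
       D f (flip i (flip j u)) = D f (flip i (flip k u)) \<and> D f (flip i u) \<noteq> D f (flip i (flip j u))" by simp
qed

lemma card_L_faces:
  assumes ijk: "i \<noteq> j" "i \<noteq> k" "j \<noteq> k"
  shows "card (L_faces c (gr f)) = of_bool (Lf f i (u i)) + of_bool (Lf f i (\<not> u i)) + of_bool (Lf f j (u j))
    + of_bool (Lf f j (\<not> u j)) + of_bool (Lf f k (u k)) + of_bool (Lf f k (\<not> u k))"
proof -
  let ?l = "[(i, u i), (i, \<not> u i), (j, u j), (j, \<not> u j), (k, u k), (k, \<not> u k)]"
  let ?P = "\<lambda>(l, t). Lf f l t"
  have "L_faces c (gr f) = (\<lambda>(l, t). sd l t) ` {x. ?P x}" unfolding L_faces_gr by auto
  moreover have "inj_on (\<lambda>(l, t). sd l t) {x. ?P x}" by (auto simp: inj_on_def)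
  ultimately have 1: "card (L_faces c (gr f)) = card {x. ?P x}" by (simp add: card_image)
  have mem: "x \<in> set ?l" for x :: "3 \<times> bool"
    using index_cases[OF ijk, of "fst x"] by (cases x; cases "snd x = u (fst x)") auto
  have "{x. ?P x} = set (filter ?P ?l)" unfolding set_filter using mem by (intro Collect_cong) blast
  moreover have "distinct ?l" using ijk by simp
  ultimately have "card {x. ?P x} = length (filter ?P ?l)" by (metis distinct_card distinct_filter)
  then show ?thesis unfolding 1 by (simp add: of_bool_def)
qed

lemma all_faces:
  fixes i j k :: 3
  assumes ijk: "i \<noteq> j" "i \<noteq> k" "j \<noteq> k"
  shows "(\<forall>l t. R l t) \<longleftrightarrow> R i (u i) \<and> R i (\<not> u i) \<and> R j (u j) \<and> R j (\<not> u j) \<and> R k (u k) \<and> R k (\<not> u k)"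
proof -
  have "(\<forall>t. R l t) \<longleftrightarrow> R l (u l) \<and> R l (\<not> u l)" for l
    by (cases "u l") (auto simp: all_bool_eq)
  then show ?thesis unfolding all_index[OF ijk] by blast
qed

lemma S_table_card:
  assumes "S_table c (gr f) r n"
  shows "card {s. D f s} = 2 \<and> r = S1 \<and> n = 1 \<or>
    card {s. D f s} = 3 \<and> card (L_faces c (gr f)) = 1 \<and> r = S1 \<and> n = 1 \<or>
    card {s. D f s} = 3 \<and> card (L_faces c (gr f)) = 3 \<and> r = S1 \<and> n = 2 \<or>
    card {s. D f s} = 4 \<and> card (L_faces c (gr f)) = 2 \<and> r = S1 \<and> n = 1 \<or>
    card {s. D f s} = 4 \<and> card (L_faces c (gr f)) = 2 \<and> r = S2 \<and> n = 1 \<or>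
    card {s. D f s} = 4 \<and> card (L_faces c (gr f)) = 6 \<and> r = S1 \<and> n = 3 \<or>
    card {s. D f s} = 5 \<and> card (L_faces c (gr f)) = 1 \<and> r = S3 \<and> n = 1 \<or>
    card {s. D f s} = 5 \<and> card (L_faces c (gr f)) = 3 \<and> r = S1 \<and> n = 1 \<or>
    card {s. D f s} = 6 \<and> r = S3 \<and> n = 1"
  using assms unfolding S_table_def disperse_gr card_v Let_def prod.inject by (elim disjE conjE) simp_all

text \<open>A star determines the kind of four corners and a bar that of six. For every choice of
  the others, either the counts contradict the row of the table or the step destroys all
  L-faces.\<close>

lemma one_step_no_L:
  assumes S: "S_step c r (gr f) J (gr g)" and T: "S_table c (gr f) r 1"
  shows "\<not> Lf g l t"
proof -
  have "\<forall>l t. \<not> Lf g l t"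
    using S
  proof (cases rule: S_step_cases)
    case (1 u)
    obtain j k :: 3 where ijk: "1 \<noteq> j" "1 \<noteq> k" "j \<noteq> k" by (rule index_others)
    have g: "D g s \<longleftrightarrow> s \<noteq> u \<and> D f s" for s using 1 by (simp add: D_Z_upd0)
    note ijk' = ijk(2,1) ijk(3)[symmetric]
    note ijk'' = ijk(1)[symmetric] ijk(3) ijk(2)
    have d: "D f u" "\<not> D f (flip 1 u)" "\<not> D f (flip j u)" "\<not> D f (flip k u)" using 1 by (simp_all add: star1_def)
    have j1: "j \<noteq> 1" and k1: "k \<noteq> 1" "k \<noteq> j" using ijk by auto
    have fs: "flip j (flip 1 w) = flip 1 (flip j w)" "flip k (flip 1 w) = flip 1 (flip k w)" "flip k (flip j w) = flip j (flip k w)" for w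
      by (rule flip_commute)+
    have neq: "flip 1 (flip j u) \<noteq> u" "flip 1 (flip k u) \<noteq> u" "flip j (flip k u) \<noteq> u" "flip 1 (flip j (flip k u)) \<noteq> u"
      using ijk by simp_all
    note L = Lf_six[OF ijk, of _ u] Lf_six[OF j1 ijk(3,2), of _ u] Lf_six[OF k1 ijk(1), of _ u]
    show ?thesis unfolding all_faces[OF ijk, of _ u]
      using S_table_card[OF T] 1(1) unfolding card_rel[OF ijk, of "D f" u] card_L_faces[OF ijk, of f u] L fs g
      by (cases "D f (flip 1 (flip j u))"; cases "D f (flip 1 (flip k u))"; cases "D f (flip j (flip k u))";
          cases "D f (flip 1 (flip j (flip k u)))") (simp_all add: d neq)
  next
    case (3 u)
    obtain j k :: 3 where ijk: "1 \<noteq> j" "1 \<noteq> k" "j \<noteq> k" by (rule index_others)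
    have g: "D g s \<longleftrightarrow> s = u \<or> D f s" for s using 3 c01 by (simp add: D_upd)
    have d: "\<not> D f u" "D f (flip 1 u)" "D f (flip j u)" "D f (flip k u)" using 3 by (simp_all add: star3_def D_def)
    have j1: "j \<noteq> 1" and k1: "k \<noteq> 1" "k \<noteq> j" using ijk by auto
    have fs: "flip j (flip 1 w) = flip 1 (flip j w)" "flip k (flip 1 w) = flip 1 (flip k w)" "flip k (flip j w) = flip j (flip k w)" for w
      by (rule flip_commute)+
    have neq: "flip 1 (flip j u) \<noteq> u" "flip 1 (flip k u) \<noteq> u" "flip j (flip k u) \<noteq> u" "flip 1 (flip j (flip k u)) \<noteq> u"
      using ijk by simp_all
    note L = Lf_six[OF ijk, of _ u] Lf_six[OF j1 ijk(3,2), of _ u] Lf_six[OF k1 ijk(1), of _ u]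
    show ?thesis unfolding all_faces[OF ijk, of _ u]
      using S_table_card[OF T] 3(1) unfolding card_rel[OF ijk, of "D f" u] card_L_faces[OF ijk, of f u] L fs g
      by (cases "D f (flip 1 (flip j u))"; cases "D f (flip 1 (flip k u))"; cases "D f (flip j (flip k u))";
          cases "D f (flip 1 (flip j (flip k u)))") (simp_all add: d neq)
  next
    case (2 u i)
    obtain j k :: 3 where ijk: "i \<noteq> j" "i \<noteq> k" "j \<noteq> k" by (rule index_others)
    have g: "D g s \<longleftrightarrow> s \<noteq> u \<and> s \<noteq> flip i u \<and> D f s" for s using 2 by (simp add: D_Z_upd0)
    have j1: "j \<noteq> i" and k1: "k \<noteq> i" "k \<noteq> j" using ijk by auto
    have fs: "flip j (flip i w) = flip i (flip j w)" "flip k (flip i w) = flip i (flip k w)" "flip k (flip j w) = flip j (flip k w)" for w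
      by (rule flip_commute)+
    have d: "D f u" "D f (flip i u)" "\<not> D f (flip j u)" "\<not> D f (flip k u)" "\<not> D f (flip i (flip j u))" "\<not> D f (flip i (flip k u))"
      using 2 j1 k1 by (simp_all add: bar2_def fs[symmetric])
    have neq: "flip j (flip k u) \<noteq> u" "flip i (flip j (flip k u)) \<noteq> u"
      using ijk by simp_all
    note L = Lf_six[OF ijk, of _ u] Lf_six[OF j1 ijk(3,2), of _ u] Lf_six[OF k1 ijk(1), of _ u]
    show ?thesis unfolding all_faces[OF ijk, of _ u]
      using S_table_card[OF T] 2(1) unfolding card_rel[OF ijk, of "D f" u] card_L_faces[OF ijk, of f u] L fs g
      by (cases "D f (flip j (flip k u))"; cases "D f (flip i (flip j (flip k u)))") (simp_all add: d neq ijk)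
  qed
  then show ?thesis by blast
qed

lemma card_le1_no_L:
  assumes "card {s. D f s} \<le> 1"
  shows "\<not> Lf f l t"
proof
  assume "Lf f l t"
  then obtain s j k where s: "j \<noteq> k" "D f s" "D f (flip j (flip k s))" unfolding Lf_def by blast
  then have "card {s, flip j (flip k s)} \<le> card {s. D f s}" by (intro card_mono) auto
  moreover have "card {s, flip j (flip k s)} = 2" using s(1) by simp
  ultimately show False using assms by simp
qed

lemma S1_steps_card:
  assumes "S_steps c S1 n (gr f) \<J> (gr g)"
  shows "card {s. D g s} + n = card {s. D f s}"
  using assms
proof (induction n arbitrary: f \<J>)
  case 0
  then have "gr g = gr f" using S_steps_0 by blast
  then show ?case by simp
next
  case (Suc n)
  from Suc.prems obtain J H \<J>' where J: "S_step c S1 (gr f) J H" "S_steps c S1 n H \<J>' (gr g)"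
    by (rule S_steps_Suc)
  from J(1) obtain u where u: "star1 f u" "H = gr (upd f {u} 0)" by (cases rule: S_step_cases) auto
  have "card {s. D g s} + n = card {s. D (upd f {u} 0) s}" using Suc.IH J(2) u by blast
  moreover have "{s. D (upd f {u} 0) s} = {s. D f s} - {u}" by (auto simp: D_Z_upd0)
  moreover have "Suc (card ({s. D f s} - {u})) = card {s. D f s}"
    using u(1) by (intro card.remove[symmetric]) (auto simp: star1_def)
  ultimately show ?case by simp
qed

text \<open>Rows with several steps are \<open>S1\<close>-rows. Each of their steps removes one
  disperse corner, and 3 - 2 = 4 - 3 = 1 disperse corner is too few for an L-face.\<close>

lemma table_no_L:
  assumes T: "S_table c (gr f) r n" and S: "S_steps c r n (gr f) \<J> (gr g)"
  shows "\<not> Lf g l t" "r = S1 \<or> n \<le> 1"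
proof -
  show "r = S1 \<or> n \<le> 1" using S_table_card[OF T] by auto
  show "\<not> Lf g l t"
  proof (cases "n = 1")
    case True
    then have "S_steps c r (Suc 0) (gr f) \<J> (gr g)" using S by simp
    then obtain J where "S_step c r (gr f) J (gr g)" by (rule S_steps_Suc0)
    then show ?thesis using one_step_no_L T True by blast
  next
    case False
    have r: "r = S1" using S_table_card[OF T] False by auto
    have "card {s. D g s} + n = card {s. D f s}" using S1_steps_card S r by blast
    then have "card {s. D g s} \<le> 1" using S_table_card[OF T] False by linarith
    then show ?thesis by (rule card_le1_no_L)
  qed
qed

text \<open>Gives the branches of the algorithm a common form: those without L-faces for two and six
  disperse nodes obey the same rows of the table, and the bare \<open>C\<close>-rules are a run of
  length 0.\<close>

lemma inner_paths:
  assumes "inner_iso_paths c \<G> (gr f) \<J>" and reg: "regular_graph c \<G> (gr f)"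
  obtains r n \<J>' g where "S_steps c r n (gr f) \<J>' (gr g)" "\<J> = insert (C_rules c (gr g)) \<J>'"
    "\<And>l t. \<not> Lf g l t" "r = S1 \<or> n \<le> 1" "L_faces c (gr f) \<noteq> {} \<Longrightarrow> S_table c (gr f) r n"
proof -
  note main = that
  have single: thesis if s: "\<J> = {J, C_rules c G'}" "S_step c r (gr f) J G'" "S_table c (gr f) r 1"
    "L_faces c (gr f) = {}" for J G' r
  proof -
    obtain g where g: "G' = gr g" using S_step_ok[OF s(2)] by metis
    have S: "S_steps c r (Suc 0) (gr f) {J} (gr g)"
      using S_steps.intros(2)[OF s(2) S_steps.intros(1)] g by simp
    have "\<not> Lf g l t" for l t using one_step_no_L s(2,3) g by blast
    then show thesis using s g by (intro main[OF S]) (simp_all add: insert_commute)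
  qed
  show thesis
  proof (cases "L_faces c (gr f) = {}")
    case False
    then obtain r n \<J>' G' where s: "S_table c (gr f) r n" "S_steps c r n (gr f) \<J>' G'" "\<J> = insert (C_rules c G') \<J>'"
      using assms unfolding inner_iso_paths_def by auto
    obtain g where g: "G' = gr g" using S_steps_gr[OF s(2)] by blast
    show thesis using main[of r n \<J>' g] s g table_no_L by blast
  next
    case True
    have none: "\<not> Lf f l t" for l t using True unfolding L_faces_gr by blast
    consider J G' where "card (disperse_nodes c (gr f)) = 2" "S_step c S1 (gr f) J G'" "\<J> = {J, C_rules c G'}"
      | J G' where "card (disperse_nodes c (gr f)) = 6" "S_step c S3 (gr f) J G'" "\<J> = {J, C_rules c G'}"
      | "\<J> = {C_rules c (gr f)}"
      using assms True unfolding inner_iso_paths_def by (auto split: if_splits)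
    then show thesis
    proof cases
      case (1 J G')
      then show ?thesis by (intro single[of J G' S1]) (auto simp: S_table_def Let_def True)
    next
      case (2 J G')
      then show ?thesis by (intro single[of J G' S3]) (auto simp: S_table_def Let_def True)
    next
      case 3
      show ?thesis using main[of S1 0 "{}" f] S_steps.intros(1) 3 none True by simp
    qed
  qed
qed

lemma inner_paths_ex:
  assumes "inner_iso_paths c \<G> (gr f) \<J>" "regular_graph c \<G> (gr f)"
  shows "\<exists>r n \<J>' g. S_steps c r n (gr f) \<J>' (gr g) \<and> \<J> = insert (C_rules c (gr g)) \<J>' \<and>
    (\<forall>l t. \<not> Lf g l t) \<and> (r = S1 \<or> n \<le> 1) \<and> (L_faces c (gr f) \<noteq> {} \<longrightarrow> S_table c (gr f) r n)"
  by (rule inner_paths[OF assms]) blast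

section \<open>Singular and isolated iso-paths in corner indices\<close>

lemma T1_gr: "T1_subgraph c (gr f) (v s) \<longleftrightarrow> Z f s \<and> (\<forall>j. D f (flip j s))"
proof -
  have "incident_nodes (gr f) (v ` {s}) \<subseteq> v ` {s. D f s} \<longleftrightarrow> (\<forall>j. D f (flip j s))"
    unfolding incident_image_gr by auto
  then show ?thesis unfolding T1_subgraph_def disperse_gr nodes_gr Z_def by auto
qed

lemma T1_free: "singular_iso_path_free c (gr f) \<Longrightarrow> \<not> T1i f"
  unfolding singular_iso_path_free_def T1i_def using T1_gr by blast

lemma F1_gr:
  assumes "F1i f" shows "F1_graph c (gr f)"
proof -
  obtain s m where s: "D f s" "D f (flip m s)" and all: "\<And>j. j \<noteq> m \<Longrightarrow> Z f (flip j s) \<and> Z f (flip m (flip j s)) \<and>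
     (\<forall>k. k \<noteq> m \<and> k \<noteq> j \<longrightarrow> D f (flip k (flip j s)) \<and> D f (flip m (flip k (flip j s))))"
    using assms unfolding F1i_def by blast
  obtain j k where mjk: "m \<noteq> j" "m \<noteq> k" "j \<noteq> k" by (rule index_others)
  have jm: "j \<noteq> m" and km: "k \<noteq> m" "k \<noteq> j" using mjk by auto
  let ?W = "{s. Z f s}"
  have fs: "flip j (flip m w) = flip m (flip j w)" "flip k (flip m w) = flip m (flip k w)" "flip k (flip j w) = flip j (flip k w)" for w
    by (rule flip_commute)+
  have Zs: "Z f (flip j s)" "Z f (flip k s)" "Z f (flip m (flip j s))" "Z f (flip m (flip k s))"
    using all[OF jm] all[OF km(1)] by auto
  have Ds: "D f s" "D f (flip m s)" "D f (flip j (flip k s))" "D f (flip m (flip j (flip k s)))"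
    using s all[OF jm] km by (auto simp: fs)
  have u: "u \<in> {s, flip j s, flip k s, flip j (flip k s), flip m s, flip m (flip j s), flip m (flip k s), flip m (flip j (flip k s))}" for u
    by (rule exhaust_flips[OF mjk])
  have ZD: "Z f u \<or> D f u" for u using u[of u] Zs Ds by auto
  have nZ: "\<not> Z f s" "\<not> Z f (flip m s)" "\<not> Z f (flip j (flip k s))" "\<not> Z f (flip m (flip j (flip k s)))"
    using Ds Z_not_D by blast+
  have card4: "card ?W = 4" unfolding card_rel[OF mjk, of "Z f" s] using Zs nZ by simp
  have two: "card {u. \<not> Z f u \<and> (\<exists>l. u = flip l w)} = 2" if "Z f w" for w
  proof -
    have "{u. \<not> Z f u \<and> (\<exists>l. u = flip l w)} = {flip j w, flip k w}"
    proof -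
      have w: "w = flip j s \<or> w = flip k s \<or> w = flip m (flip j s) \<or> w = flip m (flip k s)"
        using u[of w] that nZ by auto
      have a: "\<not> Z f (flip j w)" "\<not> Z f (flip k w)" "Z f (flip m w)"
        using w nZ Zs by (auto simp: fs)
      have "(\<exists>l. u = flip l w) \<longleftrightarrow> u = flip m w \<or> u = flip j w \<or> u = flip k w" for u
        using index_cases[OF mjk] by metis
      then show ?thesis using a by auto
    qed
    then show ?thesis using mjk by simp
  qed
  show ?thesis unfolding F1_graph_def
  proof (intro exI[of _ "v ` ?W"] conjI ballI)
    show "v ` ?W \<subseteq> nodes (gr f)" by (auto simp: nodes_gr)
    show "card (v ` ?W) = 4" unfolding card_v by (rule card4)
    fix P assume "P \<in> v ` ?W"
    then obtain w where w: "P = v w" "Z f w" by blast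
    have "{Q \<in> nodes (gr f) - v ` ?W. incident (gr f) P Q} = v ` {u. \<not> Z f u \<and> (\<exists>l. u = flip l w)}"
      unfolding nodes_gr w(1) by (auto simp: incident_gr)
    then show "card {Q \<in> nodes (gr f) - v ` ?W. incident (gr f) P Q} = 2" unfolding card_v[symmetric] using two[OF w(2)] card_v by simp
    show "label (gr f) P = c" using w by (simp add: Z_def)
  next
    fix P assume "P \<in> nodes (gr f) - v ` ?W"
    then obtain w where w: "P = v w" "\<not> Z f w" by (auto simp: nodes_gr)
    then show "c < label (gr f) P" using ZD[of w] by (simp add: D_def)
  qed
qed

lemma F1_free: "isolated_iso_path_free c \<G> (gr f) \<Longrightarrow> \<not> F1i f"
  unfolding isolated_iso_path_free_def using F1_gr by blast

text \<open>If one of the two corners diagonally opposite to the edge were disperse, omitting the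
  other one would leave a \<open>T\<^sub>2\<close>-subgraph.\<close>

lemma T2_free:
  assumes free: "singular_iso_path_free c (gr f)" and Zs: "Z f s" "Z f (flip m s)"
    and Ds: "\<And>j. j \<noteq> m \<Longrightarrow> D f (flip j s) \<and> D f (flip m (flip j s))"
    and jk: "j \<noteq> m" "k \<noteq> m" "j \<noteq> k"
  shows "\<not> D f (flip k (flip j s)) \<and> \<not> D f (flip m (flip k (flip j s)))"
proof -
  have mjk: "m \<noteq> j" "m \<noteq> k" "j \<noteq> k" using jk by auto
  have fs: "flip j (flip m w) = flip m (flip j w)" "flip k (flip m w) = flip m (flip k w)" "flip k (flip j w) = flip j (flip k w)" for w
    by (rule flip_commute)+
  have "\<not> D f y" if y: "y = flip j (flip k s) \<or> y = flip m (flip j (flip k s))" for y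
  proof
    assume Dy: "D f y"
    define x where "x = flip m y"
    have x: "x = flip m (flip j (flip k s)) \<or> x = flip j (flip k s)" using y by (auto simp: x_def)
    let ?H = "UNIV - {x}"
    have xs: "x \<noteq> s" "x \<noteq> flip m s" "x \<noteq> flip j s" "x \<noteq> flip k s" "x \<noteq> flip m (flip j s)" "x \<noteq> flip m (flip k s)"
    proof -
      have "x j = (\<not> s j)" "x k = (\<not> s k)" using x mjk by auto
      then have ne: "x \<noteq> w" if "w j = s j \<or> w k = s k" for w using that by metis
      show "x \<noteq> s" "x \<noteq> flip m s" "x \<noteq> flip j s" "x \<noteq> flip k s" "x \<noteq> flip m (flip j s)" "x \<noteq> flip m (flip k s)"
        by (rule ne, use mjk in simp)+
    qed
    have "T2_subgraph c (gr f) (v ` ?H) (v s) (v (flip m s))"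
      unfolding T2_subgraph_def
    proof (intro conjI)
      show "v ` ?H \<subseteq> nodes (gr f)" by (auto simp: nodes_gr)
      have "card (UNIV :: (3 \<Rightarrow> bool) set) = 8"
        using card_rel[OF mjk, of "\<lambda>_. True"] by simp
      then show "card (v ` ?H) = 7" unfolding card_v by (subst card_Diff_singleton) auto
      show "v s \<in> v ` ?H" "v (flip m s) \<in> v ` ?H" using xs by (auto simp: v_image_mem)
      show "incident (gr f) (v s) (v (flip m s))" unfolding incident_gr by blast
      show "label (gr f) (v s) = c" "label (gr f) (v (flip m s)) = c" using Zs by (simp_all add: Z_def)
      have "D f u" if "u \<noteq> x" "u \<noteq> s" "u \<noteq> flip m s" for u
      proof -
        have "u \<in> {s, flip j s, flip k s, flip j (flip k s), flip m s, flip m (flip j s), flip m (flip k s), flip m (flip j (flip k s))}"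
          by (rule exhaust_flips[OF mjk])
        moreover have "u = y" if "u = flip j (flip k s) \<or> u = flip m (flip j (flip k s))"
          using that \<open>u \<noteq> x\<close> x y by (auto simp: x_def)
        ultimately show ?thesis using that Ds[OF jk(1)] Ds[OF jk(2)] Dy by auto
      qed
      then show "v ` ?H - {v s, v (flip m s)} \<subseteq> disperse_nodes c (gr f)" unfolding disperse_gr by auto
      have "incident_nodes (gr f) (v ` {s, flip m s}) \<subseteq> v ` ?H"
        unfolding incident_image_gr
      proof (intro ballI allI impI)
        fix w l assume w: "w \<in> {s, flip m s}" "flip l w \<notin> {s, flip m s}"
        have "flip l w \<noteq> x"
        proof
          assume "flip l w = x"
          moreover have "l = m \<or> l = j \<or> l = k" by (rule index_cases[OF mjk])
          ultimately show False using w(1) xs fs by auto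
        qed
        then show "flip l w \<in> ?H" by simp
      qed
      then show "incident_nodes (gr f) {v s, v (flip m s)} \<subseteq> v ` ?H" by simp
    qed
    then show False using free unfolding singular_iso_path_free_def by blast
  qed
  then show ?thesis unfolding fs by blast
qed

section \<open>Inner iso-lines of a regular graph\<close>

lemma regular_edge_lines:
  assumes inner: "inner_iso_paths c \<G> (gr f) \<J>" and reg: "regular_graph c \<G> (gr f)"
  shows "eseg s m \<in> \<Union>\<J> \<longleftrightarrow> EL f s m"
proof -
  obtain r n \<J>' g where S: "S_steps c r n (gr f) \<J>' (gr g)" "\<J> = insert (C_rules c (gr g)) \<J>'"
    "\<And>l t. \<not> Lf g l t" "r = S1 \<or> n \<le> 1" "L_faces c (gr f) \<noteq> {} \<longrightarrow> S_table c (gr f) r n"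
    using inner_paths_ex[OF inner reg] by blast
  show ?thesis using S_steps_EL[OF S(1)] S(2) by simp
qed

lemma regular_resolved:
  assumes inner: "inner_iso_paths c \<G> (gr f) \<J>" and reg: "regular_graph c \<G> (gr f)"
  shows "resolved f \<J>"
proof -
  obtain r n \<J>' g where S: "S_steps c r n (gr f) \<J>' (gr g)" "\<J> = insert (C_rules c (gr g)) \<J>'"
    "\<And>l t. \<not> Lf g l t" "r = S1 \<or> n \<le> 1" "L_faces c (gr f) \<noteq> {} \<longrightarrow> S_table c (gr f) r n"
    using inner_paths_ex[OF inner reg] by blast
  show ?thesis using S_steps_resolved[OF S(1,3)] S(2) by simp
qed

lemma regular_trivial_two_paths:
  assumes inner: "inner_iso_paths c \<G> (gr f) \<J>" and reg: "regular_graph c \<G> (gr f)"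
    and "tri f i t" "e \<in> W1 f i t"
  shows "\<exists>J1\<in>\<J>. \<exists>J2\<in>\<J>. J1 \<noteq> J2 \<and> e \<in> J1 \<and> e \<in> J2"
proof -
  obtain r n \<J>' g where S: "S_steps c r n (gr f) \<J>' (gr g)" "\<J> = insert (C_rules c (gr g)) \<J>'"
    "\<And>l t. \<not> Lf g l t" "r = S1 \<or> n \<le> 1" "L_faces c (gr f) \<noteq> {} \<longrightarrow> S_table c (gr f) r n"
    using inner_paths_ex[OF inner reg] by blast
  have "\<not> T1i f" "\<not> F1i f" using reg T1_free F1_free unfolding regular_graph_def by blast+
  then show ?thesis unfolding S(2) using two_paths_trivial[OF S(1,4,3)] assms(3,4) by blast
qed

text \<open>By \<open>T2_free\<close> the two sides orthogonal to the edge are the only L-faces.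
  They are parallel and there are four disperse corners, so the table prescribes a single
  \<open>S2\<close>-step.\<close>

lemma regular_edge_two_paths:
  assumes inner: "inner_iso_paths c \<G> (gr f) \<J>" and reg: "regular_graph c \<G> (gr f)"
    and Zs: "Z f s" "Z f (flip m s)"
    and Ds: "\<And>j. j \<noteq> m \<Longrightarrow> D f (flip j s) \<and> D f (flip m (flip j s))"
  shows "\<exists>J1\<in>\<J>. \<exists>J2\<in>\<J>. J1 \<noteq> J2 \<and> eseg s m \<in> J1 \<and> eseg s m \<in> J2"
proof -
  obtain r n \<J>' g where S: "S_steps c r n (gr f) \<J>' (gr g)" "\<J> = insert (C_rules c (gr g)) \<J>'"
    "\<And>l t. \<not> Lf g l t" "r = S1 \<or> n \<le> 1" "L_faces c (gr f) \<noteq> {} \<longrightarrow> S_table c (gr f) r n"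
    using inner_paths_ex[OF inner reg] by blast
  have free: "singular_iso_path_free c (gr f)" "\<not> F1i f" using reg F1_free unfolding regular_graph_def by blast+
  have nD: "\<not> D f (flip k (flip j s)) \<and> \<not> D f (flip m (flip k (flip j s)))"
    if "j \<noteq> m" "k \<noteq> m" "j \<noteq> k" for j k
    by (rule T2_free[OF free(1) Zs _ that]) (rule Ds)
  obtain j k where mjk: "m \<noteq> j" "m \<noteq> k" "j \<noteq> k" by (rule index_others)
  have jm: "j \<noteq> m" and km: "k \<noteq> m" "k \<noteq> j" using mjk by auto
  have fs: "flip j (flip m w) = flip m (flip j w)" "flip k (flip m w) = flip m (flip k w)" "flip k (flip j w) = flip j (flip k w)" for w
    by (rule flip_commute)+
  have d: "\<not> D f s" "\<not> D f (flip m s)" "D f (flip j s)" "D f (flip k s)" "D f (flip m (flip j s))" "D f (flip m (flip k s))"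
    "\<not> D f (flip j (flip k s))" "\<not> D f (flip m (flip j (flip k s)))"
    using Zs Ds[OF jm] Ds[OF km(1)] nD[OF jm km(1) mjk(3)] by (auto simp: fs)
  note L = Lf_six[OF mjk, of _ s] Lf_six[OF jm mjk(3,2), of _ s] Lf_six[OF km mjk(1), of _ s]
  have Lm: "Lf f m (s m)" "Lf f m (\<not> s m)" and Lo: "\<not> Lf f j (s j)" "\<not> Lf f j (\<not> s j)" "\<not> Lf f k (s k)" "\<not> Lf f k (\<not> s k)"
    unfolding L using d by (simp_all add: fs)
  have "L_faces c (gr f) \<noteq> {}" unfolding L_faces_gr using Lm by blast
  then have T: "S_table c (gr f) r n" using S(5) by simp
  have d4: "card (disperse_nodes c (gr f)) = 4" unfolding disperse_gr card_v card_rel[OF mjk, of "D f" s] using d by simp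
  have l2: "card (L_faces c (gr f)) = 2" unfolding card_L_faces[OF mjk, of f s] using Lm Lo by simp
  have "sd m (s m) \<in> L_faces c (gr f)" "sd m (\<not> s m) \<in> L_faces c (gr f)" unfolding L_faces_gr using Lm by blast+
  moreover have "sd m (s m) \<noteq> sd m (\<not> s m)" by simp
  moreover have "parallel_faces (gr f) (sd m (s m)) (sd m (\<not> s m))"
    unfolding parallel_faces_def nodes_side by auto
  ultimately have par: "\<exists>M \<in> L_faces c (gr f). \<exists>M' \<in> L_faces c (gr f). M \<noteq> M' \<and> parallel_faces (gr f) M M'" by blast
  have rn: "r = S2" "n = 1" using T unfolding S_table_def Let_def d4 l2 using par by simp_all
  have "S_steps c S2 1 (gr f) \<J>' (gr g)" using S(1) rn by simp
  then show ?thesis unfolding S(2)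
    by (rule two_paths_edge[OF _ free(2) Zs]) (rule Ds nD; assumption)+
qed

end

subsection \<open>Polygons\<close>

lemma collinear_Un:
  fixes A B :: "'a::euclidean_space set"
  assumes "collinear A" "collinear B" "y \<noteq> z" "y \<in> A" "z \<in> A" "y \<in> B" "z \<in> B"
  shows "collinear (A \<union> B)"
proof -
  have "collinear {y, z, x}" if "x \<in> A \<union> B" for x
  proof (cases "x \<in> A")
    case True
    then show ?thesis using assms by (intro collinear_subset[OF assms(1)]) auto
  next
    case False
    then show ?thesis using assms that by (intro collinear_subset[OF assms(2)]) auto
  qed
  then have "collinear (insert y (insert z (A \<union> B)))" using collinear_triples[OF assms(3)] by blast
  then show ?thesis by (rule collinear_subset) auto
qed

text \<open>Some member of the finite cover contains infinitely many points of the segment. Any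
  other member meets the segment in finitely many points, since two shared points would make both
  members collinear. Removing finitely many points keeps all limit points, and the member is
  closed.\<close>

lemma segment_in_Union:
  fixes p q :: "'a::euclidean_space"
  assumes fin: "finite \<L>" "finite X" and pq: "p \<noteq> q"
    and seg: "\<And>l. l \<in> \<L> \<Longrightarrow> collinear l \<and> closed l"
    and ncol: "\<And>l l'. l \<in> \<L> \<Longrightarrow> l' \<in> \<L> \<Longrightarrow> l \<noteq> l' \<Longrightarrow> \<not> collinear (l \<union> l')"
    and sub: "closed_segment p q \<subseteq> \<Union>\<L> \<union> X"
  shows "\<exists>l\<in>\<L>. closed_segment p q \<subseteq> l"
proof -
  let ?s = "closed_segment p q"
  have "\<exists>l\<in>\<L>. infinite (?s \<inter> l)"
  proof (rule ccontr)
    assume "\<not> (\<exists>l\<in>\<L>. infinite (?s \<inter> l))"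
    then have "finite ((\<Union>l\<in>\<L>. ?s \<inter> l) \<union> X)" using fin by blast
    moreover have "?s \<subseteq> (\<Union>l\<in>\<L>. ?s \<inter> l) \<union> X" using sub by blast
    ultimately have "finite ?s" by (rule finite_subset[rotated])
    then show False using pq by simp
  qed
  then obtain l where l: "l \<in> \<L>" "infinite (?s \<inter> l)" by blast
  have inf2: "\<exists>y z. y \<noteq> z \<and> y \<in> A \<and> z \<in> A" if "infinite A" for A :: "'a set"
    using that by (metis finite.emptyI finite.insertI infinite_arbitrarily_large subsetI finite_subset singletonI insertI1)
  have few: "finite (?s \<inter> l')" if l': "l' \<in> \<L>" "l' \<noteq> l" for l'
  proof (rule ccontr)
    assume "infinite (?s \<inter> l')"
    then obtain y z where yz: "y \<noteq> z" "y \<in> ?s \<inter> l'" "z \<in> ?s \<inter> l'" using inf2 by blast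
    obtain y' z' where yz': "y' \<noteq> z'" "y' \<in> ?s \<inter> l" "z' \<in> ?s \<inter> l" using inf2[OF l(2)] by blast
    have 1: "collinear (?s \<union> l')" using collinear_Un[of ?s l' y z] seg[OF l'(1)] yz by simp
    have "collinear ((?s \<union> l') \<union> l)"
      by (rule collinear_Un[OF 1 _ yz'(1)]) (use seg[OF l(1)] yz' in auto)
    then have "collinear (l \<union> l')" by (rule collinear_subset) auto
    then show False using ncol l' l(1) by blast
  qed
  let ?F = "(\<Union>l'\<in>\<L> - {l}. ?s \<inter> l') \<union> X"
  have F: "finite ?F" using fin few by blast
  have cov: "?s \<subseteq> ?F \<union> (?s \<inter> l)" using sub by blast
  have "x \<in> l" if x: "x \<in> ?s" for x
  proof -
    have "?s \<noteq> {w}" for w using pq by (metis ends_in_segment(1) ends_in_segment(2) singletonD)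
    then have "x islimpt ?s" using connected_imp_perfect[OF connected_segment(1) x] by blast
    then have "x islimpt (?F \<union> (?s \<inter> l))" using cov islimpt_subset by blast
    then have "x islimpt (?s \<inter> l)" using islimpt_Un_finite[OF F] by blast
    then have "x islimpt l" using islimpt_subset by blast
    then show ?thesis using seg[OF l(1)] closed_limpt by blast
  qed
  then show ?thesis using l(1) by blast
qed

definition is_end :: "'a::real_vector \<Rightarrow> 'a set \<Rightarrow> bool" where
  "is_end x l \<longleftrightarrow> (\<exists>y. l = closed_segment x y)"

text \<open>Segments in general position are determined by their union, up to finitely many points.\<close>

definition general_position :: "'a::euclidean_space set set \<Rightarrow> bool" where
  "general_position \<L> \<longleftrightarrow> finite \<L> \<and> (\<forall>l\<in>\<L>. \<exists>p q. p \<noteq> q \<and> l = closed_segment p q) \<and>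
     (\<forall>l\<in>\<L>. \<forall>l'\<in>\<L>. l \<noteq> l' \<longrightarrow> \<not> collinear (l \<union> l') \<and> (\<forall>x\<in>l \<inter> l'. is_end x l))"

lemma general_position_mono: "general_position \<L> \<Longrightarrow> \<L>' \<subseteq> \<L> \<Longrightarrow> general_position \<L>'"
  unfolding general_position_def by (meson finite_subset subsetD)

text \<open>Each edge lies in one member of \<open>\<L>\<close>. Consecutive edges are not collinear
  and so lie in different members, whose common point, the vertex, is an end of both. Hence the ends
  of an edge are the ends of its member.\<close>

lemma polygon_edges:
  assumes gen: "general_position \<L>" and fin: "finite X"
    and E: "simple_closed_polygon E" and sub: "\<Union>E \<subseteq> \<Union>\<L> \<union> X"
  shows "E \<subseteq> \<L>"
proof
  obtain xs :: "point list" where xs: "length xs \<ge> 3" "distinct xs"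
    and E': "E = (\<lambda>i. closed_segment (xs ! (i mod length xs)) (xs ! ((i + 1) mod length xs))) ` {..<length xs}"
    and nc: "\<forall>i<length xs. \<not> collinear {xs ! (i mod length xs), xs ! ((i + 1) mod length xs), xs ! ((i + 2) mod length xs)}"
    using E unfolding simple_closed_polygon_def Let_def by blast
  define n where "n = length xs"
  define x where "x i = xs ! (i mod n)" for i
  define s where "s i = closed_segment (x i) (x (i + 1))" for i
  have n0: "n > 0" using xs(1) unfolding n_def by linarith
  have xmod: "x (i mod n) = x i" "x (i mod n + 1) = x (i + 1)" "x (i mod n + 2) = x (i + 2)" for i
    unfolding x_def by (simp_all add: mod_simps)
  have smod: "s (i mod n) = s i" for i unfolding s_def xmod ..
  have sE: "s i \<in> E" for i
  proof -
    have "s (i mod n) \<in> E" unfolding E' s_def x_def n_def using n0 by (auto simp: n_def)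
    then show ?thesis by (simp add: smod)
  qed
  have ncol: "\<not> collinear {x i, x (i + 1), x (i + 2)}" for i
  proof -
    have "i mod n < length xs" using n0 by (simp add: n_def)
    then have "\<not> collinear {x (i mod n), x (i mod n + 1), x (i mod n + 2)}"
      using nc unfolding x_def n_def by blast
    then show ?thesis unfolding xmod .
  qed
  have ne: "x i \<noteq> x (i + 1)" for i
  proof
    assume "x i = x (i + 1)"
    then have "collinear {x i, x (i + 1), x (i + 2)}" by simp
    then show False using ncol by blast
  qed
  have "\<exists>l\<in>\<L>. s i \<subseteq> l" for i unfolding s_def
  proof (rule segment_in_Union[OF _ fin ne])
    show "finite \<L>" using gen by (simp add: general_position_def)
    show "collinear l \<and> closed l" if "l \<in> \<L>" for l using gen that unfolding general_position_def by auto
    show "\<not> collinear (l \<union> l')" if "l \<in> \<L>" "l' \<in> \<L>" "l \<noteq> l'" for l l'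
      using gen that unfolding general_position_def by blast
    show "closed_segment (x i) (x (i + 1)) \<subseteq> \<Union>\<L> \<union> X" using sE[of i] sub unfolding s_def by blast
  qed
  then obtain L where L: "\<And>i. L i \<in> \<L>" "\<And>i. s i \<subseteq> L i" by metis
  have col: "collinear (L i)" for i using gen L(1)[of i] unfolding general_position_def by auto
  have Lne: "L i \<noteq> L (i + 1)" for i
  proof
    assume eq: "L i = L (i + 1)"
    have "{x i, x (i + 1), x (i + 2)} \<subseteq> L i"
      using L(2)[of i] L(2)[of "i + 1"] unfolding s_def eq[symmetric] by (auto simp: numeral_2_eq_2)
    then show False using ncol[of i] col collinear_subset by blast
  qed
  have e1: "is_end (x (i + 1)) (L i)" "is_end (x (i + 1)) (L (i + 1))" for i
  proof -
    have x: "x (i + 1) \<in> L i" "x (i + 1) \<in> L (i + 1)" using L(2)[of i] L(2)[of "i + 1"] unfolding s_def by auto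
    have ex: "\<forall>l\<in>\<L>. \<forall>l'\<in>\<L>. l \<noteq> l' \<longrightarrow> (\<forall>x\<in>l \<inter> l'. is_end x l)"
      using gen unfolding general_position_def by blast
    show "is_end (x (i + 1)) (L i)" using ex L(1) Lne[of i] x by blast
    show "is_end (x (i + 1)) (L (i + 1))" using ex L(1) Lne[of i] x by (metis IntI)
  qed
  fix e assume "e \<in> E"
  then obtain i where i: "e = s i" unfolding E' s_def x_def n_def by blast
  \<comment> \<open>Shifting by a full period makes the predecessor index available for
    \<open>i = 0\<close> too.\<close>
  have e: "e = s (i + n)" using i smod by (metis mod_add_self2)
  have "is_end (x (i + n)) (L (i + n))" using e1(2)[of "i + n - 1"] n0 by simp
  moreover have "is_end (x (i + n + 1)) (L (i + n))" by (rule e1(1))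
  ultimately obtain y z where yz: "L (i + n) = closed_segment (x (i + n)) y" "L (i + n) = closed_segment (x (i + n + 1)) z"
    unfolding is_end_def by blast
  then have "{x (i + n), y} = {x (i + n + 1), z}" by simp
  then have "y = x (i + n + 1)" using ne[of "i + n"] by (auto simp: doubleton_eq_iff)
  then have "L (i + n) = s (i + n)" using yz by (simp add: s_def)
  then show "e \<in> \<L>" using L(1) e by metis
qed

section \<open>Triangles and quadrilaterals\<close>

lemma not_collinear3:
  assumes "\<not> collinear {p, q, r}" shows "p \<noteq> q" "q \<noteq> r" "p \<noteq> r"
proof -
  have "collinear {p, p, r}" "collinear {p, q, q}" "collinear {p, q, p}"
    using collinear_2[of p q] by (simp_all add: insert_commute)
  then show "p \<noteq> q" "q \<noteq> r" "p \<noteq> r" using assms by metis+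
qed

lemma segments_Int:
  fixes p q r :: "'a::euclidean_space"
  assumes "\<not> collinear {p, q, r}"
  shows "closed_segment p q \<inter> closed_segment q r = {q}"
  using Int_closed_segment assms by blast

text \<open>Symmetric form of the condition on pairs in \<open>general_position\<close>, so that
  each pair has to be treated in one order only.\<close>

definition crossing_free :: "'a::euclidean_space set \<Rightarrow> 'a set \<Rightarrow> bool" where
  "crossing_free l l' \<longleftrightarrow> \<not> collinear (l \<union> l') \<and> (\<forall>x\<in>l \<inter> l'. is_end x l \<and> is_end x l')"

lemma crossing_free_sym: "crossing_free l l' \<Longrightarrow> crossing_free l' l"
  unfolding crossing_free_def by (simp add: Un_commute Int_commute conj_commute)

lemma is_end_segment: "is_end p (closed_segment p q)" "is_end q (closed_segment p q)"
  unfolding is_end_def by (metis closed_segment_commute)+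

lemma crossing_free_adjacent:
  assumes "\<not> collinear {p, q, r}"
  shows "crossing_free (closed_segment p q) (closed_segment q r)"
proof -
  have "{p, q, r} \<subseteq> closed_segment p q \<union> closed_segment q r" by simp
  then have "\<not> collinear (closed_segment p q \<union> closed_segment q r)" using assms collinear_subset by blast
  then show ?thesis unfolding crossing_free_def segments_Int[OF assms] using is_end_segment by blast
qed

lemma crossing_free_disjoint:
  assumes "\<not> collinear {p, q, r}" "{p, q, r} \<subseteq> l \<union> l'" "l \<inter> l' = {}"
  shows "crossing_free l l'"
  unfolding crossing_free_def using assms collinear_subset by blast

lemma general_positionI:
  assumes "finite \<L>" "\<And>l. l \<in> \<L> \<Longrightarrow> \<exists>p q. p \<noteq> q \<and> l = closed_segment p q"
    "\<And>l l'. l \<in> \<L> \<Longrightarrow> l' \<in> \<L> \<Longrightarrow> l \<noteq> l' \<Longrightarrow> crossing_free l l'"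
  shows "general_position \<L>"
  unfolding general_position_def using assms unfolding crossing_free_def by blast

lemma simple_closed_polygonI:
  fixes P :: "nat \<Rightarrow> point"
  assumes "n \<ge> 3" "distinct xs" "length xs = n" "\<And>i. P i = xs ! (i mod n)"
    and "E = (\<lambda>i. closed_segment (P i) (P (i + 1))) ` {..<n}"
    and "\<And>i. i < n \<Longrightarrow> \<not> collinear {P i, P (i + 1), P (i + 2)}"
    and "\<And>i. i < n \<Longrightarrow> closed_segment (P i) (P (i + 1)) \<inter> closed_segment (P (i + 1)) (P (i + 1 + 1)) = {P (i + 1)}"
    and "\<And>i j. i < n \<Longrightarrow> j < n \<Longrightarrow> j \<noteq> i \<Longrightarrow> j \<noteq> (i + 1) mod n \<Longrightarrow> i \<noteq> (j + 1) mod n \<Longrightarrow>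
      closed_segment (P i) (P (i + 1)) \<inter> closed_segment (P j) (P (j + 1)) = {}"
  shows "simple_closed_polygon E"
proof -
  have P: "P = (\<lambda>i. xs ! (i mod n))" using assms(4) by blast
  show ?thesis unfolding simple_closed_polygon_def Let_def
    using assms(1,2,5-8) assms(3) unfolding P by (intro exI[of _ xs]) blast
qed

lemma segment_nondegenerate:
  "l = closed_segment x y \<Longrightarrow> x \<noteq> y \<Longrightarrow> \<exists>p q. p \<noteq> q \<and> l = closed_segment p q"
  by blast

lemma triangle_polygon:
  fixes p q r :: point
  assumes nc: "\<not> collinear {p, q, r}"
  shows "simple_closed_polygon {closed_segment p q, closed_segment q r, closed_segment r p}"
    and "general_position {closed_segment p q, closed_segment q r, closed_segment r p}"
proof -
  have nc': "\<not> collinear {q, r, p}" "\<not> collinear {r, p, q}" using nc by (simp_all add: insert_commute)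
  note I = segments_Int[OF nc] segments_Int[OF nc'(1)] segments_Int[OF nc'(2)]
  note d = not_collinear3[OF nc]
  define P where "P i = [p, q, r] ! (i mod 3)" for i
  have P: "P 0 = p" "P 1 = q" "P 2 = r" "P 3 = p" "P 4 = q" "P (Suc (Suc 0)) = r"
    by (simp_all add: P_def)
  have set3: "{..<3::nat} = {0, 1, 2}" by auto
  show "simple_closed_polygon {closed_segment p q, closed_segment q r, closed_segment r p}"
  proof (rule simple_closed_polygonI[of 3 "[p, q, r]" P])
    show "{closed_segment p q, closed_segment q r, closed_segment r p} = (\<lambda>i. closed_segment (P i) (P (i + 1))) ` {..<3}"
      unfolding set3 image_insert image_empty by (simp del: One_nat_def add: P)
    fix i :: nat assume "i < 3"
    then have i: "i = 0 \<or> i = 1 \<or> i = 2" by linarith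
    show "\<not> collinear {P i, P (i + 1), P (i + 2)}" using i nc nc' by (elim disjE) (simp_all del: One_nat_def add: P)
    show "closed_segment (P i) (P (i + 1)) \<inter> closed_segment (P (i + 1)) (P (i + 1 + 1)) = {P (i + 1)}"
      using i I by (elim disjE) (simp_all del: One_nat_def add: P)
    fix j :: nat assume "j < 3" and ne: "j \<noteq> i" "j \<noteq> (i + 1) mod 3" "i \<noteq> (j + 1) mod 3"
    then have "j = 0 \<or> j = 1 \<or> j = 2" by linarith
    then have False using i ne by (elim disjE) simp_all
    then show "closed_segment (P i) (P (i + 1)) \<inter> closed_segment (P j) (P (j + 1)) = {}" ..
  qed (use d in \<open>simp_all add: P_def\<close>)
  note cf = crossing_free_adjacent[OF nc] crossing_free_adjacent[OF nc'(1)] crossing_free_adjacent[OF nc'(2)]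
  note cf' = cf[THEN crossing_free_sym]
  show "general_position {closed_segment p q, closed_segment q r, closed_segment r p}"
  proof (rule general_positionI)
    fix l assume "l \<in> {closed_segment p q, closed_segment q r, closed_segment r p}"
    then show "\<exists>p q. p \<noteq> q \<and> l = closed_segment p q" by (elim insertE emptyE) (erule segment_nondegenerate, use d in metis)+
  next
    fix l l' assume "l \<in> {closed_segment p q, closed_segment q r, closed_segment r p}"
      "l' \<in> {closed_segment p q, closed_segment q r, closed_segment r p}" "l \<noteq> l'"
    then show "crossing_free l l'" by (elim insertE emptyE; hypsubst) (simp_all only: cf cf' simp_thms)
  qed simp
qed

lemma quadrilateral_polygon:
  fixes p q r w :: point
  assumes nc: "\<not> collinear {p, q, r}" "\<not> collinear {q, r, w}" "\<not> collinear {r, w, p}" "\<not> collinear {w, p, q}"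
    and dj: "closed_segment p q \<inter> closed_segment r w = {}" "closed_segment q r \<inter> closed_segment w p = {}"
  shows "simple_closed_polygon {closed_segment p q, closed_segment q r, closed_segment r w, closed_segment w p}"
    and "general_position {closed_segment p q, closed_segment q r, closed_segment r w, closed_segment w p}"
proof -
  note I = segments_Int[OF nc(1)] segments_Int[OF nc(2)] segments_Int[OF nc(3)] segments_Int[OF nc(4)]
  have "closed_segment r w \<inter> closed_segment p q = {}" "closed_segment w p \<inter> closed_segment q r = {}"
    using dj by (simp_all add: Int_commute)
  note dj' = dj this
  have d: "p \<noteq> q" "q \<noteq> r" "p \<noteq> r" "r \<noteq> w" "q \<noteq> w" "w \<noteq> p"
    using not_collinear3[OF nc(1)] not_collinear3[OF nc(2)] not_collinear3[OF nc(3)] by auto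
  define P where "P i = [p, q, r, w] ! (i mod 4)" for i
  have P: "P 0 = p" "P 1 = q" "P 2 = r" "P 3 = w" "P 4 = p" "P 5 = q" "P (Suc (Suc 0)) = r"
    by (simp_all add: P_def)
  have set4: "{..<4::nat} = {0, 1, 2, 3}" by auto
  show "simple_closed_polygon {closed_segment p q, closed_segment q r, closed_segment r w, closed_segment w p}"
  proof (rule simple_closed_polygonI[of 4 "[p, q, r, w]" P])
    show "{closed_segment p q, closed_segment q r, closed_segment r w, closed_segment w p} =
        (\<lambda>i. closed_segment (P i) (P (i + 1))) ` {..<4}"
      unfolding set4 image_insert image_empty by (simp del: One_nat_def add: P)
    fix i :: nat assume "i < 4"
    then have i: "i = 0 \<or> i = 1 \<or> i = 2 \<or> i = 3" by linarith
    show "\<not> collinear {P i, P (i + 1), P (i + 2)}" using i nc by (elim disjE) (simp_all del: One_nat_def add: P)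
    show "closed_segment (P i) (P (i + 1)) \<inter> closed_segment (P (i + 1)) (P (i + 1 + 1)) = {P (i + 1)}"
      using i I by (elim disjE) (simp_all del: One_nat_def add: P)
    fix j :: nat assume "j < 4" and ne: "j \<noteq> i" "j \<noteq> (i + 1) mod 4" "i \<noteq> (j + 1) mod 4"
    then have "j = 0 \<or> j = 1 \<or> j = 2 \<or> j = 3" by linarith
    then show "closed_segment (P i) (P (i + 1)) \<inter> closed_segment (P j) (P (j + 1)) = {}"
      using i ne dj' by (elim disjE) (simp_all del: One_nat_def add: P)
  qed (use d in \<open>simp_all add: P_def\<close>)
  note cf = crossing_free_adjacent[OF nc(1)] crossing_free_adjacent[OF nc(2)] crossing_free_adjacent[OF nc(3)]
    crossing_free_adjacent[OF nc(4)]
  have "crossing_free (closed_segment p q) (closed_segment r w)" "crossing_free (closed_segment q r) (closed_segment w p)"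
    by (rule crossing_free_disjoint[OF nc(1)], use dj in auto)+
  note cf = cf this
  note cf' = cf[THEN crossing_free_sym]
  show "general_position {closed_segment p q, closed_segment q r, closed_segment r w, closed_segment w p}"
  proof (rule general_positionI)
    fix l assume "l \<in> {closed_segment p q, closed_segment q r, closed_segment r w, closed_segment w p}"
    then show "\<exists>p q. p \<noteq> q \<and> l = closed_segment p q" by (elim insertE emptyE) (erule segment_nondegenerate, use d in metis)+
  next
    fix l l' assume "l \<in> {closed_segment p q, closed_segment q r, closed_segment r w, closed_segment w p}"
      "l' \<in> {closed_segment p q, closed_segment q r, closed_segment r w, closed_segment w p}" "l \<noteq> l'"
    then show "crossing_free l l'" by (elim insertE emptyE; hypsubst) (simp_all only: cf cf' simp_thms)
  qed simp
qed

subsection \<open>The outer polygon of an L-face\<close>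

text \<open>The two products are the terms of a 2 by 2 minor of the vectors \<open>q - p\<close> and
  \<open>r - p\<close>.\<close>

lemma not_collinear_minor:
  fixes p q r :: point
  assumes "(q $ j - p $ j) * (r $ k - p $ k) \<noteq> (r $ j - p $ j) * (q $ k - p $ k)"
  shows "\<not> collinear {p, q, r}"
proof
  assume "collinear {p, q, r}"
  then obtain u where u: "\<forall>x\<in>{p, q, r}. \<forall>y\<in>{p, q, r}. \<exists>t. x - y = t *\<^sub>R u" unfolding collinear_def by blast
  obtain t t' where t: "q - p = t *\<^sub>R u" "r - p = t' *\<^sub>R u" using u by blast
  have "q $ l - p $ l = t * u $ l" "r $ l - p $ l = t' * u $ l" for l
    using arg_cong[OF t(1), of "\<lambda>x. x $ l"] arg_cong[OF t(2), of "\<lambda>x. x $ l"] by simp_all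
  then show False using assms by simp
qed

lemma separated_segments:
  fixes p q r w :: point
  assumes "linear \<phi>" "\<phi> p < (e::real)" "\<phi> q < e" "e < \<phi> r" "e < \<phi> w"
  shows "closed_segment p q \<inter> closed_segment r w = {}"
proof -
  have "\<phi> x < e" if "x \<in> closed_segment p q" for x
  proof -
    have "convex {x. \<phi> x < e}" using convex_linear_vimage[OF assms(1), of "{..<e}"] by (simp add: vimage_def)
    then have "closed_segment p q \<subseteq> {x. \<phi> x < e}" using assms(2,3) by (intro closed_segment_subset) auto
    then show ?thesis using that by blast
  qed
  moreover have "\<phi> x > e" if "x \<in> closed_segment r w" for x
  proof -
    have "convex {x. \<phi> x > e}" using convex_linear_vimage[OF assms(1), of "{e<..}"] by (simp add: vimage_def)
    then have "closed_segment r w \<subseteq> {x. \<phi> x > e}" using assms(4,5) by (intro closed_segment_subset) auto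
    then show ?thesis using that by blast
  qed
  ultimately show ?thesis by fastforce
qed

context iso_corners
begin

text \<open>Coordinates in which \<open>v s\<close> is the origin and the adjacent corners are at distance 1.\<close>

definition rel :: "(3 \<Rightarrow> bool) \<Rightarrow> 3 \<Rightarrow> point \<Rightarrow> real" where
  "rel s j p = (p $ j - v s $ j) / (v (flip j s) $ j - v s $ j)"

lemma rel_denom: "v (flip j s) $ j - v s $ j \<noteq> 0"
  using box[of j] by auto

lemma rel_nth: "p $ j = v s $ j + rel s j p * (v (flip j s) $ j - v s $ j)"
  using rel_denom[of j s] by (simp add: rel_def)

lemma rel_corner: "rel s j (v u) = (if u j = s j then 0 else 1)"
  using rel_denom[of j s] by (auto simp: rel_def)

lemma rel_bound:
  assumes "mix f u j" "\<not> Z f (cend f u j)"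
  shows "0 < rel s j (xp f u j)" "rel s j (xp f u j) < 1"
  using xp_interior[OF assms] unfolding rel_def by (auto simp: divide_simps)

lemma rel_other: "j \<noteq> l \<Longrightarrow> rel s j (xp f u l) = rel s j (v u)"
  by (simp add: rel_def)

lemma not_collinear_rel:
  assumes "(rel s j q - rel s j p) * (rel s k r - rel s k p) \<noteq> (rel s j r - rel s j p) * (rel s k q - rel s k p)"
  shows "\<not> collinear {p, q, r}"
proof (rule not_collinear_minor[of q j p r k])
  define da db where "da = v (flip j s) $ j - v s $ j" and "db = v (flip k s) $ k - v s $ k"
  have dd: "da * db \<noteq> 0" using rel_denom[of j s] rel_denom[of k s] unfolding da_def db_def by simp
  have "x $ j = v s $ j + rel s j x * da" "x $ k = v s $ k + rel s k x * db" for x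
    using rel_nth[of x j s] rel_nth[of x k s] unfolding da_def db_def by blast+
  then have d: "x $ j - y $ j = (rel s j x - rel s j y) * da" "x $ k - y $ k = (rel s k x - rel s k y) * db" for x y
    by (metis add_diff_cancel_left left_diff_distrib)+
  have e: "(q $ j - p $ j) * (r $ k - p $ k) = ((rel s j q - rel s j p) * (rel s k r - rel s k p)) * (da * db)"
    "(r $ j - p $ j) * (q $ k - p $ k) = ((rel s j r - rel s j p) * (rel s k q - rel s k p)) * (da * db)"
    unfolding d by (simp_all add: mult_ac)
  show "(q $ j - p $ j) * (r $ k - p $ k) \<noteq> (r $ j - p $ j) * (q $ k - p $ k)"
    unfolding e using assms dd by simp
qed

text \<open>Splits a negative minor into two terms whose signs are evident.\<close>

lemma not_collinear_relI:
  assumes "(rel s j q - rel s j p) * (rel s k r - rel s k p) - (rel s j r - rel s j p) * (rel s k q - rel s k p) = - (g + h)"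
    and "0 < g" "0 < h"
  shows "\<not> collinear {p, q, r}"
  by (rule not_collinear_rel[of s j _ _ k]) (use assms in linarith)

lemma separated_rel:
  assumes "\<alpha> * rel s j p + \<beta> * rel s k p < e" "\<alpha> * rel s j q + \<beta> * rel s k q < e"
    "e < \<alpha> * rel s j r + \<beta> * rel s k r" "e < \<alpha> * rel s j w + \<beta> * rel s k w"
  shows "closed_segment p q \<inter> closed_segment r w = {}"
proof -
  define da db where "da = v (flip j s) $ j - v s $ j" and "db = v (flip k s) $ k - v s $ k"
  define \<phi> where "\<phi> x = (\<alpha> / da) * x $ j + (\<beta> / db) * x $ k" for x :: point
  define e' where "e' = e + (\<alpha> / da) * v s $ j + (\<beta> / db) * v s $ k"
  have lin: "linear \<phi>" unfolding \<phi>_def by (intro linearI) (simp_all add: algebra_simps)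
  have \<phi>: "\<phi> x = \<alpha> * rel s j x + \<beta> * rel s k x + (e' - e)" for x
    unfolding \<phi>_def e'_def rel_def da_def[symmetric] db_def[symmetric]
    by (simp add: diff_divide_distrib right_diff_distrib)
  show ?thesis by (rule separated_segments[OF lin, of _ e']) (use assms in \<open>simp_all add: \<phi>\<close>)
qed

text \<open>In relative coordinates the side is the unit square with \<open>A = (x1, 0)\<close>,
  \<open>B = (0, y4)\<close>, \<open>C = (1, y2)\<close> and \<open>E = (x3, 1)\<close>.
  \<open>W1\<close> consists of \<open>A B\<close> and \<open>E C\<close>, and \<open>W2\<close> of
  \<open>E B\<close> and \<open>A C\<close>, the latter only if its corner has label below
  \<open>c\<close>. Together they bound a quadrilateral or a triangle.\<close>

lemma nontrivial_polygon:
  assumes L: "Lf f i t" and nt: "\<not> tri f i t"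
  shows "simple_closed_polygon (W1 f i t \<union> W2 f i t)" "general_position (W1 f i t \<union> W2 f i t)"
proof -
  obtain s0 j k where s0: "i \<noteq> j" "i \<noteq> k" "j \<noteq> k" "s0 i = t" "D f s0" "D f (flip j (flip k s0))"
    "\<not> D f (flip j s0)" "\<not> D f (flip k s0)" using L unfolding Lf_def by blast
  note ijk = s0(1-3)
  have fs: "flip k (flip j w) = flip j (flip k w)" for w by (rule flip_commute)
  \<comment> \<open>The corner \<open>flip k s\<close> may be assumed to have label below
    \<open>c\<close>; otherwise the opposite disperse corner takes the place of
    \<open>s\<close>.\<close>
  have goal: "simple_closed_polygon (W1 f i (s i) \<union> W2 f i (s i)) \<and> general_position (W1 f i (s i) \<union> W2 f i (s i))"
    if D: "D f s" "D f (flip j (flip k s))" "\<not> D f (flip j s)" "\<not> D f (flip k s)" and nZ: "\<not> Z f (flip k s)" for s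
  proof -
    define A where "A = xp f s j"
    define B where "B = xp f s k"
    define C where "C = xp f (flip j s) k"
    define E where "E = xp f (flip k s) j"
    define x1 where "x1 = rel s j A"
    define y4 where "y4 = rel s k B"
    define y2 where "y2 = rel s k C"
    define x3 where "x3 = rel s j E"
    have mixs: "mix f s j" "mix f s k" "mix f (flip j s) k" "mix f (flip k s) j" using D fs by simp_all
    have ce: "cend f s j = flip j s" "cend f s k = flip k s" "cend f (flip j s) k = flip j s" "cend f (flip k s) j = flip k s"
      using D by (simp_all add: cend_def)
    have rA: "rel s k A = 0" using rel_other[of k j s f s] ijk by (simp add: A_def rel_corner)
    have rB: "rel s j B = 0" using rel_other[of j k s f s] ijk by (simp add: B_def rel_corner)
    have rC: "rel s j C = 1" using rel_other[of j k s f "flip j s"] ijk by (simp add: C_def rel_corner)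
    have rE: "rel s k E = 1" using rel_other[of k j s f "flip k s"] ijk by (simp add: E_def rel_corner)
    have b4: "0 < y4" "y4 < 1" using rel_bound[OF mixs(2), of s] nZ ce by (simp_all add: y4_def B_def)
    have b3: "0 < x3" "x3 < 1" using rel_bound[OF mixs(4), of s] nZ ce by (simp_all add: x3_def E_def)
    note R = rA rB rC rE x1_def[symmetric] y4_def[symmetric] y2_def[symmetric] x3_def[symmetric]
    have cut: "closed_segment (xp f s j) (xp f s k) = closed_segment A B"
      "closed_segment (xp f (flip j s) j) (xp f (flip j s) k) = closed_segment A C"
      "closed_segment (xp f (flip k s) j) (xp f (flip k s) k) = closed_segment E B"
      "closed_segment (xp f (flip j (flip k s)) j) (xp f (flip j (flip k s)) k) = closed_segment E C"
      using xp_flip[OF mixs(1)] xp_flip[OF mixs(2)] xp_flip[OF mixs(3)] xp_flip[OF mixs(4)]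
      by (simp_all add: A_def B_def C_def E_def fs)
    have W1: "W1 f i (s i) = {closed_segment A B, closed_segment E C}"
      unfolding cuts_eq4[OF ijk] cut using D by (simp add: insert_commute)
    have less: "f (v u) < c \<longleftrightarrow> \<not> D f u \<and> \<not> Z f u" for u by (auto simp: D_def Z_def)
    show ?thesis
    proof (cases "Z f (flip j s)")
      case True
      \<comment> \<open>A label-\<open>c\<close> corner merges two of the four iso-points and leaves
        a triangle.\<close>
      have AC: "C = A" unfolding A_def C_def using xp_Z_flip[OF D(1) True] xp_Z[OF True] by simp
      have W2: "W2 f i (s i) = {closed_segment E B}"
        unfolding cuts_eq4[OF ijk] cut less using D nZ True by simp
      have x1: "x1 = 1" unfolding x1_def A_def using xp_Z_flip[OF D(1) True] by (simp add: rel_corner)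
      have nc: "\<not> collinear {A, B, E}"
        by (rule not_collinear_relI[of s j B A k E "1 - y4" "x3 * y4"], unfold R x1, algebra) (use b4 b3 in simp_all)
      have "W1 f i (s i) \<union> W2 f i (s i) = {closed_segment A B, closed_segment B E, closed_segment E A}"
        unfolding W1 W2 AC by (auto simp: closed_segment_commute)
      then show ?thesis using triangle_polygon[OF nc] by simp
    next
      case False
      have b1: "0 < x1" "x1 < 1" using rel_bound[OF mixs(1), of s] False ce by (simp_all add: x1_def A_def)
      have b2: "0 < y2" "y2 < 1" using rel_bound[OF mixs(3), of s] False ce by (simp_all add: y2_def C_def)
      have W2: "W2 f i (s i) = {closed_segment A C, closed_segment E B}"
        unfolding cuts_eq4[OF ijk] cut less using D nZ False by (simp add: insert_commute)
      have nc1: "\<not> collinear {A, B, E}"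
        by (rule not_collinear_relI[of s j B A k E "x1 * (1 - y4)" "x3 * y4"], unfold R, algebra) (use b1 b2 b3 b4 in simp_all)
      have nc2: "\<not> collinear {B, E, C}"
        by (rule not_collinear_relI[of s j E B k C "(1 - y4) * (1 - x3)" "x3 * (1 - y2)"], unfold R, algebra) (use b1 b2 b3 b4 in simp_all)
      have nc3: "\<not> collinear {E, C, A}"
        by (rule not_collinear_relI[of s j C E k A "(1 - x1) * (1 - y2)" "(1 - x3) * y2"], unfold R, algebra) (use b1 b2 b3 b4 in simp_all)
      have nc4: "\<not> collinear {C, A, B}"
        by (rule not_collinear_relI[of s j A C k B "(1 - x1) * y4" "x1 * y2"], unfold R, algebra) (use b1 b2 b3 b4 in simp_all)
      \<comment> \<open>The line \<open>x + y = 1\<close> separates the two cuts of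
        \<open>W1\<close>.\<close>
      have d1: "closed_segment A B \<inter> closed_segment E C = {}"
        by (rule separated_rel[of 1 s j A 1 k 1]) (use b1 b2 b3 b4 in \<open>simp_all add: R\<close>)
      \<comment> \<open>The line \<open>x = y\<close> separates the two cuts of
        \<open>W2\<close>.\<close>
      have d2: "closed_segment B E \<inter> closed_segment C A = {}"
        by (rule separated_rel[of 1 s j B "-1" k 0]) (use b1 b2 b3 b4 in \<open>simp_all add: R\<close>)
      have "W1 f i (s i) \<union> W2 f i (s i) = {closed_segment A B, closed_segment B E, closed_segment E C, closed_segment C A}"
        unfolding W1 W2 by (auto simp: closed_segment_commute)
      then show ?thesis using quadrilateral_polygon[OF nc1 nc2 nc3 nc4 d1 d2] by simp
    qed
  qed
  have "\<exists>s. s i = t \<and> D f s \<and> D f (flip j (flip k s)) \<and> \<not> D f (flip j s) \<and> \<not> D f (flip k s) \<and> \<not> Z f (flip k s)"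
  proof (cases "Z f (flip k s0)")
    case False
    then show ?thesis using s0 by blast
  next
    case True
    have "\<not> Z f (flip j s0)"
    proof
      assume Zj: "Z f (flip j s0)"
      have "Z f u" if "u i = t" "\<not> D f u" for u
      proof -
        have "u \<in> {s0, flip j s0, flip k s0, flip j (flip k s0)}" using face_indices[OF ijk, of s0] that s0(4) by blast
        then show ?thesis using that(2) s0 True Zj by auto
      qed
      then show False using nt L by (auto simp: tri_def)
    qed
    have w: "flip j (flip k (flip j (flip k s0))) = s0" "flip j (flip j (flip k s0)) = flip k s0"
      "flip k (flip j (flip k s0)) = flip j s0" by (simp_all add: fs)
    have "flip j (flip k s0) i = t" using s0 by simp
    with \<open>\<not> Z f (flip j s0)\<close> show ?thesis using s0(5-8) w
      by (intro exI[of _ "flip j (flip k s0)"]) simp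
  qed
  then show "simple_closed_polygon (W1 f i t \<union> W2 f i t)" "general_position (W1 f i t \<union> W2 f i t)"
    using goal by blast+
qed

text \<open>An invariant common to all recorded lines. It controls how a line meets a side in which
  it is not contained.\<close>

definition iso_line_of :: "(point \<Rightarrow> real) \<Rightarrow> point set \<Rightarrow> bool" where
  "iso_line_of f e \<longleftrightarrow> (\<exists>w l w' l' i t. isop f w l \<and> isop f w' l' \<and> e = closed_segment (xp f w l) (xp f w' l') \<and>
     xp f w l \<noteq> xp f w' l' \<and> xp f w l \<in> sd i t \<and> xp f w' l' \<in> sd i t)"

lemma iso_line_ofI:
  "isop f w l \<Longrightarrow> isop f w' l' \<Longrightarrow> p = xp f w l \<Longrightarrow> q = xp f w' l' \<Longrightarrow> e = closed_segment p q \<Longrightarrow>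
   p \<noteq> q \<Longrightarrow> p \<in> sd i t \<Longrightarrow> q \<in> sd i t \<Longrightarrow> iso_line_of f e"
  unfolding iso_line_of_def by blast

lemma iso_line_star1:
  assumes st: "star1 f u" and e: "e \<in> star_lines f u"
  shows "iso_line_of f e"
proof -
  obtain j k where jk: "j \<noteq> k" "e = closed_segment (xp f u j) (xp f u k)" using e unfolding star_lines_def by blast
  obtain i where i: "i \<noteq> j" "i \<noteq> k" by (rule third_index)
  have "xp f u j \<in> sd i (u i) \<and> xp f u k \<in> sd i (u i)" using star_pair_side[of f u j k i "u i"] st jk i by blast
  moreover have "xp f u j \<noteq> xp f u k" using star1_inj[OF st jk(1)] .
  ultimately show ?thesis
    using iso_line_ofI[OF star_isop(1)[OF st] star_isop(1)[OF st] star_isop(2)[OF st] star_isop(2)[OF st] jk(2)] by blast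
qed

lemma iso_line_star3:
  assumes st: "star3 f u" and e: "e \<in> star_lines f u"
  shows "iso_line_of f e"
proof -
  obtain j k where jk: "j \<noteq> k" "e = closed_segment (xp f u j) (xp f u k)" using e unfolding star_lines_def by blast
  obtain i where i: "i \<noteq> j" "i \<noteq> k" by (rule third_index)
  have "xp f u j \<in> sd i (u i) \<and> xp f u k \<in> sd i (u i)" using star_pair_side[of f u j k i "u i"] st jk i by blast
  moreover have "xp f u j \<noteq> xp f u k" using star3_inj[OF st jk(1)] .
  ultimately show ?thesis
    using iso_line_ofI[OF star3_isop[OF st] star3_isop[OF st] refl refl jk(2)] by blast
qed

lemma iso_line_bar:
  assumes b: "bar2 f s m" and e: "e \<in> bar_lines f s m"
  shows "iso_line_of f e"
proof -
  have "e \<in> S_polygon c (gr f) (v ` {s, flip m s} \<union> incident_nodes (gr f) (v ` {s, flip m s}))"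
    using e bar_polygon[OF b] by simp
  then obtain p q i t u j w k where e: "e = closed_segment p q" "p \<noteq> q" "p \<in> sd i t" "q \<in> sd i t"
    "p = xp f u j" "mix f u j" "q = xp f w k" "mix f w k"
    unfolding incident_nodes_gr v_image_Un S_polygon_gr mem_Collect_eq by blast
  have "p = xp f (cend f u j) j" "q = xp f (cend f w k) k" using e(5-8) xp_cend by auto
  then show ?thesis by (rule iso_line_ofI[OF mix_isop[OF e(6)] mix_isop[OF e(8)] _ _ e(1-4)])
qed

lemma iso_line_C_rules:
  assumes "e \<in> C_rules c (gr f)"
  shows "iso_line_of f e"
proof -
  obtain p q i t where pq: "e = closed_segment p q" "p \<noteq> q" "ipf f i t = {p, q}" using assms unfolding C_rules_gr mem_Collect_eq by blast
  have p: "p \<in> ipf f i t" "q \<in> ipf f i t" using pq(3) by simp_all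
  obtain w l where w: "p = xp f w l" "isop f w l" using p(1) unfolding ipf_isop by blast
  obtain w' l' where w': "q = xp f w' l'" "isop f w' l'" using p(2) unfolding ipf_isop by blast
  show ?thesis by (rule iso_line_ofI[OF w(2) w'(2) w(1) w'(1) pq(1,2) ipf_side[OF p(1)] ipf_side[OF p(2)]])
qed

lemma iso_line_mono:
  assumes "\<And>w l. isop g w l \<Longrightarrow> isop f w l \<and> xp g w l = xp f w l" "iso_line_of g e"
  shows "iso_line_of f e"
  using assms(2) unfolding iso_line_of_def using assms(1) by metis

text \<open>Lowering labels can create new iso-points only on edges from \<open>X\<close> to
  disperse corners outside \<open>X\<close>. The hypothesis excludes these, so all iso-points were
  present before, at the same places.\<close>

lemma isop_upd0:
  assumes nb: "\<And>w l. w \<in> X \<Longrightarrow> D f (flip l w) \<Longrightarrow> flip l w \<in> X" and i: "isop (upd f X 0) w l"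
  shows "isop f w l \<and> xp (upd f X 0) w l = xp f w l"
proof -
  have fw: "flip l w \<notin> X" "D f (flip l w)" using i by (simp_all add: isop_def D_Z_upd0)
  then have w: "w \<notin> X" using nb by blast
  then have "\<not> D f w" using i by (simp add: isop_def D_Z_upd0)
  then show ?thesis using fw w xp_upd[of w X l f 0] by (simp add: isop_def)
qed

lemma S_step_lines:
  assumes "S_step c r (gr f) J (gr g)"
  shows "(\<forall>e\<in>J. iso_line_of f e) \<and> (\<forall>e. iso_line_of g e \<longrightarrow> iso_line_of f e)"
  using assms
proof (cases rule: S_step_cases)
  case (1 u)
  have g: "g = upd f {u} 0" using 1 by simp
  have "isop g w l \<Longrightarrow> isop f w l \<and> xp g w l = xp f w l" for w l
    unfolding g by (rule isop_upd0) (use 1 in \<open>auto simp: star1_def\<close>)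
  then show ?thesis using iso_line_star1 1 iso_line_mono[of g f] by metis
next
  case (2 u m)
  have g: "g = upd f {u, flip m u} 0" using 2 by simp
  have nb: "flip l w \<in> {u, flip m u}" if "w \<in> {u, flip m u}" "D f (flip l w)" for w l
  proof -
    have "l = m" using that 2 by (auto simp: bar2_def)
    then show ?thesis using that(1) by auto
  qed
  have "isop g w l \<Longrightarrow> isop f w l \<and> xp g w l = xp f w l" for w l
    unfolding g by (rule isop_upd0) (rule nb)
  then show ?thesis using iso_line_bar 2 iso_line_mono[of g f] by metis
next
  case (3 u)
  have g: "g = upd f {u} 1" using 3 by simp
  have "isop f w l \<and> xp g w l = xp f w l" if i: "isop g w l" for w l
  proof -
    have w: "w \<noteq> u" "\<not> D f w" using i c01 by (auto simp: isop_def g D_upd split: if_splits)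
    have nb: "D f (flip l' u)" for l' using 3 by (simp add: star3_def)
    have fw: "flip l w \<noteq> u" using nb[of l] w(2) by auto
    then have "D f (flip l w)" using i by (auto simp: isop_def g D_upd)
    then show ?thesis using w fw xp_upd[of w "{u}" l f 1] by (simp add: isop_def g)
  qed
  then show ?thesis using iso_line_star3 3 iso_line_mono[of g f] by metis
qed

lemma S_steps_lines:
  assumes "S_steps c r n (gr f) \<J> (gr g)" "e \<in> \<Union>(insert (C_rules c (gr g)) \<J>)"
  shows "iso_line_of f e"
  using assms
proof (induction n arbitrary: f \<J>)
  case 0
  then have "gr g = gr f" "\<J> = {}" using S_steps_0 by blast+
  then show ?case using 0 iso_line_C_rules by simp
next
  case (Suc n)
  from Suc.prems(1) obtain J H \<J>' where J: "S_step c r (gr f) J H" "S_steps c r n H \<J>' (gr g)" "\<J> = insert J \<J>'"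
    by (rule S_steps_Suc)
  obtain h where h: "H = gr h" using S_step_ok[OF J(1)] by metis
  have st: "(\<forall>e\<in>J. iso_line_of f e) \<and> (\<forall>e. iso_line_of h e \<longrightarrow> iso_line_of f e)" using S_step_lines J(1) h by blast
  consider "e \<in> J" | "e \<in> \<Union>(insert (C_rules c (gr g)) \<J>')" using Suc.prems(2) J(3) by auto
  then show ?case
  proof cases
    case 1 then show ?thesis using st by blast
  next
    case 2
    have "iso_line_of h e" by (rule Suc.IH[OF _ 2]) (use J(2) h in simp)
    then show ?thesis using st by blast
  qed
qed

lemma regular_lines:
  assumes "inner_iso_paths c \<G> (gr f) \<J>" "regular_graph c \<G> (gr f)" "e \<in> \<Union>\<J>"
  shows "iso_line_of f e"
proof -
  obtain r n \<J>' g where "S_steps c r n (gr f) \<J>' (gr g)" "\<J> = insert (C_rules c (gr g)) \<J>'"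
    using inner_paths_ex[OF assms(1,2)] by blast
  then show ?thesis using S_steps_lines assms(3) by simp
qed

end

subsection \<open>The removal step\<close>

text \<open>The extreme points of a face are the extreme points of the whole set that lie in it;
  this is applied to the common face from both cuboids.\<close>

lemma face_neighbors_nodes:
  assumes "face_neighbors G G'"
  shows "nodes G \<inter> nodes G' = nodes G \<inter> (cuboid_of G \<inter> cuboid_of G')"
proof -
  have 1: "(cuboid_of G \<inter> cuboid_of G') face_of cuboid_of G" "(cuboid_of G \<inter> cuboid_of G') face_of cuboid_of G'"
    using assms facet_of_imp_face_of unfolding face_neighbors_def by blast+
  show ?thesis
  proof (intro subset_antisym subsetI)
    fix P assume "P \<in> nodes G \<inter> nodes G'"
    then show "P \<in> nodes G \<inter> (cuboid_of G \<inter> cuboid_of G')"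
      unfolding nodes_def extreme_point_of_def by simp
  next
    fix P assume "P \<in> nodes G \<inter> (cuboid_of G \<inter> cuboid_of G')"
    then have "P extreme_point_of (cuboid_of G \<inter> cuboid_of G')" "P \<in> nodes G"
      using extreme_point_of_face[OF 1(1)] unfolding nodes_def by auto
    then show "P \<in> nodes G \<inter> nodes G'" using extreme_point_of_face[OF 1(2)] unfolding nodes_def by auto
  qed
qed

context iso_corners
begin

text \<open>An \<open>F\<^sub>2\<close>-graph as seen from one of its two cuboids.\<close>

definition F2i :: "(point \<Rightarrow> real) \<Rightarrow> 3 \<Rightarrow> bool \<Rightarrow> bool" where
  "F2i F l q \<longleftrightarrow> (\<forall>u. if u l = q then Z F u else D F u)"

text \<open>\<open>f\<close> is a labelling after and \<open>F\<close> the one before the removal step; \<open>B\<close> says that the graph is an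
  \<open>F\<^sub>2\<close>-graph.\<close>

definition removed :: "bool \<Rightarrow> (point \<Rightarrow> real) \<Rightarrow> (point \<Rightarrow> real) \<Rightarrow> bool" where
  "removed B F f \<longleftrightarrow> (B \<longrightarrow> (\<forall>s. D f s)) \<and>
    (\<forall>s. f (v s) \<noteq> F (v s) \<longrightarrow> Z F s \<and> f (v s) = 1 \<and> (\<forall>l. D f (flip l s)) \<and>
      ((\<exists>m. (\<forall>l. l \<noteq> m \<longrightarrow> D F (flip l s)) \<and>
          (D F (flip m s) \<or> Z F (flip m s) \<and> (\<forall>l. l \<noteq> m \<longrightarrow> D F (flip l (flip m s))))) \<or>
       B \<and> (\<exists>l q. F2i F l q)))"

lemma T2_gr:
  assumes "T2_subgraph c (gr f) H (v s) Q"
  obtains m where "Q = v (flip m s)" "Z f s" "Z f (flip m s)"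
    "\<And>l. l \<noteq> m \<Longrightarrow> D f (flip l s) \<and> D f (flip l (flip m s))"
proof -
  have T: "incident (gr f) (v s) Q" "label (gr f) (v s) = c" "label (gr f) Q = c"
     "H - {v s, Q} \<subseteq> disperse_nodes c (gr f)" "incident_nodes (gr f) {v s, Q} \<subseteq> H"
    using assms unfolding T2_subgraph_def by blast+
  obtain s' where s': "Q = v s'" using T(1) unfolding incident_def nodes_gr by blast
  then obtain m where m: "s' = flip m s" using T(1) incident_gr by blast
  have Q: "Q = v (flip m s)" using s' m by simp
  have "incident_nodes (gr f) (v ` {s, flip m s}) \<subseteq> v ` {s. D f s}"
  proof
    fix P assume P: "P \<in> incident_nodes (gr f) (v ` {s, flip m s})"
    then have "P \<notin> {v s, Q}" unfolding incident_nodes_def Q by simp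
    moreover have "P \<in> H" using P T(5) unfolding Q by auto
    ultimately show "P \<in> v ` {s. D f s}" using T(4) unfolding disperse_gr by blast
  qed
  then have nb: "\<forall>w\<in>{s, flip m s}. \<forall>l. flip l w \<notin> {s, flip m s} \<longrightarrow> flip l w \<in> {s. D f s}"
    unfolding incident_image_gr .
  have "D f (flip l s) \<and> D f (flip l (flip m s))" if "l \<noteq> m" for l
  proof -
    have "flip l s \<notin> {s, flip m s}" "flip l (flip m s) \<notin> {s, flip m s}"
      using flip_bar[of s s m l] flip_bar[of "flip m s" s m l] that by simp_all
    then show ?thesis using nb by blast
  qed
  moreover have "Z f s" "Z f (flip m s)" using T(2,3) Q by (simp_all add: Z_def)
  ultimately show thesis using that Q by blast
qed

lemma T2_sym: "T2_subgraph c G H P Q \<Longrightarrow> T2_subgraph c G H Q P"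
  unfolding T2_subgraph_def incident_def by (simp add: insert_commute closed_segment_commute)

text \<open>Each label-\<open>c\<close> corner has exactly two neighbours outside \<open>W\<close>,
  hence one inside, so the label-\<open>c\<close> corners form edges all of whose neighbours are
  disperse.\<close>

lemma removed_F1:
  assumes "F1_graph c (gr F)"
  shows "(\<forall>s. Z F s \<or> D F s) \<and> (\<forall>s. Z F s \<longrightarrow> (\<exists>m. Z F (flip m s) \<and> (\<forall>l. l \<noteq> m \<longrightarrow> D F (flip l s) \<and> D F (flip l (flip m s)))))"
proof -
  obtain W where W: "W \<subseteq> nodes (gr F)" "\<forall>P\<in>W. card {Q \<in> nodes (gr F) - W. incident (gr F) P Q} = 2"
    "\<forall>P\<in>W. label (gr F) P = c" "\<forall>P \<in> nodes (gr F) - W. label (gr F) P > c"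
    using assms unfolding F1_graph_def by blast
  have ZD: "v s \<in> W \<longleftrightarrow> Z F s" "v s \<notin> W \<longleftrightarrow> D F s" for s
  proof -
    have "v s \<in> nodes (gr F)" by (simp add: nodes_gr)
    then show "v s \<in> W \<longleftrightarrow> Z F s" "v s \<notin> W \<longleftrightarrow> D F s"
      using W(3)[THEN bspec, of "v s"] W(4)[THEN bspec, of "v s"] by (auto simp: Z_def D_def)
  qed
  have ex: "\<exists>m. Z F (flip m s) \<and> (\<forall>l. l \<noteq> m \<longrightarrow> D F (flip l s))" if "Z F s" for s
  proof -
    have eq: "{Q \<in> nodes (gr F) - W. incident (gr F) (v s) Q} = v ` (\<lambda>l. flip l s) ` {l. D F (flip l s)}"
      unfolding nodes_gr using ZD(2) incident_gr by auto
    have "v s \<in> W" using ZD(1) that by blast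
    then have "card {Q \<in> nodes (gr F) - W. incident (gr F) (v s) Q} = 2" using W(2) by blast
    then have c2': "card ((\<lambda>l. flip l s) ` {l. D F (flip l s)}) = 2" unfolding eq card_v .
    have "card ((\<lambda>l. flip l s) ` {l. D F (flip l s)}) = card {l. D F (flip l s)}"
      by (rule card_image) (simp add: inj_on_def)
    then have c2: "card {l. D F (flip l s)} = 2" using c2' by simp
    have fin: "finite {l. D F (flip l s)}" by (rule finite_subset[of _ UNIV]) auto
    have "card (- {l. D F (flip l s)}) = card (UNIV :: 3 set) - 2"
      using card_Diff_subset[OF fin, of UNIV] c2 by (simp add: Compl_eq_Diff_UNIV)
    then have "card (- {l. D F (flip l s)}) = 1" by simp
    then obtain m where m: "- {l. D F (flip l s)} = {m}" by (auto simp: card_1_singleton_iff)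
    have "l \<in> - {l. D F (flip l s)} \<longleftrightarrow> l = m" for l unfolding m by simp
    then have "D F (flip l s) \<longleftrightarrow> l \<noteq> m" for l by blast
    then show ?thesis using ZD by metis
  qed
  have "\<exists>m. Z F (flip m s) \<and> (\<forall>l. l \<noteq> m \<longrightarrow> D F (flip l s) \<and> D F (flip l (flip m s)))" if Zs: "Z F s" for s
  proof -
    obtain m where m: "Z F (flip m s)" "\<And>l. l \<noteq> m \<Longrightarrow> D F (flip l s)" using ex[OF Zs] by blast
    obtain n where n: "\<And>l. l \<noteq> n \<Longrightarrow> D F (flip l (flip m s))" using ex[OF m(1)] by blast
    have "n = m" using n[of m] Zs by auto
    then show ?thesis using m n by blast
  qed
  then show ?thesis using ZD by blast
qed

lemma F2_gr:
  assumes "F2_graph c \<G> (gr F)"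
  obtains G' l q where "G' \<in> \<G>" "face_neighbors (gr F) G'" "cbox a b \<inter> cuboid_of G' = sd l q" "F2i F l q"
    "\<And>P. P \<in> nodes G' - nodes (gr F) \<Longrightarrow> label G' P > c"
    "\<And>P. P \<in> nodes (gr F) \<inter> nodes G' \<Longrightarrow> label G' P = c"
proof -
  obtain G' where G': "G' \<in> \<G>" "face_neighbors (gr F) G'"
     "\<forall>P \<in> nodes (gr F) \<inter> nodes G'. label (gr F) P = c \<and> label G' P = c"
     "\<forall>P \<in> nodes (gr F) - nodes G'. label (gr F) P > c" "\<forall>P \<in> nodes G' - nodes (gr F). label G' P > c"
    using assms unfolding F2_graph_def by blast
  have "(cbox a b \<inter> cuboid_of G') facet_of cbox a b" using G'(2) unfolding face_neighbors_def by simp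
  then obtain l q where lq: "cbox a b \<inter> cuboid_of G' = sd l q" unfolding facet_iff by blast
  have nd: "nodes (gr F) \<inter> nodes G' = v ` {s. s l = q}"
    using face_neighbors_nodes[OF G'(2)] lq nodes_side by simp
  have "if u l = q then Z F u else D F u" for u
  proof (cases "u l = q")
    case True
    then have "v u \<in> nodes (gr F) \<inter> nodes G'" unfolding nd by blast
    then show ?thesis using G'(3) True by (simp add: Z_def)
  next
    case False
    then have "v u \<notin> nodes (gr F) \<inter> nodes G'" unfolding nd by auto
    moreover have "v u \<in> nodes (gr F)" by (simp add: nodes_gr)
    ultimately have "v u \<in> nodes (gr F) - nodes G'" by blast
    then have "label (gr F) (v u) > c" using G'(4) by blast
    then show ?thesis using False by (simp add: D_def)
  qed
  then have "F2i F l q" by (simp add: F2i_def)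
  then show thesis using that G' lq by blast
qed

lemma removal_gr:
  obtains f where "removal_step c \<G> (gr F) = gr f" "removed (F2_graph c \<G> (gr F)) F f"
proof (cases "F1_graph c (gr F) \<or> F2_graph c \<G> (gr F)")
  case True
  define f where "f = (\<lambda>P. if P \<in> {P \<in> nodes (gr F). label (gr F) P = c} then 1 else F P)"
  have step: "removal_step c \<G> (gr F) = gr f"
    unfolding removal_step_def f_def using True by (auto simp: relabel_gr)
  have fv: "f (v s) = (if Z F s then 1 else F (v s))" for s
    unfolding f_def by (auto simp: Z_def nodes_gr)
  \<comment> \<open>An \<open>F\<^sub>1\<close>- or \<open>F\<^sub>2\<close>-graph has no labels
    below \<open>c\<close>, so raising its label-\<open>c\<close> corners makes it disperse.\<close>
  have ZD: "Z F s \<or> D F s" for s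
  proof (cases "F2_graph c \<G> (gr F)")
    case True
    then obtain l q where "F2i F l q" by (rule F2_gr)
    then show ?thesis unfolding F2i_def by metis
  next
    case False
    then show ?thesis using removed_F1 True by blast
  qed
  have Df: "D f s" for s using ZD[of s] fv[of s] c01 by (auto simp: D_def)
  have "removed (F2_graph c \<G> (gr F)) F f" unfolding removed_def
  proof (intro conjI allI impI)
    fix s assume ch: "f (v s) \<noteq> F (v s)"
    show Zs: "Z F s" using ch fv by metis
    show "f (v s) = 1" using Zs fv by simp
    show "(\<exists>m. (\<forall>l. l \<noteq> m \<longrightarrow> D F (flip l s)) \<and>
          (D F (flip m s) \<or> Z F (flip m s) \<and> (\<forall>l. l \<noteq> m \<longrightarrow> D F (flip l (flip m s))))) \<or>
       F2_graph c \<G> (gr F) \<and> (\<exists>l q. F2i F l q)"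
    proof (cases "F2_graph c \<G> (gr F)")
      case True
      then obtain l q where "F2i F l q" by (rule F2_gr)
      then show ?thesis using True by blast
    next
      case False
      then have "F1_graph c (gr F)" using \<open>F1_graph c (gr F) \<or> _\<close> by blast
      then show ?thesis using removed_F1 Zs by blast
    qed
  qed (rule Df)+
  then show thesis using that step by blast
next
  case False
  define X1 where "X1 = {s. Z F s \<and> (\<forall>l. D F (flip l s))}"
  define f1 where "f1 = upd F X1 1"
  define X2 where "X2 = {s. \<exists>H Q. T2_subgraph c (gr f1) H (v s) Q}"
  define f where "f = upd f1 X2 1"
  have T1: "{P. T1_subgraph c (gr F) P} = v ` X1"
  proof -
    have "T1_subgraph c (gr F) P \<Longrightarrow> P \<in> range v" for P unfolding T1_subgraph_def nodes_gr by blast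
    then show ?thesis unfolding X1_def using T1_gr by blast
  qed
  have T2: "{P. \<exists>H Q. T2_subgraph c (gr f1) H P Q} = v ` X2"
  proof -
    have "T2_subgraph c (gr f1) H P Q \<Longrightarrow> P \<in> range v" for H P Q unfolding T2_subgraph_def nodes_gr by blast
    then show ?thesis unfolding X2_def by blast
  qed
  have r1: "relabel (gr F) (v ` X1) 1 = gr f1" unfolding f1_def upd_def by (rule relabel_gr)
  have r2: "relabel (gr f1) (v ` X2) 1 = gr f" unfolding f_def upd_def by (rule relabel_gr)
  have step: "removal_step c \<G> (gr F) = gr f"
    unfolding removal_step_def Let_def T1 r1 T2 r2 using False by simp
  have Z1: "Z f1 s \<longleftrightarrow> s \<notin> X1 \<and> Z F s" for s using c01 by (simp add: f1_def Z_upd)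
  have D1: "D f1 s \<longleftrightarrow> s \<in> X1 \<or> D F s" for s using c01 by (simp add: f1_def D_upd)
  have Df: "D f s \<longleftrightarrow> s \<in> X2 \<or> D f1 s" for s using c01 by (simp add: f_def D_upd)
  have fv: "f (v s) = (if s \<in> X2 \<or> s \<in> X1 then 1 else F (v s))" for s
    by (simp add: f_def f1_def upd_v)
  \<comment> \<open>A corner relabelled for a \<open>T\<^sub>1\<close>-subgraph had only disperse
    neighbours, so it is not adjacent to a label-\<open>c\<close> corner. Disperse neighbours of
    such corners were therefore disperse from the start.\<close>
  have DF: "D F s" if "D f1 s" "Z F (flip l s)" for s l
    using that D1 X1_def by (metis (mono_tags, lifting) Z_not_D mem_Collect_eq)
  have "removed (F2_graph c \<G> (gr F)) F f" unfolding removed_def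
  proof (intro conjI allI impI)
    fix s assume "F2_graph c \<G> (gr F)" then show "D f s" using False by blast
  next
    fix s assume ch: "f (v s) \<noteq> F (v s)"
    then have s12: "s \<in> X2 \<or> s \<in> X1" using fv by metis
    show "f (v s) = 1" using s12 fv by simp
    show "Z F s" using s12
    proof
      assume "s \<in> X2"
      then obtain H Q where "T2_subgraph c (gr f1) H (v s) Q" unfolding X2_def by blast
      then have "Z f1 s" by (rule T2_gr)
      then show ?thesis using Z1 by blast
    qed (simp add: X1_def)
    have both: "(\<forall>l. D f (flip l s)) \<and> (\<exists>m. (\<forall>l. l \<noteq> m \<longrightarrow> D F (flip l s)) \<and>
          (D F (flip m s) \<or> Z F (flip m s) \<and> (\<forall>l. l \<noteq> m \<longrightarrow> D F (flip l (flip m s)))))"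
      using s12
    proof
      assume "s \<in> X1"
      then have "\<And>l. D F (flip l s)" by (simp add: X1_def)
      then show ?thesis using Df D1 by blast
    next
      assume "s \<in> X2"
      then obtain H Q where T: "T2_subgraph c (gr f1) H (v s) Q" unfolding X2_def by blast
      then obtain m where m: "Q = v (flip m s)" "Z f1 s" "Z f1 (flip m s)"
        and nb: "\<And>l. l \<noteq> m \<Longrightarrow> D f1 (flip l s) \<and> D f1 (flip l (flip m s))" by (rule T2_gr) blast
      have "flip m s \<in> X2" using T2_sym[OF T] m(1) unfolding X2_def by blast
      then have 1: "D f (flip l s)" for l using nb Df by (cases "l = m") auto
      have "D F (flip l s) \<and> D F (flip l (flip m s))" if "l \<noteq> m" for l
      proof -
        have "Z F s" "Z F (flip m s)" using m Z1 by blast+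
        then show ?thesis using nb[OF that] DF[of "flip l s" l] DF[of "flip l (flip m s)" l] by simp
      qed
      then show ?thesis using 1 m Z1 by blast
    qed
    show "D f (flip l s)" for l using both by blast
    show "(\<exists>m. (\<forall>l. l \<noteq> m \<longrightarrow> D F (flip l s)) \<and>
          (D F (flip m s) \<or> Z F (flip m s) \<and> (\<forall>l. l \<noteq> m \<longrightarrow> D F (flip l (flip m s))))) \<or>
       F2_graph c \<G> (gr F) \<and> (\<exists>l q. F2i F l q)" using both by blast
  qed
  then show thesis using that step by blast
qed

section \<open>Labels and lines before and after the removal step\<close>

lemma removedD:
  assumes "removed B F f" "f (v s) \<noteq> F (v s)"
  shows "Z F s" "f (v s) = 1" "D f s" "D f (flip l s)"
  using assms c01 unfolding removed_def by (auto simp: D_def)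

lemma removed_D: "removed B F f \<Longrightarrow> D F s \<Longrightarrow> f (v s) = F (v s)"
  using removedD(1)[of B F f s] Z_not_D by blast

lemma removed_D_mono: "removed B F f \<Longrightarrow> D F s \<Longrightarrow> D f s"
  using removed_D[of B F f s] by (simp add: D_def)

lemma removed_cont: "removed B F f \<Longrightarrow> \<not> D f s \<Longrightarrow> f (v s) = F (v s)"
  using removedD(3)[of B F f s] by blast

text \<open>Raising \<open>s\<close> leaves the opposite corner as the only continuous one, and the
  \<open>C\<close>-rules cut it off. \<open>W2\<close> consists of the same line, because the
  label-\<open>c\<close> corner \<open>s\<close> contributes nothing to it.\<close>

lemma ncl_face_minus_one:
  assumes ijk: "i \<noteq> j" "i \<noteq> k" "j \<noteq> k" and r: "removed B F f" and ch: "f (v s) \<noteq> F (v s)"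
    and D: "D F (flip j s)" "D F (flip k s)" and N: "F (v (flip j (flip k s))) < c"
  shows "ncl f i (s i) = W2 F i (s i)" "\<not> Lf f i (s i)"
proof -
  let ?w = "flip j (flip k s)"
  have fs: "flip k (flip j s) = ?w" by (rule flip_commute)
  have kw: "flip k ?w = flip j s" by (simp add: flip_commute[of k j])
  have nw: "\<not> D F ?w" "\<not> Z F ?w" using N by (simp_all add: D_def Z_def)
  have Zs: "Z F s" "D f s" using removedD[OF r ch] by auto
  have Df: "D f (flip j s)" "D f (flip k s)" using removed_D_mono[OF r] D by auto
  have fw: "f (v ?w) = F (v ?w)" using removedD(1)[OF r, of ?w] nw(2) by blast
  have nfw: "\<not> D f ?w" using fw nw by (simp add: D_def)
  show L: "\<not> Lf f i (s i)" unfolding Lf_eq[OF ijk] using Zs Df by simp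
  have x: "xp f (flip j s) k = xp F ?w k" "xp f (flip k s) j = xp F ?w j"
  proof -
    have "xp f (flip j s) k = xp F (flip j s) k"
      by (rule xp_cong) (use removed_D[OF r D(1)] fw fs in simp_all)
    then show "xp f (flip j s) k = xp F ?w k" using xp_flip[of F "flip j s" k] D nw fs by simp
    have "xp f (flip k s) j = xp F (flip k s) j"
      by (rule xp_cong) (use removed_D[OF r D(2)] fw in simp_all)
    then show "xp f (flip k s) j = xp F ?w j" using xp_flip[of F "flip k s" j] D nw by simp
  qed
  have ip: "ipf f i (s i) = {xp F ?w k, xp F ?w j}"
    unfolding ipf_eq[OF ijk] using Zs Df nfw fs x by (simp add: insert_commute)
  have is2: "isop F ?w k" "isop F ?w j" using D nw kw by (simp_all add: isop_def)
  have ne: "xp F ?w k \<noteq> xp F ?w j" using isop_eq_iff[OF is2] ijk nw by simp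
  have "\<not> edgeline (closed_segment (xp F ?w k) (xp F ?w j))" by (rule isop_not_edgeline[OF is2]) simp
  then have n: "ncl f i (s i) = {closed_segment (xp F ?w k) (xp F ?w j)}" using ncl_pair[OF ip ne L] by simp
  have "\<not> F (v s) < c" "\<not> F (v (flip j s)) < c" "\<not> F (v (flip k s)) < c" using Zs D by (simp_all add: Z_def D_def)
  then have "W2 F i (s i) = {closed_segment (xp F ?w j) (xp F ?w k)}" unfolding cuts_eq4[OF ijk] using N by simp
  then show "ncl f i (s i) = W2 F i (s i)" using n by (simp add: closed_segment_commute)
qed

text \<open>The neighbours of a relabelled corner are disperse, so a line on the side can only cut
  off the opposite corner. That corner has kept its label below \<open>c\<close>, and its neighbours
  on the side have kept theirs; so the side was a non-trivial L-face and now shows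
  \<open>W2\<close>.\<close>

lemma face_line_origin:
  assumes r: "removed B F f" and res: "resolved f \<J>" and e: "e \<in> fl \<J> i t"
  shows "(\<forall>s. s i = t \<longrightarrow> f (v s) = F (v s)) \<or> Lf F i t \<and> \<not> tri F i t \<and> fl \<J> i t = W2 F i t"
proof (rule disjCI)
  assume "\<not> (Lf F i t \<and> \<not> tri F i t \<and> fl \<J> i t = W2 F i t)"
  show "\<forall>s. s i = t \<longrightarrow> f (v s) = F (v s)"
  proof (rule ccontr)
    assume "\<not> (\<forall>s. s i = t \<longrightarrow> f (v s) = F (v s))"
    then obtain s where s: "s i = t" "f (v s) \<noteq> F (v s)" by blast
    obtain j k where ijk: "i \<noteq> j" "i \<noteq> k" "j \<noteq> k" by (rule index_others)
    let ?w = "flip j (flip k s)"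
    have fs: "flip k (flip j s) = ?w" by (rule flip_commute)
    have kw: "flip k ?w = flip j s" by (simp add: flip_commute[of k j])
    note ch = removedD[OF r s(2)]
    have L: "\<not> Lf f i (s i)" unfolding Lf_eq[OF ijk] using ch(3) ch(4)[of j] by simp
    have eq: "fl \<J> i t = ncl f i t" using res L s(1) unfolding resolved_def by auto
    have ip: "ipf f i (s i) = (if D f ?w then {} else {xp f ?w k, xp f ?w j})"
      unfolding ipf_eq[OF ijk] using ch(3) ch(4)[of j] ch(4)[of k] fs xp_flip[of f "flip j s" k] xp_flip[of f "flip k s" j]
      by (simp add: insert_commute)
    have nw: "\<not> D f ?w"
    proof
      assume "D f ?w"
      then have "ncl f i (s i) = {}" using ip by (intro ncl_sub1) simp
      then show False using e eq s(1) by simp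
    qed
    have nZ: "\<not> Z f ?w"
    proof
      assume "Z f ?w"
      then have "ncl f i (s i) = {}" using ip nw by (intro ncl_sub1[of _ _ _ "v ?w"]) (simp add: xp_Z)
      then show False using e eq s(1) by simp
    qed
    have "f (v ?w) = F (v ?w)" using removed_cont[OF r nw] .
    then have N: "F (v ?w) < c" using nw nZ by (simp add: D_def Z_def)
    have un: "f (v (flip j s)) = F (v (flip j s))" "f (v (flip k s)) = F (v (flip k s))"
      using removedD(4)[OF r, of "flip j s" k] removedD(4)[OF r, of "flip k s" j] nw fs by auto
    have D: "D F (flip j s)" "D F (flip k s)" using un ch(4)[of j] ch(4)[of k] by (simp_all add: D_def)
    have "Lf F i (s i)" unfolding Lf_eq[OF ijk] using ch(1) D N Z_not_D[of F s] by (auto simp: D_def)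
    moreover have "\<not> tri F i (s i)"
    proof
      assume "tri F i (s i)"
      moreover have "?w i = s i" using ijk by simp
      moreover have "\<not> D F ?w" using N by (simp add: D_def)
      ultimately have "Z F ?w" unfolding tri_def by blast
      then show False using N by (simp add: Z_def)
    qed
    moreover have "fl \<J> i t = W2 F i t" using ncl_face_minus_one(1)[OF ijk r s(2) D N] eq s(1) by simp
    ultimately show False using \<open>\<not> (Lf F i t \<and> _)\<close> s(1) by blast
  qed
qed

text \<open>A relabelled corner forces \<open>W2\<close>. Conversely, a graph that does not show
  \<open>W2\<close> has its original labels on the side, which decides later to which graph the
  outer iso-path is attributed.\<close>

lemma nontrivial_face_lines:
  assumes r: "removed B F f" and res: "resolved f \<J>" and L: "Lf F i t" "\<not> tri F i t"
  shows "fl \<J> i t = W2 F i t \<or> fl \<J> i t = W1 F i t \<and> (\<forall>s. s i = t \<longrightarrow> f (v s) = F (v s))"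
proof (cases "\<forall>s. s i = t \<longrightarrow> f (v s) = F (v s)")
  case True
  have eq: "f (v s) = F (v s)" if "s i = t" for s using True that by blast
  have LL: "Lf f i t = Lf F i t" by (rule Lf_cong) (rule eq)
  have W: "W1 f i t = W1 F i t" by (rule cuts_cong) (use eq in \<open>auto simp: D_def\<close>)
  have W': "W2 f i t = W2 F i t" by (rule cuts_cong) (use eq in auto)
  have "if Lf f i t then fl \<J> i t = W1 f i t \<or> fl \<J> i t = W2 f i t else fl \<J> i t = ncl f i t"
    using res unfolding resolved_def by blast
  then have "fl \<J> i t = W1 F i t \<or> fl \<J> i t = W2 F i t" using L(1) unfolding LL W W' by simp
  then show ?thesis using True by blast
next
  case False
  then obtain s where s: "s i = t" "f (v s) \<noteq> F (v s)" by blast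
  obtain j k where ijk: "i \<noteq> j" "i \<noteq> k" "j \<noteq> k" by (rule index_others)
  let ?w = "flip j (flip k s)"
  have Zs: "Z F s" using removedD[OF r s(2)] by blast
  have D: "\<not> D F ?w" "D F (flip j s)" "D F (flip k s)"
    using L(1) Zs Z_not_D[of F s] unfolding s(1)[symmetric] Lf_eq[OF ijk] by auto
  have "\<not> Z F ?w"
  proof
    assume Zw: "Z F ?w"
    have "Z F u" if "u i = t" "\<not> D F u" for u
    proof -
      have "u \<in> {s, flip j s, flip k s, ?w}" using face_indices[OF ijk, of s] that s(1) by blast
      then show ?thesis using that(2) Zs Zw D by auto
    qed
    then show False using L by (auto simp: tri_def)
  qed
  then have N: "F (v ?w) < c" using D(1) by (simp add: D_def Z_def)
  note one = ncl_face_minus_one[OF ijk r s(2) D(2,3) N]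
  have "fl \<J> i t = ncl f i t" using res one(2) s(1) unfolding resolved_def by auto
  then show ?thesis using one(1) s(1) by simp
qed

lemma ncl_empty_adjacent_Z:
  assumes ijk: "i \<noteq> j" "i \<noteq> k" "j \<noteq> k" and "Z F s" "Z F (flip j s)" "D F (flip k s)" "D F (flip j (flip k s))"
  shows "ncl F i (s i) = {}"
proof -
  have fs: "flip k (flip j s) = flip j (flip k s)" by (rule flip_commute)
  have nD: "\<not> D F s" "\<not> D F (flip j s)" using assms by simp_all
  have ip: "ipf F i (s i) = {v s, v (flip j s)}"
    unfolding ipf_eq[OF ijk] using assms(4-7) nD fs by (simp add: xp_Z insert_commute)
  have L: "\<not> Lf F i (s i)" unfolding Lf_eq[OF ijk] using nD assms by simp
  have "edgeline (closed_segment (v s) (v (flip j s)))" unfolding edgeline_def by blast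
  then show ?thesis using ncl_pair[OF ip _ L] by simp
qed

text \<open>A relabelled corner would restrict the iso-points on the side to this corner, or to the
  ends of a label-\<open>c\<close> edge, or leave none; in no case is there a line off the
  edges.\<close>

lemma regular_face_unchanged:
  assumes r: "removed B F f" and L: "\<not> Lf F i t" and e: "e \<in> ncl F i t" and s: "s i = t"
  shows "f (v s) = F (v s)"
proof (rule ccontr)
  assume ch: "f (v s) \<noteq> F (v s)"
  obtain j k where ijk: "i \<noteq> j" "i \<noteq> k" "j \<noteq> k" by (rule index_others)
  have ikj: "i \<noteq> k" "i \<noteq> j" "k \<noteq> j" using ijk by auto
  have fs: "flip k (flip j s) = flip j (flip k s)" by (rule flip_commute)
  have Zs: "Z F s" "\<not> D F s" using removedD(1)[OF r ch] by auto
  have ne: "ncl F i (s i) \<noteq> {}" using e s by auto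
  have jk: "\<not> (D F (flip j s) \<and> D F (flip k s))"
  proof
    assume D: "D F (flip j s) \<and> D F (flip k s)"
    have "D F (flip j (flip k s))" using L Zs D unfolding s[symmetric] Lf_eq[OF ijk] by auto
    then have "ipf F i (s i) = {v s}" unfolding ipf_eq[OF ijk] using Zs D fs by (simp add: xp_Z)
    then show False using ne ncl_sub1[of F i "s i" "v s"] by simp
  qed
  have a1: "ncl F i (s i) = {}" if "Z F (flip j s)" "D F (flip k s)" "D F (flip k (flip j s))"
    by (rule ncl_empty_adjacent_Z[OF ijk Zs(1)]) (use that fs in simp_all)
  have a2: "ncl F i (s i) = {}" if "Z F (flip k s)" "D F (flip j s)" "D F (flip j (flip k s))"
    by (rule ncl_empty_adjacent_Z[OF ikj Zs(1)]) (use that fs in simp_all)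
  have "(\<exists>m. (\<forall>l. l \<noteq> m \<longrightarrow> D F (flip l s)) \<and>
          (D F (flip m s) \<or> Z F (flip m s) \<and> (\<forall>l. l \<noteq> m \<longrightarrow> D F (flip l (flip m s))))) \<or> (\<exists>l q. F2i F l q)"
    using r ch unfolding removed_def by blast
  then show False
  proof
    assume "\<exists>m. (\<forall>l. l \<noteq> m \<longrightarrow> D F (flip l s)) \<and>
          (D F (flip m s) \<or> Z F (flip m s) \<and> (\<forall>l. l \<noteq> m \<longrightarrow> D F (flip l (flip m s))))"
    then obtain m where m: "\<And>l. l \<noteq> m \<Longrightarrow> D F (flip l s)"
      "D F (flip m s) \<or> Z F (flip m s) \<and> (\<forall>l. l \<noteq> m \<longrightarrow> D F (flip l (flip m s)))" by blast
    consider "m = i" | "m = j" | "m = k" using index_cases[OF ijk] by blast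
    then show False
    proof cases
      case 1 then show ?thesis using m(1)[of j] m(1)[of k] jk ijk by auto
    next
      case 2
      then have Dk: "D F (flip k s)" using m(1)[of k] ijk by auto
      then have "Z F (flip j s)" "D F (flip k (flip j s))" using m(2) jk 2 ijk by auto
      then show ?thesis using a1 Dk ne by blast
    next
      case 3
      then have Dj: "D F (flip j s)" using m(1)[of j] ijk by auto
      then have "Z F (flip k s)" "D F (flip j (flip k s))" using m(2) jk 3 ijk by auto
      then show ?thesis using a2 Dj ne by blast
    qed
  next
    assume "\<exists>l q. F2i F l q"
    then obtain l q where F2: "\<And>u. if u l = q then Z F u else D F u" unfolding F2i_def by blast
    have sl: "s l = q" using F2[of s] Zs by (auto split: if_splits)
    consider "l = i" | "l = j" | "l = k" using index_cases[OF ijk] by blast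
    then show False
    proof cases
      case 1
      have "Z F u" if "u i = s i" for u using F2[of u] that sl 1 by simp
      then have "\<not> D F s" "\<not> D F (flip j s)" "\<not> D F (flip k s)" "\<not> D F (flip j (flip k s))" using ijk by simp_all
      then have "ipf F i (s i) = {}" unfolding ipf_eq[OF ijk] using fs by simp
      then show False using ne ncl_sub1[of F i "s i" "v s"] by simp
    next
      case 2
      then have "D F (flip j s)" "Z F (flip k s)" "D F (flip j (flip k s))"
        using F2[of "flip j s"] F2[of "flip k s"] F2[of "flip j (flip k s)"] sl ijk by simp_all
      then show False using a2 ne by blast
    next
      case 3
      then have "D F (flip k s)" "Z F (flip j s)" "D F (flip k (flip j s))"
        using F2[of "flip k s"] F2[of "flip j s"] F2[of "flip k (flip j s)"] sl ijk by simp_all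
      then show False using a1 ne by blast
    qed
  qed
qed

text \<open>Since the other end has label \<open>c\<close> too, an end could be relabelled only if
  all neighbours of the edge were disperse, against the face in direction \<open>k\<close>.\<close>

lemma edge_survives:
  assumes r: "removed B F f" and nB: "\<not> B" and Zs: "Z F s" "Z F (flip m s)"
    and one: "D F (flip j s)" "D F (flip m (flip j s))" "j \<noteq> m"
    and not: "\<not> (D F (flip k s) \<and> D F (flip m (flip k s)))" "k \<noteq> m"
  shows "EL f s m" "D f s \<or> D f (flip j s)"
proof -
  have km: "flip k (flip m s) = flip m (flip k s)" by (rule flip_commute)
  have un: "f (v u) = F (v u)" if u: "u = s \<or> u = flip m s" for u
  proof (rule ccontr)
    assume "f (v u) \<noteq> F (v u)"
    then obtain n where n: "\<And>l. l \<noteq> n \<Longrightarrow> D F (flip l u)"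
      "D F (flip n u) \<or> Z F (flip n u) \<and> (\<forall>l. l \<noteq> n \<longrightarrow> D F (flip l (flip n u)))"
      using r nB unfolding removed_def by blast
    have "Z F (flip m u)" using u Zs by auto
    then have nm: "n = m" using n(1)[of m] by auto
    then have "D F (flip k u) \<and> D F (flip k (flip m u))"
      using n(1)[of k] n(2) \<open>Z F (flip m u)\<close> not(2) by auto
    then show False using u not(1) km by auto
  qed
  have "Z f s" "Z f (flip m s)" using un[of s] un[of "flip m s"] Zs by (simp_all add: Z_def)
  moreover have "D f (flip j s)" "D f (flip m (flip j s))" using removed_D_mono[OF r] one by auto
  ultimately show "EL f s m" "D f s \<or> D f (flip j s)" unfolding EL_def using one(3) by blast+
qed

text \<open>All neighbours of a relabelled corner are disperse, so neither the ends of the edge nor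
  their neighbours can have been relabelled.\<close>

lemma edge_origin:
  assumes r: "removed B F f" and E: "EL f s m"
  shows "\<not> B" "Z F s" "Z F (flip m s)"
    "j \<noteq> m \<Longrightarrow> D f (flip j s) \<longleftrightarrow> D F (flip j s)" "j \<noteq> m \<Longrightarrow> D f (flip m (flip j s)) \<longleftrightarrow> D F (flip m (flip j s))"
proof -
  have Zf: "Z f s" "Z f (flip m s)" using E by (simp_all add: EL_def)
  have nD: "\<not> D f s" "\<not> D f (flip m s)" using Zf by simp_all
  show "\<not> B" using r nD unfolding removed_def by blast
  show "Z F s" "Z F (flip m s)" using removed_cont[OF r nD(1)] removed_cont[OF r nD(2)] Zf by (simp_all add: Z_def)
  have "f (v (flip j s)) = F (v (flip j s))" for j using removedD(4)[OF r, of "flip j s" j] nD by auto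
  then show "D f (flip j s) \<longleftrightarrow> D F (flip j s)" by (simp add: D_def)
  have "flip j (flip m (flip j s)) = flip m s" for j by (simp add: flip_commute[of j m])
  then have "f (v (flip m (flip j s))) = F (v (flip m (flip j s)))" for j
    using removedD(4)[OF r, of "flip m (flip j s)" j] nD by metis
  then show "D f (flip m (flip j s)) \<longleftrightarrow> D F (flip m (flip j s))" by (simp add: D_def)
qed

end

subsection \<open>Neighbouring cuboids\<close>

lemma side_nth: "x \<in> side a b i t \<Longrightarrow> x $ i = (if t then b $ i else a $ i)"
  by (simp add: side_def)

lemma side_in_box: "x \<in> side a b i t \<Longrightarrow> x \<in> cbox a b"
  by (simp add: side_def)

text \<open>Only coordinate \<open>i\<close> is constant on the side.\<close>

lemma side_transfer_index:
  assumes "corners a b" "corners a' b'" and eq: "side a b i t = side a' b' i' t'"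
  shows "i' = i"
proof (rule ccontr)
  interpret A: corners a b by fact
  assume ne: "i' \<noteq> i"
  let ?s = "\<lambda>_::3. t"
  have "corner a b ?s \<in> side a b i t" "corner a b (flip i' ?s) \<in> side a b i t" using ne by simp_all
  note this[THEN subsetD[OF equalityD1[OF eq]], THEN side_nth]
  then have "corner a b ?s $ i' = corner a b (flip i' ?s) $ i'" by (rule trans[OF _ sym])
  then show False using A.box[of i'] by (simp split: if_splits)
qed

lemma side_transfer_bounds:
  assumes "corners a b" and eq: "side a b i t = side a' b' i t'" and l: "l \<noteq> i"
  shows "a' $ l \<le> a $ l" "b $ l \<le> b' $ l"
proof -
  interpret A: corners a b by fact
  have "corner a b ((\<lambda>_. q)(i := t)) \<in> side a b i t" for q by simp
  then have in': "corner a b ((\<lambda>_. q)(i := t)) \<in> cbox a' b'" for q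
    using subsetD[OF equalityD1[OF eq]] side_in_box by blast
  show "a' $ l \<le> a $ l" using in'[of False] l unfolding mem_box_cart by (auto dest!: spec[of _ l])
  show "b $ l \<le> b' $ l" using in'[of True] l unfolding mem_box_cart by (auto dest!: spec[of _ l])
qed

lemma side_transfer_corner:
  assumes A: "corners a b" and B: "corners a' b'" and eq: "side a b i t = side a' b' i t'" and s: "s i = t"
  shows "corner a b s = corner a' b' (s(i := t'))"
proof -
  interpret A: corners a b by fact
  interpret B: corners a' b' by fact
  have "corner a b s $ l = corner a' b' (s(i := t')) $ l" for l
  proof (cases "l = i")
    case True
    have "corner a b s \<in> side a b i t" using s by simp
    from side_nth[OF subsetD[OF equalityD1[OF eq] this]] show ?thesis using True by simp
  next
    case False
    have "a' $ l = a $ l" "b' $ l = b $ l"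
      using side_transfer_bounds[OF A eq False] side_transfer_bounds[OF B eq[symmetric] False] by simp_all
    then show ?thesis using False by simp
  qed
  then show ?thesis by (simp add: vec_eq_iff)
qed

text \<open>The finitely many cuboids that miss \<open>p\<close> are closed and avoid a
  neighbourhood of \<open>p\<close>, so a short step in any direction ends in a cuboid that contains
  \<open>p\<close> as well.\<close>

lemma direction_cuboid:
  fixes p d :: point
  assumes fin: "finite \<T>" and cl: "\<And>C. C \<in> \<T> \<Longrightarrow> closed C" and op: "open \<Omega>" "p \<in> \<Omega>" "\<Omega> \<subseteq> \<Union>\<T>"
  obtains C e where "C \<in> \<T>" "p \<in> C" "e > 0" "p + e *\<^sub>R d \<in> C"
proof -
  define U where "U = \<Omega> \<inter> (\<Inter>C\<in>{C \<in> \<T>. p \<notin> C}. - C)"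
  have "open U" unfolding U_def using fin cl op by (intro open_Int open_INT) (auto simp: open_Compl)
  moreover have "p \<in> U" unfolding U_def using op by auto
  ultimately obtain r where r: "r > 0" "ball p r \<subseteq> U" by (meson openE)
  \<comment> \<open>The summand 1 keeps the divisor positive even if \<open>d\<close> is
    zero.\<close>
  define N where "N = norm d + 1"
  define e where "e = r / (2 * N)"
  have nd: "N > 0" using norm_ge_zero[of d] unfolding N_def by linarith
  then have e: "e > 0" using r(1) by (simp add: e_def)
  have "e * norm d \<le> e * N" using e by (simp add: N_def)
  also have "\<dots> = r / 2" unfolding e_def using nd by simp
  also have "\<dots> < r" using r(1) by simp
  finally have "p + e *\<^sub>R d \<in> ball p r" using e by (simp add: dist_norm)
  then have x: "p + e *\<^sub>R d \<in> U" using r(2) by blast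
  then obtain C where C: "C \<in> \<T>" "p + e *\<^sub>R d \<in> C" using op(3) unfolding U_def by blast
  then have "p \<in> C" using x unfolding U_def by blast
  then show thesis using that[OF C(1) _ e C(2)] by blast
qed

section \<open>Relative position of cuboids in the partition\<close>

lemma partition_cases:
  assumes "cuboid_partition \<Omega> \<T>" "C \<in> \<T>" "C' \<in> \<T>" "C \<noteq> C'" "x \<in> C" "x \<in> C'"
  shows "(C \<inter> C') facet_of C \<and> (C \<inter> C') facet_of C' \<or> (C \<inter> C') edge_of C \<and> (C \<inter> C') edge_of C' \<or>
    (\<exists>P. C \<inter> C' = {P} \<and> P extreme_point_of C \<and> P extreme_point_of C')"
  using assms unfolding cuboid_partition_def by blast

lemma partition_corners:
  assumes "cuboid_partition \<Omega> \<T>" "C \<in> \<T>"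
  obtains a b where "corners a b" "C = cbox a b"
proof -
  have "cuboid C" using assms by (simp add: cuboid_partition_def)
  then obtain a b where "\<forall>i. a $ i < b $ i" "C = cbox a b" unfolding cuboid_def by metis
  then show thesis by (intro that[of a b]) (simp_all add: corners_def)
qed

lemma (in corners) edge_in_sides:
  obtains i j where "i \<noteq> j" "i \<noteq> k" "j \<noteq> k" "closed_segment (v s) (v (flip k s)) = sd i (s i) \<inter> sd j (s j)"
proof -
  obtain i where i: "i \<noteq> k" by (rule third_index)
  obtain j where j: "j \<noteq> i" "j \<noteq> k" by (rule third_index)
  show thesis by (rule that[of i j]) (use i j edge_eq_sides[of i j k s] in auto)
qed

text \<open>An edge lies in sides of two directions and a corner in sides of three, so a point that
  lies on sides of one direction only leaves the facet case.\<close>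

lemma (in corners) partition_facet:
  assumes part: "cuboid_partition \<Omega> \<T>" and C: "cbox a b \<in> \<T>" "C' \<in> \<T>" "cbox a b \<noteq> C'"
    and x: "x \<in> cbox a b" "x \<in> C'" and only: "\<And>l q. x \<in> sd l q \<Longrightarrow> l = i"
    and side: "x \<in> sd i t"
  shows "cbox a b \<inter> C' = sd i t" "(cbox a b \<inter> C') facet_of C'"
proof -
  have "(cbox a b \<inter> C') facet_of cbox a b \<and> (cbox a b \<inter> C') facet_of C'"
    using partition_cases[OF part C x]
  proof (elim disjE)
    assume "(cbox a b \<inter> C') edge_of cbox a b \<and> (cbox a b \<inter> C') edge_of C'"
    then obtain s k where sk: "cbox a b \<inter> C' = closed_segment (v s) (v (flip k s))" using edge_iff by blast
    obtain l n where ln: "l \<noteq> n" "closed_segment (v s) (v (flip k s)) = sd l (s l) \<inter> sd n (s n)" using edge_in_sides by metis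
    have "x \<in> cbox a b \<inter> C'" using x by blast
    then have "x \<in> sd l (s l)" "x \<in> sd n (s n)" unfolding sk ln(2) by blast+
    then show ?thesis using only ln(1) by metis
  next
    assume "\<exists>P. cbox a b \<inter> C' = {P} \<and> P extreme_point_of cbox a b \<and> P extreme_point_of C'"
    then obtain P where "cbox a b \<inter> C' = {P}" "P \<in> range v" using extreme_iff by blast
    then obtain s where "x = v s" using x by blast
    then have "x \<in> sd l (s l)" for l by simp
    then have "l = i" for l using only by blast
    moreover obtain l where "l \<noteq> i" using third_index by blast
    ultimately show ?thesis by blast
  qed
  moreover then obtain l q where lq: "cbox a b \<inter> C' = sd l q" using facet_iff by blast
  moreover have "l = i \<and> q = t"
  proof -
    have "x \<in> sd l q" using x lq by blast
    then have "l = i" using only by blast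
    then show ?thesis using \<open>x \<in> sd l q\<close> side box[of i] by (auto simp: side_def split: if_splits)
  qed
  ultimately show "cbox a b \<inter> C' = sd i t" "(cbox a b \<inter> C') facet_of C'" by auto
qed

lemma (in corners) partition_no_interior:
  assumes part: "cuboid_partition \<Omega> \<T>" and C: "cbox a b \<in> \<T>" "C' \<in> \<T>" "cbox a b \<noteq> C'"
    and x: "x \<in> cbox a b" "x \<in> C'"
  shows "\<exists>l q. x \<in> sd l q"
proof -
  have xx: "x \<in> cbox a b \<inter> C'" using x by blast
  show ?thesis using partition_cases[OF part C x]
  proof (elim disjE)
    assume "(cbox a b \<inter> C') facet_of cbox a b \<and> (cbox a b \<inter> C') facet_of C'"
    then show ?thesis using xx facet_iff by blast
  next
    assume "(cbox a b \<inter> C') edge_of cbox a b \<and> (cbox a b \<inter> C') edge_of C'"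
    then obtain s k where sk: "cbox a b \<inter> C' = closed_segment (v s) (v (flip k s))" using edge_iff by blast
    obtain l n where ln: "closed_segment (v s) (v (flip k s)) = sd l (s l) \<inter> sd n (s n)" using edge_in_sides by metis
    then show ?thesis using xx unfolding sk ln by blast
  next
    assume "\<exists>P. cbox a b \<inter> C' = {P} \<and> P extreme_point_of cbox a b \<and> P extreme_point_of C'"
    then obtain P where "cbox a b \<inter> C' = {P}" "P \<in> range v" using extreme_iff by blast
    then obtain s where "x = v s" using x by blast
    then have "x \<in> sd l (s l)" for l by simp
    then show ?thesis by blast
  qed
qed

lemma partition_cover:
  assumes part: "cuboid_partition \<Omega> \<T>" and "open \<Omega>" "p \<in> \<Omega>"
  obtains C e where "C \<in> \<T>" "p \<in> C" "e > 0" "p + e *\<^sub>R d \<in> C"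
proof -
  have fin: "finite \<T>" and un: "\<Union>\<T> = closure \<Omega>" using part unfolding cuboid_partition_def by simp_all
  have cl: "closed C" if C: "C \<in> \<T>" for C
  proof -
    obtain a b where "C = cbox a b" using partition_corners[OF part C] by metis
    then show ?thesis using compact_imp_closed[OF compact_cbox] by metis
  qed
  have sub: "\<Omega> \<subseteq> \<Union>\<T>" unfolding un by (rule closure_subset)
  show thesis by (rule direction_cuboid[OF fin cl assms(2,3) sub]) (use that in blast)+
qed

text \<open>A short step from \<open>p\<close> across the side leaves the box and ends in another
  cuboid through \<open>p\<close>; as \<open>p\<close> is interior to the side, the two share this
  facet.\<close>

lemma (in corners) face_neighbor_exists:
  assumes part: "cuboid_partition \<Omega> \<T>" and op: "open \<Omega>" "p \<in> \<Omega>" and C: "cbox a b \<in> \<T>"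
    and side: "p \<in> sd i t" and int: "\<And>l. l \<noteq> i \<Longrightarrow> a $ l < p $ l \<and> p $ l < b $ l"
  obtains C' where "C' \<in> \<T>" "C' \<noteq> cbox a b" "cbox a b \<inter> C' = sd i t" "(cbox a b \<inter> C') facet_of C'"
proof -
  define d :: point where "d = axis i (if t then 1 else - 1)"
  obtain C' e where C': "C' \<in> \<T>" "p \<in> C'" "e > 0" "p + e *\<^sub>R d \<in> C'" by (rule partition_cover[OF part op, where d = d])
  have "p + e *\<^sub>R d \<notin> cbox a b"
  proof
    assume "p + e *\<^sub>R d \<in> cbox a b"
    then have "\<forall>l. a $ l \<le> (p + e *\<^sub>R d) $ l \<and> (p + e *\<^sub>R d) $ l \<le> b $ l" unfolding mem_box .
    then have "a $ i \<le> (p + e *\<^sub>R d) $ i \<and> (p + e *\<^sub>R d) $ i \<le> b $ i" by (rule spec)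
    moreover have "p $ i = (if t then b $ i else a $ i)" using side by (simp add: side_def)
    ultimately show False using C'(3) by (cases t) (simp_all add: d_def axis_def)
  qed
  then have ne: "cbox a b \<noteq> C'" using C'(4) by blast
  have pb: "p \<in> cbox a b" using side side_subset by blast
  have only: "l = i" if "p \<in> sd l q" for l q
    using that int[of l] by (cases "l = i") (auto simp: side_def split: if_splits)
  have "cbox a b \<inter> C' = sd i t" "(cbox a b \<inter> C') facet_of C'"
    by (rule partition_facet[OF part C C'(1) ne pb C'(2) _ side], rule only, assumption)+
  then show thesis using that[OF C'(1)] ne by blast
qed

text \<open>Two boxes on the same side of a common facet overlap in points interior to the first,
  which the partition allows only if they are equal.\<close>

lemma same_side_eq:
  assumes part: "cuboid_partition \<Omega> \<T>" and A: "corners a b" and B: "corners a' b'"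
    and C: "cbox a b \<in> \<T>" "cbox a' b' \<in> \<T>" and eq: "side a b i t = side a' b' i t"
  shows "cbox a b = cbox a' b'"
proof (rule ccontr)
  interpret A: corners a b by fact
  interpret B: corners a' b' by fact
  assume ne: "cbox a b \<noteq> cbox a' b'"
  \<comment> \<open>Half of the smaller thickness keeps \<open>y\<close> strictly inside both
    boxes.\<close>
  define \<delta> where "\<delta> = min (b $ i - a $ i) (b' $ i - a' $ i) / 2"
  have \<delta>: "0 < \<delta>" "\<delta> < b $ i - a $ i" "\<delta> < b' $ i - a' $ i"
    using A.box[of i] B.box[of i] by (auto simp: \<delta>_def min_def)
  define base where "base = (if t then b $ i else a $ i)"
  have base': "base = (if t then b' $ i else a' $ i)"
  proof -
    have "corner a b (\<lambda>_. t) \<in> side a b i t" by simp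
    then have "corner a b (\<lambda>_. t) $ i = (if t then b' $ i else a' $ i)"
      by (rule side_nth[OF subsetD[OF equalityD1[OF eq]]])
    then show ?thesis unfolding base_def by simp
  qed
  have bd: "a' $ l = a $ l" "b' $ l = b $ l" if "l \<noteq> i" for l
    using side_transfer_bounds[OF A eq that] side_transfer_bounds[OF B eq[symmetric] that] by simp_all
  define y :: point where "y = (\<chi> l. if l = i then base + (if t then - \<delta> else \<delta>) else (a $ l + b $ l) / 2)"
  have yi: "a $ i < y $ i \<and> y $ i < b $ i \<and> a' $ i < y $ i \<and> y $ i < b' $ i"
    using \<delta> base' by (auto simp: y_def base_def split: if_splits)
  have yl: "a $ l < y $ l \<and> y $ l < b $ l" if "l \<noteq> i" for l
    using A.box[of l] that by (simp add: y_def)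
  have "a $ l < y $ l \<and> y $ l < b $ l \<and> a' $ l \<le> y $ l \<and> y $ l \<le> b' $ l" for l
    using yi yl[of l] bd[of l] by (cases "l = i") (auto simp: less_imp_le)
  then have y: "y \<in> cbox a b" "y \<in> cbox a' b'" "\<And>l q. y \<notin> side a b l q"
    unfolding A.mem_box B.mem_box side_def by (auto simp: less_imp_le dest: less_imp_neq) (metis less_irrefl)+
  show False using A.partition_no_interior[OF part C ne y(1,2)] y(3) by blast
qed

text \<open>Every partner lies beyond the side, so it has the side as a facet with the opposite bit
  \<open>\<not> t\<close>, and \<open>same_side_eq\<close> applies to any two partners.\<close>

lemma facet_partner_unique:
  assumes part: "cuboid_partition \<Omega> \<T>" and A: "corners a b" "cbox a b \<in> \<T>"
    and C2: "C2 \<in> \<T>" "cbox a b \<inter> C2 = side a b i t" "side a b i t facet_of C2"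
    and C3: "C3 \<in> \<T>" "cbox a b \<inter> C3 = side a b i t" "side a b i t facet_of C3"
  shows "C2 = C3"
proof -
  interpret A: corners a b by fact
  have opp: "\<exists>a' b'. corners a' b' \<and> C' = cbox a' b' \<and> side a b i t = side a' b' i (\<not> t)"
    if C': "C' \<in> \<T>" "cbox a b \<inter> C' = side a b i t" "side a b i t facet_of C'" for C'
  proof -
    obtain a' b' where B: "corners a' b'" "C' = cbox a' b'" using partition_corners[OF part C'(1)] by metis
    interpret B: corners a' b' by fact
    obtain i' t' where it: "side a b i t = side a' b' i' t'" using C'(3) B.facet_iff B(2) by blast
    have i': "i' = i" by (rule side_transfer_index[OF A(1) B(1) it])
    have "t' \<noteq> t"
    proof
      assume "t' = t"
      then have "cbox a b = cbox a' b'" using same_side_eq[OF part A(1) B(1) A(2) _ ] C'(1) B(2) it i' by blast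
      then have "cbox a b = side a b i t" using C'(2) B(2) by simp
      moreover have "corner a b (\<lambda>_. \<not> t) \<in> cbox a b" by (rule A.corner_in_box)
      moreover have "corner a b (\<lambda>_. \<not> t) \<notin> side a b i t" by simp
      ultimately show False by blast
    qed
    then have "t' = (\<not> t)" by blast
    then show ?thesis using B it i' by blast
  qed
  obtain a2 b2 where 2: "corners a2 b2" "C2 = cbox a2 b2" "side a b i t = side a2 b2 i (\<not> t)" using opp[OF C2] by blast
  obtain a3 b3 where 3: "corners a3 b3" "C3 = cbox a3 b3" "side a b i t = side a3 b3 i (\<not> t)" using opp[OF C3] by blast
  have "side a2 b2 i (\<not> t) = side a3 b3 i (\<not> t)" using 2(3) 3(3) by simp
  then show ?thesis using same_side_eq[OF part 2(1) 3(1)] C2(1) C3(1) unfolding 2(2) 3(2) by blast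
qed

text \<open>The index \<open>s\<close> of the end point \<open>u\<close> tells which of the four cuboids around the edge is meant: neighbours
  differ by a flip in one of the two directions other than \<open>m\<close>.\<close>

definition at_edge :: "point set set \<Rightarrow> point \<Rightarrow> point \<Rightarrow> 3 \<Rightarrow> (3 \<Rightarrow> bool) \<Rightarrow> point \<Rightarrow> point \<Rightarrow> bool" where
  "at_edge \<T> u w m s a b \<longleftrightarrow> corners a b \<and> cbox a b \<in> \<T> \<and> corner a b s = u \<and> corner a b (flip m s) = w"

text \<open>A short step from the midpoint of the edge into the quadrant named by \<open>s'\<close>
  ends in a cuboid through the midpoint. It is the given cuboid or shares a facet or the edge with
  it, so \<open>u\<close> and \<open>w\<close> are corners of it, and the direction of the step
  identifies their index.\<close>

lemma edge_quadrant:
  assumes part: "cuboid_partition \<Omega> \<T>" and op: "open \<Omega>" "midpoint u w \<in> \<Omega>" and E: "at_edge \<T> u w m s a b"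
    and s': "s' m = s m"
  obtains a' b' where "at_edge \<T> u w m s' a' b'"
proof -
  interpret A: corners a b using E by (simp add: at_edge_def)
  have C: "cbox a b \<in> \<T>" and uw: "corner a b s = u" "corner a b (flip m s) = w" using E by (simp_all add: at_edge_def)
  let ?p = "midpoint u w"
  have pl: "?p $ l = u $ l" if "l \<noteq> m" for l using that uw by (auto simp: midpoint_def)
  have pm: "a $ m < ?p $ m" "?p $ m < b $ m" using A.box[of m] uw by (auto simp: midpoint_def)
  \<comment> \<open>If \<open>s' l\<close> holds, the edge is at the upper bound of the wanted
    cuboid, which therefore extends in the negative direction.\<close>
  define d :: point where "d = (\<chi> l. if l = m then 0 else if s' l then - 1 else 1)"
  obtain C' e where C': "C' \<in> \<T>" "?p \<in> C'" "e > 0" "?p + e *\<^sub>R d \<in> C'" by (rule partition_cover[OF part op, where d = d])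
  have seg: "?p \<in> closed_segment u w" by (rule midpoint_in_closed_segment)
  have pC: "?p \<in> cbox a b"
    using seg closed_segment_subset[OF A.corner_in_box A.corner_in_box convex_box(1), of s "flip m s"] uw by blast
  have only: "l \<noteq> m \<and> q = s l" if "?p \<in> side a b l q" for l q
  proof -
    have lm: "l \<noteq> m" using that pm by (auto simp: side_def split: if_splits)
    have "?p $ l = corner a b s $ l" using pl[OF lm] uw by simp
    then show ?thesis using that lm A.box[of l] by (auto simp: side_def split: if_splits)
  qed
  have "\<exists>a' b' s''. corners a' b' \<and> C' = cbox a' b' \<and> corner a' b' s'' = u \<and> corner a' b' (flip m s'') = w"
  proof (cases "cbox a b = C'")
    case True
    then show ?thesis using uw A.corners_axioms by blast
  next
    case ne: False
    obtain a' b' where B: "corners a' b'" "C' = cbox a' b'" using partition_corners[OF part C'(1)] by metis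
    interpret B: corners a' b' by fact
    have "\<exists>s''. corner a' b' s'' = u \<and> corner a' b' (flip m s'') = w"
      using partition_cases[OF part C C'(1) ne pC C'(2)]
    proof (elim disjE)
      assume f: "(cbox a b \<inter> C') facet_of cbox a b \<and> (cbox a b \<inter> C') facet_of C'"
      obtain l q where lq: "cbox a b \<inter> C' = side a b l q" using f A.facet_iff by blast
      obtain l' q' where lq': "cbox a b \<inter> C' = side a' b' l' q'" using f B.facet_iff B(2) by blast
      have eq: "side a b l q = side a' b' l' q'" using lq lq' by simp
      have l': "l' = l" by (rule side_transfer_index[OF A.corners_axioms B(1) eq])
      have "?p \<in> side a b l q" using pC C'(2) lq by blast
      then have o: "l \<noteq> m" "q = s l" using only by blast+
      note tr = side_transfer_corner[OF A.corners_axioms B(1) eq[unfolded l']]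
      have "corner a' b' (s(l := q')) = u" using tr[of s] uw o by simp
      moreover have "(flip m s)(l := q') = flip m (s(l := q'))" using o by (auto simp: flip_def fun_eq_iff)
      then have "corner a' b' (flip m (s(l := q'))) = w" using tr[of "flip m s"] uw o by simp
      ultimately show ?thesis by blast
    next
      assume f: "(cbox a b \<inter> C') edge_of cbox a b \<and> (cbox a b \<inter> C') edge_of C'"
      obtain r n where rn: "cbox a b \<inter> C' = closed_segment (corner a b r) (corner a b (flip n r))" using f A.edge_iff by blast
      obtain r' n' where rn': "cbox a b \<inter> C' = closed_segment (corner a' b' r') (corner a' b' (flip n' r'))"
        using f B.edge_iff B(2) by blast
      obtain i j where ij: "i \<noteq> j" "i \<noteq> n" "j \<noteq> n"
        "closed_segment (corner a b r) (corner a b (flip n r)) = side a b i (r i) \<inter> side a b j (r j)" using A.edge_in_sides by metis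
      have "?p \<in> cbox a b \<inter> C'" using pC C'(2) by blast
      then have "?p \<in> side a b i (r i)" "?p \<in> side a b j (r j)" unfolding rn ij(4) by blast+
      then have o: "i \<noteq> m" "r i = s i" "j \<noteq> m" "r j = s j" using only by blast+
      have nm: "n = m" using index_cases[OF ij(1-3), of m] o by blast
      have "closed_segment (corner a b r) (corner a b (flip n r)) = closed_segment u w"
        using A.edge_eq_sides[OF ij(1-3), of r] A.edge_eq_sides[OF ij(1-3), of s] o uw nm by simp
      then have "closed_segment (corner a' b' r') (corner a' b' (flip n' r')) = closed_segment u w" using rn rn' by simp
      then have dbl: "corner a' b' r' = u \<and> corner a' b' (flip n' r') = w \<or> corner a' b' r' = w \<and> corner a' b' (flip n' r') = u"
        by (simp add: doubleton_eq_iff)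
      have nm': "n' = m"
      proof (rule ccontr)
        assume "n' \<noteq> m"
        then have "corner a' b' r' $ m = corner a' b' (flip n' r') $ m" by simp
        then have "u $ m = w $ m" using dbl by metis
        then show False using uw A.box[of m] by (auto split: if_splits)
      qed
      show ?thesis using dbl unfolding nm' by (metis flip_flip)
    next
      assume "\<exists>P. cbox a b \<inter> C' = {P} \<and> P extreme_point_of cbox a b \<and> P extreme_point_of C'"
      then obtain P where "cbox a b \<inter> C' = {P}" "P \<in> range (corner a b)" using A.extreme_iff by blast
      then obtain r where "?p = corner a b r" using pC C'(2) by blast
      then have "?p \<in> side a b m (r m)" by simp
      then show ?thesis using only by blast
    qed
    then show ?thesis using B by blast
  qed
  then obtain a' b' s'' where B: "corners a' b'" "C' = cbox a' b'" "corner a' b' s'' = u" "corner a' b' (flip m s'') = w" by blast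
  interpret B: corners a' b' by fact
  have "s'' l = s' l" for l
  proof (cases "l = m")
    case True
    have "corner a b s $ m = corner a' b' s'' $ m" "corner a b (flip m s) $ m = corner a' b' (flip m s'') $ m"
      using uw B by simp_all
    then show ?thesis using True s' A.box[of m] B.box[of m] by (auto split: if_splits)
  next
    case False
    have "?p $ l = corner a' b' s'' $ l" using pl[OF False] B by simp
    moreover have "a' $ l \<le> (?p + e *\<^sub>R d) $ l \<and> (?p + e *\<^sub>R d) $ l \<le> b' $ l" using C'(4) B.mem_box B(2) by blast
    ultimately show ?thesis using C'(3) False by (auto simp: d_def split: if_splits)
  qed
  then have "s'' = s'" by blast
  then have "at_edge \<T> u w m s' a' b'" unfolding at_edge_def using B C'(1) by simp
  then show thesis by (rule that)
qed

lemma at_edge_facet: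
  assumes part: "cuboid_partition \<Omega> \<T>" and 1: "at_edge \<T> u w m s a b" and 2: "at_edge \<T> u w m (flip j s) a' b'"
    and jm: "j \<noteq> m"
  shows "cbox a b \<inter> cbox a' b' = side a b j (s j)" "(cbox a b \<inter> cbox a' b') facet_of cbox a' b'" "cbox a b \<noteq> cbox a' b'"
proof -
  interpret A: corners a b using 1 by (simp add: at_edge_def)
  interpret B: corners a' b' using 2 by (simp add: at_edge_def)
  have C: "cbox a b \<in> \<T>" "cbox a' b' \<in> \<T>" using 1 2 by (simp_all add: at_edge_def)
  have u: "u = corner a b s" "u = corner a' b' (flip j s)" and w: "w = corner a b (flip m s)" "w = corner a' b' (flip m (flip j s))"
    using 1 2 by (simp_all add: at_edge_def)
  have uj: "corner a b s $ j = corner a' b' (flip j s) $ j" using u by simp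
  have "corner a b (flip j s) \<notin> cbox a' b'"
  proof
    assume "corner a b (flip j s) \<in> cbox a' b'"
    then have "a' $ j \<le> corner a b (flip j s) $ j \<and> corner a b (flip j s) $ j \<le> b' $ j" unfolding B.mem_box by blast
    then show False using uj A.box[of j] by (auto split: if_splits)
  qed
  then show ne: "cbox a b \<noteq> cbox a' b'" using A.corner_in_box by blast
  obtain k where k: "k \<noteq> m" "k \<noteq> j" by (rule third_index)
  have mjk: "m \<noteq> j" "m \<noteq> k" "j \<noteq> k" using jm k by auto
  have mm: "a $ m = a' $ m \<and> b $ m = b' $ m"
  proof -
    have "corner a b s $ m = corner a' b' (flip j s) $ m" "corner a b (flip m s) $ m = corner a' b' (flip m (flip j s)) $ m"
      using u w by simp_all
    then show ?thesis using jm by (auto split: if_splits)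
  qed
  have uk: "corner a b s $ k = corner a' b' (flip j s) $ k" using u by simp
  define \<delta> where "\<delta> = min (b $ k - a $ k) (b' $ k - a' $ k) / 2"
  have \<delta>: "0 < \<delta>" "\<delta> < b $ k - a $ k" "\<delta> < b' $ k - a' $ k"
    using A.box[of k] B.box[of k] by (auto simp: \<delta>_def min_def)
  \<comment> \<open>A point of the common face near the edge: half-way along \<open>m\<close>, in
    the plane of the face, and off the edge in direction \<open>k\<close> by less than either
    thickness.\<close>
  define x :: point where "x = (\<chi> l. if l = m then (a $ m + b $ m) / 2 else if l = j then u $ j
     else u $ k + (if s k then - \<delta> else \<delta>))"
  have xk: "a $ k < x $ k \<and> x $ k < b $ k \<and> a' $ k < x $ k \<and> x $ k < b' $ k"
    using \<delta> uk mjk unfolding x_def u(1) by (auto split: if_splits)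
  have xm: "a $ m < x $ m \<and> x $ m < b $ m \<and> a' $ m < x $ m \<and> x $ m < b' $ m"
    using A.box[of m] mm by (auto simp: x_def)
  have xj: "x $ j = corner a b s $ j" "x $ j = corner a' b' (flip j s) $ j" using mjk u by (simp_all add: x_def)
  have xA: "x \<in> cbox a b" unfolding A.mem_box all_index[OF mjk]
    using xk xm xj(1) A.box[of j] by (auto simp: less_imp_le)
  have xB: "x \<in> cbox a' b'" unfolding B.mem_box all_index[OF mjk]
    using xk xm xj(2) B.box[of j] by (auto simp: less_imp_le)
  have only: "l = j" if "x \<in> side a b l q" for l q
    using index_cases[OF mjk, of l] that xk xm by (auto simp: side_def split: if_splits)
  have sj: "x \<in> side a b j (s j)" unfolding side_def using xA xj(1) by simp
  show "cbox a b \<inter> cbox a' b' = side a b j (s j)" "(cbox a b \<inter> cbox a' b') facet_of cbox a' b'"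
    by (rule A.partition_facet[OF part C ne xA xB _ sj], rule only, assumption)+
qed

lemma at_edge_side_eq:
  assumes part: "cuboid_partition \<Omega> \<T>" and 1: "at_edge \<T> u w m s a b" and 2: "at_edge \<T> u w m (flip j s) a' b'"
    and jm: "j \<noteq> m"
  shows "side a b j (s j) = side a' b' j (\<not> s j)"
proof -
  have "at_edge \<T> u w m (flip j (flip j s)) a b" using 1 by simp
  from at_edge_facet(1)[OF part 2 this jm] at_edge_facet(1)[OF part 1 2 jm] show ?thesis by (simp add: Int_commute)
qed

lemma at_edge_corner:
  assumes part: "cuboid_partition \<Omega> \<T>" and 1: "at_edge \<T> u w m s a b" and 2: "at_edge \<T> u w m (flip j s) a' b'"
    and jm: "j \<noteq> m" and kj: "k \<noteq> j"
  shows "corner a b (flip k s) = corner a' b' (flip k (flip j s))"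
    "corner a b (flip m (flip k s)) = corner a' b' (flip m (flip k (flip j s)))"
proof -
  have AB: "corners a b" "corners a' b'" using 1 2 by (simp_all add: at_edge_def)
  note tr = side_transfer_corner[OF AB at_edge_side_eq[OF assms(1-4)]]
  have "(flip k s)(j := \<not> s j) = flip k (flip j s)" "(flip m (flip k s))(j := \<not> s j) = flip m (flip k (flip j s))"
    using kj jm by (auto simp: flip_def fun_eq_iff)
  then show "corner a b (flip k s) = corner a' b' (flip k (flip j s))"
    "corner a b (flip m (flip k s)) = corner a' b' (flip m (flip k (flip j s)))"
    using tr[of "flip k s"] tr[of "flip m (flip k s)"] kj jm by simp_all
qed

text \<open>In directions \<open>j\<close> and \<open>k\<close> the two cuboids lie on opposite
  sides of the edge, which fixes these coordinates for common points.\<close>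

lemma at_edge_opposite:
  assumes 1: "at_edge \<T> u w m s a b" and 2: "at_edge \<T> u w m (flip j (flip k s)) a' b'"
    and jkm: "j \<noteq> k" "j \<noteq> m" "k \<noteq> m"
  shows "cbox a b \<inter> cbox a' b' = closed_segment u w"
proof -
  interpret A: corners a b using 1 by (simp add: at_edge_def)
  interpret B: corners a' b' using 2 by (simp add: at_edge_def)
  have u: "u = corner a b s" "u = corner a' b' (flip j (flip k s))" and w: "w = corner a b (flip m s)" "w = corner a' b' (flip m (flip j (flip k s)))"
    using 1 2 by (simp_all add: at_edge_def)
  have seg: "closed_segment u w = side a b j (s j) \<inter> side a b k (s k)" unfolding u(1) w(1) by (rule A.edge_eq_sides[OF jkm])
  have "closed_segment u w \<subseteq> cbox a b"
    unfolding u(1) w(1) by (rule closed_segment_subset[OF A.corner_in_box A.corner_in_box convex_box(1)])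
  moreover have "closed_segment u w \<subseteq> cbox a' b'"
    unfolding u(2) w(2) by (rule closed_segment_subset[OF B.corner_in_box B.corner_in_box convex_box(1)])
  moreover have "y \<in> side a b l (s l)" if y: "y \<in> cbox a b" "y \<in> cbox a' b'" and l: "l = j \<or> l = k" for y l
  proof -
    have ul: "corner a b s $ l = corner a' b' (flip j (flip k s)) $ l" using u by simp
    have "flip j (flip k s) l = (\<not> s l)" using l jkm by (auto simp: flip_apply)
    then have "(if s l then b $ l else a $ l) = (if s l then a' $ l else b' $ l)" using ul by simp
    moreover have "a $ l \<le> y $ l" "y $ l \<le> b $ l" "a' $ l \<le> y $ l" "y $ l \<le> b' $ l"
      using y unfolding A.mem_box B.mem_box by blast+
    ultimately have "y $ l = (if s l then b $ l else a $ l)" by (auto split: if_splits)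
    then show ?thesis using y(1) by (simp add: side_def)
  qed
  ultimately show ?thesis unfolding seg by blast
qed

subsection \<open>Transfer along a common face\<close>

text \<open>Corners of the common side correspond under \<open>h\<close>, which replaces only the
  bit in direction \<open>i\<close>, and everything on the side depends on the labels at these
  corners. Inclusions suffice because the boxes can exchange roles.\<close>

lemma face_transfer_sub:
  assumes A: "iso_corners a b c" and B: "iso_corners a' b' c" and eq: "side a b i t = side a' b' i t'"
  shows "iso_corners.Lf a b c F i t \<Longrightarrow> iso_corners.Lf a' b' c F i t'"
    "iso_corners.tri a b c F i t \<Longrightarrow> iso_corners.tri a' b' c F i t'"
    "iso_corners.cuts a b c F i t (iso_corners.D a b c F) \<subseteq> iso_corners.cuts a' b' c F i t' (iso_corners.D a' b' c F)"
    "iso_corners.cuts a b c F i t (\<lambda>u. F (corner a b u) < c) \<subseteq> iso_corners.cuts a' b' c F i t' (\<lambda>u. F (corner a' b' u) < c)"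
    "iso_corners.ipf a b c F i t \<subseteq> iso_corners.ipf a' b' c F i t'"
    "e \<subseteq> side a b i t \<Longrightarrow> iso_corners.edgeline a b e \<Longrightarrow> iso_corners.edgeline a' b' e"
proof -
  interpret A: iso_corners a b c by fact
  interpret B: iso_corners a' b' c by fact
  define h where "h s = s(i := t')" for s :: "3 \<Rightarrow> bool"
  have hv: "corner a b s = corner a' b' (h s)" if "s i = t" for s
    unfolding h_def using side_transfer_corner[OF A.corners_axioms B.corners_axioms eq] that by blast
  have hi: "h s i = t'" for s by (simp add: h_def)
  have hf: "h (flip j s) = flip j (h s)" if "j \<noteq> i" for s j using that by (auto simp: h_def flip_def fun_eq_iff)
  have hD: "A.D F s = B.D F (h s)" "A.Z F s = B.Z F (h s)" if "s i = t" for s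
    using hv[of s] that by (simp_all add: A.D_def B.D_def A.Z_def B.Z_def)
  have hx: "A.xp F s j = B.xp F (h s) j" if "s i = t" "j \<noteq> i" for s j
    using hv[of s] hv[of "flip j s"] hf[of j s] that by (simp add: A.xp_def B.xp_def)
  have onto: "\<exists>s. s i = t \<and> u = h s" if "u i = t'" for u
    by (rule exI[of _ "u(i := t)"]) (use that in \<open>auto simp: h_def fun_eq_iff\<close>)
  show L: "B.Lf F i t'" if L0: "A.Lf F i t"
  proof -
    obtain s j k where s: "i \<noteq> j" "i \<noteq> k" "j \<noteq> k" "s i = t" "A.D F s" "A.D F (flip j (flip k s))"
      "\<not> A.D F (flip j s)" "\<not> A.D F (flip k s)" using L0 unfolding A.Lf_def by blast
    have "B.D F (h s)" "B.D F (flip j (flip k (h s)))" "\<not> B.D F (flip j (h s))" "\<not> B.D F (flip k (h s))"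
      using s hD[of s] hD[of "flip j (flip k s)"] hD[of "flip j s"] hD[of "flip k s"] hf[of j] hf[of k] by simp_all
    then show ?thesis unfolding B.Lf_def using s(1-3) hi by blast
  qed
  show "B.tri F i t'" if T: "A.tri F i t"
    unfolding B.tri_def
  proof (intro conjI allI impI)
    show "B.Lf F i t'" using T L unfolding A.tri_def by blast
    fix u assume u: "u i = t' \<and> \<not> B.D F u"
    then obtain s where s: "s i = t" "u = h s" using onto by blast
    then have "A.Z F s" using T u hD(1)[of s] unfolding A.tri_def by blast
    then show "B.Z F u" using hD(2)[of s] s by blast
  qed
  have cuts: "A.cuts F i t Q \<subseteq> B.cuts F i t' R" if QR: "\<And>s. s i = t \<Longrightarrow> Q s \<Longrightarrow> R (h s)" for Q R
  proof
    fix e assume "e \<in> A.cuts F i t Q"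
    then obtain u j k where u: "e = closed_segment (A.xp F u j) (A.xp F u k)" "u i = t" "i \<noteq> j" "i \<noteq> k" "j \<noteq> k" "Q u"
      unfolding A.cuts_def by blast
    then have "e = closed_segment (B.xp F (h u) j) (B.xp F (h u) k)" using hx[of u j] hx[of u k] by simp
    then show "e \<in> B.cuts F i t' R" unfolding B.cuts_def using u hi QR[of u] by blast
  qed
  show "A.cuts F i t (A.D F) \<subseteq> B.cuts F i t' (B.D F)" by (rule cuts) (use hD in blast)
  show "A.cuts F i t (\<lambda>u. F (corner a b u) < c) \<subseteq> B.cuts F i t' (\<lambda>u. F (corner a' b' u) < c)"
    by (rule cuts) (use hv in simp)
  show "A.ipf F i t \<subseteq> B.ipf F i t'"
  proof
    fix p assume "p \<in> A.ipf F i t"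
    then obtain s j where s: "p = A.xp F s j" "s i = t" "j \<noteq> i" "A.D F s \<noteq> A.D F (flip j s)" unfolding A.ipf_def by blast
    have "B.D F (h s) \<noteq> B.D F (flip j (h s))" using s hD(1)[of s] hD(1)[of "flip j s"] hf[of j s] by simp
    then show "p \<in> B.ipf F i t'" unfolding B.ipf_def using s hx[of s j] hi by blast
  qed
  show "B.edgeline e" if e: "e \<subseteq> side a b i t" "A.edgeline e"
  proof -
    obtain s l where s: "e = closed_segment (corner a b s) (corner a b (flip l s))" using e(2) unfolding A.edgeline_def by blast
    have "corner a b s \<in> side a b i t" "corner a b (flip l s) \<in> side a b i t" using e(1) unfolding s A.segment_side by blast+
    then have si: "s i = t" "l \<noteq> i" by auto
    then have "e = closed_segment (corner a' b' (h s)) (corner a' b' (flip l (h s)))"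
      using s hv[of s] hv[of "flip l s"] hf[of l s] by simp
    then show ?thesis unfolding B.edgeline_def by blast
  qed
qed

lemma face_transfer:
  assumes A: "iso_corners a b c" and B: "iso_corners a' b' c" and eq: "side a b i t = side a' b' i t'"
  shows "iso_corners.Lf a b c F i t \<longleftrightarrow> iso_corners.Lf a' b' c F i t'"
    "iso_corners.tri a b c F i t \<longleftrightarrow> iso_corners.tri a' b' c F i t'"
    "iso_corners.cuts a b c F i t (iso_corners.D a b c F) = iso_corners.cuts a' b' c F i t' (iso_corners.D a' b' c F)"
    "iso_corners.cuts a b c F i t (\<lambda>u. F (corner a b u) < c) = iso_corners.cuts a' b' c F i t' (\<lambda>u. F (corner a' b' u) < c)"
    "iso_corners.ipf a b c F i t = iso_corners.ipf a' b' c F i t'"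
    "iso_corners.ncl a b c F i t = iso_corners.ncl a' b' c F i t'"
    "iso_corners.fl a b \<J> i t = iso_corners.fl a' b' \<J> i t'"
proof -
  interpret A: iso_corners a b c by fact
  interpret B: iso_corners a' b' c by fact
  note f = face_transfer_sub[OF A B eq]
  note g = face_transfer_sub[OF B A eq[symmetric]]
  show L: "A.Lf F i t \<longleftrightarrow> B.Lf F i t'" using f(1) g(1) by blast
  show "A.tri F i t \<longleftrightarrow> B.tri F i t'" using f(2) g(2) by blast
  show "A.cuts F i t (A.D F) = B.cuts F i t' (B.D F)" using f(3) g(3) by blast
  show "A.cuts F i t (\<lambda>u. F (corner a b u) < c) = B.cuts F i t' (\<lambda>u. F (corner a' b' u) < c)"
    by (rule subset_antisym[OF f(4) g(4)])
  show I: "A.ipf F i t = B.ipf F i t'" using f(5) g(5) by blast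
  have E: "A.edgeline e \<longleftrightarrow> B.edgeline e" if "e \<subseteq> side a b i t" for e using f(6)[OF that] g(6) that eq by blast
  have E2: "A.edgeline (closed_segment p q) \<longleftrightarrow> B.edgeline (closed_segment p q)" if "A.ipf F i t = {p, q}" for p q
  proof (rule E)
    have "p \<in> side a b i t" "q \<in> side a b i t" using A.ipf_side[of _ F i t] that by blast+
    then show "closed_segment p q \<subseteq> side a b i t" using A.segment_side by blast
  qed
  have "e = closed_segment p q \<and> p \<noteq> q \<and> \<not> A.Lf F i t \<and> A.ipf F i t = {p, q} \<and> \<not> A.edgeline (closed_segment p q) \<longleftrightarrow>
    e = closed_segment p q \<and> p \<noteq> q \<and> \<not> B.Lf F i t' \<and> B.ipf F i t' = {p, q} \<and> \<not> B.edgeline (closed_segment p q)" for e p q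
    using E2[of p q] unfolding L I by blast
  then show "A.ncl F i t = B.ncl F i t'" unfolding A.ncl_def B.ncl_def by presburger
  show "A.fl \<J> i t = B.fl \<J> i t'" unfolding A.fl_def B.fl_def using E eq by blast
qed

subsection \<open>Lines of a labeled partition\<close>

lemma (in corners) open_segment_side:
  assumes "x \<in> sd i t" "x \<in> closed_segment p q" "p \<in> cbox a b" "q \<in> cbox a b" "x \<noteq> p" "x \<noteq> q"
  shows "p \<in> sd i t \<and> q \<in> sd i t"
proof -
  have "x \<in> open_segment p q" using assms by (simp add: open_segment_def)
  then show ?thesis using side_face[of i t] assms(1,3,4) unfolding face_of_def by blast
qed

lemma (in iso_corners) finite_ipf: "finite (ipf f i t)"
proof -
  have "ipf f i t \<subseteq> (\<lambda>(s, j). xp f s j) ` UNIV" unfolding ipf_def by auto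
  then show ?thesis by (rule finite_subset) simp
qed

text \<open>Every mixed edge has a disperse end, and the cut around that end starts at the iso-point
  of the edge.\<close>

lemma (in iso_corners) ipf_W1: "ipf f i t \<subseteq> \<Union>(W1 f i t)"
proof
  fix p assume "p \<in> ipf f i t"
  then obtain w l where w: "p = xp f w l" "isop f w l" "w i = t" "l \<noteq> i" unfolding ipf_isop by blast
  obtain k where k: "k \<noteq> l" "k \<noteq> i" by (rule third_index)
  have "D f (flip l w)" using w(2) by (simp add: isop_def)
  moreover have "(flip l w) i = t" using w by simp
  ultimately have "closed_segment (xp f (flip l w) l) (xp f (flip l w) k) \<in> W1 f i t"
    unfolding cuts_def using k w(4) by blast
  moreover have "p = xp f (flip l w) l" using w(1) xp_flip[OF isop_mix[OF w(2)]] by simp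
  ultimately show "p \<in> \<Union>(W1 f i t)" by (metis UnionI ends_in_segment(1))
qed

lemma (in iso_corners) Lf_neighbors:
  assumes L: "Lf f i (s i)" and j: "j \<noteq> i"
  shows "D f (flip j s) \<longleftrightarrow> \<not> D f s"
proof -
  obtain k where k: "k \<noteq> i" "k \<noteq> j" by (rule third_index)
  then show ?thesis using L Lf_eq[of i j k f s] j by auto
qed

text \<open>A relabelled corner is disperse with disperse neighbours only, so it lies on no mixed
  edge.\<close>

lemma (in iso_corners) removed_isop:
  assumes r: "removed B F f" and i: "isop f w l"
  shows "isop F w l" "xp f w l = xp F w l" "F (v w) = f (v w)"
proof -
  have w: "\<not> D f w" "D f (flip l w)" using i by (simp_all add: isop_def)
  show eq: "F (v w) = f (v w)" using removed_cont[OF r w(1)] by simp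
  have eq': "F (v (flip l w)) = f (v (flip l w))"
  proof (rule ccontr)
    assume "F (v (flip l w)) \<noteq> f (v (flip l w))"
    then have "D f (flip l (flip l w))" by (intro removedD(4)[OF r]) simp
    then show False using w(1) by simp
  qed
  show "isop F w l" using w eq eq' by (simp add: isop_def D_def)
  show "xp f w l = xp F w l" using eq eq' by (intro xp_cong) simp_all
qed

text \<open>On an L-face every point of an iso-line lies on an iso-line in the face or is an iso-point,
  so the point set of the inner iso-paths in the face is that of its own lines up to finitely many points.\<close>

lemma (in iso_corners) line_on_L_face:
  assumes r: "removed B F f" and L: "Lf F i t" and line: "iso_line_of f e" "e \<in> \<Union>\<J>" and x: "x \<in> e" "x \<in> sd i t"
  shows "x \<in> \<Union>(fl \<J> i t) \<union> ipf F i t"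
proof -
  obtain w l w' l' where w: "isop f w l" "isop f w' l'" "e = closed_segment (xp f w l) (xp f w' l')" "xp f w l \<noteq> xp f w' l'"
    using line(1) unfolding iso_line_of_def by blast
  \<comment> \<open>An iso-point of an edge that leaves the side is on the side only as a
    label-\<open>c\<close> corner; the L-face then provides a mixed edge within the side at that
    corner.\<close>
  have endp: "xp f y n \<in> ipf F i t" if y: "isop f y n" "xp f y n \<in> sd i t" for y n
  proof -
    have yi: "y i = t \<and> (i \<noteq> n \<or> Z f y)" using y(2) isop_in_side[OF y(1)] by blast
    note o = removed_isop[OF r y(1)]
    show ?thesis
    proof (cases "i = n")
      case False
      then show ?thesis unfolding ipf_isop using o yi by blast
    next
      case True
      then have Z: "Z F y" using yi o(3) by (simp add: Z_def)
      obtain j where j: "j \<noteq> i" using third_index by blast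
      have "D F (flip j y)" using Lf_neighbors[of F i y j] L yi j Z by simp
      then have "isop F y j" using Z by (simp add: isop_def)
      moreover have "xp f y n = xp F y j" using o(2) xp_Z[OF Z] by simp
      ultimately show ?thesis unfolding ipf_isop using yi j by blast
    qed
  qed
  have inb: "xp f w l \<in> cbox a b" "xp f w' l' \<in> cbox a b" using w(1,2) by (simp_all add: xp_in_box isop_mix)
  show ?thesis
  proof (cases "x = xp f w l \<or> x = xp f w' l'")
    case True
    then show ?thesis using endp w(1,2) x(2) by blast
  next
    case False
    have sub: "xp f w l \<in> sd i t \<and> xp f w' l' \<in> sd i t"
      using open_segment_side[OF x(2) _ inb] x(1) w(3) False by blast
    \<comment> \<open>Adjacent corners of an L-face are of different kinds, so none of its edges has
      two ends of label \<open>c\<close>.\<close>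
    have "\<not> edgeline e"
    proof
      assume "edgeline e"
      then obtain s m where s: "e = closed_segment (v s) (v (flip m s))" unfolding edgeline_def by blast
      then have Zs: "Z f s" "Z f (flip m s)" using isop_edgeline(1,2)[OF w(1,2)] w(3) by simp_all
      have "closed_segment (v s) (v (flip m s)) \<subseteq> sd i t" using sub w(3) s segment_side by metis
      then have "s i = t" "m \<noteq> i" unfolding segment_side by auto
      moreover have "\<not> D F s" "\<not> D F (flip m s)" using Zs removed_D_mono[OF r] Z_not_D by blast+
      ultimately show False using Lf_neighbors[of F i s m] L by simp
    qed
    then have "e \<in> fl \<J> i t" using line(2) sub w(3) segment_side unfolding fl_def by blast
    then show ?thesis using x(1) by blast
  qed
qed

section \<open>Setting of the theorem and its cells\<close>

locale iso_partition =
  fixes \<Omega> :: "point set" and \<T> :: "point set set" and F :: "point \<Rightarrow> real" and c :: real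
    and \<G> :: "lgraph set" and \<J> :: "lgraph \<Rightarrow> polygon set"
  assumes level: "0 < c" "c < 1"
    and open_dom: "open \<Omega>" and part: "cuboid_partition \<Omega> \<T>"
    and graphs: "\<G> = resulting_graphs c F \<T>"
    and free: "\<And>G. G \<in> \<G> \<Longrightarrow> singular_iso_path_free c G \<and> isolated_iso_path_free c \<G> G"
    and inner: "\<And>G. G \<in> \<G> \<Longrightarrow> inner_iso_paths c \<G> G (\<J> G)"
    and boundary: "\<And>G p. G \<in> \<G> \<Longrightarrow> p \<in> iso_paths c \<G> \<J> G \<Longrightarrow> \<Union>(iso_lines p) \<inter> frontier \<Omega> = {}"
begin

abbreviation \<G>0 :: "lgraph set" where "\<G>0 \<equiv> (\<lambda>C. LGraph C F) ` \<T>"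

text \<open>Names the labels that the removal step leaves on a cuboid together with their
  properties, so that \<open>removal_step\<close> need not be unfolded again.\<close>

definition cell :: "point \<Rightarrow> point \<Rightarrow> (point \<Rightarrow> real) \<Rightarrow> bool" where
  "cell a b f \<longleftrightarrow> corners a b \<and> cbox a b \<in> \<T> \<and> removal_step c \<G>0 (LGraph (cbox a b) F) = LGraph (cbox a b) f \<and>
     iso_corners.removed a b c (F2_graph c \<G>0 (LGraph (cbox a b) F)) F f"

abbreviation graph_of :: "point \<Rightarrow> point \<Rightarrow> (point \<Rightarrow> real) \<Rightarrow> lgraph" where
  "graph_of a b f \<equiv> LGraph (cbox a b) f"

lemma iso_cornersI: "corners a b \<Longrightarrow> iso_corners a b c"
  using level by (simp add: iso_corners_def iso_corners_axioms_def)

lemma cellD: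
  assumes "cell a b f"
  shows "corners a b" "iso_corners a b c" "cbox a b \<in> \<T>"
    "iso_corners.removed a b c (F2_graph c \<G>0 (graph_of a b F)) F f" "graph_of a b f \<in> \<G>"
proof -
  show "corners a b" "cbox a b \<in> \<T>" "iso_corners.removed a b c (F2_graph c \<G>0 (graph_of a b F)) F f"
    using assms by (simp_all add: cell_def)
  then show "iso_corners a b c" by (simp add: iso_cornersI)
  have eq: "graph_of a b f = removal_step c \<G>0 (graph_of a b F)" using assms by (simp add: cell_def)
  show "graph_of a b f \<in> \<G>" unfolding graphs resulting_graphs_def Let_def eq
    by (rule imageI, rule imageI) fact
qed

lemma cell_exists:
  assumes "corners a b" "cbox a b \<in> \<T>"
  obtains f where "cell a b f"
proof -
  interpret iso_corners a b c using assms(1) by (rule iso_cornersI)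
  obtain f where "removal_step c \<G>0 (gr F) = gr f" "removed (F2_graph c \<G>0 (gr F)) F f" by (rule removal_gr)
  then show thesis using that[of f] assms by (simp add: cell_def)
qed

lemma cuboid_cell:
  assumes "C \<in> \<T>"
  obtains a b f where "C = cbox a b" "cell a b f"
proof -
  obtain a b where ab: "corners a b" "C = cbox a b" by (rule partition_corners[OF part assms])
  obtain f where "cell a b f" by (rule cell_exists[OF ab(1)]) (use ab assms in simp)
  then show thesis using that ab by blast
qed

lemma graph_cell:
  assumes "G \<in> \<G>"
  obtains a b f where "G = graph_of a b f" "cell a b f"
proof -
  obtain C where C: "C \<in> \<T>" "G = removal_step c \<G>0 (LGraph C F)"
    using assms unfolding graphs resulting_graphs_def Let_def by blast
  obtain a b f where ab: "C = cbox a b" "cell a b f" by (rule cuboid_cell[OF C(1)])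
  then have "G = graph_of a b f" using C(2) by (simp add: cell_def)
  then show thesis using that ab by blast
qed

text \<open>Freeness is assumed for all graphs, so one corner of each kind is enough for
  regularity.\<close>

lemma cell_regular:
  assumes "cell a b f" "iso_corners.D a b c f s" "\<not> iso_corners.D a b c f s'"
  shows "regular_graph c \<G> (graph_of a b f)"
proof -
  interpret iso_corners a b c using assms(1) by (rule cellD)
  have "\<not> range v \<subseteq> v ` {s. D f s}" "\<not> range v \<subseteq> v ` {s. \<not> D f s}"
    using assms(2,3) unfolding v_subset by blast+
  then show ?thesis using free[OF cellD(5)[OF assms(1)]]
    unfolding regular_graph_def disperse_graph_def continuous_graph_def nodes_gr disperse_gr continuous_gr by blast
qed

lemma line_regular:
  assumes "G \<in> \<G>" "e \<in> \<Union>(\<J> G)"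
  shows "regular_graph c \<G> G"
  using inner[OF assms(1)] assms(2) unfolding inner_iso_paths_def by (auto split: if_splits)

lemma line_in_domain:
  assumes G: "G \<in> \<G>" and e: "e \<in> \<Union>(\<J> G)" and x: "x \<in> e" "x \<in> C" "C \<in> \<T>"
  shows "x \<in> \<Omega>"
proof -
  obtain J where J: "J \<in> \<J> G" "e \<in> J" using e by blast
  have "Inner G J \<in> iso_paths c \<G> \<J> G" using J by (simp add: iso_paths_def)
  from boundary[OF G this] have "x \<notin> frontier \<Omega>" using J x(1) by auto
  moreover have "\<Union>\<T> = closure \<Omega>" using part by (simp add: cuboid_partition_def)
  then have "x \<in> closure \<Omega>" using x by blast
  ultimately show ?thesis using open_dom by (simp add: frontier_def interior_open)
qed

abbreviation near :: "lgraph \<Rightarrow> lgraph \<Rightarrow> bool" where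
  "near G G' \<equiv> G' = G \<or> face_neighbors G G' \<or> edge_neighbors G G'"

definition twice :: "lgraph \<Rightarrow> point set \<Rightarrow> bool" where
  "twice G e \<longleftrightarrow> (\<exists>G1\<in>\<G>. \<exists>G2\<in>\<G>. \<exists>p1 \<in> iso_paths c \<G> \<J> G1. \<exists>p2 \<in> iso_paths c \<G> \<J> G2.
      near G G1 \<and> near G G2 \<and> p1 \<noteq> p2 \<and> e \<in> iso_lines p1 \<and> e \<in> iso_lines p2)"

lemma twiceI:
  assumes "G1 \<in> \<G>" "G2 \<in> \<G>" "p1 \<in> iso_paths c \<G> \<J> G1" "p2 \<in> iso_paths c \<G> \<J> G2" "near G G1" "near G G2"
    "p1 \<noteq> p2" "e \<in> iso_lines p1" "e \<in> iso_lines p2"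
  shows "twice G e"
  using assms unfolding twice_def by blast

lemma twice_same:
  assumes "G \<in> \<G>" "\<exists>J1\<in>\<J> G. \<exists>J2\<in>\<J> G. J1 \<noteq> J2 \<and> e \<in> J1 \<and> e \<in> J2"
  shows "twice G e"
proof -
  obtain J1 J2 where "J1 \<in> \<J> G" "J2 \<in> \<J> G" "J1 \<noteq> J2" "e \<in> J1" "e \<in> J2" using assms(2) by blast
  then show ?thesis by (intro twiceI[OF assms(1,1), of "Inner G J1" "Inner G J2"]) (simp_all add: iso_paths_def)
qed

text \<open>The graph carried by \<open>Inner\<close> keeps the two iso-paths distinct even if their
  polygons agree.\<close>

lemma twice_two:
  assumes "G \<in> \<G>" "G' \<in> \<G>" "near G G'" "G' \<noteq> G" "e \<in> \<Union>(\<J> G)" "e \<in> \<Union>(\<J> G')"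
  shows "twice G e"
proof -
  obtain J1 J2 where "J1 \<in> \<J> G" "J2 \<in> \<J> G'" "e \<in> J1" "e \<in> J2" using assms(5,6) by blast
  then show ?thesis using assms(3,4)
    by (intro twiceI[OF assms(1,2), of "Inner G J1" "Inner G' J2"]) (auto simp: iso_paths_def)
qed

lemma twice_outer:
  assumes "G1 \<in> \<G>" "G2 \<in> \<G>" "near G G1" "near G G2" "e \<in> \<Union>(\<J> G1)" "outer_iso_path c \<G> \<J> G2 E" "e \<in> E"
  shows "twice G e"
proof -
  obtain J where "J \<in> \<J> G1" "e \<in> J" using assms(5) by blast
  then show ?thesis using assms
    by (intro twiceI[OF assms(1,2), of "Inner G1 J" "Outer E"]) (auto simp: iso_paths_def)
qed

end

lemma UN_polygons: "(\<Union>J \<in> K \<union> K'. \<Union>J) = \<Union>(\<Union>K) \<union> \<Union>(\<Union>K')"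
  by blast

subsection \<open>Two cuboids with a common face\<close>

locale cell_pair = iso_partition +
  fixes a b f a' b' f' i t t'
  assumes cells: "cell a b f" "cell a' b' f'"
    and common: "cbox a b \<inter> cbox a' b' = side a b i t" "side a b i t = side a' b' i t'"
    and distinct: "cbox a b \<noteq> cbox a' b'"
begin

sublocale A: iso_corners a b c using cells(1) by (rule cellD)
sublocale B: iso_corners a' b' c using cells(2) by (rule cellD)

abbreviation "GA \<equiv> A.gr f"
abbreviation "GB \<equiv> B.gr f'"

lemma swap: "cell_pair \<Omega> \<T> F c \<G> \<J> a' b' f' a b f i t' t"
  by unfold_locales (use cells common distinct in \<open>auto simp: Int_commute\<close>)

lemma GA: "GA \<in> \<G>" and GB: "GB \<in> \<G>"
  using cells by (simp_all add: cellD)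

lemma GB_neq_GA: "GB \<noteq> GA"
  using distinct by simp

lemma neighbors: "face_neighbors GA GB" "face_neighbors GB GA"
proof -
  have "side a b i t facet_of cbox a b" "side a b i t facet_of cbox a' b'"
    using A.facet_iff B.facet_iff common(2) by blast+
  moreover have "cbox a' b' \<inter> cbox a b = side a b i t" using common(1) by (simp add: Int_commute)
  ultimately show "face_neighbors GA GB" "face_neighbors GB GA" unfolding face_neighbors_def using common(1) by simp_all
qed

lemmas transfer = face_transfer[OF A.iso_corners_axioms B.iso_corners_axioms common(2)]
lemmas remA = cellD(4)[OF cells(1)]
lemmas remB = cellD(4)[OF cells(2)]

text \<open>The disperse corners of the L-face and its corner with label below \<open>c\<close>
  survive the removal step, so both kinds are present.\<close>

lemma regular_of_nontrivial:
  assumes L: "A.Lf F i t" "\<not> A.tri F i t"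
  shows "regular_graph c \<G> GA"
proof -
  obtain s where "A.D F s" using L(1) unfolding A.Lf_def by blast
  then have "A.D f s" by (rule A.removed_D_mono[OF remA])
  moreover obtain s' where s': "\<not> A.D F s'" "\<not> A.Z F s'" using L unfolding A.tri_def by blast
  then have "f (corner a b s') = F (corner a b s')" using A.removedD(1)[OF remA] by blast
  then have "\<not> A.D f s'" using s'(1) by (simp add: A.D_def)
  ultimately show ?thesis by (rule cell_regular[OF cells(1)])
qed

lemma lines_of_nontrivial:
  assumes L: "A.Lf F i t" "\<not> A.tri F i t"
  shows "A.fl (\<J> GA) i t = A.W2 F i t \<or>
    A.fl (\<J> GA) i t = A.W1 F i t \<and> (\<forall>s. s i = t \<longrightarrow> f (corner a b s) = F (corner a b s))"
  by (rule A.nontrivial_face_lines[OF remA A.regular_resolved[OF inner[OF GA] regular_of_nontrivial[OF L]] L])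

lemma points_on_face:
  assumes L: "A.Lf F i t" "\<not> A.tri F i t"
  shows "\<Union>(\<Union>(\<J> GA)) \<inter> side a b i t \<subseteq> \<Union>(A.fl (\<J> GA) i t) \<union> A.ipf F i t"
proof
  fix x assume "x \<in> \<Union>(\<Union>(\<J> GA)) \<inter> side a b i t"
  then obtain e where e: "e \<in> \<Union>(\<J> GA)" "x \<in> e" "x \<in> side a b i t" by blast
  have "A.iso_line_of f e" by (rule A.regular_lines[OF inner[OF GA] regular_of_nontrivial[OF L] e(1)])
  then show "x \<in> \<Union>(A.fl (\<J> GA) i t) \<union> A.ipf F i t" by (rule A.line_on_L_face[OF remA L(1) _ e])
qed

lemma fl_lines: "A.fl K i t \<subseteq> \<Union>K" "\<Union>(A.fl K i t) \<subseteq> \<Union>(\<Union>K) \<inter> side a b i t"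
  unfolding A.fl_def by blast+

end

context cell_pair
begin

interpretation S: cell_pair \<Omega> \<T> F c \<G> \<J> a' b' f' a b f i t' t
  by (rule swap)

lemma nontrivial_both:
  assumes L: "A.Lf F i t" "\<not> A.tri F i t"
  shows "B.Lf F i t'" "\<not> B.tri F i t'" "A.fl (\<J> GB) i t = A.W1 F i t \<or> A.fl (\<J> GB) i t = A.W2 F i t"
    "A.fl (\<J> GA) i t = A.W1 F i t \<or> A.fl (\<J> GA) i t = A.W2 F i t"
    "(\<Union>J \<in> \<J> GA \<union> \<J> GB. \<Union>J) \<inter> side a b i t \<subseteq> \<Union>(A.fl (\<J> GA) i t \<union> A.fl (\<J> GB) i t) \<union> A.ipf F i t"
proof -
  show L': "B.Lf F i t'" "\<not> B.tri F i t'" using L transfer(1,2) by blast+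
  show "A.fl (\<J> GB) i t = A.W1 F i t \<or> A.fl (\<J> GB) i t = A.W2 F i t"
    using S.lines_of_nontrivial[OF L'] unfolding transfer(3,4,7) by argo
  show "A.fl (\<J> GA) i t = A.W1 F i t \<or> A.fl (\<J> GA) i t = A.W2 F i t"
    using lines_of_nontrivial[OF L] by argo
  have "\<Union>(\<Union>(\<J> GB)) \<inter> side a b i t \<subseteq> \<Union>(A.fl (\<J> GB) i t) \<union> A.ipf F i t"
    using S.points_on_face[OF L'] unfolding transfer(5,7) common(2) .
  from Un_mono[OF points_on_face[OF L] this]
  show "(\<Union>J \<in> \<J> GA \<union> \<J> GB. \<Union>J) \<inter> side a b i t \<subseteq> \<Union>(A.fl (\<J> GA) i t \<union> A.fl (\<J> GB) i t) \<union> A.ipf F i t"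
    unfolding UN_polygons Int_Un_distrib2 Union_Un_distrib by (simp only: Un_ac)
qed

text \<open>The assumption \<open>un\<close> is what makes the side an L-face of \<open>GA\<close>
  after the removal step, as the definition of an outer iso-path demands.\<close>

lemma outer_path:
  assumes L: "A.Lf F i t" "\<not> A.tri F i t" and un: "\<And>s. s i = t \<Longrightarrow> f (corner a b s) = F (corner a b s)"
    and all: "A.fl (\<J> GA) i t \<union> A.fl (\<J> GB) i t = A.W1 F i t \<union> A.W2 F i t"
  shows "outer_iso_path c \<G> \<J> GA (A.W1 F i t \<union> A.W2 F i t)"
proof -
  let ?E = "A.W1 F i t \<union> A.W2 F i t"
  have "A.Lf f i t = A.Lf F i t" by (rule A.Lf_cong) (rule un)
  then have Lf: "A.Lf f i t" using L(1) by simp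
  have DZ: "A.D f s = A.D F s" "A.Z f s = A.Z F s" if "s i = t" for s
    using un[of s] that by (simp_all add: A.D_def A.Z_def)
  have "\<not> A.tri f i t" using L DZ unfolding A.tri_def by blast
  then have "\<not> trivial_L_face c GA (side a b i t)" unfolding A.trivial_gr A.tri_def by blast
  moreover have "side a b i t \<in> L_faces c GA" unfolding A.L_faces_gr using Lf by blast
  moreover have "simple_closed_polygon ?E" by (rule A.nontrivial_polygon[OF L])
  moreover have "\<Union>?E = (\<Union>J \<in> \<J> GA \<union> \<J> GB. \<Union>J) \<inter> side a b i t"
  proof (rule subset_antisym)
    show "\<Union>?E \<subseteq> (\<Union>J \<in> \<J> GA \<union> \<J> GB. \<Union>J) \<inter> side a b i t"
      unfolding all[symmetric] Union_Un_distrib UN_polygons Int_Un_distrib2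
      by (rule Un_mono[OF fl_lines(2) fl_lines(2)])
    \<comment> \<open>The stray iso-points add nothing to the union, since they are ends of lines of
      \<open>W1\<close>.\<close>
    have "\<Union>(A.fl (\<J> GA) i t \<union> A.fl (\<J> GB) i t) \<union> A.ipf F i t \<subseteq> \<Union>?E"
      unfolding all by (rule Un_least[OF subset_refl]) (use A.ipf_W1[of F i t] in \<open>simp add: le_supI1\<close>)
    with nontrivial_both(5)[OF L] show "(\<Union>J \<in> \<J> GA \<union> \<J> GB. \<Union>J) \<inter> side a b i t \<subseteq> \<Union>?E"
      by (rule subset_trans)
  qed
  ultimately show ?thesis unfolding outer_iso_path_def using GB neighbors(1) common(1)
    by (intro bexI[OF _ GB] exI[of _ "side a b i t"]) simp_all
qed

end

context cell_pair
begin

interpretation S: cell_pair \<Omega> \<T> F c \<G> \<J> a' b' f' a b f i t' t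
  by (rule swap)

lemma face_line_twice:
  assumes e: "e \<in> A.fl (\<J> GA) i t"
  shows "twice GA e"
proof -
  have eA: "e \<in> \<Union>(\<J> GA)" using e fl_lines(1) by blast
  have regA: "regular_graph c \<G> GA" by (rule line_regular[OF GA eA])
  note resA = A.regular_resolved[OF inner[OF GA] regA]
  have near: "near GA GA" "near GA GB" using neighbors by blast+
  show ?thesis
  proof (cases "A.Lf F i t \<and> \<not> A.tri F i t")
    case True
    then have L: "A.Lf F i t" "\<not> A.tri F i t" by blast+
    note N = nontrivial_both[OF L]
    show ?thesis
    proof (cases "A.fl (\<J> GA) i t = A.fl (\<J> GB) i t")
      case True
      then have "e \<in> \<Union>(\<J> GB)" using e fl_lines(1)[of "\<J> GB"] by blast
      then show ?thesis by (rule twice_two[OF GA GB near(2) GB_neq_GA eA])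
    next
      case False
      have all: "A.fl (\<J> GA) i t \<union> A.fl (\<J> GB) i t = A.W1 F i t \<union> A.W2 F i t"
        using N(3,4) False by (elim disjE) (simp_all add: Un_commute)
      have eW: "e \<in> A.W1 F i t \<union> A.W2 F i t" using e all by blast
      \<comment> \<open>The two graphs show different cuts. The one with \<open>W1\<close> has
        unchanged labels on the side, so the outer iso-path is attributed to it.\<close>
      show ?thesis
      proof (cases "A.fl (\<J> GA) i t = A.W2 F i t")
        case True
        then have "A.fl (\<J> GB) i t \<noteq> A.W2 F i t" using False by simp
        then have un: "\<forall>s. s i = t' \<longrightarrow> f' (corner a' b' s) = F (corner a' b' s)"
          using S.lines_of_nontrivial[OF N(1,2)] unfolding transfer(3,4,7) by blast
        have "outer_iso_path c \<G> \<J> GB (B.W1 F i t' \<union> B.W2 F i t')"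
          by (rule S.outer_path[OF N(1,2)]) (use un all in \<open>auto simp: transfer Un_commute\<close>)
        then show ?thesis using twice_outer[OF GA GB near eA] eW unfolding transfer(3,4) by blast
      next
        case W1: False
        then have un: "\<forall>s. s i = t \<longrightarrow> f (corner a b s) = F (corner a b s)"
          using lines_of_nontrivial[OF L] by blast
        have "outer_iso_path c \<G> \<J> GA (A.W1 F i t \<union> A.W2 F i t)"
          by (rule outer_path[OF L _ all]) (use un in blast)
        then show ?thesis using twice_outer[OF GA GA near(1,1) eA] eW by blast
      qed
    qed
  next
    case nontriv: False
    then have un: "\<And>s. s i = t \<Longrightarrow> f (corner a b s) = F (corner a b s)"
      using A.face_line_origin[OF remA resA e] by blast
    have Lf: "A.Lf f i t = A.Lf F i t" by (rule A.Lf_cong) (rule un)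
    show ?thesis
    proof (cases "A.Lf F i t")
      case True
      then have tri: "A.tri F i t" using nontriv by blast
      have DZ: "A.D f s = A.D F s" "A.Z f s = A.Z F s" if "s i = t" for s
        using un[of s] that by (simp_all add: A.D_def A.Z_def)
      have trif: "A.tri f i t" using tri DZ Lf unfolding A.tri_def by blast
      \<comment> \<open>A trivial L-face has no label below \<open>c\<close>, so \<open>W2\<close>
        is empty and the line belongs to \<open>W1\<close>.\<close>
      have "\<not> f (corner a b u) < c" if "u i = t" for u
        using trif that unfolding A.tri_def A.D_def A.Z_def by force
      then have "A.W2 f i t = {}" unfolding A.cuts_def by blast
      moreover have "A.fl (\<J> GA) i t = A.W1 f i t \<or> A.fl (\<J> GA) i t = A.W2 f i t"
        using resA True Lf unfolding A.resolved_def by presburger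
      ultimately have "e \<in> A.W1 f i t" using e by blast
      then show ?thesis by (intro twice_same[OF GA] A.regular_trivial_two_paths[OF inner[OF GA] regA trif])
    next
      case False
      have "A.fl (\<J> GA) i t = A.ncl f i t" using resA False Lf unfolding A.resolved_def by presburger
      moreover have "A.ncl f i t = A.ncl F i t" by (rule A.ncl_cong) (rule un)
      ultimately have eF: "e \<in> A.ncl F i t" using e by simp
      then have eF': "e \<in> B.ncl F i t'" unfolding transfer(6) .
      have L': "\<not> B.Lf F i t'" using False transfer(1) by blast
      have un': "f' (corner a' b' s) = F (corner a' b' s)" if "s i = t'" for s
        using B.regular_face_unchanged[where s = s, OF remB L' eF'] that by blast
      obtain p q where "B.ipf F i t' = {p, q}" using eF' unfolding B.ncl_def by blast
      then have "p \<in> B.ipf F i t'" by simp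
      then obtain w l where w: "B.isop F w l" "w i = t'" "l \<noteq> i" unfolding B.ipf_isop by blast
      have "B.D f' (flip l w)" "\<not> B.D f' w" using w un'[of w] un'[of "flip l w"] by (simp_all add: B.isop_def B.D_def)
      then have regB: "regular_graph c \<G> GB" by (rule cell_regular[OF cells(2)])
      have Lf': "B.Lf f' i t' = B.Lf F i t'" by (rule B.Lf_cong) (rule un')
      have ncl': "B.ncl f' i t' = B.ncl F i t'" by (rule B.ncl_cong) (rule un')
      have "B.fl (\<J> GB) i t' = B.ncl f' i t'"
        using B.regular_resolved[OF inner[OF GB] regB] L' Lf' unfolding B.resolved_def by presburger
      then have "e \<in> B.fl (\<J> GB) i t'" using eF' ncl' by simp
      then have "e \<in> \<Union>(\<J> GB)" using S.fl_lines(1) by blast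
      then show ?thesis by (rule twice_two[OF GA GB near(2) GB_neq_GA eA])
    qed
  qed
qed

text \<open>The polygon is known only through its point set; \<open>polygon_edges\<close> identifies
  its edges as inner iso-lines of one of the two graphs, which supplies the second iso-path.\<close>

lemma outer_line_twice:
  assumes L0: "A.Lf f i t" "\<not> A.tri f i t" and poly: "simple_closed_polygon E"
    and E: "\<Union>E = (\<Union>J \<in> \<J> GA \<union> \<J> GB. \<Union>J) \<inter> side a b i t" and e: "e \<in> E"
    and out: "outer_iso_path c \<G> \<J> GA E"
  shows "twice GA e"
proof -
  have un: "f (corner a b s) = F (corner a b s)" if s: "s i = t" for s
  proof (rule ccontr)
    assume "f (corner a b s) \<noteq> F (corner a b s)"
    note ch = A.removedD(3,4)[OF remA this]
    obtain j where j: "j \<noteq> i" using third_index by blast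
    show False using A.Lf_neighbors[of f i s j] L0(1) s j ch by simp
  qed
  have DZ: "A.D f s = A.D F s" "A.Z f s = A.Z F s" if "s i = t" for s
    using un[of s] that by (simp_all add: A.D_def A.Z_def)
  have "A.Lf f i t = A.Lf F i t" by (rule A.Lf_cong) (rule un)
  then have L: "A.Lf F i t" using L0(1) by simp
  have nt: "\<not> A.tri F i t" using L0 L DZ unfolding A.tri_def by blast
  note N = nontrivial_both[OF L nt]
  have sub: "A.fl (\<J> GA) i t \<union> A.fl (\<J> GB) i t \<subseteq> A.W1 F i t \<union> A.W2 F i t"
    using N(3,4) by (elim disjE) simp_all
  have "E \<subseteq> A.fl (\<J> GA) i t \<union> A.fl (\<J> GB) i t"
    by (rule polygon_edges[OF general_position_mono[OF A.nontrivial_polygon(2)[OF L nt] sub] A.finite_ipf poly])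
      (use N(5) E in simp)
  then have "e \<in> \<Union>(\<J> GA) \<or> e \<in> \<Union>(\<J> GB)" using e fl_lines(1)[of "\<J> GA"] fl_lines(1)[of "\<J> GB"] by blast
  moreover have "near GA GA" "near GA GB" using neighbors by blast+
  ultimately show ?thesis using twice_outer[OF GA GA _ _ _ out e] twice_outer[OF GB GA _ _ _ out e] by blast
qed

end

context iso_partition
begin

lemma cell_pairI:
  assumes "cell a b f" "cell a' b' f'" "cbox a b \<inter> cbox a' b' = side a b i t"
    "(cbox a b \<inter> cbox a' b') facet_of cbox a' b'" "cbox a b \<noteq> cbox a' b'"
  obtains t' where "cell_pair \<Omega> \<T> F c \<G> \<J> a b f a' b' f' i t t'"
proof -
  interpret B: corners a' b' using assms(2) by (rule cellD)
  obtain i' t' where it: "side a b i t = side a' b' i' t'" using assms(3,4) B.facet_iff by metis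
  have "i' = i" by (rule side_transfer_index[OF cellD(1)[OF assms(1)] cellD(1)[OF assms(2)] it])
  then have "cell_pair \<Omega> \<T> F c \<G> \<J> a b f a' b' f' i t t'"
    using assms it by unfold_locales auto
  then show thesis by (rule that)
qed

lemma outer_twice:
  assumes G: "G \<in> \<G>" and out: "outer_iso_path c \<G> \<J> G E" and e: "e \<in> E"
  shows "twice G e"
proof -
  obtain G' where G': "G' \<in> \<G>" "face_neighbors G G'" "cuboid_of G \<inter> cuboid_of G' \<in> L_faces c G"
    "\<not> trivial_L_face c G (cuboid_of G \<inter> cuboid_of G')" "simple_closed_polygon E"
    "\<Union>E = (\<Union>J \<in> \<J> G \<union> \<J> G'. \<Union>J) \<inter> (cuboid_of G \<inter> cuboid_of G')"
    using out unfolding outer_iso_path_def by blast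
  obtain a b f where A: "G = graph_of a b f" "cell a b f" by (rule graph_cell[OF G])
  obtain a' b' f' where B: "G' = graph_of a' b' f'" "cell a' b' f'" by (rule graph_cell[OF G'(1)])
  interpret A: iso_corners a b c using A(2) by (rule cellD)
  obtain i t where it: "cbox a b \<inter> cbox a' b' = side a b i t" "A.Lf f i t"
    using G'(3) unfolding A(1) B(1) A.L_faces_gr by auto
  have "(cbox a b \<inter> cbox a' b') facet_of cbox a' b'" using G'(2) by (simp add: A(1) B(1) face_neighbors_def)
  moreover have "cbox a b \<noteq> cbox a' b'"
  proof
    assume "cbox a b = cbox a' b'"
    then have "cbox a b = side a b i t" using it(1) by simp
    moreover have "corner a b (\<lambda>_. \<not> t) \<in> cbox a b" by (rule A.corner_in_box)
    moreover have "corner a b (\<lambda>_. \<not> t) \<notin> side a b i t" by simp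
    ultimately show False by blast
  qed
  ultimately obtain t' where "cell_pair \<Omega> \<T> F c \<G> \<J> a b f a' b' f' i t t'" by (rule cell_pairI[OF A(2) B(2) it(1)])
  then interpret P: cell_pair \<Omega> \<T> F c \<G> \<J> a b f a' b' f' i t t' .
  have "\<not> A.tri f i t" using G'(4) it unfolding A(1) B(1) A.tri_def by (simp add: A.trivial_gr)
  then show ?thesis unfolding A(1)
    by (rule P.outer_line_twice[OF it(2) _ G'(5) _ e]) (use G'(6) out it(1) A(1) B(1) in simp_all)
qed

text \<open>The midpoint of the line is interior to its side, for otherwise a second side would
  contain the whole line and make it an edge line. So the cuboid beyond the midpoint has the side as
  common face.\<close>

lemma inner_face_line_twice:
  assumes A: "cell a b f" and e: "e \<in> \<Union>(\<J> (graph_of a b f))" and ne: "\<not> iso_corners.edgeline a b e"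
  shows "twice (graph_of a b f) e"
proof -
  interpret A: iso_corners a b c using A by (rule cellD)
  note G = cellD(5)[OF A]
  obtain w l w' l' i t where w: "A.isop f w l" "A.isop f w' l'" "e = closed_segment (A.xp f w l) (A.xp f w' l')"
    "A.xp f w l \<noteq> A.xp f w' l'" "A.xp f w l \<in> side a b i t" "A.xp f w' l' \<in> side a b i t"
    using A.regular_lines[OF inner[OF G] line_regular[OF G e] e] unfolding A.iso_line_of_def by blast
  define p where "p = midpoint (A.xp f w l) (A.xp f w' l')"
  have pe: "p \<in> e" unfolding p_def w(3) by (rule midpoint_in_closed_segment)
  have es: "e \<subseteq> side a b i t" unfolding w(3) A.segment_side using w(5,6) by blast
  have inb: "A.xp f w l \<in> cbox a b" "A.xp f w' l' \<in> cbox a b" using w(5,6) by (simp_all add: side_in_box)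
  have off: "p \<notin> side a b j q" if j: "j \<noteq> i" for j q
  proof
    assume "p \<in> side a b j q"
    moreover have "p \<noteq> A.xp f w l" "p \<noteq> A.xp f w' l'" using w(4) by (simp_all add: p_def)
    ultimately have "A.xp f w l \<in> side a b j q \<and> A.xp f w' l' \<in> side a b j q"
      using A.open_segment_side[OF _ _ inb] pe w(3) by blast
    then have "A.edgeline e" unfolding w(3) using j
      by (intro A.two_faces_edgeline[OF w(1,2,4,5,6), of j q]) auto
    then show False using ne by blast
  qed
  have pb: "p \<in> cbox a b" using pe es side_in_box by blast
  have int: "a $ j < p $ j \<and> p $ j < b $ j" if "j \<noteq> i" for j
  proof -
    have "a $ j \<le> p $ j" "p $ j \<le> b $ j" using pb unfolding A.mem_box by blast+
    moreover have "p $ j \<noteq> a $ j" "p $ j \<noteq> b $ j"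
      using off[OF that, of False] off[OF that, of True] pb by (auto simp: side_def)
    ultimately show ?thesis by simp
  qed
  have pO: "p \<in> \<Omega>" by (rule line_in_domain[OF G e pe pb cellD(3)[OF A]])
  have pS: "p \<in> side a b i t" using pe es by blast
  obtain C' where C': "C' \<in> \<T>" "C' \<noteq> cbox a b" "cbox a b \<inter> C' = side a b i t" "(cbox a b \<inter> C') facet_of C'"
    by (rule A.face_neighbor_exists[OF part open_dom pO cellD(3)[OF A] pS int])
  obtain a' b' f' where B: "C' = cbox a' b'" "cell a' b' f'" by (rule cuboid_cell[OF C'(1)])
  obtain t' where "cell_pair \<Omega> \<T> F c \<G> \<J> a b f a' b' f' i t t'"
    by (rule cell_pairI[OF A B(2)]) (use C' B(1) in auto)
  then interpret P: cell_pair \<Omega> \<T> F c \<G> \<J> a b f a' b' f' i t t' .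
  have "e \<in> A.fl (\<J> (graph_of a b f)) i t" unfolding A.fl_def using e es ne by blast
  then show ?thesis by (rule P.face_line_twice)
qed

end

subsection \<open>Iso-lines along edges\<close>

text \<open>Around an edge the four cuboids are separated by four faces; \<open>ray F c a b m s j\<close> says that both
  vertices of such a face that are off the edge are disperse.\<close>

definition ray :: "(point \<Rightarrow> real) \<Rightarrow> real \<Rightarrow> point \<Rightarrow> point \<Rightarrow> 3 \<Rightarrow> (3 \<Rightarrow> bool) \<Rightarrow> 3 \<Rightarrow> bool" where
  "ray F c a b m s j \<longleftrightarrow> c < F (corner a b (flip j s)) \<and> c < F (corner a b (flip m (flip j s)))"

context iso_partition
begin

lemma ray_common:
  assumes "at_edge \<T> u w m s a b" "at_edge \<T> u w m (flip j s) a' b'" "j \<noteq> m" "k \<noteq> j"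
  shows "ray F c a b m s k \<longleftrightarrow> ray F c a' b' m (flip j s) k"
  using at_edge_corner[OF part assms] by (simp add: ray_def)

text \<open>The disperse ray gives \<open>EL\<close> before the removal step; the other ray, not
  being disperse, keeps the ends of the edge from being relabelled.\<close>

lemma edge_line_transfer:
  assumes A: "cell a b f" and E: "at_edge \<T> u w m s a b" and uw: "F u = c" "F w = c"
    and r: "ray F c a b m s j" "\<not> ray F c a b m s k" "j \<noteq> m" "k \<noteq> m"
    and nF2: "\<not> F2_graph c \<G>0 (graph_of a b F)"
  shows "closed_segment u w \<in> \<Union>(\<J> (graph_of a b f))"
proof -
  interpret A: iso_corners a b c using A by (rule cellD)
  have pts: "corner a b s = u" "corner a b (flip m s) = w" using E by (simp_all add: at_edge_def)
  have Zs: "A.Z F s" "A.Z F (flip m s)" using uw pts by (simp_all add: A.Z_def)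
  have EL: "A.EL f s m"
    by (rule A.edge_survives(1)[OF cellD(4)[OF A] nF2 Zs _ _ r(3) _ r(4)])
      (use r(1,2) in \<open>simp_all add: ray_def A.D_def\<close>)
  then have "A.Z f s" unfolding A.EL_def by blast
  then have "\<not> A.D f s" by simp
  moreover obtain l where "A.D f (flip l s)" using EL unfolding A.EL_def by blast
  ultimately have "regular_graph c \<G> (graph_of a b f)" using cell_regular[OF A] by blast
  then show ?thesis using A.regular_edge_lines[OF inner[OF cellD(5)[OF A]]] EL pts by metis
qed

text \<open>The label-\<open>c\<close> face of an \<open>F\<^sub>2\<close>-graph contains
  \<open>u\<close> and \<open>w\<close>, and a face whose complement contained the corners of ray
  \<open>n\<close> would make that ray disperse. So it is the face towards the cuboid at
  \<open>flip l s\<close>, which is then the unique partner, and being an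
  \<open>F\<^sub>2\<close>-graph is symmetric.\<close>

lemma F2_partner:
  assumes Q: "at_edge \<T> u w m s a b" and R: "at_edge \<T> u w m (flip l s) a' b'"
    and uw: "F u = c" "F w = c" and idx: "l \<noteq> m" "n \<noteq> m" "n \<noteq> l" and r: "\<not> ray F c a b m s n"
    and F2: "F2_graph c \<G>0 (graph_of a b F)"
  shows "F2_graph c \<G>0 (graph_of a' b' F)" "ray F c a' b' m (flip l s) l"
proof -
  have cA: "corners a b" "cbox a b \<in> \<T>" and cB: "corners a' b'" "cbox a' b' \<in> \<T>" using Q R by (simp_all add: at_edge_def)
  interpret A: iso_corners a b c using cA(1) by (rule iso_cornersI)
  interpret B: iso_corners a' b' c using cB(1) by (rule iso_cornersI)
  have pts: "corner a b s = u" "corner a b (flip m s) = w" using Q by (simp_all add: at_edge_def)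
  obtain G' l' q where G': "G' \<in> \<G>0" "face_neighbors (graph_of a b F) G'" "cbox a b \<inter> cuboid_of G' = side a b l' q"
    "A.F2i F l' q" "\<And>P. P \<in> nodes G' - nodes (graph_of a b F) \<Longrightarrow> label G' P > c"
    "\<And>P. P \<in> nodes (graph_of a b F) \<inter> nodes G' \<Longrightarrow> label G' P = c"
    using A.F2_gr[OF F2] by metis
  have f2: "if y l' = q then A.Z F y else A.D F y" for y using G'(4) unfolding A.F2i_def by blast
  have Zs: "A.Z F s" "A.Z F (flip m s)" using uw pts by (simp_all add: A.Z_def)
  have q: "s l' = q" using f2[of s] Zs(1) A.Z_not_D by metis
  have "l' \<noteq> m"
  proof
    assume "l' = m"
    then have "A.D F (flip m s)" using f2[of "flip m s"] q by auto
    then show False using Zs(2) by simp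
  qed
  moreover have "l' \<noteq> n"
  proof
    assume "l' = n"
    then have "A.D F (flip n s)" "A.D F (flip m (flip n s))"
      using f2[of "flip n s"] f2[of "flip m (flip n s)"] q idx by auto
    then show False using r by (simp add: ray_def A.D_def)
  qed
  ultimately have l: "l' = l" using index_cases[of m n l l'] idx by metis
  have common: "cbox a b \<inter> cbox a' b' = side a b l (s l)" "side a b l (s l) facet_of cbox a' b'"
    using at_edge_facet(1,2)[OF part Q R idx(1)] by simp_all
  obtain C' where C': "C' \<in> \<T>" "G' = LGraph C' F" using G'(1) by blast
  have G'c: "cbox a b \<inter> C' = side a b l (s l)" "side a b l (s l) facet_of C'"
    using G'(2,3) unfolding face_neighbors_def C'(2) l q[symmetric] by simp_all
  have "C' = cbox a' b'" by (rule facet_partner_unique[OF part cA C'(1) G'c cB(2) common])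
  then have GR: "G' = graph_of a' b' F" using C'(2) by simp
  note nb = G'(2)[unfolded GR]
  have nb': "face_neighbors (graph_of a' b' F) (graph_of a b F)"
    using nb unfolding face_neighbors_def by (simp add: Int_commute)
  have off: "F P > c" if P: "P \<in> nodes (graph_of a b F) - nodes (graph_of a' b' F)" for P
  proof -
    obtain y where y: "P = corner a b y" using P unfolding A.nodes_gr by blast
    have "y l \<noteq> s l"
    proof
      assume "y l = s l"
      then have "P \<in> cbox a b \<inter> cbox a' b'" unfolding common(1) y by simp
      then have "P \<in> nodes (graph_of a b F) \<inter> nodes (graph_of a' b' F)"
        using P face_neighbors_nodes[OF nb] by simp
      then show False using P by blast
    qed
    then show ?thesis using f2[of y] q l y by (simp add: A.D_def)
  qed
  have on: "F P = c" if "P \<in> nodes (graph_of a b F) \<inter> nodes (graph_of a' b' F)" for P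
    using G'(6)[of P] that unfolding GR by simp
  have off': "F P > c" if "P \<in> nodes (graph_of a' b' F) - nodes (graph_of a b F)" for P
    using G'(5)[of P] that unfolding GR by simp
  show "F2_graph c \<G>0 (graph_of a' b' F)"
    unfolding F2_graph_def
  proof (intro bexI[of _ "graph_of a b F"] conjI ballI)
    show "graph_of a b F \<in> \<G>0" using cA(2) by blast
  qed (use nb' on off off' in auto)
  have out: "corner a' b' y \<notin> nodes (graph_of a b F)" if y: "y l = s l" for y
  proof
    assume "corner a' b' y \<in> nodes (graph_of a b F)"
    then obtain z where "corner a' b' y = corner a b z" unfolding A.nodes_gr by blast
    then have "corner a' b' y \<in> cbox a b \<inter> cbox a' b'" using A.corner_in_box[of z] B.corner_in_box[of y] by simp
    then have "corner a' b' y \<in> side a' b' l (\<not> s l)"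
      unfolding common(1) at_edge_side_eq[OF part Q R idx(1)] .
    then show False using y by simp
  qed
  have in': "corner a' b' y \<in> nodes (graph_of a' b' F)" for y unfolding B.nodes_gr by blast
  show "ray F c a' b' m (flip l s) l"
    unfolding ray_def using off'[of "corner a' b' s"] off'[of "corner a' b' (flip m s)"] out[of s] out[of "flip m s"] in' idx(1)
    by simp
qed

lemma edge_line_twice:
  assumes A: "cell a b f" and e: "e \<in> \<Union>(\<J> (graph_of a b f))" and edge: "iso_corners.edgeline a b e"
  shows "twice (graph_of a b f) e"
proof -
  interpret A: iso_corners a b c using A by (rule cellD)
  note G = cellD(5)[OF A]
  note rem = cellD(4)[OF A]
  note reg = line_regular[OF G e]
  obtain s m where em: "e = closed_segment (corner a b s) (corner a b (flip m s))"
    using edge unfolding A.edgeline_def by blast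
  define u w where "u = corner a b s" and "w = corner a b (flip m s)"
  have euw: "e = closed_segment u w" unfolding em u_def w_def ..
  have EL: "A.EL f s m" using A.regular_edge_lines[OF inner[OF G] reg, of s m] e em by simp
  note o = A.edge_origin[OF rem EL]
  have uw: "F u = c" "F w = c" using o(2,3) by (simp_all add: u_def w_def A.Z_def)
  have E: "at_edge \<T> u w m s a b" using A by (simp add: at_edge_def cell_def u_def w_def)
  obtain x where x: "x \<noteq> m" "A.D f (flip x s)" "A.D f (flip m (flip x s))" using EL unfolding A.EL_def by blast
  have rx: "ray F c a b m s x" using x o(4,5)[of x] by (simp add: ray_def A.D_def)
  show ?thesis
  proof (cases "\<forall>j. j \<noteq> m \<longrightarrow> ray F c a b m s j")
    case True
    have Zf: "A.Z f s" "A.Z f (flip m s)" using EL unfolding A.EL_def by blast+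
    have "A.D f (flip j s) \<and> A.D f (flip m (flip j s))" if "j \<noteq> m" for j
      using True that o(4,5)[of j] by (simp add: ray_def A.D_def)
    from A.regular_edge_two_paths[OF inner[OF G] reg Zf this] show ?thesis
      unfolding em by (intro twice_same[OF G])
  next
    case False
    then obtain j where j: "j \<noteq> m" "\<not> ray F c a b m s j" by blast
    define k where "k = x"
    have k: "k \<noteq> m" "ray F c a b m s k" using x(1) rx by (simp_all add: k_def)
    have jk: "j \<noteq> k" using j k by blast
    note F2A = o(1)
    have "midpoint u w \<in> e" unfolding euw by (rule midpoint_in_closed_segment)
    moreover have "midpoint u w \<in> cbox a b"
      using calculation closed_segment_subset[OF A.corner_in_box A.corner_in_box convex_box(1), of s "flip m s"] em by blast
    ultimately have mid: "midpoint u w \<in> \<Omega>" by (rule line_in_domain[OF G e _ _ cellD(3)[OF A]])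
    have cell_at: "\<exists>a' b' f'. at_edge \<T> u w m s' a' b' \<and> cell a' b' f'" if s': "s' m = s m" for s'
    proof -
      obtain a' b' where q: "at_edge \<T> u w m s' a' b'" by (rule edge_quadrant[where s' = s', OF part open_dom mid E]) (use s' in simp)
      then have "corners a' b'" "cbox a' b' \<in> \<T>" by (simp_all add: at_edge_def)
      then show ?thesis using q cell_exists by metis
    qed
    \<comment> \<open>\<open>aj bj\<close> and \<open>ak bk\<close> belong to the two
      face-neighbours at the edge, \<open>al bl\<close> to the cuboid diagonally opposite.\<close>
    obtain aj bj fj where J: "at_edge \<T> u w m (flip j s) aj bj" "cell aj bj fj" using cell_at[of "flip j s"] j(1) by auto
    obtain ak bk fk where K: "at_edge \<T> u w m (flip k s) ak bk" "cell ak bk fk" using cell_at[of "flip k s"] k(1) by auto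
    obtain al bl fl where L: "at_edge \<T> u w m (flip j (flip k s)) al bl" "cell al bl fl"
      using cell_at[of "flip j (flip k s)"] j(1) k(1) by auto
    have L': "at_edge \<T> u w m (flip k (flip j s)) al bl" using L(1) by (simp add: flip_commute)
    have around: "at_edge \<T> u w m (flip k (flip k s)) a b" "at_edge \<T> u w m (flip j (flip j s)) a b"
      "at_edge \<T> u w m (flip j (flip j (flip k s))) ak bk" "at_edge \<T> u w m (flip k (flip k (flip j s))) aj bj"
      using E J K by simp_all
    have rK: "\<not> ray F c ak bk m (flip k s) j" using ray_common[OF E K(1) k(1) jk] j(2) by simp
    have rJ: "ray F c aj bj m (flip j s) k" using ray_common[OF E J(1) j(1) jk[symmetric]] k(2) by simp
    have rKL: "ray F c ak bk m (flip k s) k \<longleftrightarrow> ray F c al bl m (flip j (flip k s)) k"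
      by (rule ray_common[OF K(1) L(1) j(1) jk[symmetric]])
    have rJL: "ray F c aj bj m (flip j s) j \<longleftrightarrow> ray F c al bl m (flip k (flip j s)) j"
      by (rule ray_common[OF J(1) L' k(1) jk])
    have neighbor: "near (graph_of a b f) (graph_of a' b' f') \<and> graph_of a' b' f' \<noteq> graph_of a b f"
      if at: "at_edge \<T> u w m (flip l s) a' b'" and l: "l \<noteq> m" for a' b' f' l
    proof -
      note fc = at_edge_facet[OF part E at l]
      have "(cbox a b \<inter> cbox a' b') facet_of cbox a b" unfolding fc(1) A.facet_iff by blast
      then show ?thesis using fc(2,3) by (simp add: face_neighbors_def)
    qed
    \<comment> \<open>Ray \<open>k\<close> is disperse and ray \<open>j\<close> is not. Going round
      the edge there is another such change, at the cuboid of index \<open>flip k s\<close>, at the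
      opposite one or at that of index \<open>flip j s\<close>, and that cuboid has the edge as an
      iso-line.\<close>
    show ?thesis
    proof (cases "ray F c ak bk m (flip k s) k")
      case y1: True
      \<comment> \<open>Its \<open>F\<^sub>2\<close>-partner would be the given cuboid, which is
        known not to be an \<open>F\<^sub>2\<close>-graph.\<close>
      have "\<not> F2_graph c \<G>0 (graph_of ak bk F)"
        using F2_partner(1)[OF K(1) around(1) uw k(1) j(1) jk rK] F2A by blast
      from edge_line_transfer[OF K(2,1) uw y1 rK k(1) j(1) this]
      have "e \<in> \<Union>(\<J> (graph_of ak bk fk))" unfolding euw .
      then show ?thesis using twice_two[OF G cellD(5)[OF K(2)] _ _ e] neighbor[OF K(1) k(1)] by blast
    next
      case y1: False
      show ?thesis
      proof (cases "ray F c aj bj m (flip j s) j")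
        case True
        then have x1: "ray F c al bl m (flip j (flip k s)) j" unfolding rJL by (simp add: flip_commute)
        have y1': "\<not> ray F c al bl m (flip j (flip k s)) k" using y1 rKL by blast
        \<comment> \<open>The partner would be the cuboid of index \<open>flip k s\<close>, whose
          ray \<open>j\<close> would then be disperse, against \<open>rK\<close>.\<close>
        have nF2: "\<not> F2_graph c \<G>0 (graph_of al bl F)"
          using F2_partner(2)[OF L(1) around(3) uw j(1) k(1) jk[symmetric] y1'] rK by auto
        from edge_line_transfer[OF L(2,1) uw x1 y1' j(1) k(1) nF2]
        have eL: "e \<in> \<Union>(\<J> (graph_of al bl fl))" unfolding euw .
        interpret L: corners al bl using L(2) by (rule cellD)
        have seg: "cbox a b \<inter> cbox al bl = closed_segment u w" by (rule at_edge_opposite[OF E L(1) jk j(1) k(1)])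
        have "closed_segment u w edge_of cbox a b" unfolding A.edge_iff u_def w_def by blast
        moreover have "closed_segment u w edge_of cbox al bl"
        proof -
          have "u = corner al bl (flip j (flip k s))" "w = corner al bl (flip m (flip j (flip k s)))"
            using L(1) by (simp_all add: at_edge_def)
          then show ?thesis unfolding L.edge_iff by blast
        qed
        ultimately have en: "edge_neighbors (graph_of a b f) (graph_of al bl fl)" by (simp add: edge_neighbors_def seg)
        have "cbox al bl \<noteq> cbox a b"
        proof
          assume "cbox al bl = cbox a b"
          then have "corner a b (flip j s) \<in> closed_segment u w" using seg A.corner_in_box by blast
          moreover have "closed_segment u w \<subseteq> side a b j (s j)"
            unfolding u_def w_def A.segment_side using j(1) by simp
          ultimately have "corner a b (flip j s) \<in> side a b j (s j)" by blast
          then show False by simp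
        qed
        then have "graph_of al bl fl \<noteq> graph_of a b f" by simp
        then show ?thesis using twice_two[OF G cellD(5)[OF L(2)] _ _ e eL] en by blast
      next
        case x1: False
        have rL: "\<not> ray F c al bl m (flip k (flip j s)) k" using y1 rKL by (simp add: flip_commute)
        \<comment> \<open>Here the partner would be the opposite cuboid, whose ray \<open>k\<close>
          would then be disperse, against \<open>rL\<close>.\<close>
        have nF2: "\<not> F2_graph c \<G>0 (graph_of aj bj F)"
          using F2_partner(2)[OF J(1) L' uw k(1) j(1) jk x1] rL by blast
        from edge_line_transfer[OF J(2,1) uw rJ x1 k(1) j(1) nF2]
        have "e \<in> \<Union>(\<J> (graph_of aj bj fj))" unfolding euw .
        then show ?thesis using twice_two[OF G cellD(5)[OF J(2)] _ _ e] neighbor[OF J(1) j(1)] by blast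
      qed
    qed
  qed
qed

lemma line_twice:
  assumes G: "G \<in> \<G>" and p: "p \<in> iso_paths c \<G> \<J> G" and e: "e \<in> iso_lines p"
  shows "twice G e"
  using p unfolding iso_paths_def
proof (elim UnE imageE)
  fix J assume J: "p = Inner G J" "J \<in> \<J> G"
  obtain a b f where A: "G = graph_of a b f" "cell a b f" by (rule graph_cell[OF G])
  have "e \<in> \<Union>(\<J> (graph_of a b f))" using J e A(1) by auto
  then show ?thesis unfolding A(1) using inner_face_line_twice[OF A(2)] edge_line_twice[OF A(2)] by blast
next
  fix E assume "p = Outer E" "E \<in> {E. outer_iso_path c \<G> \<J> G E}"
  then show ?thesis using outer_twice[OF G] e by simp
qed

end

theorem theorem6p9:
  fixes \<Omega> :: "point set" and \<T> :: "point set set" and F :: "point \<Rightarrow> real" and c :: real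
    and \<G> :: "lgraph set" and \<J> :: "lgraph \<Rightarrow> polygon set"
  assumes "0 < c" and "c < 1"
    and "polygonal_domain \<Omega>" and "cuboid_partition \<Omega> \<T>"
    and "\<forall>C\<in>\<T>. labeled_cuboid_graph (LGraph C F)"
    and "\<G> = resulting_graphs c F \<T>"
    and "\<forall>G\<in>\<G>. singular_iso_path_free c G \<and> isolated_iso_path_free c \<G> G"
    and "\<forall>G\<in>\<G>. inner_iso_paths c \<G> G (\<J> G)"
    and "\<forall>G\<in>\<G>. \<forall>p \<in> iso_paths c \<G> \<J> G. \<Union>(iso_lines p) \<inter> frontier \<Omega> = {}"
  shows "\<forall>G\<in>\<G>. \<forall>p \<in> iso_paths c \<G> \<J> G. \<forall>e \<in> iso_lines p.
    \<exists>G1\<in>\<G>. \<exists>G2\<in>\<G>. \<exists>p1 \<in> iso_paths c \<G> \<J> G1. \<exists>p2 \<in> iso_paths c \<G> \<J> G2.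
      (G1 = G \<or> face_neighbors G G1 \<or> edge_neighbors G G1) \<and>
      (G2 = G \<or> face_neighbors G G2 \<or> edge_neighbors G G2) \<and>
      p1 \<noteq> p2 \<and> e \<in> iso_lines p1 \<and> e \<in> iso_lines p2"
proof (intro ballI)
  interpret iso_partition \<Omega> \<T> F c \<G> \<J>
    using assms by unfold_locales (auto simp: polygonal_domain_def)
  fix G p e assume "G \<in> \<G>" "p \<in> iso_paths c \<G> \<J> G" "e \<in> iso_lines p"
  from line_twice[OF this, unfolded twice_def]
  show "\<exists>G1\<in>\<G>. \<exists>G2\<in>\<G>. \<exists>p1 \<in> iso_paths c \<G> \<J> G1. \<exists>p2 \<in> iso_paths c \<G> \<J> G2.
      (G1 = G \<or> face_neighbors G G1 \<or> edge_neighbors G G1) \<and>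
      (G2 = G \<or> face_neighbors G G2 \<or> edge_neighbors G G2) \<and>
      p1 \<noteq> p2 \<and> e \<in> iso_lines p1 \<and> e \<in> iso_lines p2" .
qed

end
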